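(* Let $A\in\mathrm{GL}_2(\mathbb{Z})$, let $G_A=\mathbb{Z}^2\rtimes_A\mathbb{Z}$, and let $\lambda$ be an eigenvalue of $A$. Then: (i) if $A$ has distinct eigenvalues, $\mathrm{tr}(A)\neq 0$, and the conjugacy class of $A$ corresponds to a class of an invertible ideal of the order $\mathbb{Z}[\lambda]$ (i.e. the ideal $I_A$ of $\mathbb{Z}[\lambda]$ is invertible), then $$h(\mathbb{Z}[\lambda])\leq \#\mathfrak{g}(\mathcal{PF},G_A)\leq \tilde{h}(\lambda)\quad\text{if }\det(A)=-1,$$ $$h(\mathbb{Z}[\lambda])/2\leq \#\mathfrak{g}(\mathcal{PF},G_A)\leq \tilde{h}(\lambda)\quad\text{if }\det(A)=1;$$ (ii) if $\mathrm{tr}(A)=0$ or $A$ has all its eigenvalues equal to $-1$, then $\#\mathfrak{g}(\mathcal{PF},G_A)=h(\mathbb{Z}[\lambda])=1$.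
   Context: For $A\in\mathrm{GL}_2(\mathbb{Z})$, $G_A=\mathbb{Z}^2\rtimes_A\mathbb{Z}$ is the semidirect product in which the generator $1\in\mathbb{Z}$ acts on $\mathbb{Z}^2$ via $A$. $\widehat{G}$ denotes the profinite completion of $G$. $\mathcal{PF}$ is the class of polycyclic-by-finite groups; for $G\in\mathcal{PF}$, $\mathfrak{g}(\mathcal{PF},G)$ is the set of isomorphism classes of groups $H\in\mathcal{PF}$ with $\widehat{H}\cong\widehat{G}$. For an order $\mathcal{O}$ with fraction field $K$, a fractional ideal is a nonzero finitely generated $\mathcal{O}$-submodule $I$ of $K$ (so $dI\subseteq\mathcal{O}$ for some nonzero $d\in\mathcal{O}$). Two fractional ideals $I,J$ are equivalent if $J=\alpha I$ for some $\alpha\in K\setminus\{0\}$; the equivalence classes are the ideal classes. A fractional ideal $I$ is invertible if $IJ$ is a nonzero principal ideal for some fractional ideal $J$. $h(\mathcal{O})$ is the order of the ideal class group (Picard group) of invertible fractional ideals modulo principal fractional ideals. $\tilde{h}(\lambda)$ is the number of all ideal classes (invertible or not) of $\mathbb{Z}[\lambda]$. If $\lambda=\pm1$ then $\mathbb{Z}[\lambda]=\mathbb{Z}$. Correspondence: for $A=\begin{pmatrix}a&b\\c&d\end{pmatrix}$ with eigenvalue $\lambda$, put $I_A=\{mb+n(\lambda-a): m,n\in\mathbb{Z}\}$, which is an ideal of $\mathbb{Z}[\lambda]$. By the Latimer–MacDuffee theorem, when the characteristic polynomial $p$ of $A$ is irreducible, $A\mapsto [I_A]$ induces a bijection between $\mathrm{GL}_2(\mathbb{Z})$-conjugacy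 classes of integer matrices with characteristic polynomial $p$ and ideal classes of $\mathbb{Z}[\lambda]$. *)

theory Defs
  imports "HOL-Analysis.Analysis" "HOL-Algebra.Algebra" "HOL-Computational_Algebra.Polynomial"
begin

section \<open>The groups \<open>\<int>\<^sup>2 \<rtimes>\<^sub>A \<int>\<close>\<close>

definition GL2Z :: "(int^2^2) monoid" where
  "GL2Z = \<lparr>carrier = {A. invertible A}, monoid.mult = (**), one = mat 1\<rparr>"

definition semidirect_Z2_Z :: "int^2^2 \<Rightarrow> ((int^2) \<times> int) monoid" where
  "semidirect_Z2_Z A =
     \<lparr>carrier = UNIV,
      monoid.mult = (\<lambda>(v, k) (w, l). (v + (A [^]\<^bsub>GL2Z\<^esub> k) *v w, k + l)),
      one = (0, 0)\<rparr>"

definition eigenvalue :: "int^2^2 \<Rightarrow> complex \<Rightarrow> bool" where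
  "eigenvalue A \<mu> \<longleftrightarrow> (\<exists>v. v \<noteq> 0 \<and> map_matrix complex_of_int A *v v = \<mu> *s v)"

lemma group_GL2Z: "group GL2Z"
proof (rule groupI)
  fix A assume "A \<in> carrier GL2Z"
  then show "\<exists>B\<in>carrier GL2Z. B \<otimes>\<^bsub>GL2Z\<^esub> A = \<one>\<^bsub>GL2Z\<^esub>"
    by (auto simp: GL2Z_def invertible_def)
next
  show "\<one>\<^bsub>GL2Z\<^esub> \<in> carrier GL2Z"
    by (auto simp: GL2Z_def invertible_def)
qed (simp_all add: GL2Z_def invertible_mult matrix_mul_assoc)

lemma group_semidirect_Z2_Z:
  assumes "invertible A"
  shows "group (semidirect_Z2_Z A)"
proof -
  interpret GL: group GL2Z by (rule group_GL2Z)
  have A: "A \<in> carrier GL2Z"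
    using assms by (simp add: GL2Z_def)
  have pow_add: "A [^]\<^bsub>GL2Z\<^esub> (k + l) = (A [^]\<^bsub>GL2Z\<^esub> k) ** (A [^]\<^bsub>GL2Z\<^esub> l)" for k l :: int
    using GL.int_pow_mult[OF A, of k l] by (simp add: GL2Z_def)
  have pow_0: "A [^]\<^bsub>GL2Z\<^esub> (0::int) = mat 1"
    by (simp add: int_pow_def2) (simp add: GL2Z_def)
  have one: "\<one>\<^bsub>GL2Z\<^esub> = mat 1"
    by (simp add: GL2Z_def)
  show ?thesis
  proof (rule groupI)
    fix x assume "x \<in> carrier (semidirect_Z2_Z A)"
    obtain v k where x: "x = (v, k)" by fastforce
    show "\<exists>y\<in>carrier (semidirect_Z2_Z A). y \<otimes>\<^bsub>semidirect_Z2_Z A\<^esub> x = \<one>\<^bsub>semidirect_Z2_Z A\<^esub>"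
      by (rule bexI[of _ "(- ((A [^]\<^bsub>GL2Z\<^esub> (-k)) *v v), -k)"]) (auto simp: semidirect_Z2_Z_def x)
  qed (auto simp: semidirect_Z2_Z_def pow_add pow_0 one matrix_vector_right_distrib
        matrix_vector_mul_assoc)
qed


section \<open>Profinite completions\<close>

definition fin_index_normal :: "('a, 'b) monoid_scheme \<Rightarrow> 'a set set" where
  "fin_index_normal G = {N. N \<lhd> G \<and> finite (rcosets\<^bsub>G\<^esub> N)}"

text \<open>
  The inverse limit of the finite quotients \<open>G Mod N\<close>. For \<open>N \<subseteq> M\<close> the transition map
  sends a coset of \<open>N\<close> to the unique coset of \<open>M\<close> containing it, so compatibility of a family
  \<open>x\<close> reads \<open>x N \<subseteq> x M\<close>.
\<close>

definition profinite_completion :: "('a, 'b) monoid_scheme \<Rightarrow> ('a set \<Rightarrow> 'a set) monoid" where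
  "profinite_completion G =
     (product_group (fin_index_normal G) (\<lambda>N. G Mod N))
       \<lparr>carrier := {x \<in> \<Pi>\<^sub>E N\<in>fin_index_normal G. carrier (G Mod N).
          \<forall>M\<in>fin_index_normal G. \<forall>N\<in>fin_index_normal G. N \<subseteq> M \<longrightarrow> x N \<subseteq> x M}\<rparr>"

definition profinite_topology :: "('a, 'b) monoid_scheme \<Rightarrow> ('a set \<Rightarrow> 'a set) topology" where
  "profinite_topology G =
     subtopology
       (product_topology (\<lambda>N. discrete_topology (carrier (G Mod N))) (fin_index_normal G))
       (carrier (profinite_completion G))"

definition profinitely_iso :: "('a, 'b) monoid_scheme \<Rightarrow> ('c, 'd) monoid_scheme \<Rightarrow> bool" where
  "profinitely_iso G H \<longleftrightarrow>
     (\<exists>f \<in> iso (profinite_completion G) (profinite_completion H).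
        homeomorphic_map (profinite_topology G) (profinite_topology H) f)"


section \<open>Polycyclic-by-finite groups and the genus\<close>

definition polycyclic :: "('a, 'b) monoid_scheme \<Rightarrow> bool" where
  "polycyclic G \<longleftrightarrow> group G \<and>
     (\<exists>(n::nat) S. S 0 = {\<one>\<^bsub>G\<^esub>} \<and> S n = carrier G \<and>
        (\<forall>i\<le>n. subgroup (S i) G) \<and>
        (\<forall>i<n. S i \<lhd> G\<lparr>carrier := S (Suc i)\<rparr> \<and>
                cyclic_group (G\<lparr>carrier := S (Suc i)\<rparr> Mod S i)))"

definition polycyclic_by_finite :: "('a, 'b) monoid_scheme \<Rightarrow> bool" where
  "polycyclic_by_finite G \<longleftrightarrow> group G \<and>
     (\<exists>N. N \<lhd> G \<and> finite (rcosets\<^bsub>G\<^esub> N) \<and> polycyclic (G\<lparr>carrier := N\<rparr>))"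

lemma countable_extension:
  assumes "N \<lhd> G" "countable N" "countable (rcosets\<^bsub>G\<^esub> N)"
  shows "countable (carrier G)"
proof -
  interpret normal N G by fact
  have "countable C" if "C \<in> rcosets\<^bsub>G\<^esub> N" for C
    using that assms(2) by (auto simp: RCOSETS_def r_coset_def)
  then have "countable (\<Union>(rcosets\<^bsub>G\<^esub> N))"
    using countable_UN[of "rcosets\<^bsub>G\<^esub> N" id] assms(3) by simp
  then show ?thesis
    using rcosets_part_G[OF subgroup_axioms] by simp
qed

lemma polycyclic_imp_countable:
  assumes "polycyclic G"
  shows "countable (carrier G)"
proof -
  obtain n S where S: "S 0 = {\<one>\<^bsub>G\<^esub>}" "S n = carrier G"
    and step: "\<And>i. i < n \<Longrightarrow> S i \<lhd> G\<lparr>carrier := S (Suc i)\<rparr>"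
      "\<And>i. i < n \<Longrightarrow> cyclic_group (G\<lparr>carrier := S (Suc i)\<rparr> Mod S i)"
    using assms unfolding polycyclic_def by metis
  have "countable (S i)" if "i \<le> n" for i
    using that
  proof (induction i)
    case 0
    then show ?case by (simp add: S)
  next
    case (Suc i)
    let ?H = "G\<lparr>carrier := S (Suc i)\<rparr>"
    have N: "S i \<lhd> ?H" and c: "cyclic_group (?H Mod S i)"
      using step Suc.prems by auto
    have "countable (carrier (?H Mod S i))"
      using c group.cyclic_group[OF normal.factorgroup_is_group[OF N]]
      by (metis countable_image countableI_type)
    then have "countable (carrier ?H)"
      using countable_extension[OF N] Suc by (simp add: FactGroup_def)
    then show ?case by simp
  qed
  then show ?thesis
    using S by force
qed

lemma polycyclic_by_finite_nat_model:
  assumes "polycyclic_by_finite G"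
  shows "\<exists>H :: nat monoid. group H \<and> G \<cong> H"
proof -
  obtain N where N: "N \<lhd> G" "finite (rcosets\<^bsub>G\<^esub> N)" "polycyclic (G\<lparr>carrier := N\<rparr>)"
    using assms unfolding polycyclic_by_finite_def by blast
  interpret group G
    using assms unfolding polycyclic_by_finite_def by blast
  have "countable (carrier G)"
    using countable_extension[OF N(1)] polycyclic_imp_countable[OF N(3)] N(2)
    by (simp add: countable_finite)
  then obtain f :: "'a \<Rightarrow> nat" where f: "inj_on f (carrier G)"
    by (auto simp: countable_def)
  let ?g = "inv_into (carrier G) f"
  define H :: "nat monoid" where
    "H = \<lparr>carrier = f ` carrier G, monoid.mult = (\<lambda>x y. f (?g x \<otimes>\<^bsub>G\<^esub> ?g y)), one = f \<one>\<^bsub>G\<^esub>\<rparr>"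
  have "f \<in> iso G H"
    using f by (auto simp: iso_def hom_def bij_betw_def H_def)
  moreover from iso_imp_img_group[OF this] have "group H"
    by (simp add: H_def)
  ultimately show ?thesis
    by (auto simp: is_iso_def)
qed

text \<open>
  By \<open>polycyclic_by_finite_nat_model\<close>, groups with carrier a set of natural numbers represent all
  isomorphism classes of polycyclic-by-finite groups.
\<close>

definition PF_genus :: "('a, 'b) monoid_scheme \<Rightarrow> nat monoid set set" where
  "PF_genus G =
     (let S = {H :: nat monoid. polycyclic_by_finite H \<and> profinitely_iso H G}
      in S // {(H, K). H \<in> S \<and> K \<in> S \<and> H \<cong> K})"


section \<open>Orders and their ideal classes\<close>

text \<open>
  Orders are subrings \<open>R\<close> of the complex numbers; the field of fractions is formed inside
  the complex numbers as well. A fractional ideal is a nonzero finitely generated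
  \<open>R\<close>-submodule of it.
\<close>

definition adjoin_Z :: "complex \<Rightarrow> complex set" where
  "adjoin_Z \<mu> = range (\<lambda>p :: int poly. poly (map_poly of_int p) \<mu>)"

definition frac_field :: "complex set \<Rightarrow> complex set" where
  "frac_field R = {x / y | x y. x \<in> R \<and> y \<in> R \<and> y \<noteq> 0}"

definition module_span :: "complex set \<Rightarrow> complex set \<Rightarrow> complex set" where
  "module_span R S = {\<Sum>s\<in>F. c s * s | F c. finite F \<and> F \<subseteq> S \<and> c ` F \<subseteq> R}"

definition fractional_ideal :: "complex set \<Rightarrow> complex set \<Rightarrow> bool" where
  "fractional_ideal R I \<longleftrightarrow>
     (\<exists>F. finite F \<and> F \<subseteq> frac_field R \<and> I = module_span R F) \<and> I \<noteq> {0}"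

definition ideal_mult :: "complex set \<Rightarrow> complex set \<Rightarrow> complex set \<Rightarrow> complex set" where
  "ideal_mult R I J = module_span R {x * y | x y. x \<in> I \<and> y \<in> J}"

definition principal_ideals :: "complex set \<Rightarrow> complex set set" where
  "principal_ideals R = {(*) \<alpha> ` R | \<alpha>. \<alpha> \<in> frac_field R - {0}}"

definition invertible_ideal :: "complex set \<Rightarrow> complex set \<Rightarrow> bool" where
  "invertible_ideal R I \<longleftrightarrow> fractional_ideal R I \<and>
     (\<exists>J. fractional_ideal R J \<and> ideal_mult R I J \<in> principal_ideals R)"

definition invertible_ideal_group :: "complex set \<Rightarrow> complex set monoid" where
  "invertible_ideal_group R =
     \<lparr>carrier = {I. invertible_ideal R I}, monoid.mult = ideal_mult R, one = R\<rparr>"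

definition Picard_group :: "complex set \<Rightarrow> complex set set monoid" where
  "Picard_group R = invertible_ideal_group R Mod principal_ideals R"

definition class_number :: "complex set \<Rightarrow> nat" where
  "class_number R = Coset.order (Picard_group R)"

definition ideal_classes :: "complex set \<Rightarrow> complex set set set" where
  "ideal_classes R =
     {I. fractional_ideal R I} //
       {(I, J). fractional_ideal R I \<and> fractional_ideal R J \<and>
          (\<exists>\<alpha>\<in>frac_field R - {0}. J = (*) \<alpha> ` I)}"

text \<open>
  The ideal of \<open>\<int>[\<mu>]\<close> that the Latimer--MacDuffee correspondence attaches to \<open>A\<close>: its
  generators are the entries of the eigenvector \<open>(b, \<mu> - a)\<close>.
\<close>

definition LM_ideal :: "int^2^2 \<Rightarrow> complex \<Rightarrow> complex set" where
  "LM_ideal A \<mu> =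
     {of_int m * of_int (A $ 1 $ 2) + of_int n * (\<mu> - of_int (A $ 1 $ 1)) | m n :: int. True}"

end

theory Submission
  imports Defs "HOL-Number_Theory.Cong"
begin

text \<open>
  An isomorphism of the profinite completions of \<open>H\<close> and \<open>G\<^sub>A\<close> is a compatible cofinal family of
  surjections from \<open>H\<close> to the finite quotients of \<open>G\<^sub>A\<close>; modulo \<open>r\<int>\<^sup>2 \<times> m\<int>\<close> it represents the elements
  of \<open>H\<close> by pairs \<open>(v, k)\<close>. A polycyclic-by-finite \<open>H\<close> is Noetherian and residually finite, so it is
  recovered from these representations. If \<open>1\<close> is not an eigenvalue of \<open>A\<close>, both abelianizations have
  rank one; the kernel of \<open>H \<rightarrow> \<int>\<close> is free abelian of rank two, and \<open>H \<cong> G\<^sub>B\<close> for some \<open>B\<close> which modulo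
  every \<open>r\<close> is conjugate to a power of \<open>A\<close> with unit exponent. Hence \<open>det B = det A\<close>, and \<open>B\<close> or its
  inverse has the same trace as \<open>A\<close>, so that Latimer--MacDuffee bounds the genus by the number of
  ideal classes. Conversely, matrices of invertible ideals are primitive, hence conjugate to the
  companion matrix modulo every integer, and so their groups lie in one genus; as \<open>G\<^sub>B \<cong> G\<^sub>C\<close> only if \<open>B\<close>
  is conjugate to \<open>C\<close> or to its inverse, at most two invertible classes (only one if the determinant is
  \<open>-1\<close>) give isomorphic groups. An involution \<open>A\<close> of trace \<open>0\<close> has eigenvalue \<open>1\<close>; there the subgroup
  of index two on which \<open>t\<^sup>2\<close> is central replaces \<open>\<int>\<^sup>2\<close>, and the two conjugacy classes of such
  involutions are told apart by the quotient \<open>(\<int>/2)\<^sup>3\<close>.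
\<close>

section \<open>Comparing profinite completions\<close>

text \<open>The obstacle is the unit exponent: it varies with the modulus, so the characteristic
  polynomials of \<open>A\<close> and \<open>B\<close> cannot be compared directly. What survives is
  divisibility. A unit modulo an even number is odd, and \<open>trace A\<close> divides the trace of
  every odd power of \<open>A\<close>; the same holds for \<open>B\<close>. So
  \<open>trace A\<close> and \<open>trace B\<close> have the same divisors and agree up to sign. For
  determinant \<open>1\<close> the number \<open>trace - 2\<close> behaves in the same way, and the
  two conditions together fix the sign. In the opposite direction, conjugacy at each prime has to
  become one coherent system of intertwining matrices. The Chinese remainder theorem supplies them,
  and each has to be invertible only modulo the number it belongs to. No structure theory of
  profinite groups enters: ranks are bounded by counting classes modulo squares, and the rest
  consists of congruences between integer matrices.\<close>

lemma (in group) r_coset_eq_iff: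
  assumes "subgroup N G" "x \<in> carrier G" "y \<in> carrier G"
  shows "N #> x = N #> y \<longleftrightarrow> x \<otimes> inv y \<in> N"
proof -
  interpret N: subgroup N G by fact
  show ?thesis
    using repr_independence[OF _ assms(3,1), of x] rcos_self[OF assms(2,1)]
      N.rcos_module[OF is_group assms(3,2)] by auto
qed

lemma (in group) carrier_Mod_rep:
  assumes "N \<lhd> G" "C \<in> carrier (G Mod N)" "g \<in> C"
  shows "g \<in> carrier G" "C = N #> g"
proof -
  have N: "subgroup N G" using assms(1) by (rule normal_imp_subgroup)
  obtain x where x: "x \<in> carrier G" "C = N #> x" using assms(2) by (auto simp: carrier_FactGroup)
  then show "g \<in> carrier G"
    using assms(3) subgroup.elemrcos_carrier[OF N is_group] by blast
  show "C = N #> g" using repr_independence[OF _ x(1) N] assms(3) x by auto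
qed

lemma (in group) carrier_Mod_nonempty:
  assumes "N \<lhd> G" "C \<in> carrier (G Mod N)"
  obtains g where "g \<in> carrier G" "g \<in> C" "C = N #> g"
proof -
  obtain x where x: "x \<in> carrier G" "C = N #> x" using assms by (auto simp: carrier_FactGroup)
  then show ?thesis using that rcos_self[OF x(1) normal_imp_subgroup[OF assms(1)]] by blast
qed

text \<open>Compatible families are related by inclusions of cosets only; one common element turns
  this into equality of cosets of one subgroup.\<close>

lemma (in group) carrier_Mod_subset_eq:
  assumes "N \<lhd> G" "C \<in> carrier (G Mod N)" "D \<in> carrier (G Mod N)" "x \<in> C" "x \<in> D"
  shows "C = D"
  using assms carrier_Mod_rep by metis

lemma (in group) fin_index_normal_carrier: "carrier G \<in> fin_index_normal G"
proof -
  have "rcosets (carrier G) = {carrier G}"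
    unfolding RCOSETS_def using one_closed coset_join2[OF _ subgroup_self] by fastforce
  then show ?thesis using normal_self by (simp add: fin_index_normal_def)
qed

text \<open>A finite-valued invariant whose equal values force equal cosets bounds the index. It
  need not be constant on cosets, which spares normal forms for coset representatives.\<close>

lemma (in group) finite_rcosetsI:
  assumes "subgroup M G" "finite (f ` carrier G)"
    and "\<And>x y. x \<in> carrier G ==> y \<in> carrier G ==> f x = f y ==> x \<otimes> inv y \<in> M"
  shows "finite (rcosets M)"
proof -
  define r where "r z = (SOME x. x \<in> carrier G \<and> f x = z)" for z
  have r: "r (f x) \<in> carrier G \<and> f (r (f x)) = f x" if "x \<in> carrier G" for x
    unfolding r_def by (rule someI_ex) (use that in blast)
  have "M #> x = M #> r (f x)" if x: "x \<in> carrier G" for x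
  proof -
    have "x \<otimes> inv (r (f x)) \<in> M" by (rule assms(3)) (use r[OF x] x in \<open>auto\<close>)
    then show ?thesis using r_coset_eq_iff[OF assms(1) x] r[OF x] by blast
  qed
  then have "rcosets M \<subseteq> (\<lambda>z. M #> r z) ` f ` carrier G" by (auto simp: RCOSETS_def)
  then show ?thesis using assms(2) finite_subset by blast
qed

lemma (in group) fin_index_normal_Int:
  assumes "M \<in> fin_index_normal G" "N \<in> fin_index_normal G"
  shows "M \<inter> N \<in> fin_index_normal G"
proof -
  have n: "M \<lhd> G" "N \<lhd> G" "finite (rcosets M)" "finite (rcosets N)"
    using assms by (auto simp: fin_index_normal_def)
  have s: "subgroup M G" "subgroup N G" using n normal_imp_subgroup by auto
  have "finite (rcosets (M \<inter> N))"
  proof (rule finite_rcosetsI[where f = "\<lambda>x. (M #> x, N #> x)"])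
    show "subgroup (M \<inter> N) G" using s by (rule subgroups_Inter_pair)
    have "(\<lambda>x. (M #> x, N #> x)) ` carrier G \<subseteq> (rcosets M) \<times> (rcosets N)"
      by (auto simp: RCOSETS_def)
    then show "finite ((\<lambda>x. (M #> x, N #> x)) ` carrier G)"
      using n finite_subset by blast
  qed (use s in \<open>auto simp: r_coset_eq_iff\<close>)
  then show ?thesis
    using normal_subgroup_intersect[OF n(1,2)] by (simp add: fin_index_normal_def)
qed

text \<open>Intersecting with \<open>carrier G\<close> gives the empty family a meaning; it occurs
  when an open set constrains no coordinate.\<close>

lemma (in group) fin_index_normal_Inter:
  assumes "finite J" "J \<subseteq> fin_index_normal G"
  shows "carrier G \<inter> \<Inter>J \<in> fin_index_normal G"
  using assms
proof (induction J)
  case empty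
  then show ?case by (simp add: fin_index_normal_carrier)
next
  case (insert N J)
  have "N \<inter> (carrier G \<inter> \<Inter>J) \<in> fin_index_normal G"
    using insert by (intro fin_index_normal_Int[OF _ insert.IH]) auto
  then show ?case by (simp add: Int_ac)
qed

lemma fin_index_normal_normal: "N \<in> fin_index_normal G ==> N \<lhd> G"
  by (simp add: fin_index_normal_def)

lemma (in group) profinite_completion_memD:
  assumes "x \<in> carrier (profinite_completion G)" "N \<in> fin_index_normal G"
  shows "x N \<in> carrier (G Mod N)"
    and "M \<in> fin_index_normal G ==> N \<subseteq> M ==> x N \<subseteq> x M"
  using assms by (auto simp: profinite_completion_def)

definition to_completion :: "('a, 'b) monoid_scheme => 'a => 'a set => 'a set" where
  "to_completion G g = (\<lambda>N\<in>fin_index_normal G. N #>\<^bsub>G\<^esub> g)"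

lemma (in group) to_completion_carrier:
  "g \<in> carrier G ==> to_completion G g \<in> carrier (profinite_completion G)"
  by (auto simp: to_completion_def profinite_completion_def carrier_FactGroup r_coset_def)

lemma (in group) mult_profinite_completion:
  "x \<otimes>\<^bsub>profinite_completion G\<^esub> y = (\<lambda>N\<in>fin_index_normal G. x N <#> y N)"
  by (simp add: profinite_completion_def)

lemma (in group) rcos_mult:
  assumes "N \<lhd> G" "x \<in> carrier G" "y \<in> carrier G"
  shows "(N #> x) <#> (N #> y) = N #> (x \<otimes> y)"
  using normal.rcos_sum[OF assms] .

lemma (in group) profinite_completion_mult_closed:
  assumes x: "x \<in> carrier (profinite_completion G)" and y: "y \<in> carrier (profinite_completion G)"
  shows "x \<otimes>\<^bsub>profinite_completion G\<^esub> y \<in> carrier (profinite_completion G)"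
proof -
  have "x L <#> y L \<in> carrier (G Mod L)" if L: "L \<in> fin_index_normal G" for L
  proof -
    obtain h h' where "h \<in> carrier G" "h' \<in> carrier G" "x L = L #> h" "y L = L #> h'"
      using profinite_completion_memD(1)[OF x L] profinite_completion_memD(1)[OF y L] by (auto simp: carrier_FactGroup)
    then show ?thesis using rcos_mult[OF fin_index_normal_normal[OF L]] by (auto simp: carrier_FactGroup)
  qed
  moreover have "x L <#> y L \<subseteq> x L' <#> y L'"
    if "L \<in> fin_index_normal G" "L' \<in> fin_index_normal G" "L \<subseteq> L'" for L L'
    using that profinite_completion_memD(2)[OF x] profinite_completion_memD(2)[OF y] by (intro mono_set_mult) auto
  ultimately show ?thesis unfolding mult_profinite_completion by (auto simp: profinite_completion_def)
qed

lemma (in group) to_completion_mult: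
  assumes "g \<in> carrier G" "h \<in> carrier G"
  shows "to_completion G (g \<otimes> h) = to_completion G g \<otimes>\<^bsub>profinite_completion G\<^esub> to_completion G h"
  using assms by (auto simp: mult_profinite_completion to_completion_def rcos_mult fin_index_normal_normal intro!: restrict_ext)

lemma profinite_completion_extensional:
  assumes "x \<in> carrier (profinite_completion G)" "y \<in> carrier (profinite_completion G)"
    "\<And>N. N \<in> fin_index_normal G ==> x N = y N"
  shows "x = y"
  using assms by (auto simp: profinite_completion_def intro: PiE_ext)

lemma topspace_profinite_topology [simp]:
  "topspace (profinite_topology G) = carrier (profinite_completion G)"
  by (auto simp: profinite_topology_def profinite_completion_def)

text \<open>A basic open set constrains finitely many coordinates, and by compatibility the
  coordinate at the intersection of the corresponding subgroups determines all of them. So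
  neighbourhoods may be taken to depend on a single coordinate.\<close>

lemma (in group) profinite_nbhd:
  assumes "openin (profinite_topology G) W" "x \<in> W"
  obtains N where "N \<in> fin_index_normal G"
    "\<And>z. z \<in> carrier (profinite_completion G) ==> z N = x N ==> z \<in> W"
proof -
  obtain W' where W': "openin (product_topology (\<lambda>N. discrete_topology (carrier (G Mod N))) (fin_index_normal G)) W'"
      "W = W' \<inter> carrier (profinite_completion G)"
    using assms(1) by (auto simp: profinite_topology_def openin_subtopology)
  obtain U where U: "finite {N \<in> fin_index_normal G. U N \<noteq> carrier (G Mod N)}"
     "x \<in> Pi\<^sub>E (fin_index_normal G) U" "Pi\<^sub>E (fin_index_normal G) U \<subseteq> W'"
    using W' assms(2) unfolding openin_product_topology_alt by fastforce
  define J where "J = {N \<in> fin_index_normal G. U N \<noteq> carrier (G Mod N)}"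
  define N where "N = carrier G \<inter> \<Inter>J"
  have N: "N \<in> fin_index_normal G" unfolding N_def J_def using U by (intro fin_index_normal_Inter) auto
  have x: "x \<in> carrier (profinite_completion G)" using assms(2) W' by auto
  show thesis
  proof (rule that[OF N])
    fix z assume z: "z \<in> carrier (profinite_completion G)" "z N = x N"
    have "z M \<in> U M" if M: "M \<in> fin_index_normal G" for M
    proof (cases "M \<in> J")
      case True
      then have "N \<subseteq> M" by (auto simp: N_def)
      then have s: "z N \<subseteq> z M" "x N \<subseteq> x M"
        using profinite_completion_memD(2)[OF z(1) N M] profinite_completion_memD(2)[OF x N M] by auto
      obtain g where "g \<in> z N"
        using carrier_Mod_nonempty[OF fin_index_normal_normal[OF N] profinite_completion_memD(1)[OF z(1) N]] .
      then have "z M = x M"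
        using carrier_Mod_subset_eq[OF fin_index_normal_normal[OF M] profinite_completion_memD(1)[OF z(1) M] profinite_completion_memD(1)[OF x M]] z(2) s by auto
      then show ?thesis using U M by auto
    next
      case False
      then show ?thesis using M profinite_completion_memD(1)[OF z(1) M] by (simp add: J_def)
    qed
    moreover have "z \<in> extensional (fin_index_normal G)" using z by (auto simp: profinite_completion_def PiE_def)
    ultimately have "z \<in> Pi\<^sub>E (fin_index_normal G) U" by (auto simp: PiE_def)
    then show "z \<in> W" using U W' z by auto
  qed
qed

text \<open>The coordinate at \<open>N\<close> is continuous into a discrete space, so
  \<open>F\<close> may be arbitrary; in the applications it involves a choice.\<close>

lemma continuous_map_profinite_coordinate:
  assumes "N \<in> fin_index_normal G"
    and "\<And>x. x \<in> carrier (profinite_completion G) ==> F (x N) \<in> S"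
  shows "continuous_map (profinite_topology G) (discrete_topology S) (\<lambda>x. F (x N))"
proof -
  have 1: "continuous_map (profinite_topology G) (discrete_topology (carrier (G Mod N))) (\<lambda>x. x N)"
    unfolding profinite_topology_def
    by (rule continuous_map_from_subtopology[OF continuous_map_product_projection[OF assms(1)]])
  show ?thesis
    unfolding continuous_map_def
  proof (intro conjI allI impI)
    fix U assume "openin (discrete_topology S) U"
    have "openin (profinite_topology G) {x \<in> topspace (profinite_topology G). x N \<in> {C \<in> carrier (G Mod N). F C \<in> U}}"
      using 1 by (rule openin_continuous_map_preimage) auto
    moreover have "{x \<in> topspace (profinite_topology G). x N \<in> {C \<in> carrier (G Mod N). F C \<in> U}}
       = {x \<in> topspace (profinite_topology G). F (x N) \<in> U}"
      using assms(1) by (auto simp: profinite_completion_def)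
    ultimately show "openin (profinite_topology G) {x \<in> topspace (profinite_topology G). F (x N) \<in> U}" by simp
  qed (use assms in auto)
qed

lemma openin_profinite_coordinate:
  assumes "N \<in> fin_index_normal G"
  shows "openin (profinite_topology G) {x \<in> carrier (profinite_completion G). x N = C}"
proof -
  have "openin (profinite_topology G) {x \<in> topspace (profinite_topology G). x N \<in> {C} \<inter> carrier (G Mod N)}"
    using continuous_map_profinite_coordinate[OF assms, of "\<lambda>x. x" "carrier (G Mod N)"] assms
    by (intro openin_continuous_map_preimage) (auto simp: profinite_completion_def)
  moreover have "{x \<in> topspace (profinite_topology G). x N \<in> {C} \<inter> carrier (G Mod N)} = {x \<in> carrier (profinite_completion G). x N = C}"
    using assms by (auto simp: profinite_completion_def)
  ultimately show ?thesis by simp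
qed

text \<open>
  A homomorphism from \<open>H\<close> to the completion of \<open>G\<close> with dense image, such that the profinite topology
  of \<open>G\<close> pulls back to that of \<open>H\<close>, given by its components in the finite quotients of \<open>G\<close>.
\<close>

definition profinite_family ::
  "('a, 'c) monoid_scheme => ('b, 'd) monoid_scheme => ('b set => 'a => 'b set) => bool" where
  "profinite_family H G \<theta> \<longleftrightarrow>
     (\<forall>M\<in>fin_index_normal G. \<theta> M \<in> hom H (G Mod M) \<and> \<theta> M ` carrier H = carrier (G Mod M)) \<and>
     (\<forall>M\<in>fin_index_normal G. \<forall>N\<in>fin_index_normal G. N \<subseteq> M \<longrightarrow>
        (\<forall>h\<in>carrier H. \<theta> N h \<subseteq> \<theta> M h)) \<and>
     (\<forall>L\<in>fin_index_normal H. \<exists>M\<in>fin_index_normal G. \<forall>h\<in>carrier H. \<theta> M h = M \<longrightarrow> h \<in> L)"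

text \<open>\<open>\<theta> M\<close> is the \<open>M\<close>-coordinate of the image of
  \<open>h\<close> under the isomorphism \<open>f\<close>. Surjectivity rests on the density of
  \<open>H\<close> in its completion, the last clause of the family on \<open>f\<close> being an
  open map.\<close>

lemma profinitely_iso_imp_family:
  assumes "group H" "group G" "profinitely_iso H G"
  shows "\<exists>\<theta>. profinite_family H G \<theta>"
proof -
  interpret H: group H by fact
  interpret G: group G by fact
  obtain f where f: "f \<in> iso (profinite_completion H) (profinite_completion G)"
     "homeomorphic_map (profinite_topology H) (profinite_topology G) f"
    using assms(3) by (auto simp: profinitely_iso_def)
  have fhom: "f (x \<otimes>\<^bsub>profinite_completion H\<^esub> y) = f x \<otimes>\<^bsub>profinite_completion G\<^esub> f y"
    if "x \<in> carrier (profinite_completion H)" "y \<in> carrier (profinite_completion H)" for x y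
    using f(1) that by (auto simp: iso_def hom_def)
  have fbij: "bij_betw f (carrier (profinite_completion H)) (carrier (profinite_completion G))"
    using f(1) by (auto simp: iso_def)
  have fcl: "f x \<in> carrier (profinite_completion G)" if "x \<in> carrier (profinite_completion H)" for x
    using fbij that by (auto simp: bij_betw_def)
  define \<theta> where "\<theta> M h = f (to_completion H h) M" for M h
  have 1: "\<theta> M \<in> hom H (G Mod M)" if M: "M \<in> fin_index_normal G" for M
    using M G.profinite_completion_memD(1)[OF fcl[OF H.to_completion_carrier] M]
    by (auto simp: hom_def \<theta>_def H.to_completion_mult fhom H.to_completion_carrier G.mult_profinite_completion)
  have 2: "\<theta> M ` carrier H = carrier (G Mod M)" if M: "M \<in> fin_index_normal G" for M
  proof
    show "\<theta> M ` carrier H \<subseteq> carrier (G Mod M)" using 1[OF M] by (auto simp: hom_def)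
    show "carrier (G Mod M) \<subseteq> \<theta> M ` carrier H"
    proof
      fix C assume C: "C \<in> carrier (G Mod M)"
      then obtain g where g: "g \<in> carrier G" "C = M #>\<^bsub>G\<^esub> g" by (auto simp: carrier_FactGroup)
      then obtain x where x: "x \<in> carrier (profinite_completion H)" "f x = to_completion G g"
        using fbij G.to_completion_carrier[OF g(1)] by (metis bij_betw_imp_surj_on imageE)
      let ?U = "{z \<in> carrier (profinite_completion G). z M = C}"
      \<comment> \<open>Density: \<open>W\<close> is an open neighbourhood of \<open>x\<close>, so
        it contains the image of an element of \<open>H\<close>.\<close>
      define W where "W = {z \<in> topspace (profinite_topology H). f z \<in> ?U}"
      have "openin (profinite_topology H) W"
        unfolding W_def using f(2) openin_profinite_coordinate[OF M]
        by (intro openin_continuous_map_preimage[OF homeomorphic_imp_continuous_map])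
      moreover have "x \<in> W"
        using x g M G.to_completion_carrier by (auto simp: W_def to_completion_def)
      ultimately obtain N where N: "N \<in> fin_index_normal H"
        "\<And>z. z \<in> carrier (profinite_completion H) ==> z N = x N ==> z \<in> W"
        using H.profinite_nbhd by blast
      obtain h where h: "h \<in> carrier H" "x N = N #>\<^bsub>H\<^esub> h"
        using H.profinite_completion_memD(1)[OF x(1) N(1)] by (auto simp: carrier_FactGroup)
      have "to_completion H h \<in> W"
        using h N(1) H.to_completion_carrier by (intro N(2)) (auto simp: to_completion_def)
      then have "\<theta> M h = C" by (simp add: W_def \<theta>_def)
      then show "C \<in> \<theta> M ` carrier H" using h by blast
    qed
  qed
  have 3: "\<theta> N h \<subseteq> \<theta> M h" if "M \<in> fin_index_normal G" "N \<in> fin_index_normal G" "N \<subseteq> M" "h \<in> carrier H" for M N h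
    using that G.profinite_completion_memD(2)[OF fcl[OF H.to_completion_carrier]] by (auto simp: \<theta>_def)
  have 4: "\<exists>M\<in>fin_index_normal G. \<forall>h\<in>carrier H. \<theta> M h = M \<longrightarrow> h \<in> L" if L: "L \<in> fin_index_normal H" for L
  proof -
    let ?W = "{z \<in> carrier (profinite_completion H). z L = L}"
    have 1: "to_completion H \<one>\<^bsub>H\<^esub> \<in> ?W"
      using L H.to_completion_carrier normal_imp_subgroup[OF fin_index_normal_normal[OF L]]
      by (simp add: to_completion_def subgroup.subset)
    have o: "openin (profinite_topology G) (f ` ?W)"
      using homeomorphic_imp_open_map[OF f(2)] openin_profinite_coordinate[OF L] by (auto simp: open_map_def)
    have "f (to_completion H \<one>\<^bsub>H\<^esub>) \<in> f ` ?W" using 1 by blast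
    then obtain M where M: "M \<in> fin_index_normal G"
       "\<And>z. z \<in> carrier (profinite_completion G) ==> z M = f (to_completion H \<one>\<^bsub>H\<^esub>) M ==> z \<in> f ` ?W"
      using G.profinite_nbhd[OF o, of "f (to_completion H \<one>\<^bsub>H\<^esub>)"] by blast
    interpret GM: group "G Mod M" using M(1) by (simp add: fin_index_normal_def normal.factorgroup_is_group)
    have one: "f (to_completion H \<one>\<^bsub>H\<^esub>) M = M"
      using hom_one[OF \<open>M \<in> fin_index_normal G ==> \<theta> M \<in> hom H (G Mod M)\<close>[OF M(1)] H.group_axioms GM.group_axioms]
      by (simp add: \<theta>_def)
    have "h \<in> L" if h: "h \<in> carrier H" "\<theta> M h = M" for h
    proof -
      have "f (to_completion H h) \<in> f ` ?W"
        using h one by (intro M(2) fcl H.to_completion_carrier) (auto simp: \<theta>_def)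
      then have "to_completion H h \<in> ?W"
        using fbij H.to_completion_carrier[OF h(1)] by (auto simp: bij_betw_def dest: inj_onD)
      then have "L #>\<^bsub>H\<^esub> h = L" using L by (simp add: to_completion_def)
      then show "h \<in> L"
        using H.rcos_self[OF h(1) normal_imp_subgroup[OF fin_index_normal_normal[OF L]]] by simp
    qed
    then show ?thesis using M(1) by blast
  qed
  show ?thesis unfolding profinite_family_def
    by (intro exI[of _ \<theta>] conjI ballI impI 1 2 3 4)
qed

text \<open>Both directions are explicit. The kernel \<open>k M\<close> of \<open>\<theta> M\<close>
  has finite index, so the coordinate \<open>x (k M)\<close> determines the
  \<open>M\<close>-coordinate of \<open>f x\<close>. Conversely \<open>m L\<close> is a level at
  which \<open>\<theta>\<close> detects membership in \<open>L\<close>, so any lift of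
  \<open>y (m L)\<close> gives the \<open>L\<close>-coordinate of \<open>g y\<close>. Each
  coordinate of the value reads one coordinate of the argument, whence continuity.\<close>

lemma profinite_family_imp_iso:
  fixes H (structure)
  assumes "group H" "group G" and fam: "profinite_family H G \<theta>"
  shows "profinitely_iso H G"
proof -
  interpret H: group H by fact
  interpret G: group G by fact
  let ?FG = "fin_index_normal G" and ?FH = "fin_index_normal H"
  let ?PG = "profinite_completion G" and ?PH = "profinite_completion H"
  have hom: "\<theta> M \<in> hom H (G Mod M)" and surj: "\<theta> M ` carrier H = carrier (G Mod M)" if "M \<in> ?FG" for M
    using fam that by (auto simp: profinite_family_def)
  have compat: "\<theta> N h \<subseteq> \<theta> M h" if "M \<in> ?FG" "N \<in> ?FG" "N \<subseteq> M" "h \<in> carrier H" for M N h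
    using fam that by (auto simp: profinite_family_def)
  obtain m where m: "\<And>L. L \<in> ?FH ==> m L \<in> ?FG" "\<And>L h. L \<in> ?FH ==> h \<in> carrier H ==> \<theta> (m L) h = m L ==> h \<in> L"
    using fam unfolding profinite_family_def by metis
  have grM: "group (G Mod M)" if "M \<in> ?FG" for M
    using that by (simp add: fin_index_normal_def normal.factorgroup_is_group)
  have gh: "group_hom H (G Mod M) (\<theta> M)" if "M \<in> ?FG" for M
    using hom[OF that] grM[OF that] by (simp add: group_hom_def group_hom_axioms_def H.group_axioms)
  have thcl: "\<theta> M h \<in> carrier (G Mod M)" if "M \<in> ?FG" "h \<in> carrier H" for M h
    using hom[OF that(1)] that by (auto simp: hom_def)
  define k where "k M = {h \<in> carrier H. \<theta> M h = M}" for M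
  have kker: "k M = kernel H (G Mod M) (\<theta> M)" for M by (simp add: k_def kernel_def)
  have kF: "k M \<in> ?FH" if M: "M \<in> ?FG" for M
  proof -
    interpret \<theta>: group_hom H "G Mod M" "\<theta> M" using gh[OF M] .
    have n: "k M \<lhd> H" using \<theta>.normal_kernel by (simp add: kker)
    moreover have "finite (rcosets (k M))"
    proof (rule H.finite_rcosetsI)
      show "subgroup (k M) H" using n by (rule normal_imp_subgroup)
      show "finite (\<theta> M ` carrier H)" using M surj[OF M] by (simp add: fin_index_normal_def FactGroup_def)
      fix x y assume xy: "x \<in> carrier H" "y \<in> carrier H" "\<theta> M x = \<theta> M y"
      then have "\<theta> M (x \<otimes> inv y) = \<theta> M y \<otimes>\<^bsub>G Mod M\<^esub> inv\<^bsub>G Mod M\<^esub> (\<theta> M y)"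
        by (metis H.inv_closed \<theta>.hom_mult \<theta>.hom_inv)
      also have "\<dots> = \<one>\<^bsub>G Mod M\<^esub>" using xy by (metis H.r_inv \<theta>.hom_mult \<theta>.hom_inv H.inv_closed \<theta>.hom_one)
      finally show "x \<otimes> inv y \<in> k M" using xy by (auto simp: k_def)
    qed
    ultimately show ?thesis by (simp add: fin_index_normal_def)
  qed
  have th_eq: "\<theta> M h = \<theta> M h' \<longleftrightarrow> h \<otimes> inv h' \<in> k M" if M: "M \<in> ?FG" and h: "h \<in> carrier H" "h' \<in> carrier H" for M h h'
  proof -
    interpret \<theta>: group_hom H "G Mod M" "\<theta> M" using gh[OF M] .
    have "\<theta> M (h \<otimes> inv h') = \<theta> M h \<otimes>\<^bsub>G Mod M\<^esub> inv\<^bsub>G Mod M\<^esub> (\<theta> M h')"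
      using h by (metis H.inv_closed \<theta>.hom_mult \<theta>.hom_inv)
    moreover have "\<theta> M h \<otimes>\<^bsub>G Mod M\<^esub> inv\<^bsub>G Mod M\<^esub> (\<theta> M h') = \<one>\<^bsub>G Mod M\<^esub> \<longleftrightarrow> \<theta> M h = \<theta> M h'"
      using group.inv_solve_right'[OF grM[OF M], of "\<one>\<^bsub>G Mod M\<^esub>" "\<theta> M h" "\<theta> M h'"]
        thcl[OF M h(1)] thcl[OF M h(2)] monoid.one_closed[OF group.is_monoid[OF grM[OF M]]]
        monoid.l_one[OF group.is_monoid[OF grM[OF M]]] by metis
    ultimately show ?thesis using h by (auto simp: k_def)
  qed
  define f where "f x = (\<lambda>M\<in>?FG. \<theta> M (SOME h. h \<in> x (k M)))" for x
  define g where "g y = (\<lambda>L\<in>?FH. L #> (SOME h. h \<in> carrier H \<and> \<theta> (m L) h = y (m L)))" for y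
  have f_eq: "f x M = \<theta> M h" if x: "x \<in> carrier ?PH" and M: "M \<in> ?FG" and h: "h \<in> x (k M)" for x M h
  proof -
    have kn: "k M \<lhd> H" using kF[OF M] by (rule fin_index_normal_normal)
    have xc: "x (k M) \<in> carrier (H Mod k M)" using H.profinite_completion_memD(1)[OF x kF[OF M]] .
    have s: "(SOME h. h \<in> x (k M)) \<in> x (k M)" using h by (rule someI)
    note r1 = H.carrier_Mod_rep[OF kn xc s] and r2 = H.carrier_Mod_rep[OF kn xc h]
    have "(SOME h. h \<in> x (k M)) \<otimes> inv h \<in> k M"
      using r1 r2 H.r_coset_eq_iff[OF normal_imp_subgroup[OF kn] r1(1) r2(1)] by simp
    then show ?thesis using th_eq[OF M r1(1) r2(1)] M by (simp add: f_def)
  qed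
  have ex: "\<exists>h. h \<in> carrier H \<and> h \<in> x L \<and> x L = L #> h" if "x \<in> carrier ?PH" "L \<in> ?FH" for x L
    using H.carrier_Mod_nonempty[OF fin_index_normal_normal[OF that(2)] H.profinite_completion_memD(1)[OF that]] by metis
  have g_eq: "g y L = L #> h" if y: "y \<in> carrier ?PG" and L: "L \<in> ?FH" and M: "M \<in> ?FG" and kM: "k M \<subseteq> L"
      and h: "h \<in> carrier H" "\<theta> M h = y M" for y L M h
  proof -
    define h1 where "h1 = (SOME h. h \<in> carrier H \<and> \<theta> (m L) h = y (m L))"
    have "y (m L) \<in> \<theta> (m L) ` carrier H" using surj[OF m(1)[OF L]] G.profinite_completion_memD(1)[OF y m(1)[OF L]] by simp
    then have "\<exists>h. h \<in> carrier H \<and> \<theta> (m L) h = y (m L)" by auto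
    then have h1: "h1 \<in> carrier H" "\<theta> (m L) h1 = y (m L)" unfolding h1_def by (metis (mono_tags, lifting) someI_ex)+
    \<comment> \<open>A lift \<open>h2\<close> at the common refinement compares the chosen lift
      \<open>h1\<close>, taken at level \<open>m L\<close>, with the given \<open>h\<close>, taken
      at level \<open>M\<close>.\<close>
    let ?M = "M \<inter> m L"
    have F: "?M \<in> ?FG" using M m L by (intro G.fin_index_normal_Int) auto
    have "y ?M \<in> \<theta> ?M ` carrier H" using surj[OF F] G.profinite_completion_memD(1)[OF y F] by simp
    then obtain h2 where h2: "h2 \<in> carrier H" "\<theta> ?M h2 = y ?M" by auto
    have agree: "\<theta> M' h2 = y M'" if M': "M' \<in> ?FG" "?M \<subseteq> M'" for M'
    proof -
      obtain z where z: "z \<in> y ?M"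
        using G.carrier_Mod_nonempty[OF fin_index_normal_normal[OF F] G.profinite_completion_memD(1)[OF y F]] by metis
      have "z \<in> \<theta> M' h2" using compat[OF M'(1) F M'(2) h2(1)] h2(2) z by auto
      moreover have "z \<in> y M'" using G.profinite_completion_memD(2)[OF y F M'(1,2)] z by auto
      ultimately show ?thesis
        using G.carrier_Mod_subset_eq[OF fin_index_normal_normal[OF M'(1)] thcl[OF M'(1) h2(1)]
            G.profinite_completion_memD(1)[OF y M'(1)]] by blast
    qed
    have "\<theta> M h2 = \<theta> M h" using agree[OF M] h by auto
    then have a: "h2 \<otimes> inv h \<in> L" using th_eq[OF M h2(1) h(1)] kM by auto
    have "\<theta> (m L) h2 = \<theta> (m L) h1" using agree[OF m(1)[OF L]] h1 by auto
    then have "h2 \<otimes> inv h1 \<in> k (m L)" using th_eq[OF m(1)[OF L] h2(1) h1(1)] by auto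
    then have b: "h2 \<otimes> inv h1 \<in> L" using m(2)[OF L] by (auto simp: k_def)
    have sL: "subgroup L H" using L by (simp add: fin_index_normal_normal normal_imp_subgroup)
    have "L #> h1 = L #> h"
      using a b H.r_coset_eq_iff[OF sL h2(1) h(1)] H.r_coset_eq_iff[OF sL h2(1) h1(1)] by simp
    then show ?thesis using L by (simp add: g_def h1_def)
  qed
  have exg: "\<exists>h\<in>carrier H. \<theta> M h = y M" if "y \<in> carrier ?PG" "M \<in> ?FG" for y M
  proof -
    have "y M \<in> \<theta> M ` carrier H" using surj[OF that(2)] G.profinite_completion_memD(1)[OF that] by simp
    then show ?thesis by auto
  qed
  have kmL: "k (m L) \<subseteq> L" if "L \<in> ?FH" for L using m(2)[OF that] by (auto simp: k_def)
  have kmono: "k N \<subseteq> k M" if "N \<subseteq> M" "N \<in> ?FG" "M \<in> ?FG" for M N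
  proof
    fix h assume h: "h \<in> k N"
    then have "h \<in> carrier H" "\<theta> N h = N" by (auto simp: k_def)
    have one: "\<one>\<^bsub>G\<^esub> \<in> N" "\<one>\<^bsub>G\<^esub> \<in> M"
      using that fin_index_normal_normal normal_imp_subgroup subgroup.one_closed by blast+
    have "\<one>\<^bsub>G\<^esub> \<in> \<theta> M h" using compat[OF that(3,2,1) \<open>h \<in> carrier H\<close>] \<open>\<theta> N h = N\<close> one by auto
    moreover have "M \<in> carrier (G Mod M)"
      using monoid.one_closed[OF group.is_monoid[OF grM[OF that(3)]]] by simp
    ultimately have "\<theta> M h = M"
      using G.carrier_Mod_subset_eq[OF fin_index_normal_normal[OF that(3)] thcl[OF that(3) \<open>h \<in> carrier H\<close>]] one by blast
    then show "h \<in> k M" using h by (simp add: k_def)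
  qed
  have fcl: "f x \<in> carrier ?PG" if x: "x \<in> carrier ?PH" for x
  proof -
    have "f x M \<in> carrier (G Mod M)" if M: "M \<in> ?FG" for M
      using ex[OF x kF[OF M]] f_eq[OF x M] thcl[OF M] by metis
    moreover have "f x N \<subseteq> f x M" if MN: "M \<in> ?FG" "N \<in> ?FG" "N \<subseteq> M" for M N
    proof -
      obtain h where h: "h \<in> carrier H" "h \<in> x (k N)" using ex[OF x kF[OF MN(2)]] by auto
      have "x (k N) \<subseteq> x (k M)"
        using H.profinite_completion_memD(2)[OF x kF[OF MN(2)] kF[OF MN(1)] kmono[OF MN(3,2,1)]] .
      then have "h \<in> x (k M)" using h by auto
      then show ?thesis using f_eq[OF x MN(1)] f_eq[OF x MN(2) h(2)] compat[OF MN h(1)] by auto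
    qed
    moreover have "f x \<in> extensional ?FG" by (simp add: f_def)
    ultimately show ?thesis by (auto simp: profinite_completion_def PiE_def)
  qed
  have gcl: "g y \<in> carrier ?PH" if y: "y \<in> carrier ?PG" for y
  proof -
    have *: "\<exists>h\<in>carrier H. g y L = L #> h \<and> g y L' = L' #> h" if L: "L \<in> ?FH" "L' \<in> ?FH" "L \<subseteq> L'" for L L'
    proof -
      obtain h where "h \<in> carrier H" "\<theta> (m L) h = y (m L)" using exg[OF y m(1)[OF L(1)]] by auto
      then show ?thesis using g_eq[OF y L(1) m(1)[OF L(1)] kmL[OF L(1)]] g_eq[OF y L(2) m(1)[OF L(1)]] kmL[OF L(1)] L(3) by auto
    qed
    have "g y L \<in> carrier (H Mod L)" if L: "L \<in> ?FH" for L
      using *[OF L L] by (auto simp: carrier_FactGroup)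
    moreover have "g y L \<subseteq> g y L'" if L: "L \<in> ?FH" "L' \<in> ?FH" "L \<subseteq> L'" for L L'
    proof -
      obtain h where "g y L = L #> h" "g y L' = L' #> h" using *[OF L] by blast
      then show ?thesis using L(3) unfolding r_coset_def by blast
    qed
    moreover have "g y \<in> extensional ?FH" by (simp add: g_def)
    ultimately show ?thesis by (auto simp: profinite_completion_def PiE_def)
  qed
  have fg: "f (g y) = y" if y: "y \<in> carrier ?PG" for y
  proof (rule profinite_completion_extensional[OF fcl[OF gcl[OF y]] y])
    fix M assume M: "M \<in> ?FG"
    obtain h where h: "h \<in> carrier H" "\<theta> M h = y M" using exg[OF y M] by auto
    have "g y (k M) = k M #> h" using g_eq[OF y kF[OF M] M _ h] by simp
    then have "h \<in> g y (k M)"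
      using H.rcos_self[OF h(1) normal_imp_subgroup[OF fin_index_normal_normal[OF kF[OF M]]]] by simp
    then show "f (g y) M = y M" using f_eq[OF gcl[OF y] M] h by simp
  qed
  have gf: "g (f x) = x" if x: "x \<in> carrier ?PH" for x
  proof (rule profinite_completion_extensional[OF gcl[OF fcl[OF x]] x])
    fix L assume L: "L \<in> ?FH"
    obtain h where h: "h \<in> carrier H" "h \<in> x (k (m L))" using ex[OF x kF[OF m(1)[OF L]]] by auto
    have 1: "g (f x) L = L #> h"
      using g_eq[OF fcl[OF x] L m(1)[OF L] kmL[OF L] h(1)] f_eq[OF x m(1)[OF L] h(2)] by simp
    have "h \<in> x L" using H.profinite_completion_memD(2)[OF x kF[OF m(1)[OF L]] L kmL[OF L]] h by auto
    then show "g (f x) L = x L"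
      using 1 H.carrier_Mod_rep(2)[OF fin_index_normal_normal[OF L] H.profinite_completion_memD(1)[OF x L]] by simp
  qed
  have fhom: "f \<in> hom ?PH ?PG"
  proof (rule homI)
    fix x y assume x: "x \<in> carrier ?PH" and y: "y \<in> carrier ?PH"
    have xyM: "\<exists>h h'. h \<in> carrier H \<and> h' \<in> carrier H \<and> x L = L #> h \<and> y L = L #> h' \<and> h \<in> x L \<and> h' \<in> y L" if "L \<in> ?FH" for L
      using ex[OF x that] ex[OF y that] by blast
    have xy: "x \<otimes>\<^bsub>?PH\<^esub> y \<in> carrier ?PH" using H.profinite_completion_mult_closed[OF x y] .
    show "f (x \<otimes>\<^bsub>?PH\<^esub> y) = f x \<otimes>\<^bsub>?PG\<^esub> f y"
    proof
      fix M show "f (x \<otimes>\<^bsub>?PH\<^esub> y) M = (f x \<otimes>\<^bsub>?PG\<^esub> f y) M"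
      proof (cases "M \<in> ?FG")
        case M: True
        obtain h h' where h: "h \<in> carrier H" "h' \<in> carrier H" "x (k M) = k M #> h" "y (k M) = k M #> h'" "h \<in> x (k M)" "h' \<in> y (k M)"
          using xyM[OF kF[OF M]] by blast
        have "(x \<otimes>\<^bsub>?PH\<^esub> y) (k M) = k M #> (h \<otimes> h')"
          using h H.rcos_mult[OF fin_index_normal_normal[OF kF[OF M]]] kF[OF M] by (simp add: H.mult_profinite_completion)
        then have "h \<otimes> h' \<in> (x \<otimes>\<^bsub>?PH\<^esub> y) (k M)"
          using H.rcos_self[OF _ normal_imp_subgroup[OF fin_index_normal_normal[OF kF[OF M]]]] h by simp
        then have "f (x \<otimes>\<^bsub>?PH\<^esub> y) M = \<theta> M (h \<otimes> h')" using f_eq[OF xy M] by simp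
        also have "\<dots> = \<theta> M h <#>\<^bsub>G\<^esub> \<theta> M h'" using hom[OF M] h by (simp add: hom_def)
        finally show ?thesis using f_eq[OF x M h(5)] f_eq[OF y M h(6)] M by (simp add: G.mult_profinite_completion)
      next
        case False
        then show ?thesis by (simp add: f_def G.mult_profinite_completion)
      qed
    qed
  qed (rule fcl)
  have "f \<in> iso ?PH ?PG"
    using fhom fcl gcl fg gf by (auto simp: iso_def intro!: bij_betw_byWitness[where f' = g])
  moreover have "homeomorphic_maps (profinite_topology H) (profinite_topology G) f g"
  proof -
    have c1: "continuous_map (profinite_topology H) (profinite_topology G) f"
      unfolding profinite_topology_def[of G] continuous_map_in_subtopology continuous_map_componentwise
    proof (intro conjI ballI)
      show "f ` topspace (profinite_topology H) \<subseteq> extensional ?FG" by (auto simp: f_def)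
      show "f \<in> topspace (profinite_topology H) \<rightarrow> carrier ?PG" using fcl by auto
      fix M assume M: "M \<in> ?FG"
      have "continuous_map (profinite_topology H) (discrete_topology (carrier (G Mod M))) (\<lambda>x. (\<lambda>C. \<theta> M (SOME h. h \<in> C)) (x (k M)))"
        using G.profinite_completion_memD(1)[OF fcl M] M
        by (intro continuous_map_profinite_coordinate[OF kF[OF M]]) (auto simp: f_def)
      then show "continuous_map (profinite_topology H) (discrete_topology (carrier (G Mod M))) (\<lambda>x. f x M)"
        using M by (simp add: f_def)
    qed
    have c2: "continuous_map (profinite_topology G) (profinite_topology H) g"
      unfolding profinite_topology_def[of H] continuous_map_in_subtopology continuous_map_componentwise
    proof (intro conjI ballI)
      show "g ` topspace (profinite_topology G) \<subseteq> extensional ?FH" by (auto simp: g_def)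
      show "g \<in> topspace (profinite_topology G) \<rightarrow> carrier ?PH" using gcl by auto
      fix L assume L: "L \<in> ?FH"
      have "continuous_map (profinite_topology G) (discrete_topology (carrier (H Mod L)))
          (\<lambda>y. (\<lambda>C. L #> (SOME h. h \<in> carrier H \<and> \<theta> (m L) h = C)) (y (m L)))"
        using H.profinite_completion_memD(1)[OF gcl L] L
        by (intro continuous_map_profinite_coordinate[OF m(1)[OF L]]) (auto simp: g_def)
      then show "continuous_map (profinite_topology G) (discrete_topology (carrier (H Mod L))) (\<lambda>y. g y L)"
        using L by (simp add: g_def)
    qed
    show ?thesis unfolding homeomorphic_maps_def using c1 c2 fg gf by auto
  qed
  then have "homeomorphic_map (profinite_topology H) (profinite_topology G) f"
    by (auto simp: homeomorphic_map_maps)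
  ultimately show ?thesis unfolding profinitely_iso_def by blast
qed

lemma profinitely_iso_trans:
  assumes "profinitely_iso F G" "profinitely_iso G H"
  shows "profinitely_iso F H"
  using assms iso_set_trans homeomorphic_map_compose unfolding profinitely_iso_def by blast

lemma profinitely_iso_sym:
  assumes "group G" "group H" "profinitely_iso G H"
  shows "profinitely_iso H G"
proof -
  let ?PG = "profinite_completion G" and ?PH = "profinite_completion H"
  obtain f where f: "f \<in> iso ?PG ?PH" "homeomorphic_map (profinite_topology G) (profinite_topology H) f"
    using assms by (auto simp: profinitely_iso_def)
  obtain g where g: "homeomorphic_maps (profinite_topology G) (profinite_topology H) f g"
    using f(2) by (auto simp: homeomorphic_map_maps)
  have g1: "g (f x) = x" if "x \<in> carrier ?PG" for x
    using g that by (auto simp: homeomorphic_maps_def)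
  have g2: "f (g x) = x" if "x \<in> carrier ?PH" for x
    using g that by (auto simp: homeomorphic_maps_def)
  have fcl: "f x \<in> carrier ?PH" if "x \<in> carrier ?PG" for x
    using f(1) that by (auto simp: iso_def hom_def)
  have gcl: "g x \<in> carrier ?PG" if "x \<in> carrier ?PH" for x
    using g that by (auto simp: homeomorphic_maps_def continuous_map_def)
  have "g (x \<otimes>\<^bsub>?PH\<^esub> y) = g x \<otimes>\<^bsub>?PG\<^esub> g y" if "x \<in> carrier ?PH" "y \<in> carrier ?PH" for x y
  proof -
    have "f (g x \<otimes>\<^bsub>?PG\<^esub> g y) = x \<otimes>\<^bsub>?PH\<^esub> y"
      using f(1) that gcl g2 by (auto simp: iso_def hom_def)
    then show ?thesis
      using g1[OF group.profinite_completion_mult_closed[OF assms(1) gcl[OF that(1)] gcl[OF that(2)]]] by simp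
  qed
  then have "g \<in> iso ?PH ?PG"
    using gcl fcl g1 g2 by (auto simp: iso_def hom_def intro!: bij_betw_byWitness[where f' = f])
  moreover have "homeomorphic_map (profinite_topology H) (profinite_topology G) g"
    using g unfolding homeomorphic_map_maps by (meson homeomorphic_maps_sym)
  ultimately show ?thesis unfolding profinitely_iso_def by blast
qed

lemma iso_imp_profinitely_iso:
  assumes "group H" "group G" "\<phi> \<in> iso H G"
  shows "profinitely_iso H G"
proof (rule profinite_family_imp_iso[OF assms(1,2)])
  interpret H: group H by fact
  interpret G: group G by fact
  have hom: "\<phi> \<in> hom H G" and im: "\<phi> ` carrier H = carrier G" and inj: "inj_on \<phi> (carrier H)"
    using assms(3) by (auto simp: iso_def bij_betw_def)
  interpret \<phi>: group_hom H G \<phi> using hom by unfold_locales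
  show "profinite_family H G (\<lambda>M h. M #>\<^bsub>G\<^esub> \<phi> h)"
    unfolding profinite_family_def
  proof (intro conjI ballI impI)
    fix M assume M: "M \<in> fin_index_normal G"
    show "(\<lambda>h. M #>\<^bsub>G\<^esub> \<phi> h) \<in> hom H (G Mod M)"
      using G.rcos_mult[OF fin_index_normal_normal[OF M]] by (auto simp: hom_def carrier_FactGroup)
    show "(\<lambda>h. M #>\<^bsub>G\<^esub> \<phi> h) ` carrier H = carrier (G Mod M)"
      unfolding carrier_FactGroup im[symmetric] by (simp add: image_image)
  next
    fix M N h assume "M \<in> fin_index_normal G" "N \<in> fin_index_normal G" "N \<subseteq> M" "h \<in> carrier H"
    then show "N #>\<^bsub>G\<^esub> \<phi> h \<subseteq> M #>\<^bsub>G\<^esub> \<phi> h" by (auto simp: r_coset_def)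
  next
    fix L assume L: "L \<in> fin_index_normal H"
    have Ln: "L \<lhd> H" and Lf: "finite (rcosets\<^bsub>H\<^esub> L)" using L by (auto simp: fin_index_normal_def)
    have Ls: "L \<subseteq> carrier H" using normal_imp_subgroup[OF Ln] by (rule subgroup.subset)
    have n: "\<phi> ` L \<lhd> G" using iso_normal_subgroup[OF assms(3) H.group_axioms G.group_axioms Ln] .
    have "rcosets\<^bsub>G\<^esub> (\<phi> ` L) \<subseteq> (\<lambda>C. \<phi> ` C) ` (rcosets\<^bsub>H\<^esub> L)"
    proof
      fix C assume "C \<in> rcosets\<^bsub>G\<^esub> (\<phi> ` L)"
      then obtain h where h: "h \<in> carrier H" "C = \<phi> ` L #>\<^bsub>G\<^esub> \<phi> h"
        unfolding RCOSETS_def im[symmetric] by blast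
      then have "C = \<phi> ` (L #>\<^bsub>H\<^esub> h)" using Ls by (force simp: r_coset_def)
      then show "C \<in> (\<lambda>C. \<phi> ` C) ` (rcosets\<^bsub>H\<^esub> L)" using h by (auto simp: RCOSETS_def)
    qed
    then have "finite (rcosets\<^bsub>G\<^esub> (\<phi> ` L))" using Lf by (rule finite_subset[OF _ finite_imageI])
    then have F: "\<phi> ` L \<in> fin_index_normal G" using n by (simp add: fin_index_normal_def)
    have "h \<in> L" if h: "h \<in> carrier H" "\<phi> ` L #>\<^bsub>G\<^esub> \<phi> h = \<phi> ` L" for h
    proof -
      have "\<phi> h \<in> \<phi> ` L" using G.rcos_self[of "\<phi> h" "\<phi> ` L"] h normal_imp_subgroup[OF n] by auto
      then show "h \<in> L" using inj h Ls by (auto dest: inj_onD)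
    qed
    then show "\<exists>M\<in>fin_index_normal G. \<forall>h\<in>carrier H. M #>\<^bsub>G\<^esub> \<phi> h = M \<longrightarrow> h \<in> L"
      using F by blast
  qed
qed

section \<open>Polycyclic-by-finite groups are Noetherian and residually finite\<close>

lemma int_subgroup_cyclic:
  fixes A :: "int set"
  assumes "0 \<in> A" "\<And>x y. x \<in> A ==> y \<in> A ==> x - y \<in> A"
  obtains d where "d \<ge> 0" "A = range ((*) d)"
proof (cases "A = {0}")
  case True
  then show ?thesis using that[of 0] by auto
next
  case False
  have neg: "- x \<in> A" if "x \<in> A" for x using assms(2)[OF assms(1) that] by simp
  have add: "x + y \<in> A" if "x \<in> A" "y \<in> A" for x y using assms(2)[OF that(1) neg[OF that(2)]] by simp
  have mul: "x * k \<in> A" if "x \<in> A" for x k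
  proof (induction k rule: int_induct[where k = 0])
    case base then show ?case using assms(1) by simp
  next
    case (step1 i) then show ?case using add[OF _ that] by (simp add: distrib_left)
  next
    case (step2 i) then show ?case using assms(2)[OF _ that] by (simp add: right_diff_distrib)
  qed
  obtain x where x: "x \<in> A" "x \<noteq> 0" using False assms(1) by auto
  have ex: "\<exists>n::nat. n > 0 \<and> int n \<in> A"
    using x neg[OF x(1)] by (cases "x > 0") (force intro!: exI[of _ "nat \<bar>x\<bar>"])+
  define n where "n = (LEAST n::nat. n > 0 \<and> int n \<in> A)"
  have n: "n > 0" "int n \<in> A" using LeastI_ex[OF ex] by (auto simp: n_def)
  have least: "n \<le> m" if "m > 0" "int m \<in> A" for m using that by (auto simp: n_def intro: Least_le)
  have "y \<in> range ((*) (int n))" if y: "y \<in> A" for y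
  proof -
    have "y - int n * (y div int n) \<in> A" using y mul[OF n(2)] assms(2) by blast
    then have r: "y mod int n \<in> A" by (simp add: minus_mult_div_eq_mod)
    have "y mod int n = 0"
    proof (rule ccontr)
      assume "y mod int n \<noteq> 0"
      moreover have "y mod int n \<ge> 0" using n(1) by simp
      ultimately have "nat (y mod int n) > 0" by linarith
      moreover have "int (nat (y mod int n)) = y mod int n" using n by simp
      ultimately have "n \<le> nat (y mod int n)" using r least by presburger
      then show False using n pos_mod_bound[of "int n" y] by linarith
    qed
    then show ?thesis using minus_mod_eq_mult_div[of y "int n"] by auto
  qed
  then show ?thesis using that[of "int n"] mul[OF n(2)] by auto
qed

text \<open>This and the next two notions are relative to an ambient group, so that the terms of a
  subnormal series can be treated without passing between restricted groups.\<close>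

definition noetherian_in :: "('a, 'b) monoid_scheme => 'a set => bool" where
  "noetherian_in G S \<longleftrightarrow> (\<forall>K. subgroup K G \<and> K \<subseteq> S \<longrightarrow> (\<exists>B. finite B \<and> B \<subseteq> K \<and> K = generate G B))"

definition fin_index_in :: "('a, 'b) monoid_scheme => 'a set => 'a set => bool" where
  "fin_index_in G S M \<longleftrightarrow> subgroup M G \<and> M \<subseteq> S \<and> finite ((\<lambda>x. M #>\<^bsub>G\<^esub> x) ` S)"

definition residually_finite_in :: "('a, 'b) monoid_scheme => 'a set => bool" where
  "residually_finite_in G S \<longleftrightarrow> (\<forall>h\<in>S. h \<noteq> \<one>\<^bsub>G\<^esub> \<longrightarrow> (\<exists>M. fin_index_in G S M \<and> h \<notin> M))"

context group
begin

lemma fin_index_inI: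
  assumes "subgroup M G" "M \<subseteq> S" "S \<subseteq> carrier G" "finite (f ` S)"
    and "\<And>x y. x \<in> S ==> y \<in> S ==> f x = f y ==> x \<otimes> inv y \<in> M"
  shows "fin_index_in G S M"
proof -
  define r where "r z = (SOME x. x \<in> S \<and> f x = z)" for z
  have r: "r (f x) \<in> S \<and> f (r (f x)) = f x" if "x \<in> S" for x
    unfolding r_def by (rule someI_ex) (use that in blast)
  have "M #> x = M #> r (f x)" if x: "x \<in> S" for x
  proof -
    have "x \<otimes> inv (r (f x)) \<in> M" by (rule assms(5)) (use r[OF x] x in \<open>auto\<close>)
    then show ?thesis using r_coset_eq_iff[OF assms(1)] r[OF x] x assms(3) by blast
  qed
  then have "(\<lambda>x. M #> x) ` S \<subseteq> (\<lambda>z. M #> r z) ` f ` S" by auto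
  then show ?thesis
    using assms(1,2) finite_subset[OF _ finite_imageI[OF assms(4)]] unfolding fin_index_in_def by blast
qed

text \<open>The intersection of the conjugates of \<open>M\<close> is the kernel of the action of
  \<open>G\<close> on the cosets of \<open>M\<close> by right multiplication, and there are finitely
  many maps from a finite set to itself.\<close>

lemma normal_core:
  assumes M: "subgroup M G" "finite (rcosets M)"
  obtains L where "L \<in> fin_index_normal G" "L \<subseteq> M"
proof -
  interpret M: subgroup M G by fact
  define L where "L = {x \<in> carrier G. \<forall>g\<in>carrier G. g \<otimes> x \<otimes> inv g \<in> M}"
  have LM: "L \<subseteq> M"
  proof
    fix x assume "x \<in> L"
    then have x: "x \<in> carrier G" "\<forall>g\<in>carrier G. g \<otimes> x \<otimes> inv g \<in> M" by (auto simp: L_def)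
    then show "x \<in> M" using x(2)[rule_format, OF one_closed] by simp
  qed
  have sub: "subgroup L G"
  proof (rule subgroupI)
    show "L \<subseteq> carrier G" by (auto simp: L_def)
    show "L \<noteq> {}" using M.one_closed by (auto simp: L_def intro!: exI[of _ "\<one>"])
  next
    fix a assume a: "a \<in> L"
    have "g \<otimes> inv a \<otimes> inv g \<in> M" if g: "g \<in> carrier G" for g
    proof -
      have "inv (g \<otimes> a \<otimes> inv g) \<in> M" using a g by (auto simp: L_def)
      then show ?thesis using a g by (simp add: L_def inv_mult_group m_assoc)
    qed
    then show "inv a \<in> L" using a by (auto simp: L_def)
  next
    fix a b assume ab: "a \<in> L" "b \<in> L"
    have "g \<otimes> (a \<otimes> b) \<otimes> inv g \<in> M" if g: "g \<in> carrier G" for g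
    proof -
      have "(g \<otimes> a \<otimes> inv g) \<otimes> (g \<otimes> b \<otimes> inv g) \<in> M" using ab g by (auto simp: L_def)
      then show ?thesis using ab g by (simp add: L_def m_assoc inv_solve_left' flip: m_assoc[of "inv g" g])
    qed
    then show "a \<otimes> b \<in> L" using ab by (auto simp: L_def)
  qed
  have "L \<lhd> G"
    unfolding normal_inv_iff
  proof (intro conjI ballI sub)
    fix x h assume x: "x \<in> carrier G" and h: "h \<in> L"
    have "g \<otimes> (x \<otimes> h \<otimes> inv x) \<otimes> inv g \<in> M" if g: "g \<in> carrier G" for g
    proof -
      have "(g \<otimes> x) \<otimes> h \<otimes> inv (g \<otimes> x) \<in> M" using h g x by (auto simp: L_def)
      then show ?thesis using h g x by (simp add: L_def m_assoc inv_mult_group)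
    qed
    then show "x \<otimes> h \<otimes> inv x \<in> L" using x h by (auto simp: L_def)
  qed
  moreover have "finite (rcosets L)"
  proof (rule finite_rcosetsI[OF sub])
    let ?f = "\<lambda>x. (\<lambda>C\<in>rcosets M. C #> x)"
    have "?f ` carrier G \<subseteq> (rcosets M) \<rightarrow>\<^sub>E (rcosets M)"
    proof (intro image_subsetI PiE_I)
      fix x C assume x: "x \<in> carrier G" and "C \<in> rcosets M"
      then obtain a where a: "a \<in> carrier G" "C = M #> a" by (auto simp: RCOSETS_def)
      then have "C #> x = M #> (a \<otimes> x)" using x M.subset by (simp add: coset_mult_assoc)
      then show "?f x C \<in> rcosets M" using \<open>C \<in> rcosets M\<close> a x by (auto simp: RCOSETS_def)
    qed auto
    then show "finite (?f ` carrier G)" using M(2) by (meson finite_PiE finite_subset)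
    fix x y assume xy: "x \<in> carrier G" "y \<in> carrier G" "?f x = ?f y"
    have "g \<otimes> (x \<otimes> inv y) \<otimes> inv g \<in> M" if g: "g \<in> carrier G" for g
    proof -
      have C: "M #> g \<in> rcosets M" using g by (auto simp: RCOSETS_def)
      have "(M #> g) #> x = (M #> g) #> y" using fun_cong[OF xy(3), of "M #> g"] C by simp
      then have "M #> (g \<otimes> x) = M #> (g \<otimes> y)" using xy g M.subset by (simp add: coset_mult_assoc)
      then have "(g \<otimes> x) \<otimes> inv (g \<otimes> y) \<in> M" using r_coset_eq_iff[OF M(1)] xy g by simp
      then show ?thesis using xy g by (simp add: inv_mult_group m_assoc)
    qed
    then show "x \<otimes> inv y \<in> L" using xy by (auto simp: L_def)
  qed
  ultimately show ?thesis using that LM by (auto simp: fin_index_normal_def)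
qed

text \<open>\<open>K \<inter> S\<close> has a finite generating set \<open>B\<close>, and
  \<open>Y\<close> generates \<open>K\<close> modulo \<open>S\<close>; together they generate
  \<open>K\<close>.\<close>

lemma noetherian_in_extend:
  assumes "noetherian_in G S" "subgroup S G" "subgroup K G"
    and Y: "finite Y" "Y \<subseteq> K" "\<And>x. x \<in> K ==> \<exists>y\<in>generate G Y. x \<otimes> inv y \<in> S"
  shows "\<exists>B. finite B \<and> B \<subseteq> K \<and> K = generate G B"
proof -
  interpret K: subgroup K G by fact
  have "subgroup (K \<inter> S) G" using assms by (intro subgroups_Inter_pair)
  then obtain B where B: "finite B" "B \<subseteq> K \<inter> S" "K \<inter> S = generate G B"
    using assms(1) unfolding noetherian_in_def by (metis inf_le2)
  have "K \<subseteq> generate G (B \<union> Y)"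
  proof
    fix x assume x: "x \<in> K"
    obtain y where y: "y \<in> generate G Y" "x \<otimes> inv y \<in> S" using Y(3)[OF x] by auto
    have yK: "y \<in> K" using y(1) generate_subgroup_incl[OF Y(2) assms(3)] by auto
    have "x \<otimes> inv y \<in> generate G B" using B(3) y x yK by auto
    then have "x \<otimes> inv y \<in> generate G (B \<union> Y)" "y \<in> generate G (B \<union> Y)"
      using y(1) mono_generate[of B "B \<union> Y"] mono_generate[of Y "B \<union> Y"] by auto
    then have "x \<otimes> inv y \<otimes> y \<in> generate G (B \<union> Y)" by (rule generate.eng)
    then show "x \<in> generate G (B \<union> Y)" using x yK by (simp add: m_assoc)
  qed
  moreover have "generate G (B \<union> Y) \<subseteq> K" using B Y assms(3) by (intro generate_subgroup_incl) auto
  ultimately show ?thesis using B Y by (intro exI[of _ "B \<union> Y"]) auto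
qed

lemma noetherian_in_finite_ext:
  assumes "noetherian_in G S" "subgroup S G" "subgroup S' G" "fin_index_in G S' S"
  shows "noetherian_in G S'"
  unfolding noetherian_in_def
proof (intro allI impI)
  fix K assume K: "subgroup K G \<and> K \<subseteq> S'"
  interpret K: subgroup K G using K by simp
  have fin: "finite ((\<lambda>x. S #> x) ` K)"
    using assms(4) K by (auto simp: fin_index_in_def intro: finite_subset[OF image_mono])
  obtain Y where Y: "Y \<subseteq> K" "finite Y" "(\<lambda>x. S #> x) ` K = (\<lambda>x. S #> x) ` Y"
    using finite_subset_image[OF fin order_refl] by auto
  show "\<exists>B. finite B \<and> B \<subseteq> K \<and> K = generate G B"
  proof (rule noetherian_in_extend[OF assms(1,2) _ Y(2,1)])
    fix x assume x: "x \<in> K"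
    then obtain y where y: "y \<in> Y" "S #> x = S #> y" using Y(3) by (metis imageE imageI)
    then have "x \<otimes> inv y \<in> S" using r_coset_eq_iff[OF assms(2), of x y] x Y by auto
    then show "\<exists>y\<in>generate G Y. x \<otimes> inv y \<in> S" using y generate.incl by metis
  qed (use K in simp)
qed

lemma residually_finite_in_finite_ext:
  assumes "residually_finite_in G S" "subgroup S G" "subgroup S' G" "fin_index_in G S' S"
  shows "residually_finite_in G S'"
  unfolding residually_finite_in_def
proof (intro ballI impI)
  fix h assume h: "h \<in> S'" "h \<noteq> \<one>"
  interpret S: subgroup S G by fact
  interpret S': subgroup S' G by fact
  show "\<exists>M. fin_index_in G S' M \<and> h \<notin> M"
  proof (cases "h \<in> S")
    case True
    then obtain M where M: "fin_index_in G S M" "h \<notin> M"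
      using assms(1) h by (auto simp: residually_finite_in_def)
    define r where "r C = (SOME y. y \<in> S' \<and> S #> y = C)" for C
    have r: "r (S #> x) \<in> S' \<and> S #> r (S #> x) = S #> x" if "x \<in> S'" for x
      unfolding r_def by (rule someI_ex) (use that in auto)
    \<comment> \<open>The part of \<open>x\<close> in \<open>S\<close> after removing the chosen
      representative of its coset. For two elements of one coset the representative cancels in
      \<open>x \<otimes> inv y\<close>.\<close>
    define \<sigma> where "\<sigma> x = x \<otimes> inv (r (S #> x))" for x
    have \<sigma>: "\<sigma> x \<in> S" if "x \<in> S'" for x
      using r_coset_eq_iff[OF assms(2), of x "r (S #> x)"] r[OF that] that by (auto simp: \<sigma>_def)
    have "fin_index_in G S' M"
    proof (rule fin_index_inI)
      show "subgroup M G" "M \<subseteq> S'" using M assms(4) by (auto simp: fin_index_in_def)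
      show "S' \<subseteq> carrier G" by (rule S'.subset)
      have "(\<lambda>x. (S #> x, M #> \<sigma> x)) ` S' \<subseteq> ((\<lambda>x. S #> x) ` S') \<times> ((\<lambda>x. M #> x) ` S)"
        using \<sigma> by auto
      then show "finite ((\<lambda>x. (S #> x, M #> \<sigma> x)) ` S')"
        by (rule finite_subset) (use assms(4) M(1) in \<open>auto simp: fin_index_in_def\<close>)
      fix x y assume xy: "x \<in> S'" "y \<in> S'" "(S #> x, M #> \<sigma> x) = (S #> y, M #> \<sigma> y)"
      have "\<sigma> x \<otimes> inv (\<sigma> y) \<in> M"
        using r_coset_eq_iff[of M "\<sigma> x" "\<sigma> y"] M(1) \<sigma> xy by (auto simp: fin_index_in_def)
      moreover have "\<sigma> x \<otimes> inv (\<sigma> y) = x \<otimes> inv y"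
      proof -
        let ?z = "r (S #> y)"
        have z: "?z \<in> carrier G" using r[OF xy(2)] by auto
        have c: "x \<in> carrier G" "y \<in> carrier G" using xy by auto
        have "x \<otimes> inv ?z \<otimes> inv (y \<otimes> inv ?z) = x \<otimes> (inv ?z \<otimes> ?z) \<otimes> inv y"
          unfolding inv_mult_group[OF c(2) inv_closed[OF z]] inv_inv[OF z] using z c by (metis inv_closed m_assoc m_closed)
        then have "x \<otimes> inv ?z \<otimes> inv (y \<otimes> inv ?z) = x \<otimes> inv y" using c z by simp
        then show ?thesis using xy z by (simp add: \<sigma>_def)
      qed
      ultimately show "x \<otimes> inv y \<in> M" by simp
    qed
    then show ?thesis using M by blast
  next
    case False
    then show ?thesis using assms(4) by blast
  qed
qed

text \<open>\<open>S\<close> is normalised by \<open>t\<close>, so that \<open>S' = S\<langle>t\<rangle>\<close> is a cyclic extension of \<open>S\<close>.\<close>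

definition cyclic_ext :: "'a set => 'a => 'a set => bool" where
  "cyclic_ext S t S' \<longleftrightarrow> subgroup S G \<and> subgroup S' G \<and> S \<subseteq> S' \<and> t \<in> S' \<and>
     (\<forall>s\<in>S. \<forall>k::int. t [^] k \<otimes> s \<otimes> t [^] (-k) \<in> S) \<and> S' = {s \<otimes> t [^] k | s k::int. s \<in> S}"

text \<open>Computations in a cyclic extension use the normal form
  \<open>s \<otimes> t [^] k\<close>; this lemma and the next are its product and its
  inverse.\<close>

lemma conj_pow_mult:
  fixes k l :: int
  assumes "t \<in> carrier G" "s \<in> carrier G" "s' \<in> carrier G"
  shows "(s \<otimes> t [^] k) \<otimes> (s' \<otimes> t [^] l) = (s \<otimes> (t [^] k \<otimes> s' \<otimes> t [^] (-k))) \<otimes> t [^] (k + l)"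
proof -
  have "t [^] (-k) \<otimes> t [^] (k + l) = t [^] l"
    using assms by (simp flip: int_pow_mult)
  then show ?thesis using assms by (simp add: m_assoc)
qed

lemma conj_pow_inv:
  fixes k :: int
  assumes "t \<in> carrier G" "s \<in> carrier G"
  shows "inv (s \<otimes> t [^] k) = (t [^] (-k) \<otimes> inv s \<otimes> t [^] (- (-k))) \<otimes> t [^] (-k)"
  using assms by (simp add: inv_mult_group int_pow_neg m_assoc)

text \<open>The factor \<open>n\<close> provides subgroups that are proper in the direction of
  \<open>t\<close>; they are needed to separate elements with a nonzero exponent of
  \<open>t\<close>.\<close>

lemma subgroup_mult_cyclic:
  assumes M: "subgroup M G" and t: "t \<in> carrier G"
    and n: "\<And>s k::int. s \<in> M ==> t [^] k \<otimes> s \<otimes> t [^] (-k) \<in> M"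
  shows "subgroup {s \<otimes> t [^] ((n::int) * k) | s k::int. s \<in> M} G"
proof (rule subgroupI)
  interpret M: subgroup M G by fact
  show "{s \<otimes> t [^] (n * k) | s k::int. s \<in> M} \<subseteq> carrier G" using t by auto
  show "{s \<otimes> t [^] (n * k) | s k::int. s \<in> M} \<noteq> {}" using M.one_closed by blast
next
  interpret M: subgroup M G by fact
  fix a assume "a \<in> {s \<otimes> t [^] (n * k) | s k::int. s \<in> M}"
  then obtain s k where a: "a = s \<otimes> t [^] (n * k)" "s \<in> M" by blast
  then have "inv a = (t [^] (-(n*k)) \<otimes> inv s \<otimes> t [^] (- (-(n*k)))) \<otimes> t [^] (n * (-k))"
    using t conj_pow_inv[of t s "n*k"] by simp
  moreover have "t [^] (-(n*k)) \<otimes> inv s \<otimes> t [^] (- (-(n*k))) \<in> M" using a by (intro n) simp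
  ultimately show "inv a \<in> {s \<otimes> t [^] (n * k) | s k::int. s \<in> M}" by blast
next
  interpret M: subgroup M G by fact
  fix a b assume "a \<in> {s \<otimes> t [^] (n * k) | s k::int. s \<in> M}" "b \<in> {s \<otimes> t [^] (n * k) | s k::int. s \<in> M}"
  then obtain s k s' k' where ab: "a = s \<otimes> t [^] (n * k)" "s \<in> M" "b = s' \<otimes> t [^] (n * k')" "s' \<in> M" by blast
  then have "a \<otimes> b = (s \<otimes> (t [^] (n*k) \<otimes> s' \<otimes> t [^] (-(n*k)))) \<otimes> t [^] (n * (k + k'))"
    using t conj_pow_mult[of t s s' "n*k" "n*k'"] by (simp add: distrib_left)
  moreover have "s \<otimes> (t [^] (n*k) \<otimes> s' \<otimes> t [^] (-(n*k))) \<in> M" using ab by (intro M.m_closed n)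
  ultimately show "a \<otimes> b \<in> {s \<otimes> t [^] (n * k) | s k::int. s \<in> M}" by blast
qed

text \<open>The exponents of \<open>t\<close> that occur in \<open>K\<close> form a subgroup of
  \<int>, generated by some \<open>d\<close>. One element of \<open>K\<close> with exponent
  \<open>d\<close> therefore generates \<open>K\<close> modulo \<open>S\<close>.\<close>

lemma noetherian_in_cyclic_ext:
  assumes "noetherian_in G S" "cyclic_ext S t S'"
  shows "noetherian_in G S'"
  unfolding noetherian_in_def
proof (intro allI impI)
  fix K assume K: "subgroup K G \<and> K \<subseteq> S'"
  interpret K: subgroup K G using K by simp
  have ext: "subgroup S G" "subgroup S' G" "t \<in> S'" "\<And>s k::int. s \<in> S ==> t [^] k \<otimes> s \<otimes> t [^] (-k) \<in> S"
     "S' = {s \<otimes> t [^] k | s k::int. s \<in> S}"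
    using assms(2) by (auto simp: cyclic_ext_def)
  interpret S: subgroup S G by fact
  have t: "t \<in> carrier G" using subgroup.mem_carrier[OF ext(2,3)] .
  define A where "A = {k::int. \<exists>s\<in>S. s \<otimes> t [^] k \<in> K}"
  have "0 \<in> A" unfolding A_def using S.one_closed K.one_closed by (auto intro!: bexI[of _ "\<one>"])
  moreover have "x - y \<in> A" if xy: "x \<in> A" "y \<in> A" for x y
  proof -
    obtain s s' where s: "s \<in> S" "s \<otimes> t [^] x \<in> K" "s' \<in> S" "s' \<otimes> t [^] y \<in> K" using xy by (auto simp: A_def)
    then have "(s \<otimes> t [^] x) \<otimes> inv (s' \<otimes> t [^] y) \<in> K" by auto
    moreover have "(s \<otimes> t [^] x) \<otimes> inv (s' \<otimes> t [^] y) = (s \<otimes> (t [^] x \<otimes> (t [^] (-y) \<otimes> inv s' \<otimes> t [^] (- (-y))) \<otimes> t [^] (-x))) \<otimes> t [^] (x + (-y))"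
      unfolding conj_pow_inv[OF t S.mem_carrier[OF s(3)]] by (rule conj_pow_mult) (use s t in auto)
    moreover have "s \<otimes> (t [^] x \<otimes> (t [^] (-y) \<otimes> inv s' \<otimes> t [^] (- (-y))) \<otimes> t [^] (-x)) \<in> S"
      using s by (intro S.m_closed ext(4)) auto
    ultimately show ?thesis by (auto simp: A_def)
  qed
  ultimately obtain d where d: "A = range ((*) d)" using int_subgroup_cyclic by metis
  then have "d \<in> A" by (metis mult.right_neutral rangeI)
  then obtain s0 where s0: "s0 \<in> S" "s0 \<otimes> t [^] d \<in> K" by (auto simp: A_def)
  let ?y = "s0 \<otimes> t [^] d"
  have pow: "\<exists>s\<in>S. ?y [^] (k::int) = s \<otimes> t [^] (d * k)" for k
  proof -
    have pn: "\<exists>s\<in>S. ?y [^] (n::nat) = s \<otimes> t [^] (d * int n)" for n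
    proof (induction n)
      case 0 then show ?case using S.one_closed by auto
    next
      case (Suc n)
      then obtain s where s: "s \<in> S" "?y [^] n = s \<otimes> t [^] (d * int n)" by auto
      have "?y [^] Suc n = (s \<otimes> (t [^] (d * int n) \<otimes> s0 \<otimes> t [^] (-(d * int n)))) \<otimes> t [^] (d * int n + d)"
        using s s0 t by (simp add: conj_pow_mult)
      moreover have "s \<otimes> (t [^] (d * int n) \<otimes> s0 \<otimes> t [^] (-(d * int n))) \<in> S"
        using s s0 by (intro S.m_closed ext(4)) auto
      ultimately show ?case by (metis distrib_left mult.right_neutral of_nat_Suc add.commute)
    qed
    show ?thesis
    proof (cases "k \<ge> 0")
      case True
      then show ?thesis using pn[of "nat k"] by (metis int_pow_int nat_0_le)
    next
      case False
      obtain s where s: "s \<in> S" "?y [^] (nat (-k)) = s \<otimes> t [^] (d * (-k))" using pn[of "nat (-k)"] False by auto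
      have "?y [^] k = inv (?y [^] (nat (-k)))"
        using False s0 t by (metis S.mem_carrier int_pow_def2 not_le)
      also have "\<dots> = (t [^] (d*k) \<otimes> inv s \<otimes> t [^] (- (d*k))) \<otimes> t [^] (d*k)"
        using s t conj_pow_inv[of t s "d * (-k)"] by simp
      finally show ?thesis using ext(4)[of "inv s" "d * k"] s by auto
    qed
  qed
  show "\<exists>B. finite B \<and> B \<subseteq> K \<and> K = generate G B"
  proof (rule noetherian_in_extend[OF assms(1) ext(1), where Y = "{?y}"])
    show "subgroup K G" using K by simp
    fix x assume x: "x \<in> K"
    then obtain s l where sl: "x = s \<otimes> t [^] (l::int)" "s \<in> S" using K ext(5) by blast
    then have "l \<in> A" using x by (auto simp: A_def)
    then obtain k where k: "l = d * k" using d by auto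
    obtain s' where s': "s' \<in> S" "?y [^] k = s' \<otimes> t [^] (d * k)" using pow by auto
    have "x \<otimes> inv (?y [^] k) = s \<otimes> inv s'"
      using sl k s' t by (simp add: inv_mult_group m_assoc) (simp flip: m_assoc)
    moreover have "?y [^] k \<in> generate G {?y}" using generate_pow[of ?y] s0 t by auto
    ultimately show "\<exists>y\<in>generate G {?y}. x \<otimes> inv y \<in> S" using sl s' by (metis S.m_closed S.m_inv_closed)
  qed (use s0 in auto)
qed

lemma hom_eq_on_generate:
  assumes "group Q" "subgroup S G" "B \<subseteq> S" "\<phi> \<in> hom (G\<lparr>carrier := S\<rparr>) Q" "\<psi> \<in> hom (G\<lparr>carrier := S\<rparr>) Q"
    and "\<And>x. x \<in> B ==> \<phi> x = \<psi> x" "y \<in> generate G B"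
  shows "\<phi> y = \<psi> y"
proof -
  interpret S: subgroup S G by fact
  interpret f: group_hom "G\<lparr>carrier := S\<rparr>" Q \<phi>
    using assms S.subgroup_is_group[OF is_group] by (simp add: group_hom_def group_hom_axioms_def)
  interpret g: group_hom "G\<lparr>carrier := S\<rparr>" Q \<psi>
    using assms S.subgroup_is_group[OF is_group] by (simp add: group_hom_def group_hom_axioms_def)
  have gS: "generate G B \<subseteq> S" using assms by (intro generate_subgroup_incl)
  show ?thesis using assms(7)
  proof induction
    case one then show ?case using f.hom_one g.hom_one by simp
  next
    case (incl h) then show ?case using assms(6) by simp
  next
    case (inv h)
    then have "h \<in> S" using assms(3) by auto
    then show ?case using f.hom_inv[of h] g.hom_inv[of h] assms(6)[OF inv] m_inv_consistent[OF assms(2)] by simp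
  next
    case (eng h1 h2)
    then show ?case using gS f.hom_mult[of h1 h2] g.hom_mult[of h1 h2] by (simp add: subsetD[OF gS])
  qed
qed

text \<open>
  The intersection of the kernels of all homomorphisms from \<open>S\<close> to the finite group \<open>S / N\<close>
  is a characteristic subgroup contained in \<open>N\<close>.
\<close>

lemma invariant_finite_index_subgroup:
  assumes S: "subgroup S G" "noetherian_in G S" and M: "fin_index_in G S M" and t: "t \<in> carrier G"
    and inv: "\<And>s k::int. s \<in> S ==> t [^] k \<otimes> s \<otimes> t [^] (-k) \<in> S"
  obtains L where "fin_index_in G S L" "L \<subseteq> M" "\<And>s k::int. s \<in> L ==> t [^] k \<otimes> s \<otimes> t [^] (-k) \<in> L"
proof -
  interpret S: subgroup S G by fact
  let ?S = "G\<lparr>carrier := S\<rparr>"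
  interpret SG: group ?S using S.subgroup_is_group[OF is_group] .
  have M': "subgroup M G" "M \<subseteq> S" "finite ((\<lambda>x. M #> x) ` S)" using M by (auto simp: fin_index_in_def)
  have "subgroup M ?S" using M' S subgroup_incl by auto
  moreover have "rcosets\<^bsub>?S\<^esub> M = (\<lambda>x. M #> x) ` S" by (auto simp: RCOSETS_def r_coset_def)
  ultimately obtain N where N: "N \<in> fin_index_normal ?S" "N \<subseteq> M" using SG.normal_core[of M] M' by auto
  let ?Q = "?S Mod N"
  have Nn: "N \<lhd> ?S" using N by (rule_tac fin_index_normal_normal)
  interpret Q: group ?Q using Nn by (rule normal.factorgroup_is_group)
  have Qf: "finite (carrier ?Q)" using N by (simp add: fin_index_normal_def FactGroup_def)
  define L where "L = {x \<in> S. \<forall>\<phi>\<in>hom ?S ?Q. \<phi> x = \<one>\<^bsub>?Q\<^esub>}"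
  have gh: "group_hom ?S ?Q \<phi>" if "\<phi> \<in> hom ?S ?Q" for \<phi>
    using that SG.group_axioms Q.group_axioms by (simp add: group_hom_def group_hom_axioms_def)
  have subL: "subgroup L G"
  proof (rule subgroupI)
    show "L \<subseteq> carrier G" by (auto simp: L_def)
    have "\<phi> \<one> = \<one>\<^bsub>?Q\<^esub>" if "\<phi> \<in> hom ?S ?Q" for \<phi> using group_hom.hom_one[OF gh[OF that]] by simp
    then have "\<one> \<in> L" using S.one_closed unfolding L_def by blast
    then show "L \<noteq> {}" by blast
  next
    fix a assume a: "a \<in> L"
    have "\<phi> (inv a) = \<one>\<^bsub>?Q\<^esub>" if "\<phi> \<in> hom ?S ?Q" for \<phi>
      using group_hom.hom_inv[OF gh[OF that], of a] a that m_inv_consistent[OF S(1)] Q.inv_one by (auto simp: L_def)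
    then show "inv a \<in> L" using a by (auto simp: L_def)
  next
    fix a b assume ab: "a \<in> L" "b \<in> L"
    have "\<phi> (a \<otimes> b) = \<one>\<^bsub>?Q\<^esub>" if "\<phi> \<in> hom ?S ?Q" for \<phi>
    proof -
      have "a \<in> S" "b \<in> S" "\<phi> a = \<one>\<^bsub>?Q\<^esub>" "\<phi> b = \<one>\<^bsub>?Q\<^esub>" using ab that by (auto simp: L_def)
      then have "\<phi> (a \<otimes> b) = \<one>\<^bsub>?Q\<^esub> \<otimes>\<^bsub>?Q\<^esub> \<one>\<^bsub>?Q\<^esub>"
        using that by (simp add: hom_def)
      then show ?thesis by (simp only: Q.l_one[OF Q.one_closed])
    qed
    then show "a \<otimes> b \<in> L" using ab by (auto simp: L_def)
  qed
  have "(\<lambda>x. N #> x) \<in> hom ?S ?Q"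
    using normal.r_coset_hom_Mod[OF Nn] by simp
  then have "N #> x = N" if "x \<in> L" for x using that by (auto simp: L_def)
  then have LN: "L \<subseteq> N"
    using rcos_self[OF S.mem_carrier incl_subgroup[OF S(1) normal_imp_subgroup[OF Nn]]] unfolding L_def by blast
  have conj: "t [^] k \<otimes> s \<otimes> t [^] (-k) \<in> L" if s: "s \<in> L" for s and k :: int
  proof -
    have "\<phi> (t [^] k \<otimes> s \<otimes> t [^] (-k)) = \<one>\<^bsub>?Q\<^esub>" if \<phi>: "\<phi> \<in> hom ?S ?Q" for \<phi>
    proof -
      have "(\<lambda>x. \<phi> (t [^] k \<otimes> x \<otimes> t [^] (-k))) \<in> hom ?S ?Q"
      proof (rule homI)
        fix x assume "x \<in> carrier ?S"
        then show "\<phi> (t [^] k \<otimes> x \<otimes> t [^] (-k)) \<in> carrier ?Q" using \<phi> inv by (auto simp: hom_def)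
      next
        fix x y assume xy: "x \<in> carrier ?S" "y \<in> carrier ?S"
        have "t [^] (-k) \<otimes> (t [^] k \<otimes> (y \<otimes> t [^] (-k))) = y \<otimes> t [^] (-k)"
          using xy t by (simp add: int_pow_neg flip: m_assoc)
        then have "t [^] k \<otimes> (x \<otimes> y) \<otimes> t [^] (-k) = (t [^] k \<otimes> x \<otimes> t [^] (-k)) \<otimes> (t [^] k \<otimes> y \<otimes> t [^] (-k))"
          using xy t by (simp add: m_assoc)
        then show "\<phi> (t [^] k \<otimes> (x \<otimes>\<^bsub>?S\<^esub> y) \<otimes> t [^] (-k)) =
            \<phi> (t [^] k \<otimes> x \<otimes> t [^] (-k)) \<otimes>\<^bsub>?Q\<^esub> \<phi> (t [^] k \<otimes> y \<otimes> t [^] (-k))"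
          using \<phi> inv xy by (auto simp: hom_def)
      qed
      then show ?thesis using s by (auto simp: L_def)
    qed
    then show ?thesis using s inv by (auto simp: L_def)
  qed
  have "fin_index_in G S L"
  proof -
    obtain B where B: "finite B" "B \<subseteq> S" "S = generate G B"
      using S unfolding noetherian_in_def by blast
    \<comment> \<open>A homomorphism is determined by its values on the finite generating set
      \<open>B\<close>, so only finitely many have to be considered; \<open>\<Phi>\<close> picks one
      for each pattern of values.\<close>
    define A where "A = (\<lambda>\<phi>. restrict \<phi> B) ` hom ?S ?Q"
    have "A \<subseteq> B \<rightarrow>\<^sub>E carrier ?Q" using B(2) by (auto simp: A_def hom_def)
    then have Af: "finite A" using B(1) Qf by (meson finite_PiE finite_subset)
    define \<Phi> where "\<Phi> a = (SOME \<phi>. \<phi> \<in> hom ?S ?Q \<and> restrict \<phi> B = a)" for a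
    have \<Phi>: "\<Phi> a \<in> hom ?S ?Q \<and> restrict (\<Phi> a) B = a" if "a \<in> A" for a
    proof -
      have "\<exists>\<phi>. \<phi> \<in> hom ?S ?Q \<and> restrict \<phi> B = a" using that by (auto simp: A_def)
      then show ?thesis unfolding \<Phi>_def by (rule someI_ex)
    qed
    show ?thesis
    proof (rule fin_index_inI[OF subL _ S.subset])
      show "L \<subseteq> S" by (auto simp: L_def)
      let ?f = "\<lambda>x. (\<lambda>a\<in>A. \<Phi> a x)"
      have "\<Phi> a x \<in> carrier ?Q" if "a \<in> A" "x \<in> S" for a x
        using \<Phi>[OF that(1)] that(2) by (auto simp: hom_def Pi_iff)
      then have "?f ` S \<subseteq> A \<rightarrow>\<^sub>E carrier ?Q" by auto
      then show "finite (?f ` S)" using Af Qf by (meson finite_PiE finite_subset)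
      fix x y assume xy: "x \<in> S" "y \<in> S" "?f x = ?f y"
      have "\<phi> (x \<otimes> inv y) = \<one>\<^bsub>?Q\<^esub>" if \<phi>: "\<phi> \<in> hom ?S ?Q" for \<phi>
      proof -
        have a: "restrict \<phi> B \<in> A" using \<phi> by (auto simp: A_def)
        have eq: "\<phi> z = \<Phi> (restrict \<phi> B) z" if "z \<in> S" for z
        proof (rule hom_eq_on_generate[OF Q.group_axioms S(1) B(2) \<phi>])
          show "\<Phi> (restrict \<phi> B) \<in> hom ?S ?Q" using \<Phi>[OF a] by simp
          show "\<phi> x = \<Phi> (restrict \<phi> B) x" if "x \<in> B" for x
            using \<Phi>[OF a] that by (metis restrict_apply')
          show "z \<in> generate G B" using that B by simp
        qed
        have "\<phi> x = \<phi> y" using fun_cong[OF xy(3), of "restrict \<phi> B"] eq[OF xy(1)] eq[OF xy(2)]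
          by (simp only: restrict_apply a if_True)
        then have "\<phi> (x \<otimes> inv y) = \<phi> y \<otimes>\<^bsub>?Q\<^esub> inv\<^bsub>?Q\<^esub> (\<phi> y)"
          using group_hom.hom_mult[OF gh[OF \<phi>], of x "inv y"] group_hom.hom_inv[OF gh[OF \<phi>], of y] xy
            m_inv_consistent[OF S(1)] by simp
        also have "\<dots> = \<one>\<^bsub>?Q\<^esub>"
          by (rule Q.r_inv) (use xy(2) \<phi> in \<open>auto simp: hom_def Pi_iff\<close>)
        finally show ?thesis .
      qed
      then show "x \<otimes> inv y \<in> L" using xy by (auto simp: L_def)
    qed
  qed
  then show ?thesis using that LN N(2) conj by blast
qed

text \<open>If a positive power of \<open>t\<close> lies in \<open>S\<close>, the extension has
  finite index. Otherwise the exponent of \<open>t\<close> is well defined: elements with nonzero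
  exponent are separated by it, and elements of \<open>S\<close> by a subgroup of finite index in
  \<open>S\<close> that is stable under conjugation by \<open>t\<close>.\<close>

lemma residually_finite_in_cyclic_ext:
  assumes "residually_finite_in G S" "noetherian_in G S" "cyclic_ext S t S'"
  shows "residually_finite_in G S'"
proof -
  have ext: "subgroup S G" "subgroup S' G" "S \<subseteq> S'" "t \<in> S'" "\<And>s k::int. s \<in> S ==> t [^] k \<otimes> s \<otimes> t [^] (-k) \<in> S"
     "S' = {s \<otimes> t [^] k | s k::int. s \<in> S}"
    using assms(3) by (auto simp: cyclic_ext_def)
  interpret S: subgroup S G by fact
  interpret S': subgroup S' G by fact
  have t: "t \<in> carrier G" using ext by auto
  \<comment> \<open>Here the power of \<open>t\<close> stands on the left, so that the two
    \<open>S\<close>-parts meet in the middle of \<open>x \<otimes> inv y\<close>.\<close>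
  have "\<forall>x\<in>S'. \<exists>p. x = t [^] (fst p::int) \<otimes> snd p \<and> snd p \<in> S"
  proof
    fix x assume "x \<in> S'"
    then obtain s k where "x = s \<otimes> t [^] (k::int)" "s \<in> S" using ext by blast
    then have "x = t [^] k \<otimes> (t [^] (-k) \<otimes> s \<otimes> t [^] (-(-k)))" using t by (simp add: int_pow_neg flip: m_assoc)
    then show "\<exists>p. x = t [^] (fst p::int) \<otimes> snd p \<and> snd p \<in> S"
      using ext(5)[OF \<open>s \<in> S\<close>, of "-k"] by (intro exI[of _ "(k, t [^] (-k) \<otimes> s \<otimes> t [^] (-(-k)))"]) auto
  qed
  then obtain p where p: "\<And>x. x \<in> S' ==> x = t [^] (fst (p x)::int) \<otimes> snd (p x)" "\<And>x. x \<in> S' ==> snd (p x) \<in> S"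
    by metis
  have SS: "fin_index_in G S S"
  proof -
    have "(\<lambda>x. S #> x) ` S \<subseteq> {S}" using S.rcos_const[OF is_group] by auto
    then show ?thesis using finite_subset ext(1) unfolding fin_index_in_def by blast
  qed
  have general: "fin_index_in G S' {s \<otimes> t [^] (n * k) | s k::int. s \<in> M}"
    if M: "fin_index_in G S M" "\<And>s k::int. s \<in> M ==> t [^] k \<otimes> s \<otimes> t [^] (-k) \<in> M" and n: "n > 0" for M and n :: int
  proof (rule fin_index_inI)
    have M': "subgroup M G" "M \<subseteq> S" "finite ((\<lambda>x. M #> x) ` S)" using M by (auto simp: fin_index_in_def)
    show "subgroup {s \<otimes> t [^] (n * k) | s k::int. s \<in> M} G" by (rule subgroup_mult_cyclic[OF M'(1) t M(2)])
    show "{s \<otimes> t [^] (n * k) | s k::int. s \<in> M} \<subseteq> S'"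
      using subgroup_int_pow_closed[OF ext(2,4)] ext(3) M'(2) S'.m_closed by auto
    show "S' \<subseteq> carrier G" by (rule S'.subset)
    let ?f = "\<lambda>x. (fst (p x) mod n, M #> snd (p x))"
    have "?f ` S' \<subseteq> {0..<n} \<times> ((\<lambda>x. M #> x) ` S)" using p(2) n by auto
    then show "finite (?f ` S')" by (rule finite_subset) (use M'(3) in auto)
    fix x y assume xy: "x \<in> S'" "y \<in> S'" "?f x = ?f y"
    obtain k s k' s' where ks: "p x = (k, s)" "p y = (k', s')" by fastforce
    have s: "s \<in> S" "s' \<in> S" "x = t [^] k \<otimes> s" "y = t [^] k' \<otimes> s'" using p[OF xy(1)] p[OF xy(2)] ks by auto
    have m: "s \<otimes> inv s' \<in> M" using xy ks s r_coset_eq_iff[OF M'(1), of s s'] by auto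
    have "n dvd k - k'" using xy ks by (simp add: mod_eq_dvd_iff)
    then obtain j where j: "k - k' = n * j" by blast
    have "x \<otimes> inv y = t [^] k \<otimes> (s \<otimes> inv s') \<otimes> t [^] (-k')"
      using s t by (simp add: inv_mult_group int_pow_neg m_assoc)
    also have "\<dots> = (t [^] k \<otimes> (s \<otimes> inv s') \<otimes> t [^] (-k)) \<otimes> t [^] (k - k')"
    proof -
      have "t [^] (-k) \<otimes> t [^] (k - k') = t [^] (-k')" using t by (simp flip: int_pow_mult)
      then show ?thesis using s t by (simp add: m_assoc)
    qed
    finally show "x \<otimes> inv y \<in> {s \<otimes> t [^] (n * k) | s k::int. s \<in> M}" using M(2)[OF m, of k] j by auto
  qed
  show ?thesis
  proof (cases "\<exists>n>0. t [^] (n::int) \<in> S")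
    case True
    then obtain n where n: "n > 0" "t [^] (n::int) \<in> S" by auto
    have "{s \<otimes> t [^] (n * k) | s k::int. s \<in> S} = S"
    proof
      have "t [^] (n * k) \<in> S" for k
        using n(2) t subgroup_int_pow_closed[OF ext(1), of "t [^] n" k] by (simp add: int_pow_pow)
      then show "{s \<otimes> t [^] (n * k) | s k::int. s \<in> S} \<subseteq> S" by auto
      show "S \<subseteq> {s \<otimes> t [^] (n * k) | s k::int. s \<in> S}" by (force intro!: exI[of _ "0::int"])
    qed
    then have "fin_index_in G S' S" using general[OF SS ext(5) n(1)] by simp
    then show ?thesis using residually_finite_in_finite_ext[OF assms(1) ext(1,2)] by blast
  next
    case False
    have no: "k = 0" if "t [^] (k::int) \<in> S" for k
    proof (rule ccontr)
      assume "k \<noteq> 0"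
      moreover have "t [^] (-k) \<in> S" using that t by (simp add: int_pow_neg)
      ultimately show False using False that by (metis neg_0_less_iff_less not_less_iff_gr_or_eq)
    qed
    show ?thesis unfolding residually_finite_in_def
    proof (intro ballI impI)
      fix h assume h: "h \<in> S'" "h \<noteq> \<one>"
      then obtain s k where sk: "h = s \<otimes> t [^] (k::int)" "s \<in> S" using ext by blast
      show "\<exists>M. fin_index_in G S' M \<and> h \<notin> M"
      proof (cases "k = 0")
        case False
        \<comment> \<open>\<open>2 * \<bar>k\<bar>\<close> is a modulus that never divides a nonzero
          \<open>k\<close>, including \<open>1\<close> and \<open>-1\<close>.\<close>
        have "h \<notin> {s \<otimes> t [^] ((2 * \<bar>k\<bar>) * k') | s k'::int. s \<in> S}"
        proof
          assume "h \<in> {s \<otimes> t [^] ((2 * \<bar>k\<bar>) * k') | s k'::int. s \<in> S}"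
          then obtain s' k' where s': "h = s' \<otimes> t [^] ((2 * \<bar>k\<bar>) * k')" "s' \<in> S" by blast
          then have "inv s' \<otimes> s = t [^] ((2 * \<bar>k\<bar>) * k') \<otimes> inv (t [^] k)"
            using sk t inv_solve_left inv_solve_right by (simp add: m_assoc inv_solve_left' inv_solve_right')
          then have "t [^] ((2 * \<bar>k\<bar>) * k' - k) = inv s' \<otimes> s" using t by (simp add: int_pow_diff)
          then have "(2 * \<bar>k\<bar>) * k' - k = 0" using sk s' by (intro no) auto
          then have "2 * \<bar>k\<bar> dvd k" by (metis dvd_triv_left eq_iff_diff_eq_0)
          then show False using False zdvd_imp_le[of "2 * \<bar>k\<bar>" "\<bar>k\<bar>"] by simp
        qed
        then show ?thesis using general[OF SS ext(5), of "2 * \<bar>k\<bar>"] False by force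
      next
        case True
        then have hS: "h \<in> S" using sk by simp
        then obtain M where M: "fin_index_in G S M" "h \<notin> M" using assms(1) h by (auto simp: residually_finite_in_def)
        obtain L where L: "fin_index_in G S L" "L \<subseteq> M" "\<And>s k::int. s \<in> L ==> t [^] k \<otimes> s \<otimes> t [^] (-k) \<in> L"
          using invariant_finite_index_subgroup[OF ext(1) assms(2) M(1) t ext(5)] by blast
        have "h \<notin> {s \<otimes> t [^] (1 * k) | s k::int. s \<in> L}"
        proof
          assume "h \<in> {s \<otimes> t [^] (1 * k) | s k::int. s \<in> L}"
          then obtain s' k' where s': "h = s' \<otimes> t [^] (k'::int)" "s' \<in> L" by auto
          have s'S: "s' \<in> S" using s' L by (auto simp: fin_index_in_def)
          then have "t [^] k' = inv s' \<otimes> h" using s' t hS by (simp add: inv_solve_left)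
          then have "k' = 0" using s'S hS by (intro no) auto
          then show False using s' s'S L M by auto
        qed
        moreover have "fin_index_in G S' {s \<otimes> t [^] (1 * k) | s k::int. s \<in> L}"
          by (rule general[OF L(1)]) (use L(3) in auto)
        ultimately show ?thesis by blast
      qed
    qed
  qed
qed

end

lemma (in group) cyclic_ext_of_normal:
  assumes "subgroup S G" "subgroup S' G" "S \<lhd> G\<lparr>carrier := S'\<rparr>" "cyclic_group (G\<lparr>carrier := S'\<rparr> Mod S)"
  shows "\<exists>t. cyclic_ext S t S'"
proof -
  let ?S = "G\<lparr>carrier := S'\<rparr>"
  interpret S': subgroup S' G by fact
  interpret n: normal S ?S by fact
  interpret Q: group "?S Mod S" by (rule n.factorgroup_is_group)
  obtain C where C: "C \<in> carrier (?S Mod S)" "carrier (?S Mod S) = range (\<lambda>n::int. C [^]\<^bsub>?S Mod S\<^esub> n)"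
    using assms(4) Q.cyclic_group by auto
  obtain t where t: "t \<in> S'" "C = S #>\<^bsub>?S\<^esub> t" using C(1) unfolding carrier_FactGroup by auto
  have pow: "C [^]\<^bsub>?S Mod S\<^esub> k = S #> (t [^] k)" for k :: int
    using n.FactGroup_int_pow[of t k] t int_pow_consistent[OF assms(2) t(1)] by simp
  have tS: "t [^] k \<in> S'" for k :: int using t assms(2) subgroup_int_pow_closed by blast
  have SS: "S \<subseteq> S'" using n.subset by simp
  have S'eq: "S' = {s \<otimes> t [^] k | s k::int. s \<in> S}"
  proof
    show "S' \<subseteq> {s \<otimes> t [^] k | s k::int. s \<in> S}"
    proof
      fix x assume x: "x \<in> S'"
      then have "S #> x \<in> carrier (?S Mod S)" by (auto simp: carrier_FactGroup)
      then obtain k :: int where "S #> x = S #> (t [^] k)" using C pow by auto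
      moreover have "x \<in> S #> x" using x rcos_self[OF _ assms(1)] by auto
      ultimately show "x \<in> {s \<otimes> t [^] k | s k::int. s \<in> S}" by (auto simp: r_coset_def)
    qed
    show "{s \<otimes> t [^] k | s k::int. s \<in> S} \<subseteq> S'" using SS tS by auto
  qed
  have "t [^] k \<otimes> s \<otimes> t [^] (-k) \<in> S" if "s \<in> S" for s and k :: int
    using n.inv_op_closed2[of "t [^] k" s] that tS[of k] t m_inv_consistent[OF assms(2) tS[of k]] by (simp add: int_pow_neg)
  then show ?thesis using assms(1,2) SS t S'eq unfolding cyclic_ext_def by blast
qed

text \<open>Both properties climb the series together, because residual finiteness of a cyclic
  extension needs finite generation of its base.\<close>

lemma (in group) polycyclic_by_finite_imp:
  assumes "polycyclic_by_finite G"
  shows "noetherian_in G (carrier G)" "residually_finite_in G (carrier G)"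
proof -
  obtain N where N: "N \<lhd> G" "finite (rcosets N)" "polycyclic (G\<lparr>carrier := N\<rparr>)"
    using assms unfolding polycyclic_by_finite_def by blast
  have sN: "subgroup N G" using N(1) by (rule normal_imp_subgroup)
  obtain n S where S: "S 0 = {\<one>}" "S n = N" "\<And>i. i \<le> n ==> subgroup (S i) (G\<lparr>carrier := N\<rparr>)"
    "\<And>i. i < n ==> S i \<lhd> G\<lparr>carrier := S (Suc i)\<rparr>"
    "\<And>i. i < n ==> cyclic_group (G\<lparr>carrier := S (Suc i)\<rparr> Mod S i)"
    using N(3) unfolding polycyclic_def by auto
  have sub: "subgroup (S i) G" if "i \<le> n" for i using incl_subgroup[OF sN S(3)[OF that]] .
  have "noetherian_in G (S i) \<and> residually_finite_in G (S i)" if "i \<le> n" for i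
    using that
  proof (induction i)
    case 0
    have "generate G {} = {\<one>}" by (rule generate_empty)
    then have "noetherian_in G {\<one>}"
      unfolding noetherian_in_def using subgroup.one_closed by (metis empty_iff finite.emptyI subsetI subset_singletonD)
    then show ?case using S by (simp add: residually_finite_in_def)
  next
    case (Suc i)
    obtain t where "cyclic_ext (S i) t (S (Suc i))"
      using cyclic_ext_of_normal[OF sub sub S(4) S(5)] Suc.prems by force
    then show ?case using Suc noetherian_in_cyclic_ext residually_finite_in_cyclic_ext by (meson Suc_leD)
  qed
  then have 1: "noetherian_in G N" "residually_finite_in G N" using S(2) by force+
  have "fin_index_in G (carrier G) N"
  proof -
    have "(\<lambda>x. N #> x) ` carrier G = rcosets N" by (auto simp: RCOSETS_def)
    then show ?thesis using N(2) sN subgroup.subset[OF sN] by (simp add: fin_index_in_def)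
  qed
  then show "noetherian_in G (carrier G)" "residually_finite_in G (carrier G)"
    using noetherian_in_finite_ext[OF 1(1) sN subgroup_self] residually_finite_in_finite_ext[OF 1(2) sN subgroup_self] by blast+
qed

lemma (in group) residually_finite_normal:
  assumes "residually_finite_in G (carrier G)" "h \<in> carrier G" "h \<noteq> \<one>"
  obtains L where "L \<in> fin_index_normal G" "h \<notin> L"
proof -
  obtain M where M: "fin_index_in G (carrier G) M" "h \<notin> M" using assms unfolding residually_finite_in_def by blast
  have "rcosets M = (\<lambda>x. M #> x) ` carrier G" by (auto simp: RCOSETS_def)
  then obtain L where "L \<in> fin_index_normal G" "L \<subseteq> M" using normal_core[of M] M by (auto simp: fin_index_in_def)
  then show ?thesis using that M by blast
qed

section \<open>Integral two-by-two matrices\<close>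

definition M2 :: "int => int => int => int => int^2^2" where
  "M2 a b c d = vector [vector [a, b], vector [c, d]]"

lemma M2_nth [simp]:
  "M2 a b c d $ 1 $ 1 = a" "M2 a b c d $ 1 $ 2 = b" "M2 a b c d $ 2 $ 1 = c" "M2 a b c d $ 2 $ 2 = d"
  by (simp_all add: M2_def)

lemma mat2_eq_iff:
  fixes A B :: "'a^2^2"
  shows "A = B \<longleftrightarrow> A $ 1 $ 1 = B $ 1 $ 1 \<and> A $ 1 $ 2 = B $ 1 $ 2 \<and> A $ 2 $ 1 = B $ 2 $ 1 \<and> A $ 2 $ 2 = B $ 2 $ 2"
  by (auto simp: vec_eq_iff forall_2)

lemma vec2_eq_iff: "(v::'a^2) = w \<longleftrightarrow> v $ 1 = w $ 1 \<and> v $ 2 = w $ 2"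
  by (auto simp: vec_eq_iff forall_2)

lemma mat2_mult_nth: "((A::'a::semiring_1^2^2) ** B) $ i $ j = A $ i $ 1 * B $ 1 $ j + A $ i $ 2 * B $ 2 $ j"
  by (simp add: matrix_matrix_mult_def sum_2)

lemma mat2_vec_nth: "((A::'a::semiring_1^2^2) *v v) $ i = A $ i $ 1 * v $ 1 + A $ i $ 2 * v $ 2"
  by (simp add: matrix_vector_mult_def sum_2)

lemma mat_1_nth [simp]: "(mat 1 :: 'a::semiring_1^2^2) $ 1 $ 1 = 1" "(mat 1 :: 'a^2^2) $ 1 $ 2 = 0"
  "(mat 1 :: 'a^2^2) $ 2 $ 1 = 0" "(mat 1 :: 'a^2^2) $ 2 $ 2 = 1"
  by (simp_all add: mat_def)

lemma trace_2: "trace (A::'a::comm_ring_1^2^2) = A $ 1 $ 1 + A $ 2 $ 2"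
  by (simp add: trace_def sum_2)

text \<open>The adjugate; it replaces the inverse wherever only a multiple by the determinant is
  available.\<close>

definition adj2 :: "int^2^2 => int^2^2" where
  "adj2 A = M2 (A $ 2 $ 2) (- A $ 1 $ 2) (- A $ 2 $ 1) (A $ 1 $ 1)"

lemma adj2_nth [simp]: "adj2 A $ 1 $ 1 = A $ 2 $ 2" "adj2 A $ 1 $ 2 = - A $ 1 $ 2" "adj2 A $ 2 $ 1 = - A $ 2 $ 1" "adj2 A $ 2 $ 2 = A $ 1 $ 1"
  by (simp_all add: adj2_def)

lemma invertible_iff_det: "invertible (A :: int^2^2) \<longleftrightarrow> det A = 1 \<or> det A = -1"
proof
  assume "invertible A"
  then obtain B where "A ** B = mat 1" by (auto simp: invertible_def)
  then have "det A * det B = 1" by (metis det_mul det_I)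
  then show "det A = 1 \<or> det A = -1" using zmult_eq_1_iff by blast
next
  assume "det A = 1 \<or> det A = -1"
  then show "invertible A"
  proof
    assume "det A = 1"
    then show ?thesis unfolding invertible_def
      by (intro exI[of _ "adj2 A"]) (simp add: mat2_eq_iff mat2_mult_nth det_2 algebra_simps)
  next
    assume "det A = -1"
    then show ?thesis unfolding invertible_def
      by (intro exI[of _ "- adj2 A"]) (simp add: mat2_eq_iff mat2_mult_nth det_2 algebra_simps)
  qed
qed

lemma invertible_of_left_inverse:
  fixes P Q :: "int^2^2"
  assumes "Q ** P = mat 1"
  shows "invertible P" "invertible Q"
proof -
  have "det Q * det P = 1" using assms by (metis det_mul det_I)
  then show "invertible P" "invertible Q" unfolding invertible_iff_det using zmult_eq_1_iff by auto
qed

text \<open>Conjugacy in \<open>GL2Z\<close>, written as an intertwining relation so that no inverse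
  has to be named.\<close>

definition mconj :: "int^2^2 => int^2^2 => bool" where
  "mconj A B \<longleftrightarrow> (\<exists>P. invertible P \<and> P ** A = B ** P)"

lemma mconj_refl: "mconj A A"
  unfolding mconj_def by (intro exI[of _ "mat 1"]) (auto simp: invertible_def intro!: exI[of _ "mat 1"])

lemma mconj_sym: "mconj A B ==> mconj B A"
proof -
  assume "mconj A B"
  then obtain P Q where P: "P ** Q = mat 1" "Q ** P = mat 1" "P ** A = B ** P"
    by (auto simp: mconj_def invertible_def)
  have "Q ** B = Q ** B ** (P ** Q)" using P by simp
  also have "\<dots> = Q ** (P ** A) ** Q" using P(3) by (simp add: matrix_mul_assoc)
  also have "\<dots> = A ** Q" using P(2) by (simp add: matrix_mul_assoc)
  finally show ?thesis using P unfolding mconj_def invertible_def by blast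
qed

lemma mconj_trans: "mconj A B ==> mconj B C ==> mconj A C"
proof -
  assume "mconj A B" "mconj B C"
  then obtain P Q where "invertible P" "P ** A = B ** P" "invertible Q" "Q ** B = C ** Q"
    by (auto simp: mconj_def)
  moreover from this have "(Q ** P) ** A = C ** (Q ** P)"
    by (metis matrix_mul_assoc)
  ultimately show ?thesis unfolding mconj_def using invertible_mult by blast
qed

lemma mconj_det: "mconj A B ==> det A = det B"
proof -
  assume "mconj A B"
  then obtain P where "invertible P" "P ** A = B ** P" by (auto simp: mconj_def)
  then have "det P * det A = det B * det P" by (metis det_mul)
  then show ?thesis using \<open>invertible P\<close> by (auto simp: invertible_iff_det)
qed

lemma trace_mult_comm: "trace ((A::int^2^2) ** B) = trace (B ** A)"
  by (simp add: trace_2 mat2_mult_nth algebra_simps)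

lemma mconj_trace: "mconj A B ==> trace A = trace B"
proof -
  assume "mconj A B"
  then obtain P Q where P: "P ** Q = mat 1" "Q ** P = mat 1" "P ** A = B ** P"
    by (auto simp: mconj_def invertible_def)
  have "trace B = trace (B ** (P ** Q))" using P by simp
  also have "\<dots> = trace ((P ** A) ** Q)" using P(3) by (simp add: matrix_mul_assoc)
  also have "\<dots> = trace (Q ** (P ** A))" by (rule trace_mult_comm)
  also have "\<dots> = trace A" using P(2) by (simp add: matrix_mul_assoc)
  finally show ?thesis by simp
qed

text \<open>A lower shear normalises \<open>a\<close> modulo \<open>b\<close>; a swap exchanges \<open>b\<close> and \<open>c\<close>.\<close>

lemma mconj_shear: "mconj A (M2 (A $ 1 $ 1 - s * A $ 1 $ 2) (A $ 1 $ 2)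
    (A $ 2 $ 1 + s * (A $ 1 $ 1 - A $ 2 $ 2) - s * s * A $ 1 $ 2) (A $ 2 $ 2 + s * A $ 1 $ 2))"
  unfolding mconj_def
  by (intro exI[of _ "M2 1 0 s 1"]) (simp add: invertible_iff_det det_2 mat2_eq_iff mat2_mult_nth algebra_simps)

lemma mconj_swap: "mconj A (M2 (A $ 2 $ 2) (A $ 2 $ 1) (A $ 1 $ 2) (A $ 1 $ 1))"
  unfolding mconj_def
  by (intro exI[of _ "M2 0 1 1 0"]) (simp add: invertible_iff_det det_2 mat2_eq_iff mat2_mult_nth)

text \<open>Lagrange reduction of the quadratic form attached to \<open>A\<close>. Among all
  conjugates take one with least \<open>\<bar>b\<bar>\<close>; a shear gives
  \<open>\<bar>a - d\<bar> \<le> \<bar>b\<bar>\<close>, and minimality against the swap gives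
  \<open>\<bar>b\<bar> \<le> \<bar>c\<bar>\<close>. The discriminant
  \<open>(a - d)^2 + 4 b c\<close> then has absolute value at least
  \<open>4 b^2 - b^2\<close>.\<close>

lemma mconj_reduced:
  assumes b: "\<And>B. mconj A B ==> B $ 1 $ 2 \<noteq> 0"
  obtains B where "mconj A B" "\<bar>2 * B $ 1 $ 1 - trace A\<bar> \<le> \<bar>B $ 1 $ 2\<bar>"
    "3 * (B $ 1 $ 2)^2 \<le> \<bar>(trace A)^2 - 4 * det A\<bar>"
proof -
  define n where "n = (LEAST n. \<exists>B. mconj A B \<and> nat \<bar>B $ 1 $ 2\<bar> = n)"
  have "\<exists>B. mconj A B \<and> nat \<bar>B $ 1 $ 2\<bar> = n"
    unfolding n_def by (rule LeastI_ex) (use mconj_refl in blast)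
  then obtain B0 where B0: "mconj A B0" "nat \<bar>B0 $ 1 $ 2\<bar> = n" by blast
  have least: "n \<le> nat \<bar>B $ 1 $ 2\<bar>" if "mconj A B" for B
    unfolding n_def using that by (intro Least_le) blast
  let ?b = "B0 $ 1 $ 2"
  define u where "u = B0 $ 1 $ 1 - B0 $ 2 $ 2"
  have b0: "?b \<noteq> 0" using b B0 by blast
  \<comment> \<open>The centred remainder of \<open>u\<close> modulo \<open>2 * ?b\<close>: a shear
    by \<open>s\<close> changes the difference of the diagonal entries by
    \<open>2 * s * ?b\<close>.\<close>
  obtain s where s: "\<bar>u - 2 * s * ?b\<bar> \<le> \<bar>?b\<bar>"
  proof -
    define m where "m = 2 * \<bar>?b\<bar>"
    have m: "m > 0" using b0 by (simp add: m_def)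
    define k where "k = (u + \<bar>?b\<bar>) div m"
    have "0 \<le> (u + \<bar>?b\<bar>) mod m" "(u + \<bar>?b\<bar>) mod m < m" using m by auto
    moreover have "(u + \<bar>?b\<bar>) mod m = u + \<bar>?b\<bar> - m * k" unfolding k_def by (simp add: minus_mult_div_eq_mod)
    ultimately have "\<bar>u - m * k\<bar> \<le> \<bar>?b\<bar>" unfolding m_def by linarith
    moreover have "m * k = 2 * (k * sgn ?b) * ?b" unfolding m_def by (simp add: abs_sgn mult_ac)
    ultimately show thesis using that[of "k * sgn ?b"] by simp
  qed
  define B where "B = M2 (B0 $ 1 $ 1 - s * ?b) ?b (B0 $ 2 $ 1 + s * (B0 $ 1 $ 1 - B0 $ 2 $ 2) - s * s * ?b) (B0 $ 2 $ 2 + s * ?b)"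
  have B: "mconj A B" using mconj_trans[OF B0(1) mconj_shear[of B0 s]] by (simp add: B_def)
  have tr: "trace A = B $ 1 $ 1 + B $ 2 $ 2" using mconj_trace[OF B] by (simp add: trace_2)
  have dt: "det A = B $ 1 $ 1 * B $ 2 $ 2 - B $ 1 $ 2 * B $ 2 $ 1" using mconj_det[OF B] by (simp add: det_2)
  have Bb: "B $ 1 $ 2 = ?b" by (simp add: B_def)
  have d: "\<bar>B $ 1 $ 1 - B $ 2 $ 2\<bar> \<le> \<bar>B $ 1 $ 2\<bar>" using s by (simp add: B_def u_def algebra_simps)
  have c: "\<bar>B $ 1 $ 2\<bar> \<le> \<bar>B $ 2 $ 1\<bar>"
    using least[OF mconj_trans[OF B mconj_swap]] B0(2) Bb by simp
  let ?x = "B $ 1 $ 1 - B $ 2 $ 2" and ?y = "B $ 1 $ 2" and ?z = "B $ 2 $ 1"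
  have disc: "(trace A)^2 - 4 * det A = ?x^2 + 4 * (?y * ?z)"
    unfolding tr dt by (simp add: power2_eq_square algebra_simps)
  have x2: "?x^2 \<le> ?y^2" using d by (metis abs_le_square_iff)
  have "?y^2 \<le> \<bar>?y * ?z\<bar>"
  proof -
    have "?y^2 = \<bar>?y\<bar> * \<bar>?y\<bar>" by (simp add: power2_eq_square)
    also have "\<dots> \<le> \<bar>?y\<bar> * \<bar>?z\<bar>" by (rule mult_left_mono[OF c]) simp
    finally show ?thesis by (simp only: abs_mult)
  qed
  moreover have "0 \<le> ?x^2" by simp
  ultimately have "3 * ?y^2 \<le> \<bar>?x^2 + 4 * (?y * ?z)\<bar>" using x2 by linarith
  then have "3 * ?y^2 \<le> \<bar>(trace A)^2 - 4 * det A\<bar>" unfolding disc .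
  moreover have "\<bar>2 * B $ 1 $ 1 - trace A\<bar> \<le> \<bar>B $ 1 $ 2\<bar>" using d tr by simp
  ultimately show ?thesis using that B by blast
qed

section \<open>Homomorphisms to the integers\<close>

definition int_hom :: "('a, 'b) monoid_scheme => 'a set => ('a => int) => bool" where
  "int_hom G S \<phi> \<longleftrightarrow> (\<forall>x\<in>S. \<forall>y\<in>S. \<phi> (x \<otimes>\<^bsub>G\<^esub> y) = \<phi> x + \<phi> y)"

text \<open>Encodes a homomorphism of \<open>S\<close> onto the free abelian group of rank
  \<open>d\<close> together with preimages of a basis; it expresses that the rank is at least
  \<open>d\<close> without quotient groups.\<close>

definition dual_system :: "('a, 'b) monoid_scheme => 'a set => nat => (nat => 'a => int) => (nat => 'a) => bool" where
  "dual_system G S d \<phi> x \<longleftrightarrow> (\<forall>i<d. int_hom G S (\<phi> i) \<and> x i \<in> S) \<and>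
     (\<forall>i<d. \<forall>j<d. \<phi> i (x j) = (if i = j then 1 else 0))"

context group
begin

lemma int_homD: "int_hom G S \<phi> ==> x \<in> S ==> y \<in> S ==> \<phi> (x \<otimes> y) = \<phi> x + \<phi> y"
  by (simp add: int_hom_def)

lemma int_hom_one: "subgroup S G ==> int_hom G S \<phi> ==> \<phi> \<one> = 0"
  using int_homD[of S \<phi> \<one> \<one>] subgroup.one_closed[of S G] by simp

lemma int_hom_inv:
  assumes "subgroup S G" "int_hom G S \<phi>" "x \<in> S"
  shows "\<phi> (inv x) = - \<phi> x"
proof -
  have x: "x \<in> carrier G" "inv x \<in> S" using assms subgroup.mem_carrier subgroup.m_inv_closed by metis+
  have "\<phi> (x \<otimes> inv x) = \<phi> x + \<phi> (inv x)" using int_homD[OF assms(2,3) x(2)] .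
  then show ?thesis using int_hom_one[OF assms(1,2)] x by simp
qed

lemma int_hom_nat_pow:
  assumes "subgroup S G" "int_hom G S \<phi>" "x \<in> S"
  shows "x [^] (n::nat) \<in> S \<and> \<phi> (x [^] n) = int n * \<phi> x"
proof (induction n)
  case 0
  show ?case using int_hom_one[OF assms(1,2)] subgroup.one_closed[OF assms(1)] by simp
next
  case (Suc n)
  then show ?case using int_homD[OF assms(2)] assms(3) subgroup.m_closed[OF assms(1)]
    by (simp add: distrib_right)
qed

lemma int_hom_int_pow:
  assumes "subgroup S G" "int_hom G S \<phi>" "x \<in> S"
  shows "\<phi> (x [^] (k::int)) = k * \<phi> x"
proof (cases "k \<ge> 0")
  case True
  then have "int (nat k) = k" by simp
  moreover have "\<phi> (x [^] int (nat k)) = int (nat k) * \<phi> x"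
    unfolding int_pow_int using int_hom_nat_pow[OF assms, of "nat k"] by blast
  ultimately show ?thesis by metis
next
  case False
  then have "k < 0" by simp
  then have "x [^] k = inv (x [^] nat (-k))" unfolding int_pow_def2 by (rule if_P)
  then have "\<phi> (x [^] k) = - (int (nat (-k)) * \<phi> x)"
    using int_hom_nat_pow[OF assms, of "nat (-k)"] int_hom_inv[OF assms(1,2)] by simp
  then show ?thesis using False by simp
qed

text \<open>The image of \<open>\<phi>\<close> is generated by one integer, by which
  \<open>\<phi>\<close> can be divided.\<close>

lemma int_hom_onto:
  assumes S: "subgroup S G" and "int_hom G S \<phi>" "x \<in> S" "\<phi> x \<noteq> 0"
  obtains \<psi> y where "int_hom G S \<psi>" "y \<in> S" "\<psi> y = 1"
proof -
  have c: "a \<otimes> inv b \<in> S" if "a \<in> S" "b \<in> S" for a b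
    using that S subgroup.m_closed subgroup.m_inv_closed by metis
  have "0 \<in> \<phi> ` S" using int_hom_one[OF S assms(2)] subgroup.one_closed[OF S] by force
  moreover have "u - v \<in> \<phi> ` S" if uv: "u \<in> \<phi> ` S" "v \<in> \<phi> ` S" for u v
  proof -
    obtain a b where "a \<in> S" "u = \<phi> a" "b \<in> S" "v = \<phi> b" using uv by auto
    then show ?thesis using int_homD[OF assms(2), of a "inv b"] int_hom_inv[OF S assms(2), of b] c[of a b]
        subgroup.m_inv_closed[OF S, of b] by (intro image_eqI[of _ _ "a \<otimes> inv b"]) auto
  qed
  ultimately obtain d where d: "d \<ge> 0" "\<phi> ` S = range ((*) d)" using int_subgroup_cyclic by metis
  then have "d \<noteq> 0" using assms(3,4) by auto
  have dv: "d dvd \<phi> a" if "a \<in> S" for a using d(2) that by (metis dvd_triv_left imageE imageI)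
  have "d \<in> \<phi> ` S" using d(2) by (metis mult.right_neutral rangeI)
  then obtain y where "y \<in> S" "\<phi> y = d" by auto
  moreover have "int_hom G S (\<lambda>a. \<phi> a div d)"
    unfolding int_hom_def using int_homD[OF assms(2)] dv by (simp add: div_plus_div_distrib_dvd_left)
  ultimately show ?thesis using that[of "\<lambda>a. \<phi> a div d" y] \<open>d \<noteq> 0\<close> by simp
qed

lemma subgroup_int_hom_kernel:
  assumes "subgroup S G" "\<And>i. i < d ==> int_hom G S (\<phi> i)"
  shows "subgroup {y \<in> S. \<forall>i<(d::nat). \<phi> i y = 0} G"
proof -
  interpret S: subgroup S G by fact
  show ?thesis
    by (rule subgroupI)
      (auto simp: int_hom_inv[OF assms(1) assms(2)] int_homD[OF assms(2)] int_hom_one[OF assms(1) assms(2)]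
        intro!: exI[of _ \<one>])
qed

text \<open>The \<open>\<phi> i\<close> modulo \<open>2\<close> take all \<open>2 ^ d\<close>
  patterns of values on \<open>S\<close>, and \<open>R\<close> realizes each of them. All upper
  bounds for ranks come from this count.\<close>

lemma dual_system_card:
  assumes S: "subgroup S G" and ds: "dual_system G S d \<phi> x"
    and R: "finite R" "R \<subseteq> S" "\<And>h. h \<in> S ==> \<exists>\<rho>\<in>R. \<forall>i<d. even (\<phi> i h - \<phi> i \<rho>)"
  shows "2 ^ d \<le> card R"
proof -
  have h: "\<And>i. i < d ==> int_hom G S (\<phi> i)" and xS: "\<And>i. i < d ==> x i \<in> S"
    and dual: "\<And>i j. i < d ==> j < d ==> \<phi> i (x j) = (if i = j then 1 else 0)"
    using ds by (auto simp: dual_system_def)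
  define P where "P h = {i. i < d \<and> odd (\<phi> i h)}" for h
  have ex: "\<exists>h\<in>S. \<forall>i<d. \<phi> i h = (if i \<in> I then 1 else 0)" if I: "finite I" "I \<subseteq> {..<d}" for I
    using I
  proof (induction I)
    case empty
    show ?case using int_hom_one[OF S h] subgroup.one_closed[OF S] by force
  next
    case (insert j I)
    then obtain h' where h': "h' \<in> S" "\<forall>i<d. \<phi> i h' = (if i \<in> I then 1 else 0)" by auto
    have j: "j < d" using insert by auto
    have "\<phi> i (x j \<otimes> h') = (if i \<in> insert j I then 1 else 0)" if i: "i < d" for i
      using int_homD[OF h[OF i] xS[OF j] h'(1)] dual[OF i j] h'(2) i insert(2) by auto
    then show ?case using subgroup.m_closed[OF S xS[OF j] h'(1)] by blast
  qed
  have "Pow {..<d} \<subseteq> P ` R"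
  proof
    fix I assume I: "I \<in> Pow {..<d}"
    then have "finite I" "I \<subseteq> {..<d}" using finite_subset[of I "{..<d}"] by auto
    then obtain h where h': "h \<in> S" "\<forall>i<d. \<phi> i h = (if i \<in> I then 1 else 0)" using ex by blast
    then obtain \<rho> where \<rho>: "\<rho> \<in> R" "\<forall>i<d. even (\<phi> i h - \<phi> i \<rho>)" using R(3) by blast
    have "P \<rho> = I" using \<rho>(2) h'(2) I by (auto simp: P_def split: if_splits)
    then show "I \<in> P ` R" using \<rho>(1) by blast
  qed
  then have "card (Pow {..<d}) \<le> card (P ` R)" using R(1) by (intro card_mono) auto
  also have "\<dots> \<le> card R" using R(1) by (rule card_image_le)
  finally show ?thesis by (simp add: card_Pow)
qed

end

section \<open>Finitely generated abelian groups\<close>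

context comm_group
begin

lemma generate_insert_eq:
  assumes B: "B \<subseteq> carrier G" and g: "g \<in> carrier G"
  shows "generate G (insert g B) = {b \<otimes> g [^] (k::int) | b k. b \<in> generate G B}"
proof
  let ?S = "{b \<otimes> g [^] (k::int) | b k. b \<in> generate G B}"
  have sB: "subgroup (generate G B) G" using generate_is_subgroup[OF B] .
  have "subgroup {b \<otimes> g [^] ((1::int) * k) | b k. b \<in> generate G B} G"
  proof (rule subgroup_mult_cyclic[OF sB g])
    fix s and k :: int assume "s \<in> generate G B"
    moreover have "g [^] k \<otimes> s \<otimes> g [^] (-k) = s" if "s \<in> carrier G"
      using that g by (simp add: m_comm[of _ s] m_assoc flip: int_pow_mult)
    ultimately show "g [^] k \<otimes> s \<otimes> g [^] (-k) \<in> generate G B" using subgroup.mem_carrier[OF sB] by simp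
  qed
  then have s: "subgroup ?S G" by simp
  have "B \<subseteq> ?S"
  proof
    fix b assume b: "b \<in> B"
    then have "b = b \<otimes> g [^] (0::int)" "b \<in> generate G B" using B generate.incl by auto
    then show "b \<in> ?S" by blast
  qed
  moreover have "g \<in> ?S"
  proof -
    have "g = \<one> \<otimes> g [^] (1::int)" "\<one> \<in> generate G B" using g generate.one by auto
    then show ?thesis by blast
  qed
  ultimately show "generate G (insert g B) \<subseteq> ?S" using s by (intro generate_subgroup_incl) auto
  have sI: "subgroup (generate G (insert g B)) G" using B g by (intro generate_is_subgroup) auto
  have "g [^] (k::int) \<in> generate G (insert g B)" for k
    by (rule subgroup_int_pow_closed[OF sI generate.incl]) simp
  moreover have "generate G B \<subseteq> generate G (insert g B)" by (rule mono_generate) auto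
  ultimately show "?S \<subseteq> generate G (insert g B)" by (auto intro: generate.eng)
qed

text \<open>Induction on the generators. If no nonzero power of the new generator \<open>g\<close>
  lies in the old group, the exponent of \<open>g\<close> is a homomorphism onto \<int>. Otherwise
  some \<open>g [^] d\<close> with \<open>d > 0\<close> does: a finite group stays finite, and a
  homomorphism \<open>\<phi>\<close> on the old group extends after multiplication by
  \<open>d\<close>.\<close>

lemma finite_or_onto_int:
  assumes "finite B" "B \<subseteq> carrier G"
  shows "finite (generate G B) \<or> (\<exists>\<phi> x. int_hom G (generate G B) \<phi> \<and> x \<in> generate G B \<and> \<phi> x = 1)"
  using assms
proof (induction B)
  case empty
  then show ?case by (simp add: generate_empty)
next
  case (insert g B)
  let ?B = "generate G B"
  have g: "g \<in> carrier G" and B: "B \<subseteq> carrier G" using insert by auto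
  have sB: "subgroup ?B G" using generate_is_subgroup[OF B] .
  interpret S: subgroup ?B G by fact
  have eq: "generate G (insert g B) = {b \<otimes> g [^] (k::int) | b k. b \<in> ?B}" using generate_insert_eq[OF B g] .
  have s': "subgroup (generate G (insert g B)) G" using B g by (intro generate_is_subgroup) auto
  \<comment> \<open>\<open>F\<close> itself need not extend with integer values, but the multiple
    \<open>D * F\<close> does once \<open>c\<close> is admissible as the value at \<open>g\<close>.
    The choice \<open>D = 0\<close>, \<open>c = 1\<close> gives the exponent of
    \<open>g\<close>.\<close>
  have extend: "\<exists>\<psi>. int_hom G (generate G (insert g B)) \<psi> \<and> (\<forall>b\<in>?B. \<forall>k::int. \<psi> (b \<otimes> g [^] k) = D * F b + k * c)"
    if F: "int_hom G ?B F" and c: "\<And>k::int. g [^] k \<in> ?B ==> D * F (g [^] k) = k * c" for F and D c :: int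
  proof -
    have wd: "D * F b + k * c = D * F b' + k' * c"
      if b: "b \<in> ?B" "b' \<in> ?B" "b \<otimes> g [^] k = b' \<otimes> g [^] (k'::int)" for b b' k k'
    proof -
      have e: "g [^] (k - k') = inv b \<otimes> b'"
      proof -
        have "inv b \<otimes> (b \<otimes> g [^] k) \<otimes> inv (g [^] k') = inv b \<otimes> (b' \<otimes> g [^] k') \<otimes> inv (g [^] k')"
          using b by simp
        moreover have "inv b \<otimes> (b \<otimes> g [^] k) = g [^] k"
          using S.mem_carrier[OF b(1)] g by (simp flip: m_assoc)
        moreover have "inv b \<otimes> (b' \<otimes> g [^] k') \<otimes> inv (g [^] k') = inv b \<otimes> b'"
          using S.mem_carrier[OF b(1)] S.mem_carrier[OF b(2)] g by (simp add: m_assoc)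
        ultimately show ?thesis using g by (simp add: int_pow_diff)
      qed
      have m: "inv b \<otimes> b' \<in> ?B" using b by simp
      then have "D * F (inv b \<otimes> b') = (k - k') * c" using c[of "k - k'"] e by simp
      moreover have "F (inv b \<otimes> b') = F b' - F b"
        using int_homD[OF F, of "inv b" b'] int_hom_inv[OF sB F b(1)] b by simp
      ultimately show ?thesis by (simp add: algebra_simps)
    qed
    define \<psi> where "\<psi> y = (SOME z. \<exists>b\<in>?B. \<exists>k::int. y = b \<otimes> g [^] k \<and> z = D * F b + k * c)" for y
    have \<psi>: "\<psi> (b \<otimes> g [^] k) = D * F b + k * c" if b: "b \<in> ?B" for b and k :: int
    proof -
      have "\<exists>b'\<in>?B. \<exists>k'::int. b \<otimes> g [^] k = b' \<otimes> g [^] k' \<and> \<psi> (b \<otimes> g [^] k) = D * F b' + k' * c"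
        unfolding \<psi>_def by (rule someI[where x = "D * F b + k * c"]) (use b in blast)
      then show ?thesis using wd b by metis
    qed
    have "int_hom G (generate G (insert g B)) \<psi>"
      unfolding int_hom_def eq
    proof (intro ballI)
      fix x y assume "x \<in> {b \<otimes> g [^] (k::int) | b k. b \<in> ?B}" "y \<in> {b \<otimes> g [^] (k::int) | b k. b \<in> ?B}"
      then obtain b k b' k' where xy: "x = b \<otimes> g [^] (k::int)" "b \<in> ?B" "y = b' \<otimes> g [^] (k'::int)" "b' \<in> ?B" by blast
      have "x \<otimes> y = (b \<otimes> b') \<otimes> g [^] (k + k')"
        using xy g by (simp add: int_pow_mult m_ac)
      then show "\<psi> (x \<otimes> y) = \<psi> x + \<psi> y" using xy \<psi> int_homD[OF F xy(2,4)] by (simp add: algebra_simps)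
    qed
    then show ?thesis using \<psi> by blast
  qed
  define A where "A = {k::int. g [^] k \<in> ?B}"
  have "0 \<in> A" by (simp add: A_def)
  moreover have "k - l \<in> A" if "k \<in> A" "l \<in> A" for k l
    using that g by (simp add: A_def int_pow_diff)
  ultimately obtain d where d: "d \<ge> 0" "A = range ((*) d)" using int_subgroup_cyclic by metis
  show ?case
  proof (cases "d = 0")
    case True
    then have "k = 0" if "g [^] (k::int) \<in> ?B" for k using that d by (auto simp: A_def)
    moreover have "int_hom G ?B (\<lambda>_. 0)" by (simp add: int_hom_def)
    ultimately have "\<exists>\<psi>. int_hom G (generate G (insert g B)) \<psi> \<and> (\<forall>b\<in>?B. \<forall>k::int. \<psi> (b \<otimes> g [^] k) = 0 * (\<lambda>_. 0) b + k * 1)"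
      by (intro extend[of "\<lambda>_. 0" 0 1]) auto
    then obtain \<psi> where \<psi>0: "int_hom G (generate G (insert g B)) \<psi>"
        "\<forall>b\<in>?B. \<forall>k::int. \<psi> (b \<otimes> g [^] k) = 0 * (\<lambda>_. 0) b + k * 1" by blast
    have \<psi>: "int_hom G (generate G (insert g B)) \<psi>" "\<And>b k::int. b \<in> ?B ==> \<psi> (b \<otimes> g [^] k) = k"
      by (fact \<psi>0(1)) (simp only: \<psi>0(2)[rule_format] mult_zero_left mult_1_right add_0)
    have "\<psi> g = 1" using \<psi>(2)[OF generate.one, of 1] g by (simp only: int_pow_1 l_one)
    then show ?thesis using \<psi>(1) generate.incl[of g "insert g B"] by blast
  next
    case False
    consider "finite ?B" | \<phi> x where "int_hom G ?B \<phi>" "x \<in> ?B" "\<phi> x = 1" using insert B by auto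
    then show ?thesis
    proof cases
      case 1
      have "generate G (insert g B) \<subseteq> (\<lambda>(b,k). b \<otimes> g [^] k) ` (?B \<times> {0..<d})"
      proof
        fix y assume "y \<in> generate G (insert g B)"
        then obtain b k where y: "y = b \<otimes> g [^] (k::int)" "b \<in> ?B" using eq by auto
        have "d * (k div d) \<in> A" using d by auto
        then have "b \<otimes> g [^] (d * (k div d)) \<in> ?B" using y by (simp add: A_def)
        moreover have "y = (b \<otimes> g [^] (d * (k div d))) \<otimes> g [^] (k mod d)"
          using y g by (simp add: m_assoc flip: int_pow_mult)
        ultimately show "y \<in> (\<lambda>(b,k). b \<otimes> g [^] k) ` (?B \<times> {0..<d})" using d False by force
      qed
      then show ?thesis using 1 finite_subset by blast
    next
      case 2
      have "d * \<phi> (g [^] k) = k * \<phi> (g [^] d)" if k: "g [^] (k::int) \<in> ?B" for k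
      proof -
        obtain j where j: "k = d * j" using k d by (auto simp: A_def)
        have "d \<in> A" using d by (metis mult.right_neutral rangeI)
        then have "\<phi> ((g [^] d) [^] j) = j * \<phi> (g [^] d)" using int_hom_int_pow[OF sB 2(1)] by (simp add: A_def)
        then show ?thesis using j g by (simp add: int_pow_pow)
      qed
      then obtain \<psi> where \<psi>: "int_hom G (generate G (insert g B)) \<psi>"
          "\<And>b k::int. b \<in> ?B ==> \<psi> (b \<otimes> g [^] k) = d * \<phi> b + k * \<phi> (g [^] d)"
        using extend[OF 2(1)] by metis
      have "\<psi> (x \<otimes> g [^] (0::int)) = d" unfolding \<psi>(2)[OF 2(2), of 0] 2(3) by simp
      moreover have "x \<otimes> g [^] (0::int) \<in> generate G (insert g B)" using eq 2(2) by blast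
      ultimately show ?thesis using int_hom_onto[OF s' \<psi>(1)] False by metis
    qed
  qed
qed

text \<open>
  The map \<open>p\<close> is the projection onto the joint kernel along the subgroup generated by the \<open>x i\<close>.
\<close>

definition split_system :: "nat => (nat => 'a => int) => (nat => 'a) => ('a => 'a) => bool" where
  "split_system d \<phi> x p \<longleftrightarrow> dual_system G (carrier G) d \<phi> x \<and>
     p \<in> hom G G \<and> (\<forall>y\<in>carrier G. \<forall>i<d. \<phi> i (p y) = 0) \<and>
     (\<forall>y\<in>carrier G. (\<forall>i<d. \<phi> i y = 0) \<longrightarrow> p y = y) \<and> (\<forall>i<d. p (x i) = \<one>)"

text \<open>One infinite cyclic factor is split off the joint kernel at a time until that kernel is
  finite or \<open>d\<close> factors have been found. The cut-off \<open>d\<close> replaces a notion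
  of rank; in the applications it exceeds a bound proved separately, so the kernel is finite
  there.\<close>

lemma split_system_exists:
  assumes "noetherian_in G (carrier G)"
  shows "\<exists>d' \<phi> x p. d' \<le> d \<and> split_system d' \<phi> x p \<and>
     (d' = d \<or> finite {y \<in> carrier G. \<forall>i<d'. \<phi> i y = 0})"
proof (induction d)
  case 0
  show ?case unfolding split_system_def
    by (intro exI[of _ 0] conjI exI[of _ "\<lambda>_ _. 0"] exI[of _ "\<lambda>_. \<one>"] exI[of _ "\<lambda>x. x"])
      (auto simp: dual_system_def hom_def)
next
  case (Suc d)
  then obtain d' \<phi> x p where IH0: "d' \<le> d" "split_system d' \<phi> x p"
      "d' = d \<or> finite {y \<in> carrier G. \<forall>i<d'. \<phi> i y = 0}" by blast
  have IH: "d' \<le> d" "dual_system G (carrier G) d' \<phi> x" "p \<in> hom G G"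
      "\<And>y i. y \<in> carrier G ==> i < d' ==> \<phi> i (p y) = 0"
      "\<And>y. y \<in> carrier G ==> (\<forall>i<d'. \<phi> i y = 0) ==> p y = y" "\<And>i. i < d' ==> p (x i) = \<one>"
      "d' = d \<or> finite {y \<in> carrier G. \<forall>i<d'. \<phi> i y = 0}"
    using IH0 unfolding split_system_def by blast+
  define K where "K = {y \<in> carrier G. \<forall>i<d'. \<phi> i y = 0}"
  show ?case
  proof (cases "finite K")
    case True
    show ?thesis
      using IH0(1,2) True[unfolded K_def] by (intro exI[of _ d'] exI[of _ \<phi>] exI[of _ x] exI[of _ p]) simp
  next
    case False
    then have dd: "d' = d" using IH(7) by (simp add: K_def)
    have h: "\<And>i. i < d ==> int_hom G (carrier G) (\<phi> i)" and xc: "\<And>i. i < d ==> x i \<in> carrier G"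
      and dual: "\<And>i j. i < d ==> j < d ==> \<phi> i (x j) = (if i = j then 1 else 0)"
      using IH(2) dd by (auto simp: dual_system_def)
    have K: "subgroup K G" unfolding K_def dd by (rule subgroup_int_hom_kernel[OF subgroup_self h])
    obtain B where B: "finite B" "B \<subseteq> K" "K = generate G B"
      using assms K subgroup.subset[OF K] unfolding noetherian_in_def by metis
    have "B \<subseteq> carrier G" using B subgroup.subset[OF K] by auto
    then obtain \<phi>0 x0 where 0: "int_hom G K \<phi>0" "x0 \<in> K" "\<phi>0 x0 = 1"
      using finite_or_onto_int[OF B(1)] False B(3) by auto
    have x0: "x0 \<in> carrier G" using 0 by (simp add: K_def)
    have pK: "p y \<in> K" if "y \<in> carrier G" for y using that IH(3,4) by (auto simp: K_def hom_def)
    have pid: "p y = y" if "y \<in> K" for y using that IH(5) by (simp add: K_def)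
    have pm: "p (a \<otimes> b) = p a \<otimes> p b" if "a \<in> carrier G" "b \<in> carrier G" for a b using IH(3) that by (simp add: hom_def)
    \<comment> \<open>\<open>\<phi>0\<close> is defined on the kernel \<open>K\<close> only;
      composing it with the projection \<open>p\<close> extends it to the whole group and makes it
      vanish at the old \<open>x i\<close>.\<close>
    define \<phi>' where "\<phi>' i = (if i < d then \<phi> i else \<phi>0 \<circ> p)" for i
    define x' where "x' i = (if i < d then x i else x0)" for i
    define p' where "p' y = p y \<otimes> x0 [^] (- \<phi>0 (p y))" for y
    have Kx0: "x0 [^] (k::int) \<in> K" for k using subgroup_int_pow_closed[OF K 0(2)] .
    have p'K: "p' y \<in> K" if "y \<in> carrier G" for y
      unfolding p'_def using subgroup.m_closed[OF K pK[OF that] Kx0] .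
    have \<phi>0p': "\<phi>0 (p' y) = 0" if "y \<in> carrier G" for y
      unfolding p'_def using int_homD[OF 0(1) pK[OF that] Kx0] int_hom_int_pow[OF K 0(1,2)] 0(3) by simp
    have hom0: "int_hom G (carrier G) (\<phi>0 \<circ> p)"
      unfolding int_hom_def by (simp add: pm int_homD[OF 0(1)] pK)
    have "dual_system G (carrier G) (Suc d) \<phi>' x'"
      unfolding dual_system_def
    proof (intro conjI allI impI)
      fix i assume "i < Suc d"
      then show "int_hom G (carrier G) (\<phi>' i)" using h hom0 by (cases "i < d") (auto simp: \<phi>'_def)
      show "x' i \<in> carrier G" using xc x0 by (simp add: x'_def)
    next
      fix i j assume ij: "i < Suc d" "j < Suc d"
      have "\<phi>0 \<one> = 0" using int_hom_one[OF K 0(1)] .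
      then show "\<phi>' i (x' j) = (if i = j then 1 else 0)"
        using ij dual IH(6) dd pid[OF 0(2)] 0 by (auto simp: \<phi>'_def x'_def K_def less_Suc_eq)
    qed
    moreover have "p' \<in> hom G G"
    proof (rule homI)
      fix a assume "a \<in> carrier G" then show "p' a \<in> carrier G" using p'K by (simp add: K_def)
    next
      fix a b assume ab: "a \<in> carrier G" "b \<in> carrier G"
      have c: "p a \<in> carrier G" "p b \<in> carrier G" using pK ab by (auto simp: K_def)
      have "\<phi>0 (p a \<otimes> p b) = \<phi>0 (p a) + \<phi>0 (p b)" using int_homD[OF 0(1)] pK ab by simp
      then have "p' (a \<otimes> b) = (p a \<otimes> p b) \<otimes> (x0 [^] (- \<phi>0 (p a)) \<otimes> x0 [^] (- \<phi>0 (p b)))"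
        using ab x0 by (simp add: p'_def pm add.commute flip: int_pow_mult)
      then show "p' (a \<otimes> b) = p' a \<otimes> p' b" using c x0 by (simp add: p'_def m_ac)
    qed
    moreover have "\<forall>y\<in>carrier G. \<forall>i<Suc d. \<phi>' i (p' y) = 0"
      using p'K \<phi>0p' pid by (auto simp: \<phi>'_def K_def dd less_Suc_eq)
    moreover have "\<forall>y\<in>carrier G. (\<forall>i<Suc d. \<phi>' i y = 0) \<longrightarrow> p' y = y"
    proof (intro ballI impI)
      fix y assume y: "y \<in> carrier G" "\<forall>i<Suc d. \<phi>' i y = 0"
      have "\<phi> i y = 0" if "i < d" for i using y(2)[rule_format, of i] that by (simp add: \<phi>'_def)
      then have py: "p y = y" using IH(5)[OF y(1)] dd by simp
      have "\<phi>0 (p y) = 0" using y(2)[rule_format, of d] by (simp add: \<phi>'_def)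
      then show "p' y = y" using py y(1) by (simp add: p'_def)
    qed
    moreover have "\<forall>i<Suc d. p' (x' i) = \<one>"
    proof (intro allI impI)
      fix i assume "i < Suc d"
      show "p' (x' i) = \<one>"
      proof (cases "i < d")
        case True
        then show ?thesis using IH(6) dd int_hom_one[OF K 0(1)] by (simp add: p'_def x'_def)
      next
        case False
        then show ?thesis using pid[OF 0(2)] 0(3) x0 by (simp add: p'_def x'_def int_pow_neg)
      qed
    qed
    ultimately have "split_system (Suc d) \<phi>' x' p'" unfolding split_system_def by blast
    then show ?thesis by blast
  qed
qed

lemma dual_system_exists:
  assumes "noetherian_in G (carrier G)"
  obtains d' \<phi> x where "d' \<le> d" "dual_system G (carrier G) d' \<phi> x"
    "d' = d \<or> finite {y \<in> carrier G. \<forall>i<d'. \<phi> i y = 0}"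
proof -
  obtain d' \<phi> x p where "d' \<le> d" "split_system d' \<phi> x p" "d' = d \<or> finite {y \<in> carrier G. \<forall>i<d'. \<phi> i y = 0}"
    using split_system_exists[OF assms, of d] by blast
  then show thesis by (intro that[of d' \<phi> x]) (auto simp: split_system_def)
qed

text \<open>Representatives modulo squares are the products of the generators with exponents
  \<open>0\<close> or \<open>1\<close>.\<close>

lemma squares_finite_index:
  assumes "finite B" "B \<subseteq> carrier G"
  shows "\<exists>R. finite R \<and> R \<subseteq> generate G B \<and> (\<forall>x\<in>generate G B. \<exists>\<rho>\<in>R. \<exists>y\<in>generate G B. x = \<rho> \<otimes> (y \<otimes> y))"
  using assms
proof (induction B)
  case empty
  then show ?case by (intro exI[of _ "{\<one>}"]) (simp add: generate_empty)
next
  case (insert g B)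
  have g: "g \<in> carrier G" and B: "B \<subseteq> carrier G" using insert by auto
  obtain R where R: "finite R" "R \<subseteq> generate G B" "\<And>x. x \<in> generate G B ==> \<exists>\<rho>\<in>R. \<exists>y\<in>generate G B. x = \<rho> \<otimes> (y \<otimes> y)"
    using insert B by auto
  have sB: "subgroup (generate G B) G" using generate_is_subgroup[OF B] .
  have eq: "generate G (insert g B) = {b \<otimes> g [^] (k::int) | b k. b \<in> generate G B}" using generate_insert_eq[OF B g] .
  let ?R = "(\<lambda>(\<rho>,k::int). \<rho> \<otimes> g [^] k) ` (R \<times> {0,1})"
  show ?case
  proof (intro exI[of _ ?R] conjI ballI)
    show "finite ?R" using R(1) by simp
    show "?R \<subseteq> generate G (insert g B)" using R(2) eq by auto
    fix x assume "x \<in> generate G (insert g B)"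
    then obtain b k where x: "x = b \<otimes> g [^] (k::int)" "b \<in> generate G B" using eq by auto
    obtain \<rho> y where y: "\<rho> \<in> R" "y \<in> generate G B" "b = \<rho> \<otimes> (y \<otimes> y)" using R(3)[OF x(2)] by auto
    have c: "\<rho> \<in> carrier G" "y \<in> carrier G" using y R(2) subgroup.mem_carrier[OF sB] by auto
    have k: "k = k mod 2 + (k div 2 + k div 2)" by presburger
    have "g [^] k = g [^] (k mod 2) \<otimes> (g [^] (k div 2) \<otimes> g [^] (k div 2))"
      using g by (subst k) (simp only: int_pow_mult)
    then have "x = (\<rho> \<otimes> g [^] (k mod 2)) \<otimes> ((y \<otimes> g [^] (k div 2)) \<otimes> (y \<otimes> g [^] (k div 2)))"
      using x y c g by (simp add: m_ac)
    moreover have "\<rho> \<otimes> g [^] (k mod 2) \<in> ?R" using y(1) by (auto intro!: image_eqI[of _ _ "(\<rho>, k mod 2)"])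
    moreover have "y \<otimes> g [^] (k div 2) \<in> generate G (insert g B)" using y(2) eq by blast
    ultimately show "\<exists>\<rho>\<in>?R. \<exists>y\<in>generate G (insert g B). x = \<rho> \<otimes> (y \<otimes> y)" by blast
  qed
qed

end

lemma (in group) noetherian_in_subgroup:
  assumes "noetherian_in G (carrier G)" "subgroup S G"
  shows "noetherian_in (G\<lparr>carrier := S\<rparr>) (carrier (G\<lparr>carrier := S\<rparr>))"
  unfolding noetherian_in_def
proof (intro allI impI)
  fix K assume K: "subgroup K (G\<lparr>carrier := S\<rparr>) \<and> K \<subseteq> carrier (G\<lparr>carrier := S\<rparr>)"
  then have "subgroup K G" using incl_subgroup[OF assms(2)] by blast
  then obtain B where B: "finite B" "B \<subseteq> K" "K = generate G B"
    using assms(1) subgroup.subset unfolding noetherian_in_def by metis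
  moreover have "B \<subseteq> S" using B K by auto
  ultimately show "\<exists>B. finite B \<and> B \<subseteq> K \<and> K = generate (G\<lparr>carrier := S\<rparr>) B"
    using generate_consistent[OF _ assms(2)] by metis
qed

lemma (in group_hom) noetherian_in_image:
  assumes "noetherian_in G (carrier G)" "h ` carrier G = carrier H"
  shows "noetherian_in H (carrier H)"
  unfolding noetherian_in_def
proof (intro allI impI)
  fix L assume L: "subgroup L H \<and> L \<subseteq> carrier H"
  interpret L: subgroup L H using L by simp
  have "subgroup {x \<in> carrier G. h x \<in> L} G"
    by (rule G.subgroupI) (auto intro!: exI[of _ "\<one>"])
  then obtain B where B: "finite B" "B \<subseteq> {x \<in> carrier G. h x \<in> L}" "{x \<in> carrier G. h x \<in> L} = generate G B"
    using assms(1) unfolding noetherian_in_def by (metis (no_types, lifting) mem_Collect_eq subsetI)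
  have "h ` {x \<in> carrier G. h x \<in> L} = L" using assms(2) L.subset by (auto simp: image_iff)
  then have "L = generate H (h ` B)" using generate_img[of B] B by auto
  then show "\<exists>B. finite B \<and> B \<subseteq> L \<and> L = generate H B" using B by (intro exI[of _ "h ` B"]) auto
qed

text \<open>If the process stops before \<open>d\<close>, the joint kernel in the abelianization is
  finite and its order serves as \<open>e\<close>. The result is phrased with the derived subgroup,
  so later arguments need not mention the quotient.\<close>

lemma (in group) abelianization_dual_system:
  assumes "noetherian_in G (carrier G)"
  obtains d' \<phi> x where "d' \<le> d" "dual_system G (carrier G) d' \<phi> x"
    "d' = d \<or> (\<exists>e>0. \<forall>h\<in>carrier G. (\<forall>i<d'. \<phi> i h = 0) \<longrightarrow> h [^] (e::nat) \<in> derived G (carrier G))"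
proof -
  let ?D = "derived G (carrier G)"
  let ?K = "G Mod ?D"
  have Dn: "?D \<lhd> G" using derived_self_is_normal .
  interpret K: comm_group ?K by (rule derived_quot_is_comm_group)
  let ?q = "\<lambda>h. ?D #> h"
  have q: "?q \<in> hom G ?K" using normal.r_coset_hom_Mod[OF Dn] .
  interpret q: group_hom G ?K ?q using q by unfold_locales
  have qim: "?q ` carrier G = carrier ?K" by (simp add: carrier_FactGroup)
  have "noetherian_in ?K (carrier ?K)" using q.noetherian_in_image[OF assms qim] .
  then obtain d' \<phi> x where 1: "d' \<le> d" "dual_system ?K (carrier ?K) d' \<phi> x"
      "d' = d \<or> finite {y \<in> carrier ?K. \<forall>i<d'. \<phi> i y = 0}"
    by (rule K.dual_system_exists)
  have h: "\<And>i. i < d' ==> int_hom ?K (carrier ?K) (\<phi> i)" and xc: "\<And>i. i < d' ==> x i \<in> carrier ?K"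
    and dual: "\<And>i j. i < d' ==> j < d' ==> \<phi> i (x j) = (if i = j then 1 else 0)"
    using 1(2) by (auto simp: dual_system_def)
  have "\<exists>z. z \<in> carrier G \<and> ?q z = x i" if "i < d'" for i
  proof -
    have "x i \<in> ?q ` carrier G" unfolding qim using xc[OF that] .
    then show ?thesis unfolding image_iff by metis
  qed
  then obtain z where z: "\<And>i. i < d' ==> z i \<in> carrier G" "\<And>i. i < d' ==> ?q (z i) = x i"
    by metis
  have "dual_system G (carrier G) d' (\<lambda>i. \<phi> i \<circ> ?q) z"
    unfolding dual_system_def
  proof (intro conjI allI impI)
    fix i assume i: "i < d'"
    show "int_hom G (carrier G) (\<phi> i \<circ> ?q)"
      unfolding int_hom_def using K.int_homD[OF h[OF i] q.hom_closed q.hom_closed] q.hom_mult by (simp del: mult_FactGroup)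
    show "z i \<in> carrier G" using z i by simp
  next
    fix i j assume "i < d'" "j < d'"
    then show "(\<phi> i \<circ> ?q) (z j) = (if i = j then 1 else 0)" using z dual by simp
  qed
  moreover have "\<exists>e>0. \<forall>h\<in>carrier G. (\<forall>i<d'. (\<phi> i \<circ> ?q) h = 0) \<longrightarrow> h [^] (e::nat) \<in> ?D" if "d' \<noteq> d"
  proof -
    define T where "T = {y \<in> carrier ?K. \<forall>i<d'. \<phi> i y = 0}"
    have Tf: "finite T" using 1(3) that by (simp add: T_def)
    have T: "subgroup T ?K" unfolding T_def by (rule K.subgroup_int_hom_kernel[OF K.subgroup_self h])
    interpret T: group "?K\<lparr>carrier := T\<rparr>" using subgroup.subgroup_is_group[OF T K.is_group] .
    have T0: "card T > 0" using Tf subgroup.one_closed[OF T] card_gt_0_iff by blast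
    have "h [^] card T \<in> ?D" if h: "h \<in> carrier G" "\<forall>i<d'. (\<phi> i \<circ> ?q) h = 0" for h
    proof -
      have "?q h \<in> T" using h q.hom_closed by (simp add: T_def)
      then have "?q h [^]\<^bsub>?K\<^esub> card T = \<one>\<^bsub>?K\<^esub>"
        using T.pow_order_eq_1[of "?q h"] by (simp add: order_def nat_pow_def)
      then have "?q (h [^] card T) = ?D" using q.hom_nat_pow[OF h(1), of "card T"] by simp
      then show ?thesis using rcos_self[OF nat_pow_closed[OF h(1)] normal_imp_subgroup[OF Dn]] by auto
    qed
    then show ?thesis using T0 by blast
  qed
  ultimately show ?thesis using that[OF 1(1)] by blast
qed

section \<open>Finite quotients of \<open>\<int>\<^sup>2 \<rtimes>\<^sub>A \<int>\<close>\<close>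

abbreviation (input) semidirect ("\<G>") where "\<G> \<equiv> semidirect_Z2_Z"

definition mpow :: "int^2^2 => int => int^2^2" where
  "mpow A k = A [^]\<^bsub>GL2Z\<^esub> k"

lemma mpow_add: "invertible A ==> mpow A (k + l) = mpow A k ** mpow A l"
  using group.int_pow_mult[OF group_GL2Z, of A k l] by (simp add: mpow_def GL2Z_def)

lemma mpow_0 [simp]: "mpow A 0 = mat 1"
  using monoid.nat_pow_0[OF group.is_monoid[OF group_GL2Z], of A] by (simp add: mpow_def int_pow_def2) (simp add: GL2Z_def)

lemma mpow_1: "invertible A ==> mpow A 1 = A"
  using group.int_pow_1[OF group_GL2Z, of A] by (simp add: mpow_def GL2Z_def)

lemma mpow_vec_add: "invertible A ==> mpow A (k + l) *v v = mpow A k *v (mpow A l *v v)"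
  by (simp add: mpow_add matrix_vector_mul_assoc)

lemma mpow_cancel [simp]: "invertible A ==> mpow A k *v (mpow A (-k) *v v) = v"
  "invertible A ==> mpow A (-k) *v (mpow A k *v v) = v"
  by (simp_all flip: mpow_vec_add)

lemma invertible_mpow: "invertible A ==> invertible (mpow A k)"
  unfolding invertible_def[of "mpow A k"]
  by (intro exI[of _ "mpow A (-k)"]) (simp flip: mpow_add)

text \<open>\<open>P\<close> need not be invertible: later it is so only modulo some number.
  Negative powers therefore come from the intertwining relation for the inverses of \<open>A\<close>
  and \<open>B\<close>.\<close>

lemma mpow_intertwine:
  assumes "invertible A" "invertible B" "P ** A = B ** P"
  shows "P ** mpow A k = mpow B k ** P"
proof -
  have inv: "P ** mpow A (-1) = mpow B (-1) ** P"
  proof -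
    have "mpow B (-1) ** B = mat 1" using mpow_add[OF assms(2), of "-1" 1] mpow_1[OF assms(2)] by simp
    then have "P ** mpow A (-1) = mpow B (-1) ** B ** P ** mpow A (-1)" by simp
    also have "\<dots> = mpow B (-1) ** (P ** (A ** mpow A (-1)))"
      by (simp only: matrix_mul_assoc assms(3))
    also have "A ** mpow A (-1) = mat 1"
      using mpow_add[OF assms(1), of 1 "-1"] mpow_1[OF assms(1)] by simp
    finally show ?thesis by simp
  qed
  show ?thesis
  proof (induction k rule: int_induct[where k = 0])
    case base show ?case by simp
  next
    case (step1 i)
    have "P ** mpow A (i + 1) = P ** mpow A i ** A" using mpow_add[OF assms(1), of i 1] mpow_1[OF assms(1)] by (simp add: matrix_mul_assoc)
    also have "\<dots> = mpow B i ** (P ** A)" using step1 by (simp add: matrix_mul_assoc)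
    also have "\<dots> = mpow B i ** B ** P" unfolding assms(3) by (simp add: matrix_mul_assoc)
    finally show ?case using mpow_add[OF assms(2), of i 1] mpow_1[OF assms(2)] by simp
  next
    case (step2 i)
    have "P ** mpow A (i - 1) = P ** mpow A i ** mpow A (-1)" using mpow_add[OF assms(1), of i "-1"] by (simp add: matrix_mul_assoc)
    also have "\<dots> = mpow B i ** (P ** mpow A (-1))" using step2 by (simp add: matrix_mul_assoc)
    also have "\<dots> = mpow B i ** mpow B (-1) ** P" unfolding inv by (simp add: matrix_mul_assoc)
    finally show ?case using mpow_add[OF assms(2), of i "-1"] by simp
  qed
qed

definition vdvd :: "int => int^2 => bool" where
  "vdvd r v \<longleftrightarrow> r dvd v $ 1 \<and> r dvd v $ 2"

lemma vdvd_0 [simp]: "vdvd r 0" by (simp add: vdvd_def)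
lemma vdvd_add: "vdvd r v ==> vdvd r w ==> vdvd r (v + w)" by (simp add: vdvd_def)
lemma vdvd_diff: "vdvd r v ==> vdvd r w ==> vdvd r (v - w)" by (simp add: vdvd_def)
lemma vdvd_minus [simp]: "vdvd r (- v) \<longleftrightarrow> vdvd r v" by (simp add: vdvd_def)
lemma vdvd_minus_commute: "vdvd r (v - w) ==> vdvd r (w - v)" by (simp add: vdvd_def dvd_diff_commute)
lemma vdvd_matvec: "vdvd r v ==> vdvd r (B *v v)" by (simp add: vdvd_def mat2_vec_nth)
lemma vdvd_smult: "vdvd r v ==> vdvd r (j *s v)" by (simp add: vdvd_def)
lemma vdvd_trans: "r dvd r' ==> vdvd r' v ==> vdvd r v" by (auto simp: vdvd_def intro: dvd_trans)
lemma vdvd_cancel: "j \<noteq> 0 ==> vdvd (r * j) (j *s v) ==> vdvd r v" by (simp add: vdvd_def mult.commute)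

lemma vdvd_all_0: "(\<And>r. r > 0 ==> vdvd r v) ==> v = 0"
proof -
  assume a: "\<And>r. r > 0 ==> vdvd r v"
  have z: "x = 0" if "\<bar>x\<bar> + 1 dvd x" for x :: int
  proof (rule ccontr)
    assume "x \<noteq> 0"
    then have "\<bar>\<bar>x\<bar> + 1\<bar> \<le> \<bar>x\<bar>" using that by (rule dvd_imp_le_int)
    then show False by simp
  qed
  have "v $ 1 = 0" using a[of "\<bar>v $ 1\<bar> + 1"] by (intro z) (simp add: vdvd_def)
  moreover have "v $ 2 = 0" using a[of "\<bar>v $ 2\<bar> + 1"] by (intro z) (simp add: vdvd_def)
  ultimately show "v = 0" by (simp add: vec2_eq_iff)
qed

lemma matvec_diff: "(B::int^2^2) *v (v - w) = B *v v - B *v w"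
  by (simp add: vec2_eq_iff mat2_vec_nth algebra_simps)

lemma matvec_add: "(B::int^2^2) *v (v + w) = B *v v + B *v w"
  by (simp add: vec2_eq_iff mat2_vec_nth algebra_simps)

lemma matvec_minus: "(B::int^2^2) *v (- v) = - (B *v v)"
  by (simp add: vec2_eq_iff mat2_vec_nth algebra_simps)

text \<open>\<open>mpow A m\<close> acts trivially modulo \<open>r\<close>; this is what makes
  \<open>r\<int>\<^sup>2 \<times> m\<int>\<close> a normal subgroup, of finite index since both
  numbers are positive.\<close>

definition trivial_mod :: "int^2^2 => int => int => bool" where
  "trivial_mod A r m \<longleftrightarrow> r > 0 \<and> m > 0 \<and> (\<forall>v. vdvd r (mpow A m *v v - v))"

definition Mset :: "int => int => ((int^2) \<times> int) set" where
  "Mset r m = {(v, k). vdvd r v \<and> m dvd k}"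

context
  fixes A :: "int^2^2"
  assumes inv: "invertible A"
begin

interpretation G: group "\<G> A" by (rule group_semidirect_Z2_Z[OF inv])

lemma semidirect_simps:
  "carrier (\<G> A) = UNIV" "\<one>\<^bsub>\<G> A\<^esub> = (0, 0)"
  "(v, k) \<otimes>\<^bsub>\<G> A\<^esub> (w, l) = (v + mpow A k *v w, k + l)"
  by (simp_all add: semidirect_Z2_Z_def mpow_def)

lemma semidirect_inv: "inv\<^bsub>\<G> A\<^esub> (v, k) = (- (mpow A (-k) *v v), - k)"
  by (rule G.inv_equality) (simp_all add: semidirect_simps)

lemma semidirect_pow:
  assumes "mpow A k = mat 1"
  shows "(v, k) [^]\<^bsub>\<G> A\<^esub> (n::nat) = (int n *s v, int n * k)"
proof -
  have "mpow A (int n * k) = mat 1" for n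
    by (induction n) (simp_all add: distrib_right mpow_add[OF inv] assms)
  note Ak = this
  show ?thesis
  proof (induction n)
    case (Suc n)
    then show ?case by (simp add: semidirect_simps Ak) (simp add: vec2_eq_iff algebra_simps)
  qed (simp add: semidirect_simps vec2_eq_iff)
qed

lemma semidirect_pow2: "(0, k) [^]\<^bsub>\<G> A\<^esub> (n::nat) = (0, int n * k)"
  by (induction n) (simp_all add: semidirect_simps vec2_eq_iff algebra_simps)

lemma trivial_mod_dvd:
  assumes "trivial_mod A r m" "m dvd k"
  shows "vdvd r (mpow A k *v v - v)"
proof -
  have p: "vdvd r (mpow A (m * int n) *v v - v)" for n v
  proof (induction n)
    case (Suc n)
    have "mpow A (m * int (Suc n)) *v v - v = (mpow A m *v (mpow A (m * int n) *v v) - mpow A (m * int n) *v v) + (mpow A (m * int n) *v v - v)"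
      using mpow_vec_add[OF inv, of m "m * int n" v] by (simp add: distrib_left)
    then show ?case using Suc assms(1) vdvd_add unfolding trivial_mod_def by metis
  qed simp
  obtain j where j: "k = m * j" using assms(2) by blast
  show ?thesis
  proof (cases "j \<ge> 0")
    case True
    then show ?thesis using p[of "nat j" v] j by simp
  next
    case False
    then have "vdvd r (mpow A (-k) *v (mpow A k *v v) - mpow A k *v v)"
      using p[of "nat (-j)" "mpow A k *v v"] j by simp
    then show ?thesis using inv vdvd_minus_commute by simp
  qed
qed

lemma trivial_mod_mult: "trivial_mod A r m ==> j > 0 ==> trivial_mod A r (m * j)"
  using trivial_mod_dvd[of r m "m * j"] by (simp add: trivial_mod_def)

text \<open>Pigeonhole: two powers of \<open>A\<close> agree modulo \<open>r\<close>, and their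
  quotient acts trivially. Multiples of an admissible exponent are admissible, so a divisor
  \<open>m0\<close> can be prescribed.\<close>

lemma trivial_mod_exists:
  assumes "r > 0" "m0 > 0"
  obtains m where "trivial_mod A r m" "m0 dvd m"
proof -
  define f where "f n = (mpow A (int n) $ 1 $ 1 mod r, mpow A (int n) $ 1 $ 2 mod r, mpow A (int n) $ 2 $ 1 mod r, mpow A (int n) $ 2 $ 2 mod r)" for n
  have "range f \<subseteq> {0..<r} \<times> {0..<r} \<times> {0..<r} \<times> {0..<r}" using assms(1) by (auto simp: f_def)
  then have "finite (range f)" by (rule finite_subset) simp
  then have "\<not> inj f" using finite_imageD infinite_UNIV_nat by blast
  then obtain i j where ij: "f i = f j" "i < j" unfolding inj_def by (metis linorder_neqE_nat)
  have d: "r dvd mpow A (int j) $ p $ q - mpow A (int i) $ p $ q" if "p \<in> {1,2}" "q \<in> {1,2}" for p q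
  proof -
    have "mpow A (int j) $ p $ q mod r = mpow A (int i) $ p $ q mod r" using ij that by (auto simp: f_def)
    then show ?thesis by (simp add: mod_eq_dvd_iff)
  qed
  have v: "vdvd r (mpow A (int j - int i) *v v - v)" for v
  proof -
    let ?B = "mpow A (int j)" and ?C = "mpow A (int i)"
    have "(?B *v v - ?C *v v) $ p = (?B $ p $ 1 - ?C $ p $ 1) * v $ 1 + (?B $ p $ 2 - ?C $ p $ 2) * v $ 2" for p
      by (simp add: mat2_vec_nth algebra_simps)
    then have "vdvd r (?B *v v - ?C *v v)" using d unfolding vdvd_def by simp
    then have "vdvd r (mpow A (- int i) *v (?B *v v - ?C *v v))" by (rule vdvd_matvec)
    then show ?thesis using mpow_vec_add[OF inv, of "- int i" "int j" v] inv by (simp add: matvec_diff)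
  qed
  then have "trivial_mod A r (int j - int i)" using assms(1) ij(2) by (simp add: trivial_mod_def)
  then show ?thesis using that[OF trivial_mod_mult[OF _ assms(2)]] by simp
qed

lemma Mset_subgroup:
  assumes "trivial_mod A r m"
  shows "subgroup (Mset r m) (\<G> A)"
proof (rule G.subgroupI)
  show "Mset r m \<subseteq> carrier (\<G> A)" by (simp add: semidirect_simps)
  have "(0, 0) \<in> Mset r m" by (simp add: Mset_def)
  then show "Mset r m \<noteq> {}" by blast
next
  fix x assume "x \<in> Mset r m"
  then show "inv\<^bsub>\<G> A\<^esub> x \<in> Mset r m"
    by (cases x) (simp add: Mset_def semidirect_inv vdvd_matvec)
next
  fix x y assume "x \<in> Mset r m" "y \<in> Mset r m"
  then show "x \<otimes>\<^bsub>\<G> A\<^esub> y \<in> Mset r m"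
    by (cases x, cases y) (simp add: Mset_def semidirect_simps vdvd_matvec vdvd_add)
qed

text \<open>The exponent of an element of \<open>Mset r m\<close> acts trivially modulo
  \<open>r\<close>, so the twist by \<open>A\<close> disappears and cosets are given by
  componentwise congruences.\<close>

lemma Mset_coset:
  assumes "trivial_mod A r m"
  shows "Mset r m #>\<^bsub>\<G> A\<^esub> (v, k) = {(w, l). vdvd r (w - v) \<and> m dvd l - k}"
proof (intro subset_antisym subsetI)
  fix y assume "y \<in> Mset r m #>\<^bsub>\<G> A\<^esub> (v, k)"
  then obtain x l where "vdvd r x" "m dvd l" "y = (x + mpow A l *v v, l + k)"
    by (auto simp: r_coset_def Mset_def semidirect_simps)
  moreover from this have "vdvd r (x + (mpow A l *v v - v))" using trivial_mod_dvd[OF assms] vdvd_add by blast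
  ultimately show "y \<in> {(w, l). vdvd r (w - v) \<and> m dvd l - k}" by (simp add: add_diff_eq)
next
  fix y assume "y \<in> {(w, l). vdvd r (w - v) \<and> m dvd l - k}"
  then obtain w l where y: "y = (w, l)" "vdvd r (w - v)" "m dvd l - k" by blast
  have "vdvd r (w - v - (mpow A (l - k) *v v - v))" using trivial_mod_dvd[OF assms y(3)] y(2) vdvd_diff by blast
  then have "(w - mpow A (l - k) *v v, l - k) \<in> Mset r m" using y by (simp add: Mset_def)
  moreover have "y = (w - mpow A (l - k) *v v, l - k) \<otimes>\<^bsub>\<G> A\<^esub> (v, k)" using y by (simp add: semidirect_simps)
  ultimately show "y \<in> Mset r m #>\<^bsub>\<G> A\<^esub> (v, k)" unfolding r_coset_def by blast
qed

lemma Mset_fin_index_normal: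
  assumes "trivial_mod A r m"
  shows "Mset r m \<in> fin_index_normal (\<G> A)"
proof -
  note sub = Mset_subgroup[OF assms]
  have "Mset r m \<lhd> \<G> A"
    unfolding G.normal_inv_iff
  proof (intro conjI ballI sub)
    fix x h :: "(int^2) \<times> int" assume "h \<in> Mset r m"
    obtain v k w l where x: "x = (v, k)" "h = (w, l)" by (cases x, cases h)
    then have h: "vdvd r w" "m dvd l" using \<open>h \<in> Mset r m\<close> by (auto simp: Mset_def)
    have "mpow A (k + l) *v (mpow A (-k) *v v) = mpow A l *v v"
      using mpow_vec_add[OF inv, of l k "mpow A (-k) *v v"] inv by (simp add: add.commute)
    then have "x \<otimes>\<^bsub>\<G> A\<^esub> h \<otimes>\<^bsub>\<G> A\<^esub> inv\<^bsub>\<G> A\<^esub> x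
        = (v + mpow A k *v w - mpow A l *v v, l)"
      unfolding x by (simp add: semidirect_simps semidirect_inv matvec_minus)
    moreover have "vdvd r (mpow A k *v w - (mpow A l *v v - v))"
      using vdvd_matvec[OF h(1)] trivial_mod_dvd[OF assms h(2)] vdvd_diff by blast
    ultimately show "x \<otimes>\<^bsub>\<G> A\<^esub> h \<otimes>\<^bsub>\<G> A\<^esub> inv\<^bsub>\<G> A\<^esub> x \<in> Mset r m"
      using h by (simp add: Mset_def algebra_simps)
  qed
  moreover have "finite (rcosets\<^bsub>\<G> A\<^esub> (Mset r m))"
  proof (rule G.finite_rcosetsI[OF sub])
    let ?f = "\<lambda>(v::int^2, k). (v $ 1 mod r, v $ 2 mod r, k mod m)"
    have "?f ` carrier (\<G> A) \<subseteq> {0..<r} \<times> {0..<r} \<times> {0..<m}"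
      using assms by (auto simp: trivial_mod_def)
    then show "finite (?f ` carrier (\<G> A))" by (rule finite_subset) simp
    fix x y :: "(int^2) \<times> int" assume xy: "?f x = ?f y"
    obtain v k w l where e: "x = (v, k)" "y = (w, l)" by (cases x, cases y)
    have "vdvd r (v - w)" "m dvd k - l" using xy by (simp_all add: e vdvd_def mod_eq_dvd_iff)
    then have "x \<in> Mset r m #>\<^bsub>\<G> A\<^esub> y" unfolding e Mset_coset[OF assms] by simp
    then show "x \<otimes>\<^bsub>\<G> A\<^esub> inv\<^bsub>\<G> A\<^esub> y \<in> Mset r m"
      using subgroup.rcos_module_imp[OF sub G.is_group] by (simp add: semidirect_simps)
  qed
  ultimately show ?thesis by (simp add: fin_index_normal_def)
qed

text \<open>In the quotient, of order \<open>n\<close>, all \<open>n\<close>-th powers are trivial,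
  and \<open>(n v, 0)\<close> and \<open>(0, n l)\<close> are \<open>n\<close>-th powers.
  \<open>Mset n n\<close> need not be a subgroup; the inclusion is applied to
  \<open>Mset r m\<close> with \<open>n\<close> dividing \<open>r\<close> and
  \<open>m\<close>.\<close>

lemma fin_index_normal_contains:
  assumes "M \<in> fin_index_normal (\<G> A)" "n = int (card (rcosets\<^bsub>\<G> A\<^esub> M))"
  shows "n > 0" "Mset n n \<subseteq> M"
proof -
  have M: "M \<lhd> \<G> A" "finite (rcosets\<^bsub>\<G> A\<^esub> M)"
    using assms(1) by (auto simp: fin_index_normal_def)
  interpret M: normal M "\<G> A" by (rule M(1))
  interpret Q: group "\<G> A Mod M" by (rule M.factorgroup_is_group)
  have order: "Coset.order (\<G> A Mod M) = nat n" by (simp add: order_def FactGroup_def assms(2))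
  have "rcosets\<^bsub>\<G> A\<^esub> M \<noteq> {}" using M.subgroup_in_rcosets[OF G.is_group] by blast
  then show n: "n > 0" using M(2) assms(2) by (simp add: card_gt_0_iff)
  have pow: "x [^]\<^bsub>\<G> A\<^esub> nat n \<in> M" for x
  proof -
    have x: "x \<in> carrier (\<G> A)" by (simp add: semidirect_simps)
    then have "M #>\<^bsub>\<G> A\<^esub> x \<in> carrier (\<G> A Mod M)" by (simp add: carrier_FactGroup)
    then have "(M #>\<^bsub>\<G> A\<^esub> x) [^]\<^bsub>\<G> A Mod M\<^esub> nat n = M"
      using Q.pow_order_eq_1 by (simp add: order)
    then have "M #>\<^bsub>\<G> A\<^esub> (x [^]\<^bsub>\<G> A\<^esub> nat n) = M" using M.FactGroup_pow[OF x] by simp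
    then show ?thesis using G.rcos_self[OF _ M.is_subgroup, of "x [^]\<^bsub>\<G> A\<^esub> nat n"] by (simp add: semidirect_simps)
  qed
  show "Mset n n \<subseteq> M"
  proof
    fix y assume "y \<in> Mset n n"
    then obtain v k where y: "y = (v, k)" "vdvd n v" "n dvd k" by (auto simp: Mset_def)
    obtain a b l where "v $ 1 = n * a" "v $ 2 = n * b" and l: "k = n * l" using y(2,3) by (auto simp: vdvd_def elim!: dvdE)
    then have v: "v = n *s vector [a, b]" by (simp add: vec2_eq_iff)
    have "(v, 0) \<in> M"
      using pow[of "(vector [a, b], 0)"] n v unfolding semidirect_pow[OF mpow_0] by simp
    moreover have "(0, k) \<in> M" using pow[of "(0, l)"] n l unfolding semidirect_pow2 by simp
    ultimately have "(v, 0) \<otimes>\<^bsub>\<G> A\<^esub> (0, k) \<in> M" by (rule M.m_closed)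
    then show "y \<in> M" by (simp add: semidirect_simps y(1))
  qed
qed

end

text \<open>
  \<open>rep \<theta> r m h v k\<close> says that \<open>\<theta>\<close> sends \<open>h\<close> to the class of \<open>(v, k)\<close>
  in the quotient of \<open>\<int>\<^sup>2 \<rtimes>\<^sub>A \<int>\<close> by \<open>r\<int>\<^sup>2 \<times> m\<int>\<close>.
\<close>

definition rep :: "(((int^2) \<times> int) set => 'a => ((int^2) \<times> int) set) => int => int => 'a => int^2 => int => bool" where
  "rep \<theta> r m h v k \<longleftrightarrow> (v, k) \<in> \<theta> (Mset r m) h"

section \<open>Elements of a group in the genus as congruence classes of pairs\<close>

locale semidirect_family = group H for H (structure) +
  fixes A :: "int^2^2" and \<theta> :: "((int^2) \<times> int) set => 'a => ((int^2) \<times> int) set"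
  assumes inv_A: "invertible A"
    and family: "profinite_family H (\<G> A) \<theta>"
begin

abbreviation "R \<equiv> rep \<theta>"
abbreviation "GA \<equiv> \<G> A"

interpretation G: group GA by (rule group_semidirect_Z2_Z[OF inv_A])

lemma theta_coset:
  assumes "trivial_mod A r m" "h \<in> carrier H"
  shows "\<exists>v k. \<theta> (Mset r m) h = Mset r m #>\<^bsub>GA\<^esub> (v, k)"
proof -
  have "\<theta> (Mset r m) h \<in> carrier (GA Mod Mset r m)"
    using family Mset_fin_index_normal[OF inv_A assms(1)] assms(2) unfolding profinite_family_def hom_def by blast
  then show ?thesis by (auto simp: carrier_FactGroup)
qed

lemma rep_exists:
  assumes "trivial_mod A r m" "h \<in> carrier H"
  shows "\<exists>v k. R r m h v k"
proof -
  obtain v k where "\<theta> (Mset r m) h = Mset r m #>\<^bsub>GA\<^esub> (v, k)" using theta_coset[OF assms] by blast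
  then have "R r m h v k" by (simp add: rep_def Mset_coset[OF inv_A assms(1)])
  then show ?thesis by blast
qed

lemma rep_iff:
  assumes "trivial_mod A r m" "h \<in> carrier H" "R r m h v k"
  shows "R r m h w l \<longleftrightarrow> vdvd r (w - v) \<and> m dvd l - k"
proof -
  obtain v0 k0 where e: "\<theta> (Mset r m) h = {(w, l). vdvd r (w - v0) \<and> m dvd l - k0}"
    using theta_coset[OF assms(1,2)] Mset_coset[OF inv_A assms(1)] by auto
  have 0: "vdvd r (v - v0)" "m dvd k - k0" using assms(3) by (simp_all add: rep_def e)
  have "vdvd r (w - v0) \<longleftrightarrow> vdvd r (w - v)"
    using vdvd_add[OF _ 0(1), of "w - v"] vdvd_diff[OF _ 0(1), of "w - v0"] by auto
  moreover have "m dvd l - k0 \<longleftrightarrow> m dvd l - k"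
    using dvd_add[OF _ 0(2), of "l - k"] dvd_diff[OF _ 0(2), of "l - k0"] by auto
  ultimately show ?thesis by (simp add: rep_def e)
qed

lemma rep_mult:
  assumes "trivial_mod A r m" "h \<in> carrier H" "h' \<in> carrier H" "R r m h v k" "R r m h' w l"
  shows "R r m (h \<otimes> h') (v + mpow A k *v w) (k + l)"
proof -
  have "\<theta> (Mset r m) (h \<otimes> h') = \<theta> (Mset r m) h <#>\<^bsub>GA\<^esub> \<theta> (Mset r m) h'"
    using family Mset_fin_index_normal[OF inv_A assms(1)] assms(2,3) unfolding profinite_family_def hom_def by auto
  moreover have "(v, k) \<otimes>\<^bsub>GA\<^esub> (w, l) \<in> \<theta> (Mset r m) h <#>\<^bsub>GA\<^esub> \<theta> (Mset r m) h'"
    using assms(4,5) unfolding rep_def set_mult_def by blast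
  ultimately show ?thesis by (simp add: rep_def semidirect_simps[OF inv_A])
qed

lemma rep_mono:
  assumes "trivial_mod A r m" "trivial_mod A r' m'" "r dvd r'" "m dvd m'" "h \<in> carrier H" "R r' m' h v k"
  shows "R r m h v k"
proof -
  have "Mset r' m' \<subseteq> Mset r m" using assms(3,4) by (auto simp: Mset_def intro: vdvd_trans dvd_trans)
  then show ?thesis
    using family Mset_fin_index_normal[OF inv_A assms(1)] Mset_fin_index_normal[OF inv_A assms(2)] assms(5,6)
    unfolding profinite_family_def rep_def by blast
qed

lemma rep_surj:
  assumes "trivial_mod A r m"
  obtains h where "h \<in> carrier H" "R r m h v k"
proof -
  have "Mset r m #>\<^bsub>GA\<^esub> (v, k) \<in> carrier (GA Mod Mset r m)" by (simp add: carrier_FactGroup semidirect_simps[OF inv_A])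
  then have "Mset r m #>\<^bsub>GA\<^esub> (v, k) \<in> \<theta> (Mset r m) ` carrier H"
    using family Mset_fin_index_normal[OF inv_A assms(1)] unfolding profinite_family_def by blast
  then obtain h where "h \<in> carrier H" "\<theta> (Mset r m) h = Mset r m #>\<^bsub>GA\<^esub> (v, k)" by auto
  then show ?thesis using that by (simp add: rep_def Mset_coset[OF inv_A assms])
qed

text \<open>\<open>n\<close> is the index of a subgroup of \<open>GA\<close> at which
  \<open>\<theta>\<close> detects \<open>L\<close>; all admissible quotients whose two moduli are
  divisible by \<open>n\<close> are finer.\<close>

lemma rep_cofinal:
  assumes "L \<in> fin_index_normal H"
  obtains n where "n > 0"
    "\<And>r m h. trivial_mod A r m ==> n dvd r ==> n dvd m ==> h \<in> carrier H ==> R r m h 0 0 ==> h \<in> L"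
proof -
  obtain M where M: "M \<in> fin_index_normal GA" "\<forall>h\<in>carrier H. \<theta> M h = M \<longrightarrow> h \<in> L"
  proof -
    have "\<forall>L\<in>fin_index_normal H. \<exists>M\<in>fin_index_normal GA. \<forall>h\<in>carrier H. \<theta> M h = M \<longrightarrow> h \<in> L"
      using family unfolding profinite_family_def by (elim conjE)
    then show thesis using assms that by blast
  qed
  define n where "n = int (card (rcosets\<^bsub>GA\<^esub> M))"
  note n = fin_index_normal_contains[OF inv_A M(1) n_def]
  show ?thesis
  proof (rule that[OF n(1)])
    fix r m h assume h: "trivial_mod A r m" "n dvd r" "n dvd m" "h \<in> carrier H" "R r m h 0 0"
    have "Mset r m \<subseteq> M" using n(2) h(2,3) by (auto simp: Mset_def intro: vdvd_trans dvd_trans)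
    then have "\<theta> (Mset r m) h \<subseteq> \<theta> M h"
      using family Mset_fin_index_normal[OF inv_A h(1)] M(1) h(4) unfolding profinite_family_def by blast
    then have 0: "(0, 0) \<in> \<theta> M h" using h(5) by (auto simp: rep_def)
    have c: "\<theta> M h \<in> carrier (GA Mod M)"
      using family M(1) h(4) unfolding profinite_family_def hom_def by blast
    have Mn: "M \<lhd> GA" using M(1) by (rule fin_index_normal_normal)
    have "\<theta> M h = M #>\<^bsub>GA\<^esub> \<one>\<^bsub>GA\<^esub>"
      using G.carrier_Mod_rep(2)[OF Mn c 0] by (simp add: semidirect_simps[OF inv_A])
    then have "\<theta> M h = M" using G.coset_mult_one subgroup.subset[OF normal_imp_subgroup[OF Mn]] by simp
    then show "h \<in> L" using M(2) h(4) by blast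
  qed
qed

lemma rep_one:
  assumes "trivial_mod A r m"
  shows "R r m \<one> 0 0"
proof -
  obtain v k where v: "R r m \<one> v k" using rep_exists[OF assms one_closed] by blast
  then have "R r m \<one> (v + mpow A k *v v) (k + k)" using rep_mult[OF assms one_closed one_closed v v] by simp
  then have "vdvd r (mpow A k *v v)" "m dvd k" using rep_iff[OF assms one_closed v] by simp_all
  then have "vdvd r (mpow A (-k) *v (mpow A k *v v))" "m dvd k" using vdvd_matvec by blast+
  then show ?thesis using rep_iff[OF assms one_closed v] inv_A by simp
qed

lemma rep_inv:
  assumes "trivial_mod A r m" "h \<in> carrier H" "R r m h v k"
  shows "R r m (inv h) (- (mpow A (-k) *v v)) (- k)"
proof -
  obtain w l where w: "R r m (inv h) w l" using rep_exists[OF assms(1) inv_closed[OF assms(2)]] by blast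
  then have "R r m \<one> (w + mpow A l *v v) (l + k)"
    using rep_mult[OF assms(1) inv_closed[OF assms(2)] assms(2) w assms(3)] assms(2) by simp
  then have a: "vdvd r (w + mpow A l *v v)" "m dvd l + k" using rep_iff[OF assms(1) one_closed rep_one[OF assms(1)]] by simp_all
  have "vdvd r (mpow A (l + k) *v (mpow A (-k) *v v) - mpow A (-k) *v v)" by (rule trivial_mod_dvd[OF inv_A assms(1) a(2)])
  moreover have "mpow A (l + k) *v (mpow A (-k) *v v) = mpow A l *v v" using inv_A by (simp add: mpow_vec_add)
  ultimately have "vdvd r (mpow A l *v v - mpow A (-k) *v v)" by simp
  then have "vdvd r ((w + mpow A l *v v) - (mpow A l *v v - mpow A (-k) *v v))" using a(1) vdvd_diff by blast
  then have "vdvd r (- (mpow A (-k) *v v) - w)" by (simp add: vdvd_def dvd_diff_commute algebra_simps)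
  moreover have "m dvd - k - l" using a(2) by (metis dvd_minus_iff minus_add_distrib add.commute diff_conv_add_uminus)
  ultimately show ?thesis using rep_iff[OF assms(1) inv_closed[OF assms(2)] w] by simp
qed

lemma rep_pow:
  assumes "trivial_mod A r m" "h \<in> carrier H" "R r m h v k" "mpow A k = mat 1"
  shows "R r m (h [^] (j::int)) (j *s v) (j * k)"
proof -
  have Ak: "mpow A (j * k) = mat 1" for j :: int
  proof (induction j rule: int_induct[where k = 0])
    case (step2 i)
    have "mpow A (i * k) = mpow A ((i - 1) * k) ** mpow A k" by (simp add: left_diff_distrib flip: mpow_add[OF inv_A])
    then show ?case using step2 assms(4) by simp
  qed (simp_all add: distrib_right mpow_add[OF inv_A] assms(4))
  have nat: "R r m (h [^] n) (int n *s v) (int n * k)" for n :: nat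
  proof (induction n)
    case 0 show ?case using rep_one[OF assms(1)] by simp
  next
    case (Suc n)
    have "R r m (h [^] n \<otimes> h) (int n *s v + mpow A (int n * k) *v v) (int n * k + k)"
      using rep_mult[OF assms(1) _ assms(2) Suc assms(3)] assms(2) by simp
    moreover have "int n *s v + mpow A (int n * k) *v v = int (Suc n) *s v"
      unfolding Ak by (simp add: vec2_eq_iff algebra_simps)
    ultimately show ?case by (simp add: algebra_simps)
  qed
  show ?thesis
  proof (cases "j \<ge> 0")
    case True
    then show ?thesis using nat[of "nat j"] by (simp add: pow_nat)
  next
    case False
    then have h: "h [^] j = inv (h [^] nat (-j))" unfolding int_pow_def2 by simp
    have "R r m (inv (h [^] nat (-j))) (- (mpow A (- (int (nat (-j)) * k)) *v (int (nat (-j)) *s v))) (- (int (nat (-j)) * k))"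
      by (rule rep_inv[OF assms(1) _ nat]) (use assms(2) in simp)
    moreover have "mpow A (- (int (nat (-j)) * k)) = mat 1" using Ak[of j] False by simp
    moreover have "- (int (nat (-j)) *s v) = j *s v" using False by (simp add: vec2_eq_iff)
    ultimately show ?thesis using False by (simp add: h)
  qed
qed

text \<open>The point at which residual finiteness is used: an identity in \<open>H\<close> may be
  verified in all representations by pairs.\<close>

lemma rep_faithful:
  assumes "residually_finite_in H (carrier H)" "h \<in> carrier H" "\<And>r m. trivial_mod A r m ==> R r m h 0 0"
  shows "h = \<one>"
proof (rule ccontr)
  assume "h \<noteq> \<one>"
  then obtain L where L: "L \<in> fin_index_normal H" "h \<notin> L" using residually_finite_normal[OF assms(1,2)] by blast
  obtain n where n: "n > 0"
    "\<And>r m h. trivial_mod A r m ==> n dvd r ==> n dvd m ==> h \<in> carrier H ==> R r m h 0 0 ==> h \<in> L"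
    using rep_cofinal[OF L(1)] by blast
  obtain m where "trivial_mod A n m" "n dvd m" using trivial_mod_exists[OF inv_A n(1) n(1)] by blast
  then show False using n(2)[of n m h] assms L(2) by simp
qed

end

section \<open>Ideal classes of quadratic orders\<close>

definition submodule_of :: "complex set => complex set => bool" where
  "submodule_of R M \<longleftrightarrow> 0 \<in> M \<and> (\<forall>x\<in>M. \<forall>y\<in>M. x + y \<in> M) \<and> (\<forall>r\<in>R. \<forall>x\<in>M. r * x \<in> M)"

definition subring_with_1 :: "complex set => bool" where
  "subring_with_1 R \<longleftrightarrow> 1 \<in> R \<and> submodule_of R R"

lemma submodule_sum:
  assumes "submodule_of R M" "finite F" "F \<subseteq> M" "c ` F \<subseteq> R"
  shows "(\<Sum>s\<in>F. c s * s) \<in> M"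
  using assms(2,3,4)
proof (induction F)
  case empty then show ?case using assms(1) by (simp add: submodule_of_def)
next
  case (insert s F)
  then show ?case using assms(1) by (auto simp: submodule_of_def)
qed

lemma module_span_minimal: "submodule_of R M ==> S \<subseteq> M ==> module_span R S \<subseteq> M"
  using submodule_sum by (fastforce simp: module_span_def)

lemma module_span_superset:
  assumes "1 \<in> R" shows "S \<subseteq> module_span R S"
proof
  fix x assume "x \<in> S"
  then show "x \<in> module_span R S"
    unfolding module_span_def using assms
    by (intro CollectI exI[of _ "{x}"] exI[of _ "\<lambda>_. 1"]) auto
qed

lemma module_span_submodule:
  assumes "subring_with_1 R"
  shows "submodule_of R (module_span R S)"
proof -
  have R: "0 \<in> R" "\<And>x y. x \<in> R ==> y \<in> R ==> x + y \<in> R" "\<And>x y. x \<in> R ==> y \<in> R ==> x * y \<in> R"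
    using assms by (auto simp: subring_with_1_def submodule_of_def)
  have "0 \<in> module_span R S"
    unfolding module_span_def by (intro CollectI exI[of _ "{}"] exI[of _ "\<lambda>_. 0"]) auto
  moreover have "x + y \<in> module_span R S" if xy: "x \<in> module_span R S" "y \<in> module_span R S" for x y
  proof -
    obtain F c F' c' where F: "x = (\<Sum>s\<in>F. c s * s)" "finite F" "F \<subseteq> S" "c ` F \<subseteq> R"
      "y = (\<Sum>s\<in>F'. c' s * s)" "finite F'" "F' \<subseteq> S" "c' ` F' \<subseteq> R"
      using xy unfolding module_span_def by blast
    let ?c = "\<lambda>s. (if s \<in> F then c s else 0) + (if s \<in> F' then c' s else 0)"
    have "x = (\<Sum>s\<in>F \<union> F'. (if s \<in> F then c s else 0) * s)"
      unfolding F(1) by (rule sum.mono_neutral_cong_left) (use F in auto)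
    moreover have "y = (\<Sum>s\<in>F \<union> F'. (if s \<in> F' then c' s else 0) * s)"
      unfolding F(5) by (rule sum.mono_neutral_cong_left) (use F in auto)
    ultimately have "x + y = (\<Sum>s\<in>F \<union> F'. ?c s * s)"
      by (simp add: sum.distrib distrib_right)
    moreover have "?c ` (F \<union> F') \<subseteq> R" using F R by (auto simp: image_subset_iff)
    ultimately show ?thesis unfolding module_span_def using F
      by (intro CollectI exI[of _ "F \<union> F'"] exI[of _ ?c]) auto
  qed
  moreover have "r * x \<in> module_span R S" if r: "r \<in> R" and x: "x \<in> module_span R S" for r x
  proof -
    obtain F c where F: "x = (\<Sum>s\<in>F. c s * s)" "finite F" "F \<subseteq> S" "c ` F \<subseteq> R"
      using x unfolding module_span_def by blast
    then show ?thesis unfolding module_span_def using r R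
      by (intro CollectI exI[of _ F] exI[of _ "\<lambda>s. r * c s"]) (auto simp: sum_distrib_left mult_ac)
  qed
  ultimately show ?thesis by (simp add: submodule_of_def)
qed

lemma module_span_of_submodule:
  "subring_with_1 R ==> submodule_of R M ==> module_span R M = M"
  using module_span_minimal[of R M M] module_span_superset[of R M] by (auto simp: subring_with_1_def)

lemma submodule_scale:
  assumes "submodule_of R M" shows "submodule_of R ((*) \<alpha> ` M)"
  unfolding submodule_of_def
proof (intro conjI ballI)
  have M: "0 \<in> M" "\<And>x y. x \<in> M ==> y \<in> M ==> x + y \<in> M" "\<And>r x. r \<in> R ==> x \<in> M ==> r * x \<in> M"
    using assms by (auto simp: submodule_of_def)
  show "0 \<in> (*) \<alpha> ` M" using M(1) by (intro image_eqI[of _ _ 0]) simp_all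
  fix x assume "x \<in> (*) \<alpha> ` M"
  then obtain x' where x: "x = \<alpha> * x'" "x' \<in> M" by blast
  show "x + y \<in> (*) \<alpha> ` M" if y: "y \<in> (*) \<alpha> ` M" for y
  proof -
    obtain y' where "y = \<alpha> * y'" "y' \<in> M" using y by blast
    then show ?thesis using x M(2) by (intro image_eqI[of _ _ "x' + y'"]) (simp_all add: distrib_left)
  qed
  show "r * x \<in> (*) \<alpha> ` M" if "r \<in> R" for r
    using x M(3)[OF that] by (intro image_eqI[of _ _ "r * x'"]) simp_all
qed

lemma ideal_mult_principal:
  assumes "subring_with_1 R" "submodule_of R M"
  shows "ideal_mult R ((*) \<alpha> ` R) M = (*) \<alpha> ` M"
proof -
  have "{x * y | x y. x \<in> (*) \<alpha> ` R \<and> y \<in> M} = (*) \<alpha> ` M"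
  proof
    show "{x * y | x y. x \<in> (*) \<alpha> ` R \<and> y \<in> M} \<subseteq> (*) \<alpha> ` M"
    proof
      fix z assume "z \<in> {x * y | x y. x \<in> (*) \<alpha> ` R \<and> y \<in> M}"
      then obtain r y where z: "z = (\<alpha> * r) * y" "r \<in> R" "y \<in> M" by blast
      then have "r * y \<in> M" using assms(2) by (simp add: submodule_of_def)
      then show "z \<in> (*) \<alpha> ` M" using z by (auto simp: mult.assoc)
    qed
    show "(*) \<alpha> ` M \<subseteq> {x * y | x y. x \<in> (*) \<alpha> ` R \<and> y \<in> M}"
    proof
      fix z assume "z \<in> (*) \<alpha> ` M"
      then obtain y where y: "z = \<alpha> * y" "y \<in> M" by blast
      have "\<alpha> \<in> (*) \<alpha> ` R" using assms(1) by (force simp: subring_with_1_def)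
      then show "z \<in> {x * y | x y. x \<in> (*) \<alpha> ` R \<and> y \<in> M}" using y by blast
    qed
  qed
  then show ?thesis
    unfolding ideal_mult_def using module_span_of_submodule[OF assms(1) submodule_scale[OF assms(2)]] by simp
qed

lemma fractional_ideal_submodule:
  "subring_with_1 R ==> fractional_ideal R I ==> submodule_of R I"
  unfolding fractional_ideal_def using module_span_submodule by blast

definition scalings :: "complex set => complex set => complex set set" where
  "scalings R I = {(*) \<alpha> ` I | \<alpha>. \<alpha> \<in> frac_field R - {0}}"

text \<open>Multiplication by a principal ideal is scaling by its generator, so the cosets of the
  principal ideals are the ideal classes viewed as sets.\<close>

lemma carrier_Picard_group:
  assumes "subring_with_1 R"
  shows "carrier (Picard_group R) = {scalings R I | I. invertible_ideal R I}"
proof -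
  have "principal_ideals R #>\<^bsub>invertible_ideal_group R\<^esub> I = scalings R I" if "invertible_ideal R I" for I
  proof -
    have M: "submodule_of R I" using that fractional_ideal_submodule[OF assms] by (simp add: invertible_ideal_def)
    show ?thesis
      unfolding r_coset_def principal_ideals_def scalings_def
      by (auto simp: invertible_ideal_group_def ideal_mult_principal[OF assms M])
  qed
  then show ?thesis
    unfolding Picard_group_def FactGroup_def RCOSETS_def by (auto simp: invertible_ideal_group_def)
qed

text \<open>A multiplier of \<open>I\<close> also maps \<open>I J\<close> into itself. Since
  \<open>I J\<close> is principal, a multiplier of it lies in \<open>R\<close>. In other words, the
  multiplier ring of an invertible ideal is no larger than the order.\<close>

lemma invertible_ideal_multiplier:
  assumes "subring_with_1 R" "invertible_ideal R I" "\<And>y. y \<in> I ==> x * y \<in> I"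
  shows "x \<in> R"
proof -
  obtain J \<beta> where J: "ideal_mult R I J = (*) \<beta> ` R" "\<beta> \<noteq> 0"
    using assms(2) by (auto simp: invertible_ideal_def principal_ideals_def)
  have sm: "submodule_of R (ideal_mult R I J)" unfolding ideal_mult_def by (rule module_span_submodule[OF assms(1)])
  have "submodule_of R {z. x * z \<in> ideal_mult R I J}"
    using sm unfolding submodule_of_def by (auto simp: distrib_left mult.left_commute)
  moreover have "{x * y | x y. x \<in> I \<and> y \<in> J} \<subseteq> {z. x * z \<in> ideal_mult R I J}"
  proof
    fix z assume "z \<in> {x * y | x y. x \<in> I \<and> y \<in> J}"
    then obtain a b where z: "z = a * b" "a \<in> I" "b \<in> J" by blast
    have "x * z = (x * a) * b" using z by simp
    then have "x * z \<in> {x * y | x y. x \<in> I \<and> y \<in> J}" using assms(3)[OF z(2)] z(3) by blast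
    moreover have "1 \<in> R" using assms(1) by (simp add: subring_with_1_def)
    ultimately have "x * z \<in> ideal_mult R I J"
      unfolding ideal_mult_def by (rule subsetD[OF module_span_superset, rotated])
    then show "z \<in> {z. x * z \<in> ideal_mult R I J}" by blast
  qed
  ultimately have "ideal_mult R I J \<subseteq> {z. x * z \<in> ideal_mult R I J}"
    unfolding ideal_mult_def by (rule module_span_minimal)
  moreover have "\<beta> \<in> ideal_mult R I J" unfolding J using assms(1) by (force simp: subring_with_1_def)
  ultimately have "x * \<beta> \<in> ideal_mult R I J" by blast
  then obtain r where "r \<in> R" "x * \<beta> = \<beta> * r" unfolding J by blast
  then show ?thesis using J(2) by simp
qed

lemma frac_field_simps:
  assumes "subring_with_1 R"
  shows "x \<in> R ==> x \<in> frac_field R" "x \<in> frac_field R ==> inverse x \<in> frac_field R"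
    "x \<in> frac_field R ==> y \<in> frac_field R ==> x * y \<in> frac_field R"
proof -
  have R: "0 \<in> R" "1 \<in> R" "\<And>x y. x \<in> R ==> y \<in> R ==> x * y \<in> R"
    using assms by (auto simp: subring_with_1_def submodule_of_def)
  show "x \<in> frac_field R" if "x \<in> R"
    unfolding frac_field_def using that R by (intro CollectI exI[of _ x] exI[of _ 1]) auto
  show "inverse x \<in> frac_field R" if x: "x \<in> frac_field R"
  proof -
    obtain a b where ab: "x = a / b" "a \<in> R" "b \<in> R" "b \<noteq> 0" using x by (auto simp: frac_field_def)
    show ?thesis
    proof (cases "a = 0")
      case True
      then show ?thesis unfolding frac_field_def using ab R by (intro CollectI exI[of _ 0] exI[of _ 1]) auto
    next
      case False
      then show ?thesis unfolding frac_field_def using ab by (intro CollectI exI[of _ b] exI[of _ a]) auto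
    qed
  qed
  show "x * y \<in> frac_field R" if xy: "x \<in> frac_field R" "y \<in> frac_field R"
  proof -
    obtain a b c d where ab: "x = a / b" "a \<in> R" "b \<in> R" "b \<noteq> 0" "y = c / d" "c \<in> R" "d \<in> R" "d \<noteq> 0"
      using xy by (auto simp: frac_field_def)
    then show ?thesis unfolding frac_field_def using R by (intro CollectI exI[of _ "a * c"] exI[of _ "b * d"]) auto
  qed
qed

lemma frac_field_mult_scalings:
  assumes "subring_with_1 R" "\<alpha> \<in> frac_field R - {0}"
  shows "scalings R ((*) \<alpha> ` I) = scalings R I"
proof
  show "scalings R ((*) \<alpha> ` I) \<subseteq> scalings R I"
  proof
    fix J assume "J \<in> scalings R ((*) \<alpha> ` I)"
    then obtain \<beta> where \<beta>: "\<beta> \<in> frac_field R - {0}" "J = (*) \<beta> ` (*) \<alpha> ` I" by (auto simp: scalings_def)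
    then have "J = (*) (\<beta> * \<alpha>) ` I" by (auto simp: image_image mult.assoc)
    moreover have "\<beta> * \<alpha> \<in> frac_field R - {0}" using \<beta> assms frac_field_simps(3)[OF assms(1)] by auto
    ultimately show "J \<in> scalings R I" by (auto simp: scalings_def)
  qed
  show "scalings R I \<subseteq> scalings R ((*) \<alpha> ` I)"
  proof
    fix J assume "J \<in> scalings R I"
    then obtain \<beta> where \<beta>: "\<beta> \<in> frac_field R - {0}" "J = (*) \<beta> ` I" by (auto simp: scalings_def)
    have "(\<beta> * inverse \<alpha>) * (\<alpha> * x) = \<beta> * x" for x using assms(2) by (simp add: field_simps)
    then have "J = (*) (\<beta> * inverse \<alpha>) ` (*) \<alpha> ` I" by (simp only: image_image \<beta>(2))
    moreover have "\<beta> * inverse \<alpha> \<in> frac_field R - {0}"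
      using \<beta> assms frac_field_simps(2,3)[OF assms(1)] by auto
    ultimately show "J \<in> scalings R ((*) \<alpha> ` I)" unfolding scalings_def by blast
  qed
qed

lemma scalings_refl: "subring_with_1 R ==> I \<in> scalings R I"
  unfolding scalings_def using frac_field_simps(1)[of R 1] by (force simp: subring_with_1_def)

lemma common_denominator:
  assumes "subring_with_1 R" "finite F" "F \<subseteq> frac_field R"
  obtains d where "d \<in> R" "d \<noteq> 0" "\<And>x. x \<in> module_span R F ==> d * x \<in> R"
proof -
  have R: "0 \<in> R" "1 \<in> R" "\<And>x y. x \<in> R ==> y \<in> R ==> x * y \<in> R" "\<And>x y. x \<in> R ==> y \<in> R ==> x + y \<in> R"
    using assms by (auto simp: subring_with_1_def submodule_of_def)
  have "\<exists>d\<in>R. d \<noteq> 0 \<and> (\<forall>x\<in>F. d * x \<in> R)"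
    using assms(2,3)
  proof (induction F)
    case empty
    then show ?case using R(2) by (intro bexI[of _ 1]) auto
  next
    case (insert f F)
    then obtain d where d: "d \<in> R" "d \<noteq> 0" "\<forall>x\<in>F. d * x \<in> R" by auto
    obtain a b where ab: "f = a / b" "a \<in> R" "b \<in> R" "b \<noteq> 0" using insert by (auto simp: frac_field_def)
    have "b * d * x \<in> R" if "x \<in> F" for x using d(3) that R(3)[OF ab(3)] by (metis mult.assoc)
    moreover have "b * d * f \<in> R" using ab d R(3) by (simp add: mult.commute)
    ultimately show ?case using ab d R(3) by (intro bexI[of _ "b * d"]) auto
  qed
  then obtain d where d: "d \<in> R" "d \<noteq> 0" "\<And>x. x \<in> F ==> d * x \<in> R" by blast
  have "submodule_of R {x. d * x \<in> R}"
    unfolding submodule_of_def using R by (auto simp: distrib_left mult.left_commute)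
  then have "module_span R F \<subseteq> {x. d * x \<in> R}" using d(3) by (intro module_span_minimal) auto
  then show ?thesis using that d by blast
qed

lemma class_number_eq_1:
  assumes R: "subring_with_1 R" and pr: "\<And>I. fractional_ideal R I ==> I \<in> scalings R R"
  shows "class_number R = 1"
proof -
  have RR: "submodule_of R R" using R by (simp add: subring_with_1_def)
  have one: "1 \<in> R" using R by (simp add: subring_with_1_def)
  have fR: "fractional_ideal R R"
  proof -
    have "module_span R {1} = R"
    proof
      show "module_span R {1} \<subseteq> R" using RR one by (intro module_span_minimal) auto
      show "R \<subseteq> module_span R {1}"
        using module_span_submodule[OF R, of "{1}"] module_span_superset[OF one, of "{1}"]
        by (auto simp: submodule_of_def) (metis mult.right_neutral)
    qed
    moreover have "1 \<in> frac_field R" using frac_field_simps(1)[OF R one] .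
    moreover have "R \<noteq> {0}" using one by auto
    ultimately show ?thesis unfolding fractional_ideal_def by (metis finite.emptyI finite.insertI insert_subset empty_subsetI)
  qed
  have "ideal_mult R R R = R" using ideal_mult_principal[OF R RR, of 1] by (simp add: image_def)
  moreover have "R \<in> principal_ideals R"
    unfolding principal_ideals_def using frac_field_simps(1)[OF R one] by (intro CollectI exI[of _ 1]) (auto simp: image_def)
  ultimately have "invertible_ideal R R" using fR unfolding invertible_ideal_def by (intro conjI exI[of _ R]) auto
  moreover have "scalings R I = scalings R R" if I: "invertible_ideal R I" for I
  proof -
    obtain \<alpha> where "\<alpha> \<in> frac_field R - {0}" "I = (*) \<alpha> ` R"
      using pr[of I] I by (auto simp: invertible_ideal_def scalings_def)
    then show ?thesis using frac_field_mult_scalings[OF R] by simp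
  qed
  ultimately have "carrier (Picard_group R) = {scalings R R}" unfolding carrier_Picard_group[OF R] by blast
  then show ?thesis by (simp add: class_number_def order_def)
qed

lemma adjoin_Z_Ints:
  assumes "\<mu> \<in> \<int>"
  shows "adjoin_Z \<mu> = \<int>"
proof
  show "adjoin_Z \<mu> \<subseteq> \<int>"
  proof
    fix x assume "x \<in> adjoin_Z \<mu>"
    then obtain p :: "int poly" where "x = poly (map_poly of_int p) \<mu>" by (auto simp: adjoin_Z_def)
    moreover have "poly (map_poly of_int p) \<mu> \<in> \<int>"
      by (induction p) (use assms in \<open>auto simp: map_poly_pCons\<close>)
    ultimately show "x \<in> \<int>" by simp
  qed
  show "\<int> \<subseteq> adjoin_Z \<mu>"
  proof
    fix x :: complex assume "x \<in> \<int>"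
    then obtain n where "x = of_int n" by (auto elim: Ints_cases)
    then have "x = poly (map_poly of_int [:n:]) \<mu>" by (simp add: map_poly_pCons)
    then show "x \<in> adjoin_Z \<mu>" unfolding adjoin_Z_def by blast
  qed
qed

text \<open>After clearing denominators a fractional ideal of \<int> is a subgroup of \<int>, hence
  cyclic.\<close>

lemma class_number_Ints: "class_number \<int> = 1"
proof (rule class_number_eq_1)
  show R: "subring_with_1 \<int>" by (auto simp: subring_with_1_def submodule_of_def)
  fix I assume I: "fractional_ideal \<int> I"
  then obtain F where F: "finite F" "F \<subseteq> frac_field \<int>" "I = module_span \<int> F" "I \<noteq> {0}"
    by (auto simp: fractional_ideal_def)
  obtain d where d: "d \<in> \<int>" "d \<noteq> 0" "\<And>x. x \<in> I ==> d * x \<in> \<int>"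
    using common_denominator[OF R F(1,2)] F(3) by metis
  have sm: "submodule_of \<int> I" using fractional_ideal_submodule[OF R I] .
  then have I': "0 \<in> I" "\<And>x y. x \<in> I ==> y \<in> I ==> x + y \<in> I" "\<And>r x. r \<in> \<int> ==> x \<in> I ==> r * x \<in> I"
    by (auto simp: submodule_of_def)
  define A where "A = {n::int. of_int n / d \<in> I}"
  have "0 \<in> A" using I' by (simp add: A_def)
  moreover have "x - y \<in> A" if "x \<in> A" "y \<in> A" for x y
    using I'(2)[of "of_int x / d" "- 1 * (of_int y / d)"] I'(3)[of "-1" "of_int y / d"] that
    by (simp add: A_def diff_divide_distrib)
  ultimately obtain c where c: "A = range ((*) c)" using int_subgroup_cyclic by metis
  have IA: "I = (\<lambda>n. of_int n / d) ` A"
  proof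
    show "I \<subseteq> (\<lambda>n. of_int n / d) ` A"
    proof
      fix x assume x: "x \<in> I"
      then obtain n where n: "d * x = of_int n" using d(3) by (auto elim: Ints_cases)
      then have "x = of_int n / d" using d(2) by (simp add: field_simps)
      then show "x \<in> (\<lambda>n. of_int n / d) ` A" using x by (auto simp: A_def)
    qed
  qed (auto simp: A_def)
  have "c \<noteq> 0"
  proof
    assume "c = 0"
    then have "A = {0}" using c by auto
    then show False using IA F(4) by simp
  qed
  have "I = (*) (of_int c / d) ` \<int>"
  proof (rule subset_antisym; rule subsetI)
    fix z assume "z \<in> I"
    then obtain k where "z = of_int (c * k) / d" unfolding IA c by blast
    then have "z = of_int c / d * of_int k" by simp
    then show "z \<in> (*) (of_int c / d) ` \<int>" using Ints_of_int by blast
  next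
    fix z assume "z \<in> (*) (of_int c / d) ` \<int>"
    then obtain k where "z = of_int c / d * of_int k" by (auto elim: Ints_cases)
    then have "z = of_int (c * k) / d" by simp
    then show "z \<in> I" unfolding IA c by blast
  qed
  moreover have "of_int c / d \<in> frac_field \<int>" unfolding frac_field_def using d(1,2) Ints_of_int by blast
  moreover have "of_int c / d \<noteq> 0" using \<open>c \<noteq> 0\<close> d(2) by simp
  ultimately show "I \<in> scalings \<int> \<int>" unfolding scalings_def by blast
qed

section \<open>Quadratic orders and the Latimer-MacDuffee correspondence\<close>

locale quadratic =
  fixes \<mu> :: complex and t D :: int
  assumes root: "\<mu> * \<mu> = of_int t * \<mu> - of_int D"
    and indep: "\<And>m n::int. of_int m + of_int n * \<mu> = 0 ==> m = 0 \<and> n = 0"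
begin

abbreviation "\<O> \<equiv> adjoin_Z \<mu>"
abbreviation "K \<equiv> frac_field \<O>"

lemma adjoin_eq: "\<O> = {of_int m + of_int n * \<mu> | m n :: int. True}"
proof
  show "\<O> \<subseteq> {of_int m + of_int n * \<mu> | m n :: int. True}"
  proof
    fix x assume "x \<in> \<O>"
    then obtain p :: "int poly" where "x = poly (map_poly of_int p) \<mu>" by (auto simp: adjoin_Z_def)
    moreover have "\<exists>m n::int. poly (map_poly of_int p) \<mu> = of_int m + of_int n * \<mu>"
    proof (induction p)
      case 0 show ?case by (intro exI[of _ 0]) simp
    next
      case (pCons a p)
      then obtain m n :: int where "poly (map_poly of_int p) \<mu> = of_int m + of_int n * \<mu>" by blast
      then have "poly (map_poly of_int (pCons a p)) \<mu> = of_int a + of_int m * \<mu> + of_int n * (\<mu> * \<mu>)"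
        using pCons by (simp add: map_poly_pCons algebra_simps)
      also have "\<dots> = of_int (a - n * D) + of_int (m + n * t) * \<mu>" unfolding root by (simp add: algebra_simps)
      finally show ?case by blast
    qed
    ultimately show "x \<in> {of_int m + of_int n * \<mu> | m n :: int. True}" by auto
  qed
  show "{of_int m + of_int n * \<mu> | m n :: int. True} \<subseteq> \<O>"
  proof
    fix x assume "x \<in> {of_int m + of_int n * \<mu> | m n :: int. True}"
    then obtain m n :: int where "x = of_int m + of_int n * \<mu>" by blast
    then have "x = poly (map_poly of_int [:m, n:]) \<mu>" by (simp add: map_poly_pCons)
    then show "x \<in> \<O>" unfolding adjoin_Z_def by blast
  qed
qed

lemma mult_explicit:
  fixes m n m' n' :: int
  shows "(of_int m + of_int n * \<mu>) * (of_int m' + of_int n' * \<mu>) =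
     of_int (m * m' - n * n' * D) + of_int (m * n' + n * m' + n * n' * t) * \<mu>"
proof -
  have "(of_int m + of_int n * \<mu>) * (of_int m' + of_int n' * \<mu>) =
     of_int (m * m') + of_int (m * n' + n * m') * \<mu> + of_int (n * n') * (\<mu> * \<mu>)"
    by (simp add: algebra_simps)
  then show ?thesis unfolding root by (simp add: algebra_simps)
qed

lemma subring: "subring_with_1 \<O>"
  unfolding subring_with_1_def submodule_of_def
proof (intro conjI ballI)
  show "1 \<in> \<O>" unfolding adjoin_eq by (intro CollectI exI[of _ 1] exI[of _ 0]) simp
  show "0 \<in> \<O>" unfolding adjoin_eq by (intro CollectI exI[of _ 0]) simp
  fix x y assume "x \<in> \<O>" "y \<in> \<O>"
  then obtain m n m' n' :: int where xy: "x = of_int m + of_int n * \<mu>" "y = of_int m' + of_int n' * \<mu>"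
    unfolding adjoin_eq by blast
  have "x + y = of_int (m + m') + of_int (n + n') * \<mu>" unfolding xy by (simp add: algebra_simps)
  then show "x + y \<in> \<O>" unfolding adjoin_eq by blast
  show "x * y \<in> \<O>" unfolding xy mult_explicit unfolding adjoin_eq by blast
qed

lemma Ints_in: "of_int n \<in> \<O>"
  unfolding adjoin_eq by (intro CollectI exI[of _ n] exI[of _ 0]) simp

lemma mu_in: "of_int m + of_int n * \<mu> \<in> \<O>"
  unfolding adjoin_eq by blast

lemma submoduleI:
  assumes "0 \<in> M" "\<And>x y. x \<in> M ==> y \<in> M ==> x + y \<in> M" "\<And>x. x \<in> M ==> - x \<in> M" "\<And>x. x \<in> M ==> \<mu> * x \<in> M"
  shows "submodule_of \<O> M"
proof -
  have int: "of_int k * x \<in> M" if x: "x \<in> M" for k :: int and x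
  proof (induction k rule: int_induct[where k = 0])
    case base then show ?case using assms(1) by simp
  next
    case (step1 i) then show ?case using assms(2)[OF _ x] by (simp add: distrib_right)
  next
    case (step2 i) then show ?case using assms(2)[OF _ assms(3)[OF x]] by (simp add: left_diff_distrib)
  qed
  have "r * x \<in> M" if r: "r \<in> \<O>" and x: "x \<in> M" for r x
  proof -
    obtain m n :: int where "r = of_int m + of_int n * \<mu>" using r unfolding adjoin_eq by blast
    then have "r * x = of_int m * x + of_int n * (\<mu> * x)" by (simp add: algebra_simps)
    then show ?thesis using assms(2)[OF int[OF x] int[OF assms(4)[OF x]]] by simp
  qed
  then show ?thesis using assms by (simp add: submodule_of_def)
qed

end

locale quadratic_matrix = quadratic +
  fixes A :: "int^2^2"
  assumes tr: "trace A = t" and dt: "det A = D"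
begin

abbreviation "a \<equiv> A $ 1 $ 1"
abbreviation "b \<equiv> A $ 1 $ 2"
abbreviation "c \<equiv> A $ 2 $ 1"
abbreviation "d \<equiv> A $ 2 $ 2"

lemma t_eq: "t = a + d" and D_eq: "D = a * d - b * c"
  using tr dt by (simp_all add: trace_2 det_2)

text \<open>This equation and the next say that \<open>(b, \<mu> - a)\<close> is an eigenvector:
  with respect to these two generators of the ideal, multiplication by \<open>\<mu>\<close> is given
  by the rows of \<open>A\<close>.\<close>

lemma eigen1: "\<mu> * of_int b = of_int a * of_int b + of_int b * (\<mu> - of_int a)"
  by (simp add: algebra_simps)

lemma eigen2: "\<mu> * (\<mu> - of_int a) = of_int c * of_int b + of_int d * (\<mu> - of_int a)"
proof -
  have "\<mu> * (\<mu> - of_int a) = \<mu> * \<mu> - of_int a * \<mu>" by (simp add: algebra_simps)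
  then show ?thesis unfolding root unfolding t_eq D_eq by (simp add: algebra_simps)
qed

text \<open>A triangular integral matrix has integral eigenvalues, against the irrationality
  expressed by \<open>indep\<close>.\<close>

lemma b_nonzero: "b \<noteq> 0"
proof
  assume b: "b = 0"
  have "\<mu> * (\<mu> - of_int a) = of_int d * (\<mu> - of_int a)" using eigen2 b by simp
  then have "(\<mu> - of_int d) * (\<mu> - of_int a) = 0" by (simp add: algebra_simps)
  then have "of_int (-d) + of_int 1 * \<mu> = 0 \<or> of_int (-a) + of_int 1 * \<mu> = 0" by auto
  then show False using indep[of "-d" 1] indep[of "-a" 1] by auto
qed

lemma indep': "of_int m * of_int b + of_int n * (\<mu> - of_int a) = 0 ==> m = 0 \<and> n = 0"
proof -
  assume "of_int m * of_int b + of_int n * (\<mu> - of_int a) = 0"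
  then have "of_int (m * b - n * a) + of_int n * \<mu> = 0" by (simp add: algebra_simps)
  then have "m * b - n * a = 0" "n = 0" using indep by blast+
  then show ?thesis using b_nonzero by simp
qed

lemma LM_submodule: "submodule_of \<O> (LM_ideal A \<mu>)"
proof (rule submoduleI)
  have "0 = of_int 0 * of_int b + of_int 0 * (\<mu> - of_int a)" by simp
  then show "0 \<in> LM_ideal A \<mu>" unfolding LM_ideal_def by blast
next
  fix x y assume "x \<in> LM_ideal A \<mu>" "y \<in> LM_ideal A \<mu>"
  then obtain m n m' n' :: int where xy: "x = of_int m * of_int b + of_int n * (\<mu> - of_int a)"
    "y = of_int m' * of_int b + of_int n' * (\<mu> - of_int a)" unfolding LM_ideal_def by blast
  have "x + y = of_int (m + m') * of_int b + of_int (n + n') * (\<mu> - of_int a)" unfolding xy by (simp add: algebra_simps)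
  then show "x + y \<in> LM_ideal A \<mu>" unfolding LM_ideal_def by blast
next
  fix x assume "x \<in> LM_ideal A \<mu>"
  then obtain m n :: int where x: "x = of_int m * of_int b + of_int n * (\<mu> - of_int a)" unfolding LM_ideal_def by blast
  have "- x = of_int (-m) * of_int b + of_int (-n) * (\<mu> - of_int a)" unfolding x by (simp add: algebra_simps)
  then show "- x \<in> LM_ideal A \<mu>" unfolding LM_ideal_def by blast
  have "\<mu> * x = of_int m * (\<mu> * of_int b) + of_int n * (\<mu> * (\<mu> - of_int a))" unfolding x by (simp add: algebra_simps)
  also have "\<dots> = of_int (m * a + n * c) * of_int b + of_int (m * b + n * d) * (\<mu> - of_int a)"
    unfolding eigen1 eigen2 by (simp add: algebra_simps)
  finally show "\<mu> * x \<in> LM_ideal A \<mu>" unfolding LM_ideal_def by blast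
qed

lemma LM_gens: "of_int b \<in> LM_ideal A \<mu>" "\<mu> - of_int a \<in> LM_ideal A \<mu>"
proof -
  have "of_int b = of_int 1 * of_int b + of_int 0 * (\<mu> - of_int a)" by simp
  then show "of_int b \<in> LM_ideal A \<mu>" unfolding LM_ideal_def by blast
  have "\<mu> - of_int a = of_int 0 * of_int b + of_int 1 * (\<mu> - of_int a)" by simp
  then show "\<mu> - of_int a \<in> LM_ideal A \<mu>" unfolding LM_ideal_def by blast
qed

lemma LM_fractional: "fractional_ideal \<O> (LM_ideal A \<mu>)"
proof -
  have "LM_ideal A \<mu> = module_span \<O> {of_int b, \<mu> - of_int a}"
  proof
    have sm: "submodule_of \<O> (module_span \<O> {of_int b, \<mu> - of_int a})" by (rule module_span_submodule[OF subring])
    have g: "of_int b \<in> module_span \<O> {of_int b, \<mu> - of_int a}" "\<mu> - of_int a \<in> module_span \<O> {of_int b, \<mu> - of_int a}"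
      using module_span_superset[of \<O> "{of_int b, \<mu> - of_int a}"] subring by (auto simp: subring_with_1_def)
    show "LM_ideal A \<mu> \<subseteq> module_span \<O> {of_int b, \<mu> - of_int a}"
    proof
      fix x assume "x \<in> LM_ideal A \<mu>"
      then obtain m n :: int where "x = of_int m * of_int b + of_int n * (\<mu> - of_int a)" unfolding LM_ideal_def by blast
      then show "x \<in> module_span \<O> {of_int b, \<mu> - of_int a}" using sm g Ints_in by (simp add: submodule_of_def)
    qed
    show "module_span \<O> {of_int b, \<mu> - of_int a} \<subseteq> LM_ideal A \<mu>"
      using LM_gens by (intro module_span_minimal[OF LM_submodule]) auto
  qed
  moreover have "of_int b \<in> K" "\<mu> - of_int a \<in> K"
  proof -
    have "\<mu> - of_int a = of_int (-a) + of_int 1 * \<mu>" by simp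
    then have "\<mu> - of_int a \<in> \<O>" using mu_in by metis
    then show "of_int b \<in> K" "\<mu> - of_int a \<in> K" using frac_field_simps(1)[OF subring] Ints_in by blast+
  qed
  moreover have "LM_ideal A \<mu> \<noteq> {0}"
  proof -
    have "complex_of_int b \<noteq> 0" using b_nonzero by simp
    then show ?thesis using LM_gens(1) by blast
  qed
  ultimately show ?thesis unfolding fractional_ideal_def
    by (intro conjI exI[of _ "{of_int b, \<mu> - of_int a}"]) simp_all
qed

text \<open>If \<open>q\<close> divides \<open>b\<close>, \<open>c\<close> and \<open>d - a\<close>,
  then \<open>A - a\<close> is \<open>q\<close> times an integral matrix, so
  \<open>(\<mu> - a) / q\<close> maps the ideal into itself. By invertibility it lies in the order,
  and its coefficient \<open>1 / q\<close> of \<open>\<mu>\<close> must be an integer.\<close>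

lemma primitive_of_invertible:
  assumes I: "invertible_ideal \<O> I" and \<alpha>: "\<alpha> \<noteq> 0" "LM_ideal A \<mu> = (*) \<alpha> ` I"
    and q: "q dvd b" "q dvd c" "q dvd d - a"
  shows "\<bar>q\<bar> = 1"
proof -
  obtain b' c' e where q': "b = q * b'" "c = q * c'" "d - a = q * e" using q by (auto elim!: dvdE)
  have q0: "q \<noteq> 0" using q' b_nonzero by auto
  let ?x = "(\<mu> - of_int a) / of_int q"
  have "?x * y \<in> LM_ideal A \<mu>" if y: "y \<in> LM_ideal A \<mu>" for y
  proof -
    obtain m n :: int where y: "y = of_int m * of_int b + of_int n * (\<mu> - of_int a)" using y unfolding LM_ideal_def by blast
    have sq: "(\<mu> - of_int a) * (\<mu> - of_int a) = of_int q * of_int e * (\<mu> - of_int a) + of_int q * of_int c' * of_int b"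
    proof -
      have "of_int d - of_int a = (of_int q * of_int e :: complex)" using arg_cong[OF q'(3), of "of_int :: int => complex"] by simp
      then have "of_int d = of_int a + (of_int q * of_int e :: complex)" by (simp add: algebra_simps)
      moreover have "(\<mu> - of_int a) * (\<mu> - of_int a) = \<mu> * (\<mu> - of_int a) - of_int a * (\<mu> - of_int a)" by (simp add: algebra_simps)
      ultimately show ?thesis unfolding eigen2 q'(2) by (simp add: algebra_simps)
    qed
    define z where "z = \<mu> - of_int a"
    have sq': "z * z = of_int q * (of_int e * z + of_int c' * of_int b)" using sq by (simp add: z_def algebra_simps)
    have "z / of_int q * (of_int m * of_int b + of_int n * z) = (of_int m * of_int b * z + of_int n * (z * z)) / of_int q"
      by (simp add: field_simps)
    also have "\<dots> = of_int (n * c') * of_int b + of_int (m * b' + n * e) * z"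
      unfolding sq' unfolding q'(1) using q0 by (simp add: field_simps)
    finally have "?x * y = of_int (n * c') * of_int b + of_int (m * b' + n * e) * (\<mu> - of_int a)"
      unfolding y z_def .
    then show ?thesis unfolding LM_ideal_def by blast
  qed
  then have "?x * y \<in> I" if "y \<in> I" for y
  proof -
    have "?x * (\<alpha> * y) \<in> (*) \<alpha> ` I" using that \<alpha>(2) \<open>\<And>y. y \<in> LM_ideal A \<mu> ==> ?x * y \<in> LM_ideal A \<mu>\<close> by blast
    then obtain z where z: "?x * (\<alpha> * y) = \<alpha> * z" "z \<in> I" by blast
    then have "\<alpha> * (?x * y) = \<alpha> * z" by (simp only: mult.left_commute)
    then have "?x * y = z" using \<alpha>(1) mult_cancel_left by blast
    then show ?thesis using z(2) by simp
  qed
  then have "?x \<in> \<O>" by (rule invertible_ideal_multiplier[OF subring I])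
  then obtain m n :: int where "?x = of_int m + of_int n * \<mu>" unfolding adjoin_eq by blast
  then have "of_int (- a - q * m) + of_int (1 - q * n) * \<mu> = 0" using q0 by (simp add: field_simps)
  then have "1 - q * n = 0" using indep by blast
  then have "q * n = 1" by simp
  then show ?thesis unfolding zmult_eq_1_iff by auto
qed

end

text \<open>\<open>P\<close> maps the eigenvector of \<open>A\<close> to an eigenvector
  \<open>(v1, v2)\<close> of \<open>B\<close>, which is proportional to the standard one; the factor
  is \<open>\<alpha>\<close>. The group generated by the entries does not change, because
  \<open>P\<close> is unimodular.\<close>

lemma (in quadratic) conj_imp_scaling:
  assumes A: "quadratic_matrix \<mu> t D A" and B: "quadratic_matrix \<mu> t D B" and "mconj A B"
  shows "\<exists>\<alpha>\<in>K - {0}. LM_ideal A \<mu> = (*) \<alpha> ` LM_ideal B \<mu>"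
proof -
  interpret A: quadratic_matrix \<mu> t D A by fact
  interpret B: quadratic_matrix \<mu> t D B by fact
  obtain P Q where P: "P ** Q = mat 1" "Q ** P = mat 1" "P ** A = B ** P"
    using assms(3) by (auto simp: mconj_def invertible_def)
  let ?p = "P $ 1 $ 1" and ?q = "P $ 1 $ 2" and ?r = "P $ 2 $ 1" and ?s = "P $ 2 $ 2"
  define w1 w2 where "w1 = complex_of_int A.b" and "w2 = \<mu> - of_int A.a"
  define v1 v2 where "v1 = of_int ?p * w1 + of_int ?q * w2" and "v2 = of_int ?r * w1 + of_int ?s * w2"
  have e: "\<mu> * w1 = of_int A.a * w1 + of_int A.b * w2" "\<mu> * w2 = of_int A.c * w1 + of_int A.d * w2"
    using A.eigen1 A.eigen2 by (simp_all add: w1_def w2_def)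
  have PA: "?p * A.a + ?q * A.c = B.a * ?p + B.b * ?r" "?p * A.b + ?q * A.d = B.a * ?q + B.b * ?s"
    using P(3) by (simp_all add: mat2_eq_iff mat2_mult_nth)
  have "\<mu> * v1 = of_int ?p * (\<mu> * w1) + of_int ?q * (\<mu> * w2)" by (simp add: v1_def algebra_simps)
  also have "\<dots> = of_int (?p * A.a + ?q * A.c) * w1 + of_int (?p * A.b + ?q * A.d) * w2"
    unfolding e by (simp add: algebra_simps)
  also have "\<dots> = of_int B.a * v1 + of_int B.b * v2" unfolding PA by (simp add: v1_def v2_def algebra_simps)
  \<comment> \<open>The first row of the eigenvector equation already fixes the ratio of
    \<open>v1\<close> and \<open>v2\<close>, since \<open>B.b\<close> is nonzero.\<close>
  finally have v: "of_int B.b * v2 = (\<mu> - of_int B.a) * v1" by (simp add: algebra_simps)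
  have v1: "v1 \<noteq> 0"
  proof
    assume "v1 = 0"
    then have "?p = 0 \<and> ?q = 0" using A.indep'[of ?p ?q] by (simp add: v1_def w1_def w2_def)
    then show False using arg_cong[OF P(1), of "\<lambda>M. M $ 1 $ 1"] by (simp add: mat2_mult_nth)
  qed
  define \<alpha> where "\<alpha> = v1 / of_int B.b"
  have b0: "complex_of_int B.b \<noteq> 0" using B.b_nonzero by simp
  have vw: "v1 = \<alpha> * of_int B.b" "v2 = \<alpha> * (\<mu> - of_int B.a)"
    using v b0 by (simp_all add: \<alpha>_def field_simps)
  have QP: "Q $ 1 $ 1 * ?p + Q $ 1 $ 2 * ?r = 1" "Q $ 1 $ 1 * ?q + Q $ 1 $ 2 * ?s = 0"
      "Q $ 2 $ 1 * ?p + Q $ 2 $ 2 * ?r = 0" "Q $ 2 $ 1 * ?q + Q $ 2 $ 2 * ?s = 1"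
    using P(2) by (simp_all add: mat2_eq_iff mat2_mult_nth)
  have w: "w1 = of_int (Q $ 1 $ 1) * v1 + of_int (Q $ 1 $ 2) * v2" "w2 = of_int (Q $ 2 $ 1) * v1 + of_int (Q $ 2 $ 2) * v2"
  proof -
    have "of_int (Q $ 1 $ 1) * v1 + of_int (Q $ 1 $ 2) * v2 = of_int (Q $ 1 $ 1 * ?p + Q $ 1 $ 2 * ?r) * w1 + of_int (Q $ 1 $ 1 * ?q + Q $ 1 $ 2 * ?s) * w2"
      by (simp add: v1_def v2_def algebra_simps)
    then show "w1 = of_int (Q $ 1 $ 1) * v1 + of_int (Q $ 1 $ 2) * v2" unfolding QP by simp
    have "of_int (Q $ 2 $ 1) * v1 + of_int (Q $ 2 $ 2) * v2 = of_int (Q $ 2 $ 1 * ?p + Q $ 2 $ 2 * ?r) * w1 + of_int (Q $ 2 $ 1 * ?q + Q $ 2 $ 2 * ?s) * w2"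
      by (simp add: v1_def v2_def algebra_simps)
    then show "w2 = of_int (Q $ 2 $ 1) * v1 + of_int (Q $ 2 $ 2) * v2" unfolding QP by simp
  qed
  have "LM_ideal A \<mu> = (*) \<alpha> ` LM_ideal B \<mu>"
  proof
    show "LM_ideal A \<mu> \<subseteq> (*) \<alpha> ` LM_ideal B \<mu>"
    proof
      fix x assume "x \<in> LM_ideal A \<mu>"
      then obtain m n :: int where "x = of_int m * w1 + of_int n * w2" unfolding LM_ideal_def w1_def w2_def by blast
      then have "x = of_int (m * Q $ 1 $ 1 + n * Q $ 2 $ 1) * v1 + of_int (m * Q $ 1 $ 2 + n * Q $ 2 $ 2) * v2"
        unfolding w by (simp add: algebra_simps)
      then have "x = \<alpha> * (of_int (m * Q $ 1 $ 1 + n * Q $ 2 $ 1) * of_int B.b + of_int (m * Q $ 1 $ 2 + n * Q $ 2 $ 2) * (\<mu> - of_int B.a))"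
        unfolding vw by (simp add: algebra_simps)
      then show "x \<in> (*) \<alpha> ` LM_ideal B \<mu>" unfolding LM_ideal_def by blast
    qed
    show "(*) \<alpha> ` LM_ideal B \<mu> \<subseteq> LM_ideal A \<mu>"
    proof
      fix x assume "x \<in> (*) \<alpha> ` LM_ideal B \<mu>"
      then obtain m n :: int where "x = \<alpha> * (of_int m * of_int B.b + of_int n * (\<mu> - of_int B.a))" unfolding LM_ideal_def by blast
      then have "x = of_int m * v1 + of_int n * v2" unfolding vw by (simp add: algebra_simps)
      then have "x = of_int (m * ?p + n * ?r) * w1 + of_int (m * ?q + n * ?s) * w2"
        by (simp add: v1_def v2_def algebra_simps)
      then show "x \<in> LM_ideal A \<mu>" unfolding LM_ideal_def w1_def w2_def by blast
    qed
  qed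
  moreover have "\<alpha> \<in> K - {0}"
  proof -
    have v1_eq: "v1 = of_int (?p * A.b - ?q * A.a) + of_int ?q * \<mu>" by (simp add: v1_def w1_def w2_def algebra_simps)
    have "v1 \<in> \<O>" unfolding v1_eq by (rule mu_in)
    then have "\<alpha> \<in> K" unfolding \<alpha>_def frac_field_def using Ints_in b0 by blast
    moreover have "\<alpha> \<noteq> 0" using v1 b0 by (simp add: \<alpha>_def)
    ultimately show ?thesis by simp
  qed
  ultimately show ?thesis by blast
qed

text \<open>The generators of one ideal and the scaled generators of the other are two bases of one
  lattice. The base change is unimodular and intertwines the two matrices of multiplication by
  \<open>\<mu>\<close>.\<close>

lemma (in quadratic) scaling_imp_conj:
  assumes A: "quadratic_matrix \<mu> t D A" and B: "quadratic_matrix \<mu> t D B"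
    and \<alpha>: "\<alpha> \<noteq> 0" "LM_ideal B \<mu> = (*) \<alpha> ` LM_ideal A \<mu>"
  shows "mconj A B"
proof -
  interpret A: quadratic_matrix \<mu> t D A by fact
  interpret B: quadratic_matrix \<mu> t D B by fact
  define w1 w2 where "w1 = complex_of_int A.b" and "w2 = \<mu> - of_int A.a"
  define v1 v2 where "v1 = complex_of_int B.b" and "v2 = \<mu> - of_int B.a"
  have eA: "\<mu> * w1 = of_int A.a * w1 + of_int A.b * w2" "\<mu> * w2 = of_int A.c * w1 + of_int A.d * w2"
    using A.eigen1 A.eigen2 by (simp_all add: w1_def w2_def)
  have eB: "\<mu> * v1 = of_int B.a * v1 + of_int B.b * v2" "\<mu> * v2 = of_int B.c * v1 + of_int B.d * v2"
    using B.eigen1 B.eigen2 by (simp_all add: v1_def v2_def)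
  have ind: "m = 0 \<and> n = 0" if "of_int m * w1 + of_int n * w2 = 0" for m n :: int
    using A.indep' that by (simp add: w1_def w2_def)
  have "v1 \<in> (*) \<alpha> ` LM_ideal A \<mu>" "v2 \<in> (*) \<alpha> ` LM_ideal A \<mu>"
    using B.LM_gens unfolding \<alpha>(2) by (simp_all add: v1_def v2_def)
  then obtain x1 x2 y1 y2 :: int where v: "v1 = \<alpha> * (of_int x1 * w1 + of_int x2 * w2)" "v2 = \<alpha> * (of_int y1 * w1 + of_int y2 * w2)"
    unfolding LM_ideal_def w1_def w2_def by blast
  have "\<alpha> * w1 \<in> LM_ideal B \<mu>" "\<alpha> * w2 \<in> LM_ideal B \<mu>"
    unfolding \<alpha>(2) w1_def w2_def using A.LM_gens by (blast intro: imageI)+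
  then obtain p1 p2 q1 q2 :: int where w: "\<alpha> * w1 = of_int p1 * v1 + of_int p2 * v2" "\<alpha> * w2 = of_int q1 * v1 + of_int q2 * v2"
    unfolding LM_ideal_def v1_def v2_def by blast
  have "\<alpha> * w1 = \<alpha> * (of_int (p1 * x1 + p2 * y1) * w1 + of_int (p1 * x2 + p2 * y2) * w2)"
    unfolding w(1) unfolding v by (simp add: algebra_simps)
  then have "w1 = of_int (p1 * x1 + p2 * y1) * w1 + of_int (p1 * x2 + p2 * y2) * w2" using \<alpha>(1) by simp
  then have "of_int (p1 * x1 + p2 * y1 - 1) * w1 + of_int (p1 * x2 + p2 * y2) * w2 = 0" by (simp add: algebra_simps)
  then have 1: "p1 * x1 + p2 * y1 - 1 = 0" "p1 * x2 + p2 * y2 = 0" using ind by blast+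
  have "\<alpha> * w2 = \<alpha> * (of_int (q1 * x1 + q2 * y1) * w1 + of_int (q1 * x2 + q2 * y2) * w2)"
    unfolding w(2) unfolding v by (simp add: algebra_simps)
  then have "w2 = of_int (q1 * x1 + q2 * y1) * w1 + of_int (q1 * x2 + q2 * y2) * w2" using \<alpha>(1) by simp
  then have "of_int (q1 * x1 + q2 * y1) * w1 + of_int (q1 * x2 + q2 * y2 - 1) * w2 = 0" by (simp add: algebra_simps)
  then have 2: "q1 * x1 + q2 * y1 = 0" "q1 * x2 + q2 * y2 - 1 = 0" using ind by blast+
  let ?Q = "M2 x1 x2 y1 y2"
  have "M2 p1 p2 q1 q2 ** ?Q = mat 1" using 1 2 by (simp add: mat2_eq_iff mat2_mult_nth)
  then have inv: "invertible ?Q" by (rule invertible_of_left_inverse)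
  have "\<mu> * v1 = \<alpha> * (of_int x1 * (\<mu> * w1) + of_int x2 * (\<mu> * w2))" unfolding v by (simp add: algebra_simps)
  also have "\<dots> = \<alpha> * (of_int (x1 * A.a + x2 * A.c) * w1 + of_int (x1 * A.b + x2 * A.d) * w2)"
    unfolding eA by (simp add: algebra_simps)
  finally have "\<alpha> * (of_int (x1 * A.a + x2 * A.c) * w1 + of_int (x1 * A.b + x2 * A.d) * w2)
      = of_int B.a * v1 + of_int B.b * v2" using eB by simp
  also have "\<dots> = \<alpha> * (of_int (B.a * x1 + B.b * y1) * w1 + of_int (B.a * x2 + B.b * y2) * w2)"
    unfolding v by (simp add: algebra_simps)
  finally have "of_int (x1 * A.a + x2 * A.c) * w1 + of_int (x1 * A.b + x2 * A.d) * w2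
      = of_int (B.a * x1 + B.b * y1) * w1 + of_int (B.a * x2 + B.b * y2) * w2" using \<alpha>(1) by simp
  then have "of_int ((x1 * A.a + x2 * A.c) - (B.a * x1 + B.b * y1)) * w1 + of_int ((x1 * A.b + x2 * A.d) - (B.a * x2 + B.b * y2)) * w2 = 0"
    by (simp add: algebra_simps)
  then have r1: "(x1 * A.a + x2 * A.c) - (B.a * x1 + B.b * y1) = 0" "(x1 * A.b + x2 * A.d) - (B.a * x2 + B.b * y2) = 0"
    using ind by blast+
  have "\<mu> * v2 = \<alpha> * (of_int y1 * (\<mu> * w1) + of_int y2 * (\<mu> * w2))" unfolding v by (simp add: algebra_simps)
  also have "\<dots> = \<alpha> * (of_int (y1 * A.a + y2 * A.c) * w1 + of_int (y1 * A.b + y2 * A.d) * w2)"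
    unfolding eA by (simp add: algebra_simps)
  finally have "\<alpha> * (of_int (y1 * A.a + y2 * A.c) * w1 + of_int (y1 * A.b + y2 * A.d) * w2)
      = of_int B.c * v1 + of_int B.d * v2" using eB by simp
  also have "\<dots> = \<alpha> * (of_int (B.c * x1 + B.d * y1) * w1 + of_int (B.c * x2 + B.d * y2) * w2)"
    unfolding v by (simp add: algebra_simps)
  finally have "of_int (y1 * A.a + y2 * A.c) * w1 + of_int (y1 * A.b + y2 * A.d) * w2
      = of_int (B.c * x1 + B.d * y1) * w1 + of_int (B.c * x2 + B.d * y2) * w2" using \<alpha>(1) by simp
  then have "of_int ((y1 * A.a + y2 * A.c) - (B.c * x1 + B.d * y1)) * w1 + of_int ((y1 * A.b + y2 * A.d) - (B.c * x2 + B.d * y2)) * w2 = 0"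
    by (simp add: algebra_simps)
  then have r2: "(y1 * A.a + y2 * A.c) - (B.c * x1 + B.d * y1) = 0" "(y1 * A.b + y2 * A.d) - (B.c * x2 + B.d * y2) = 0"
    using ind by blast+
  have "?Q ** A = B ** ?Q" using r1 r2 by (simp add: mat2_eq_iff mat2_mult_nth)
  then show ?thesis unfolding mconj_def using inv by blast
qed

text \<open>Scaled into the order, the ideal is a lattice \<open>J\<close> with a Hermite basis:
  \<open>n0\<close> generates the integers in \<open>J\<close>, and \<open>c\<close> the
  coefficients of \<open>\<mu>\<close> that occur. Stability under \<open>\<mu>\<close> makes
  \<open>c\<close> divide \<open>n0\<close> and the constant term \<open>b\<close>. After division
  by \<open>c\<close> the basis is \<open>y\<close>, \<open>\<mu> - x\<close>, which is the ideal of
  a matrix with first row \<open>x\<close>, \<open>y\<close>.\<close>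

lemma (in quadratic) fractional_ideal_LM:
  assumes "fractional_ideal \<O> I"
  obtains \<alpha> A where "\<alpha> \<in> K - {0}" "quadratic_matrix \<mu> t D A" "LM_ideal A \<mu> = (*) \<alpha> ` I"
proof -
  obtain F where F: "finite F" "F \<subseteq> K" "I = module_span \<O> F" "I \<noteq> {0}"
    using assms by (auto simp: fractional_ideal_def)
  have sm: "submodule_of \<O> I" using fractional_ideal_submodule[OF subring assms] .
  obtain d where d: "d \<in> \<O>" "d \<noteq> 0" "\<And>x. x \<in> I ==> d * x \<in> \<O>"
    using common_denominator[OF subring F(1,2)] F(3) by metis
  define J where "J = (*) d ` I"
  have JO: "J \<subseteq> \<O>" using d(3) by (auto simp: J_def)
  have smJ: "submodule_of \<O> J" unfolding J_def by (rule submodule_scale[OF sm])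
  have J: "0 \<in> J" "\<And>x y. x \<in> J ==> y \<in> J ==> x + y \<in> J" "\<And>r x. r \<in> \<O> ==> x \<in> J ==> r * x \<in> J"
    using smJ by (auto simp: submodule_of_def)
  have Jdiff: "x - y \<in> J" if "x \<in> J" "y \<in> J" for x y
    using J(2)[OF that(1) J(3)[OF _ that(2), of "-1"]] Ints_in[of "-1"] by simp
  have Jint: "of_int k * x \<in> J" if "x \<in> J" for k :: int and x using J(3)[OF Ints_in that] .
  have Jmu: "\<mu> * x \<in> J" if "x \<in> J" for x using J(3)[OF _ that, of \<mu>] mu_in[of 0 1] by simp
  define N where "N = {m::int. of_int m \<in> J}"
  define C where "C = {n::int. \<exists>m::int. of_int m + of_int n * \<mu> \<in> J}"
  have "0 \<in> N" using J by (simp add: N_def)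
  moreover have "x - y \<in> N" if "x \<in> N" "y \<in> N" for x y using Jdiff that by (simp add: N_def)
  ultimately obtain n0 where n0: "N = range ((*) n0)" using int_subgroup_cyclic by metis
  have "0 \<in> C" using J by (force simp: C_def intro: exI[of _ 0])
  moreover have "x - y \<in> C" if xy: "x \<in> C" "y \<in> C" for x y
  proof -
    obtain m m' :: int where "of_int m + of_int x * \<mu> \<in> J" "of_int m' + of_int y * \<mu> \<in> J" using xy by (auto simp: C_def)
    then have "of_int m + of_int x * \<mu> - (of_int m' + of_int y * \<mu>) \<in> J" by (rule Jdiff)
    moreover have "of_int m + of_int x * \<mu> - (of_int m' + of_int y * \<mu>) = of_int (m - m') + of_int (x - y) * \<mu>" by (simp add: algebra_simps)
    ultimately show ?thesis unfolding C_def by (intro CollectI exI[of _ "m - m'"]) simp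
  qed
  ultimately obtain c where c: "C = range ((*) c)" using int_subgroup_cyclic by metis
  have n0J: "of_int n0 \<in> J" using n0 unfolding N_def by (metis mem_Collect_eq mult.right_neutral rangeI)
  have n0_nz: "n0 \<noteq> 0"
  proof -
    obtain x where x: "x \<in> I" "x \<noteq> 0" using F(4) sm by (auto simp: submodule_of_def)
    then have "d * x \<in> J" "d * x \<noteq> 0" using d(2) by (auto simp: J_def)
    moreover obtain m n :: int where mn: "d * x = of_int m + of_int n * \<mu>" using JO calculation(1) unfolding adjoin_eq by blast
    \<comment> \<open>The first factor is the conjugate of \<open>d * x\<close>, so the product is
      its norm, a nonzero integer in \<open>J\<close>.\<close>
    ultimately have "(of_int (m + n * t) + of_int (-n) * \<mu>) * (d * x) \<in> J" using J(3)[OF mu_in] by blast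
    moreover have "(of_int (m + n * t) + of_int (-n) * \<mu>) * (d * x) = of_int (m * m + m * n * t + n * n * D)"
      unfolding mn mult_explicit by (simp add: algebra_simps)
    ultimately have "m * m + m * n * t + n * n * D \<in> N" unfolding N_def by simp
    moreover have "m * m + m * n * t + n * n * D \<noteq> 0"
    proof
      assume "m * m + m * n * t + n * n * D = 0"
      then have "(of_int (m + n * t) + of_int (-n) * \<mu>) * (d * x) = 0"
        using \<open>(of_int (m + n * t) + of_int (-n) * \<mu>) * (d * x) = of_int (m * m + m * n * t + n * n * D)\<close> by simp
      then have "of_int (m + n * t) + of_int (-n) * \<mu> = 0" using \<open>d * x \<noteq> 0\<close> by simp
      then have "m + n * t = 0 \<and> - n = 0" by (rule indep)
      then have "m = 0" "n = 0" by auto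
      then show False using mn \<open>d * x \<noteq> 0\<close> by simp
    qed
    ultimately show ?thesis using n0 by auto
  qed
  have "of_int 0 + of_int n0 * \<mu> \<in> J" using Jmu[OF n0J] by (simp add: mult.commute)
  then have "n0 \<in> C" unfolding C_def by blast
  then obtain y where y: "n0 = c * y" using c by auto
  then have cy: "c \<noteq> 0" "y \<noteq> 0" using n0_nz by auto
  have "c \<in> C" using c by (metis mult.right_neutral rangeI)
  then obtain b :: int where b: "of_int b + of_int c * \<mu> \<in> J" unfolding C_def by blast
  \<comment> \<open>The combination in which \<open>\<mu>\<close> cancels: it is an integer of
    \<open>J\<close>, hence a multiple of \<open>n0 = c * y\<close>.\<close>
  have "\<mu> * of_int n0 - of_int y * (of_int b + of_int c * \<mu>) \<in> J" using Jdiff[OF Jmu[OF n0J] Jint[OF b]] .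
  moreover have "\<mu> * of_int n0 - of_int y * (of_int b + of_int c * \<mu>) = of_int (- (y * b))" unfolding y by (simp add: algebra_simps)
  ultimately have "- (y * b) \<in> N" unfolding N_def by simp
  then obtain x' where "- (y * b) = c * y * x'" using n0 y by auto
  then have "y * (b + c * x') = 0" by (simp add: algebra_simps)
  then have bx: "b = - (c * x')" using cy by simp
  define x where "x = x'"
  have g1: "of_int (c * y) \<in> J" using n0J y by simp
  have g2: "of_int c * (\<mu> - of_int x) \<in> J" using b bx by (simp add: x_def algebra_simps)
  have Jeq: "J = {of_int c * (of_int m * of_int y + of_int n * (\<mu> - of_int x)) | m n :: int. True}"
  proof
    show "{of_int c * (of_int m * of_int y + of_int n * (\<mu> - of_int x)) | m n :: int. True} \<subseteq> J"
    proof
      fix z assume "z \<in> {of_int c * (of_int m * of_int y + of_int n * (\<mu> - of_int x)) | m n :: int. True}"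
      then obtain m n :: int where "z = of_int c * (of_int m * of_int y + of_int n * (\<mu> - of_int x))" by blast
      then have "z = of_int m * of_int (c * y) + of_int n * (of_int c * (\<mu> - of_int x))" by (simp add: algebra_simps)
      then show "z \<in> J" using J(2)[OF Jint[OF g1] Jint[OF g2]] by simp
    qed
    show "J \<subseteq> {of_int c * (of_int m * of_int y + of_int n * (\<mu> - of_int x)) | m n :: int. True}"
    proof
      fix z assume z: "z \<in> J"
      then obtain m k :: int where mk: "z = of_int m + of_int k * \<mu>" using JO unfolding adjoin_eq by blast
      then have "k \<in> C" using z unfolding C_def by blast
      then obtain n where n: "k = c * n" using c by auto
      have "z - of_int n * (of_int c * (\<mu> - of_int x)) \<in> J" using Jdiff[OF z Jint[OF g2]] .
      moreover have "z - of_int n * (of_int c * (\<mu> - of_int x)) = of_int (m + n * c * x)" unfolding mk n by (simp add: algebra_simps)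
      ultimately have "m + n * c * x \<in> N" unfolding N_def by simp
      then obtain l where l: "m + n * c * x = c * y * l" using n0 y by auto
      have "z = of_int (c * y * l) + of_int n * (of_int c * (\<mu> - of_int x))"
        unfolding l[symmetric] mk n by (simp add: algebra_simps)
      then have "z = of_int c * (of_int l * of_int y + of_int n * (\<mu> - of_int x))" by (simp add: algebra_simps)
      then show "z \<in> {of_int c * (of_int m * of_int y + of_int n * (\<mu> - of_int x)) | m n :: int. True}" by blast
    qed
  qed
  have "\<mu> * (of_int c * (\<mu> - of_int x)) \<in> J" using Jmu[OF g2] .
  \<comment> \<open>These coordinates become the second row of the matrix; comparison with the
    quadratic equation of \<open>\<mu>\<close> yields trace and determinant.\<close>
  then obtain m n :: int where "\<mu> * (of_int c * (\<mu> - of_int x)) = of_int c * (of_int m * of_int y + of_int n * (\<mu> - of_int x))"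
    unfolding Jeq by blast
  then have "\<mu> * (\<mu> - of_int x) = of_int m * of_int y + of_int n * (\<mu> - of_int x)"
    using cy(1) by (simp add: mult.left_commute)
  then have "\<mu> * \<mu> = of_int (m * y - n * x) + of_int (n + x) * \<mu>" by (simp add: algebra_simps)
  then have "of_int (- D - (m * y - n * x)) + of_int (t - (n + x)) * \<mu> = 0" unfolding root by (simp add: algebra_simps)
  then have tn: "- D - (m * y - n * x) = 0" "t - (n + x) = 0" using indep by blast+
  define A where "A = M2 x y m n"
  have "quadratic_matrix \<mu> t D A"
    by unfold_locales (use tn in \<open>simp_all add: A_def trace_2 det_2 algebra_simps\<close>)
  moreover have "LM_ideal A \<mu> = (*) (d / of_int c) ` I"
  proof -
    have "LM_ideal A \<mu> = (\<lambda>z. z / of_int c) ` J"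
    proof
      show "LM_ideal A \<mu> \<subseteq> (\<lambda>z. z / of_int c) ` J"
      proof
        fix z assume "z \<in> LM_ideal A \<mu>"
        then obtain m n :: int where z: "z = of_int m * of_int y + of_int n * (\<mu> - of_int x)"
          unfolding LM_ideal_def A_def by auto
        then have "of_int c * z \<in> J" unfolding Jeq by blast
        then show "z \<in> (\<lambda>z. z / of_int c) ` J" using cy by (intro image_eqI[of _ _ "of_int c * z"]) auto
      qed
      show "(\<lambda>z. z / of_int c) ` J \<subseteq> LM_ideal A \<mu>"
      proof
        fix z assume "z \<in> (\<lambda>z. z / of_int c) ` J"
        then obtain m n :: int where "z = of_int c * (of_int m * of_int y + of_int n * (\<mu> - of_int x)) / of_int c"
          unfolding Jeq by blast
        then have "z = of_int m * of_int y + of_int n * (\<mu> - of_int x)" using cy by simp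
        then show "z \<in> LM_ideal A \<mu>" unfolding LM_ideal_def A_def M2_nth by blast
      qed
    qed
    then show ?thesis by (simp add: J_def image_image)
  qed
  moreover have "d / of_int c \<in> K - {0}"
  proof -
    have "complex_of_int c \<noteq> 0" using cy by simp
    then have "d / of_int c \<in> K" unfolding frac_field_def using d(1) Ints_in by blast
    then show ?thesis using d(2) cy by simp
  qed
  ultimately show ?thesis using that by blast
qed

text \<open>The inequalities are the ones provided by \<open>mconj_reduced\<close>.\<close>

definition (in quadratic) reduced_matrices :: "(int^2^2) set" where
  "reduced_matrices = {B. quadratic_matrix \<mu> t D B \<and> \<bar>2 * B $ 1 $ 1 - t\<bar> \<le> \<bar>B $ 1 $ 2\<bar> \<and> 3 * (B $ 1 $ 2)^2 \<le> \<bar>t^2 - 4 * D\<bar>}"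

lemma (in quadratic) quadratic_matrix_mconj:
  "quadratic_matrix \<mu> t D A ==> mconj A B ==> quadratic_matrix \<mu> t D B"
  using mconj_trace mconj_det quadratic_axioms
  by (auto simp: quadratic_matrix_def quadratic_matrix_axioms_def)

lemma (in quadratic) mconj_reduced_matrix:
  assumes "quadratic_matrix \<mu> t D A"
  obtains B where "B \<in> reduced_matrices" "mconj A B"
proof -
  have q: "quadratic_matrix \<mu> t D B" if "mconj A B" for B using quadratic_matrix_mconj[OF assms that] .
  then have "B $ 1 $ 2 \<noteq> 0" if "mconj A B" for B using that quadratic_matrix.b_nonzero by blast
  then obtain B where "mconj A B" "\<bar>2 * B $ 1 $ 1 - trace A\<bar> \<le> \<bar>B $ 1 $ 2\<bar>"
    "3 * (B $ 1 $ 2)^2 \<le> \<bar>(trace A)^2 - 4 * det A\<bar>" using mconj_reduced by blast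
  moreover have "trace A = t" "det A = D" using assms by (auto simp: quadratic_matrix_def quadratic_matrix_axioms_def)
  ultimately show ?thesis using that q by (simp add: reduced_matrices_def)
qed

text \<open>The first row is bounded and determines the matrix: the trace gives \<open>d\<close>,
  and the determinant gives \<open>c\<close> because \<open>b\<close> is nonzero.\<close>

lemma (in quadratic) finite_reduced_matrices: "finite reduced_matrices"
proof -
  define M where "M = \<bar>t^2 - 4 * D\<bar> + \<bar>t\<bar>"
  have "inj_on (\<lambda>B. (B $ 1 $ 1, B $ 1 $ 2)) reduced_matrices"
  proof (rule inj_onI)
    fix B C assume BC: "B \<in> reduced_matrices" "C \<in> reduced_matrices" "(B $ 1 $ 1, B $ 1 $ 2) = (C $ 1 $ 1, C $ 1 $ 2)"
    interpret B: quadratic_matrix \<mu> t D B using BC by (simp add: reduced_matrices_def)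
    interpret C: quadratic_matrix \<mu> t D C using BC by (simp add: reduced_matrices_def)
    have d: "B.d = C.d" using B.t_eq C.t_eq BC by simp
    have "B.b * B.c = B.b * C.c" using B.D_eq C.D_eq d BC by auto
    then have "B.c = C.c" using mult_left_cancel[OF B.b_nonzero] by blast
    then show "B = C" using d BC by (simp add: mat2_eq_iff)
  qed
  moreover have "(\<lambda>B. (B $ 1 $ 1, B $ 1 $ 2)) ` reduced_matrices \<subseteq> {-M..M} \<times> {-M..M}"
  proof
    fix z assume "z \<in> (\<lambda>B. (B $ 1 $ 1, B $ 1 $ 2)) ` reduced_matrices"
    then obtain B where B: "B \<in> reduced_matrices" "z = (B $ 1 $ 1, B $ 1 $ 2)" by blast
    have b: "\<bar>B $ 1 $ 2\<bar> \<le> (B $ 1 $ 2)^2"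
    proof (cases "B $ 1 $ 2 = 0")
      case False
      then have "1 * \<bar>B $ 1 $ 2\<bar> \<le> \<bar>B $ 1 $ 2\<bar> * \<bar>B $ 1 $ 2\<bar>" by (intro mult_right_mono) auto
      then show ?thesis by (simp add: power2_eq_square)
    qed simp
    have r: "\<bar>2 * B $ 1 $ 1 - t\<bar> \<le> \<bar>B $ 1 $ 2\<bar>" "3 * (B $ 1 $ 2)^2 \<le> \<bar>t^2 - 4 * D\<bar>"
      using B(1) by (simp_all add: reduced_matrices_def)
    then have "\<bar>B $ 1 $ 2\<bar> \<le> M" "\<bar>B $ 1 $ 1\<bar> \<le> M" using b unfolding M_def by linarith+
    then show "z \<in> {-M..M} \<times> {-M..M}" using B(2) by auto
  qed
  moreover have "finite ({-M..M} \<times> {-M..M})" by simp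
  ultimately show ?thesis using finite_imageD finite_subset by blast
qed

lemma (in quadratic) fractional_ideal_reduced:
  assumes "fractional_ideal \<O> I"
  obtains \<alpha> B where "B \<in> reduced_matrices" "\<alpha> \<in> K - {0}" "LM_ideal B \<mu> = (*) \<alpha> ` I"
proof -
  obtain \<alpha> A where A: "\<alpha> \<in> K - {0}" "quadratic_matrix \<mu> t D A" "LM_ideal A \<mu> = (*) \<alpha> ` I"
    using fractional_ideal_LM[OF assms] .
  obtain B where B: "B \<in> reduced_matrices" "mconj A B" using mconj_reduced_matrix[OF A(2)] .
  have Bq: "quadratic_matrix \<mu> t D B" using B(1) by (simp add: reduced_matrices_def)
  obtain \<beta> where \<beta>: "\<beta> \<in> K - {0}" "LM_ideal B \<mu> = (*) \<beta> ` LM_ideal A \<mu>"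
    using conj_imp_scaling[OF Bq A(2) mconj_sym[OF B(2)]] by blast
  have "LM_ideal B \<mu> = (*) (\<beta> * \<alpha>) ` I" unfolding \<beta>(2) A(3) by (auto simp: image_image mult.assoc)
  moreover have "\<beta> * \<alpha> \<in> K - {0}" using \<beta>(1) A(1) frac_field_simps(3)[OF subring] by auto
  ultimately show ?thesis using that B(1) by blast
qed

section \<open>Integer-valued functions additive modulo a number\<close>

context group
begin

text \<open>Integer lifts of homomorphisms to \<int> modulo \<open>r\<close>: the components of an
  element of \<open>H\<close> are known only up to congruence, so any integer-valued choice of them
  is additive only in this sense.\<close>

definition additive_mod :: "int => ('a => int) => bool" where
  "additive_mod r q \<longleftrightarrow> (\<forall>x\<in>carrier G. \<forall>y\<in>carrier G. r dvd q (x \<otimes> y) - (q x + q y))"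

lemma additive_modD:
  "additive_mod r q ==> x \<in> carrier G ==> y \<in> carrier G ==> r dvd q (x \<otimes> y) - (q x + q y)"
  by (simp add: additive_mod_def)

lemma additive_mod_one: "additive_mod r q ==> r dvd q \<one>"
  using additive_modD[of r q \<one> \<one>] by simp

lemma additive_mod_inv:
  assumes "additive_mod r q" "x \<in> carrier G"
  shows "r dvd q (inv x) + q x"
proof -
  have "r dvd q (inv x \<otimes> x) - (q (inv x) + q x)" by (rule additive_modD[OF assms(1) inv_closed[OF assms(2)] assms(2)])
  then have "r dvd q \<one> - (q \<one> - (q (inv x) + q x))" using additive_mod_one[OF assms(1)] assms(2) by (metis dvd_diff l_inv)
  then show ?thesis by simp
qed

lemma additive_mod_pow:
  assumes "additive_mod r q" "x \<in> carrier G"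
  shows "r dvd q (x [^] (k::int)) - k * q x"
proof -
  have n: "r dvd q (x [^] n) - int n * q x" for n :: nat
  proof (induction n)
    case 0 show ?case using additive_mod_one[OF assms(1)] by simp
  next
    case (Suc n)
    have "r dvd q (x [^] n \<otimes> x) - (q (x [^] n) + q x)" using assms by (simp add: additive_mod_def)
    then have "r dvd (q (x [^] n \<otimes> x) - (q (x [^] n) + q x)) + (q (x [^] n) - int n * q x)" using Suc dvd_add by blast
    then show ?case by (simp add: algebra_simps)
  qed
  show ?thesis
  proof (cases "k \<ge> 0")
    case True
    then have "int (nat k) = k" by simp
    then show ?thesis using n[of "nat k"] int_pow_int[of G x "nat k"] by metis
  next
    case False
    then have "k < 0" by simp
    then have e: "x [^] k = inv (x [^] nat (-k))" unfolding int_pow_def2 by (rule if_P)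
    have "r dvd (q (inv (x [^] nat (-k))) + q (x [^] nat (-k))) - (q (x [^] nat (-k)) - int (nat (-k)) * q x)"
      using additive_mod_inv[OF assms(1), of "x [^] nat (-k)"] n[of "nat (-k)"] assms(2) dvd_diff by blast
    then show ?thesis using \<open>k < 0\<close> unfolding e by simp
  qed
qed

lemma additive_mod_subgroup:
  assumes "additive_mod r q"
  shows "subgroup {x \<in> carrier G. r dvd q x} G"
proof (rule subgroupI)
  show "{x \<in> carrier G. r dvd q x} \<noteq> {}" using additive_mod_one[OF assms] by blast
next
  fix a assume "a \<in> {x \<in> carrier G. r dvd q x}"
  then show "inv a \<in> {x \<in> carrier G. r dvd q x}"
    using additive_mod_inv[OF assms, of a] by (simp add: dvd_add_left_iff)
next
  fix a b assume "a \<in> {x \<in> carrier G. r dvd q x}" "b \<in> {x \<in> carrier G. r dvd q x}"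
  then have ab: "a \<in> carrier G" "b \<in> carrier G" "r dvd q a + q b" "r dvd q (a \<otimes> b) - (q a + q b)"
    using assms by (simp_all add: additive_mod_def)
  then have "r dvd (q (a \<otimes> b) - (q a + q b)) + (q a + q b)" using dvd_add by blast
  then show "a \<otimes> b \<in> {x \<in> carrier G. r dvd q x}" using ab by simp
qed auto

lemma additive_mod_conj:
  assumes "additive_mod r q" "x \<in> carrier G" "y \<in> carrier G"
  shows "r dvd q (x \<otimes> y \<otimes> inv x) - q y"
proof -
  have a: "r dvd q (x \<otimes> y \<otimes> inv x) - (q (x \<otimes> y) + q (inv x))" and b: "r dvd q (x \<otimes> y) - (q x + q y)"
    using assms by (simp_all add: additive_mod_def)
  have "r dvd (q (x \<otimes> y \<otimes> inv x) - (q (x \<otimes> y) + q (inv x))) + (q (x \<otimes> y) - (q x + q y)) + (q (inv x) + q x)"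
    by (rule dvd_add[OF dvd_add[OF a b] additive_mod_inv[OF assms(1,2)]])
  then show ?thesis by (simp add: algebra_simps)
qed

lemma additive_mod_derived:
  assumes "additive_mod r q" "h \<in> derived G (carrier G)"
  shows "r dvd q h"
proof -
  have "derived G (carrier G) \<subseteq> {x \<in> carrier G. r dvd q x}"
    unfolding derived_def
  proof (rule generate_subgroup_incl[OF _ additive_mod_subgroup[OF assms(1)]])
    show "derived_set G (carrier G) \<subseteq> {x \<in> carrier G. r dvd q x}"
    proof
      fix z assume "z \<in> derived_set G (carrier G)"
      then obtain x y where xy: "x \<in> carrier G" "y \<in> carrier G" "z = x \<otimes> y \<otimes> inv x \<otimes> inv y" by blast
      have a: "r dvd q z - (q (x \<otimes> y \<otimes> inv x) + q (inv y))" using assms(1) xy by (simp add: additive_mod_def)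
      have "r dvd (q z - (q (x \<otimes> y \<otimes> inv x) + q (inv y))) + (q (x \<otimes> y \<otimes> inv x) - q y) + (q (inv y) + q y)"
        by (rule dvd_add[OF dvd_add[OF a additive_mod_conj[OF assms(1) xy(1,2)]] additive_mod_inv[OF assms(1) xy(2)]])
      then show "z \<in> {x \<in> carrier G. r dvd q x}" using xy by (simp add: algebra_simps)
    qed
  qed
  then show ?thesis using assms(2) by blast
qed

lemma dvd_kernel_fin_index_normal:
  assumes "\<And>i. i < d ==> int_hom G (carrier G) (\<phi> i)" "(n::int) > 0"
  shows "{h \<in> carrier G. \<forall>i<(d::nat). n dvd \<phi> i h} \<in> fin_index_normal G" (is "?L \<in> _")
proof -
  note S = subgroup_self
  have sub: "subgroup ?L G"
    by (rule subgroupI)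
      (auto simp: int_hom_inv[OF S assms(1)] int_homD[OF assms(1)] int_hom_one[OF S assms(1)] intro!: exI[of _ \<one>])
  have "?L \<lhd> G"
    unfolding normal_inv_iff
    by (intro conjI ballI sub) (auto simp: int_hom_inv[OF S assms(1)] int_homD[OF assms(1)])
  moreover have "finite (rcosets ?L)"
  proof (rule finite_rcosetsI[OF sub])
    let ?f = "\<lambda>h. (\<lambda>i\<in>{..<d}. \<phi> i h mod n)"
    have "?f ` carrier G \<subseteq> {..<d} \<rightarrow>\<^sub>E {0..<n}" using assms(2) by auto
    then show "finite (?f ` carrier G)" by (rule finite_subset) (simp add: finite_PiE)
    fix x y assume xy: "x \<in> carrier G" "y \<in> carrier G" "?f x = ?f y"
    have "n dvd \<phi> i x - \<phi> i y" if "i < d" for i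
      using fun_cong[OF xy(3), of i] that by (simp add: mod_eq_dvd_iff)
    then show "x \<otimes> inv y \<in> ?L" using xy int_hom_inv[OF S assms(1)] int_homD[OF assms(1)] by simp
  qed
  ultimately show ?thesis by (simp add: fin_index_normal_def)
qed

end

section \<open>Homomorphisms from a group in the genus to the integers\<close>

context semidirect_family
begin

lemma rep_same:
  assumes "trivial_mod A r m" "h \<in> carrier H" "h' \<in> carrier H" "R r m h v k" "R r m h' v k"
  shows "R r m (h \<otimes> inv h') 0 0"
  using rep_mult[OF assms(1,2) inv_closed[OF assms(3)] assms(4) rep_inv[OF assms(1,3,5)]] inv_A
  by (simp add: matvec_minus)

definition kpart :: "int => int => 'a => int" where
  "kpart r m h = (SOME k. \<exists>v. R r m h v k)"

lemma kpart_rep: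
  assumes "trivial_mod A r m" "h \<in> carrier H"
  shows "\<exists>v. R r m h v (kpart r m h)"
  unfolding kpart_def by (rule someI_ex) (use rep_exists[OF assms] in blast)

lemma kpart_dvd:
  assumes "trivial_mod A r m" "h \<in> carrier H" "R r m h v k"
  shows "m dvd kpart r m h - k"
  using kpart_rep[OF assms(1,2)] rep_iff[OF assms] by blast

lemma kpart_additive:
  assumes "trivial_mod A r m"
  shows "additive_mod m (kpart r m)"
  unfolding additive_mod_def
proof (intro ballI)
  fix x y assume xy: "x \<in> carrier H" "y \<in> carrier H"
  obtain v w where "R r m x v (kpart r m x)" "R r m y w (kpart r m y)" using kpart_rep[OF assms] xy by blast
  then show "m dvd kpart r m (x \<otimes> y) - (kpart r m x + kpart r m y)"
    using kpart_dvd[OF assms _ rep_mult[OF assms xy]] xy by blast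
qed

lemma kpart_mono:
  assumes "trivial_mod A r m" "trivial_mod A r' m'" "r dvd r'" "m dvd m'" "h \<in> carrier H"
  shows "m dvd kpart r m h - kpart r' m' h"
  using kpart_rep[OF assms(2,5)] rep_mono[OF assms] kpart_dvd[OF assms(1,5)] by blast

lemma kpart_zero_rep:
  assumes "trivial_mod A r m" "h \<in> carrier H" "m dvd kpart r m h - k"
  shows "\<exists>v. R r m h v k"
proof -
  obtain v where v: "R r m h v (kpart r m h)" using kpart_rep[OF assms(1,2)] by blast
  then have "R r m h v k" using rep_iff[OF assms(1,2) v] assms(3) by (simp add: dvd_diff_commute)
  then show ?thesis by blast
qed

text \<open>Pass to the modulus \<open>m * e\<close>: there \<open>e\<close> times the component of
  \<open>h\<close> vanishes, so the component vanishes modulo \<open>m\<close>. In effect, torsion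
  of the abelianization cannot be seen in a torsion-free completion.\<close>

lemma torsion_kpart:
  assumes "trivial_mod A r m" "h \<in> carrier H" "e > 0" "h [^] (e::nat) \<in> derived H (carrier H)"
  shows "m dvd kpart r m h"
proof -
  have T: "trivial_mod A r (m * int e)" using trivial_mod_mult[OF inv_A assms(1)] assms(3) by simp
  have "m * int e dvd kpart r (m * int e) (h [^] e)" by (rule additive_mod_derived[OF kpart_additive[OF T] assms(4)])
  moreover have "m * int e dvd kpart r (m * int e) (h [^] int e) - int e * kpart r (m * int e) h"
    by (rule additive_mod_pow[OF kpart_additive[OF T] assms(2)])
  ultimately have "m * int e dvd int e * kpart r (m * int e) h"
    unfolding int_pow_int by (metis dvd_diff_right_iff)
  then have "m dvd kpart r (m * int e) h" using assms(3) by (simp add: mult.commute)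
  moreover have "m dvd kpart r m h - kpart r (m * int e) h" by (rule kpart_mono[OF assms(1) T _ _ assms(2)]) simp_all
  ultimately show ?thesis by (metis dvd_add diff_add_cancel)
qed

text \<open>In a finite quotient of \<open>GA\<close> every element becomes one of eight
  representatives after squares are removed on both sides. The common kernel of the
  \<open>\<phi> i\<close> modulo \<open>2\<close> contains the elements trivial at a suitable level
  \<open>n\<close>, so the eight representatives realize all values modulo \<open>2\<close>.\<close>

lemma dual_system_bound:
  assumes "dual_system H (carrier H) d \<phi> x"
  shows "d \<le> 3"
proof -
  have h: "\<And>i. i < d ==> int_hom H (carrier H) (\<phi> i)" using assms by (simp add: dual_system_def)
  let ?L = "{h \<in> carrier H. \<forall>i<d. 2 dvd \<phi> i h}"
  have "?L \<in> fin_index_normal H" by (rule dvd_kernel_fin_index_normal[OF h]) simp_all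
  then obtain n where n: "n > 0"
    "\<And>r m h. trivial_mod A r m ==> n dvd r ==> n dvd m ==> h \<in> carrier H ==> R r m h 0 0 ==> h \<in> ?L"
    using rep_cofinal by blast
  obtain m where T: "trivial_mod A n m" "n dvd m" using trivial_mod_exists[OF inv_A n(1) n(1)] by blast
  have "\<exists>h. h \<in> carrier H \<and> R n m h v k" for v k using rep_surj[OF T(1)] by blast
  then obtain g where g: "\<And>v k. g v k \<in> carrier H" "\<And>v k. R n m (g v k) v k" by metis
  let ?F = "\<lambda>(a::int, b::int, k::int). g (vector [a, b]) k"
  let ?R = "?F ` ({0,1} \<times> {0,1} \<times> {0,1})"
  have "2 ^ d \<le> card ?R"
  proof (rule dual_system_card[OF subgroup_self assms])
    show "finite ?R" by simp
    show "?R \<subseteq> carrier H" using g by auto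
    fix h0 assume h0: "h0 \<in> carrier H"
    obtain v k where v: "R n m h0 v k" using rep_exists[OF T(1) h0] by blast
    define \<epsilon> w where "\<epsilon> = (vector [v $ 1 mod 2, v $ 2 mod 2] :: int^2)" and "w = (vector [v $ 1 div 2, v $ 2 div 2] :: int^2)"
    \<comment> \<open>The square with the vector part stands on the left and the square with the
      \<int>-part on the right, so that the action of \<open>A\<close> does not interfere.\<close>
    define y1 \<rho> y2 where "y1 = g w 0" and "\<rho> = g \<epsilon> (k mod 2)" and "y2 = g 0 (k div 2)"
    have c: "y1 \<in> carrier H" "\<rho> \<in> carrier H" "y2 \<in> carrier H" using g by (simp_all add: y1_def \<rho>_def y2_def)
    have "R n m (y1 \<otimes> y1) (w + mpow A 0 *v w) (0 + 0)"
      using rep_mult[OF T(1) c(1) c(1)] g unfolding y1_def by blast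
    moreover have "R n m (y2 \<otimes> y2) (0 + mpow A (k div 2) *v 0) (k div 2 + k div 2)"
      using rep_mult[OF T(1) c(3) c(3)] g unfolding y2_def by blast
    moreover have "R n m \<rho> \<epsilon> (k mod 2)" using g by (simp add: \<rho>_def)
    ultimately have "R n m ((y1 \<otimes> y1 \<otimes> \<rho>) \<otimes> (y2 \<otimes> y2)) ((w + w) + \<epsilon>) (k mod 2 + (k div 2 + k div 2))"
      using rep_mult[OF T(1) m_closed[OF m_closed[OF c(1) c(1)] c(2)] m_closed[OF c(3) c(3)]
          rep_mult[OF T(1) m_closed[OF c(1) c(1)] c(2)]] by force
    moreover have "(w + w) + \<epsilon> = v" by (simp add: w_def \<epsilon>_def vec2_eq_iff)
    moreover have "k mod 2 + (k div 2 + k div 2) = k" by presburger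
    ultimately have "R n m ((y1 \<otimes> y1 \<otimes> \<rho>) \<otimes> (y2 \<otimes> y2)) v k" by simp
    then have "h0 \<otimes> inv ((y1 \<otimes> y1 \<otimes> \<rho>) \<otimes> (y2 \<otimes> y2)) \<in> ?L"
      using rep_same[OF T(1) h0 _ v] c h0 by (intro n(2)[OF T(1) dvd_refl T(2)]) simp_all
    then have "2 dvd \<phi> i h0 - (2 * \<phi> i y1 + \<phi> i \<rho> + 2 * \<phi> i y2)" if "i < d" for i
      using that c h0 int_homD[OF h[OF that]] int_hom_inv[OF subgroup_self h[OF that]] by auto
    then have "\<forall>i<d. even (\<phi> i h0 - \<phi> i \<rho>)" by (auto simp: algebra_simps)
    moreover have "\<rho> \<in> ?R"
    proof -
      have m2: "i mod 2 \<in> {0, 1}" for i :: int by (cases "even i") auto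
      have "(v $ 1 mod 2, v $ 2 mod 2, k mod 2) \<in> {0,1} \<times> {0,1} \<times> {0,1}" by (intro SigmaI m2)
      then have "?F (v $ 1 mod 2, v $ 2 mod 2, k mod 2) \<in> ?R" by (rule imageI)
      then show ?thesis by (simp only: \<rho>_def \<epsilon>_def split_conv)
    qed
    ultimately show "\<exists>\<rho>\<in>?R. \<forall>i<d. even (\<phi> i h0 - \<phi> i \<rho>)" by blast
  qed
  also have "card ?R \<le> card ({0,1::int} \<times> {0,1::int} \<times> {0,1::int})" by (rule card_image_le) simp
  also have "\<dots> = 2 ^ 3" by (simp add: card_cartesian_product)
  finally show ?thesis by (rule power_le_imp_le_exp[rotated]) simp
qed

text \<open>\<open>4\<close> exceeds the bound of \<open>dual_system_bound\<close>, so the splitting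
  process must have stopped with a finite kernel.\<close>

lemma abelianization:
  assumes "noetherian_in H (carrier H)"
  obtains d \<phi> x e where "dual_system H (carrier H) d \<phi> x" "(e::nat) > 0"
    "\<And>h. h \<in> carrier H ==> (\<And>i. i < d ==> \<phi> i h = 0) ==> h [^] e \<in> derived H (carrier H)"
proof -
  obtain d' \<phi> x where d: "d' \<le> 4" "dual_system H (carrier H) d' \<phi> x"
    "d' = 4 \<or> (\<exists>e>0. \<forall>h\<in>carrier H. (\<forall>i<d'. \<phi> i h = 0) \<longrightarrow> h [^] (e::nat) \<in> derived H (carrier H))"
    by (rule abelianization_dual_system[OF assms, where d = 4])
  have "d' \<noteq> 4" using dual_system_bound[OF d(2)] by simp
  then obtain e :: nat where "e > 0" "\<forall>h\<in>carrier H. (\<forall>i<d'. \<phi> i h = 0) \<longrightarrow> h [^] e \<in> derived H (carrier H)" using d(3) by blast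
  then show thesis using that[OF d(2)] by blast
qed

lemma trivial_mod_1: "m > 0 ==> trivial_mod A 1 m"
  by (simp add: trivial_mod_def vdvd_def)

text \<open>Here both abelianizations have rank one.\<close>

lemma projection_main:
  assumes "noetherian_in H (carrier H)" and det: "det (A - mat 1) \<noteq> 0"
  obtains \<pi> t where "int_hom H (carrier H) \<pi>" "t \<in> carrier H" "\<pi> t = 1"
    "\<And>h r m. h \<in> carrier H ==> \<pi> h = 0 ==> trivial_mod A r m ==> m dvd kpart r m h"
proof -
  obtain d \<phi> x and e :: nat where ds: "dual_system H (carrier H) d \<phi> x" and e: "e > 0"
    "\<And>h. h \<in> carrier H ==> (\<And>i. i < d ==> \<phi> i h = 0) ==> h [^] e \<in> derived H (carrier H)"
    using abelianization[OF assms(1)] by blast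
  have h: "\<And>i. i < d ==> int_hom H (carrier H) (\<phi> i)" and xc: "\<And>i. i < d ==> x i \<in> carrier H"
    and dual: "\<And>i j. i < d ==> j < d ==> \<phi> i (x j) = (if i = j then 1 else 0)"
    using ds by (auto simp: dual_system_def)
  have "d \<noteq> 0"
  proof
    assume "d = 0"
    then have D: "\<And>h. h \<in> carrier H ==> h [^] e \<in> derived H (carrier H)" using e by simp
    \<comment> \<open>\<open>int e + 1\<close> serves as a modulus greater than \<open>1\<close>:
      all components would vanish modulo it, although the component \<open>1\<close> occurs.\<close>
    have T: "trivial_mod A 1 (int e + 1)" by (rule trivial_mod_1) simp
    obtain h where h: "h \<in> carrier H" "R 1 (int e + 1) h 0 1" using rep_surj[OF T] .
    have "int e + 1 dvd kpart 1 (int e + 1) h" "int e + 1 dvd kpart 1 (int e + 1) h - 1"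
      using torsion_kpart[OF T h(1) e(1) D[OF h(1)]] kpart_dvd[OF T h] by simp_all
    then have "int e + 1 dvd kpart 1 (int e + 1) h - (kpart 1 (int e + 1) h - 1)" by (rule dvd_diff)
    then show False using e(1) zdvd_imp_le[of "int e + 1" 1] by simp
  qed
  \<comment> \<open>\<open>n\<close> is chosen prime to \<open>\<delta>\<close>. Since
    \<open>\<delta> v = A w - w\<close> comes from a commutator, every \<open>\<phi> i\<close>
    vanishes modulo \<open>n\<close> on elements without \<int>-component. Modulo \<open>n\<close>
    the values of the \<open>\<phi> i\<close> are then multiples of their values at the single
    element \<open>s\<close>, which is impossible for two independent homomorphisms.\<close>
  moreover have "\<not> d \<ge> 2"
  proof
    assume d2: "d \<ge> 2"
    define \<delta> where "\<delta> = det (A - mat 1)"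
    define n where "n = \<bar>\<delta>\<bar> + 1"
    have n2: "n \<ge> 2" using det by (simp add: n_def \<delta>_def)
    let ?L = "{h \<in> carrier H. \<forall>i<d. n dvd \<phi> i h}"
    have "?L \<in> fin_index_normal H" by (rule dvd_kernel_fin_index_normal[OF h]) (use n2 in simp_all)
    then obtain N where N: "N > 0"
      "\<And>r m h. trivial_mod A r m ==> N dvd r ==> N dvd m ==> h \<in> carrier H ==> R r m h 0 0 ==> h \<in> ?L"
      using rep_cofinal by blast
    obtain m where T: "trivial_mod A N m" "N dvd m" using trivial_mod_exists[OF inv_A N(1) N(1)] by blast
    obtain s where s: "s \<in> carrier H" "R N m s 0 1" using rep_surj[OF T(1)] .
    have base: "n dvd \<phi> i h'" if h': "h' \<in> carrier H" "R N m h' v 0" and i: "i < d" for h' v i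
    proof -
      define w where "w = adj2 (A - mat 1) *v v"
      have "A *v w - w = \<delta> *s v"
        by (simp add: w_def \<delta>_def vec2_eq_iff mat2_vec_nth det_2 adj2_def algebra_simps)
      obtain g where g: "g \<in> carrier H" "R N m g w 0" using rep_surj[OF T(1)] .
      have "R N m (s \<otimes> g) (0 + mpow A 1 *v w) (1 + 0)" by (rule rep_mult[OF T(1) s(1) g(1) s(2) g(2)])
      moreover have "R N m (inv s) (- (mpow A (-1) *v 0)) (- 1)" by (rule rep_inv[OF T(1) s])
      ultimately have "R N m (s \<otimes> g \<otimes> inv s) (A *v w) 0"
        using rep_mult[OF T(1) m_closed[OF s(1) g(1)] inv_closed[OF s(1)]] mpow_1[OF inv_A] by force
      moreover have "R N m (inv g) (- w) 0" using rep_inv[OF T(1) g] by simp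
      ultimately have "R N m (s \<otimes> g \<otimes> inv s \<otimes> inv g) (A *v w + mpow A 0 *v (- w)) (0 + 0)"
        using rep_mult[OF T(1) m_closed[OF m_closed[OF s(1) g(1)] inv_closed[OF s(1)]] inv_closed[OF g(1)]] by blast
      then have "R N m (s \<otimes> g \<otimes> inv s \<otimes> inv g) (\<delta> *s v) 0" using \<open>A *v w - w = \<delta> *s v\<close> by simp
      moreover have "R N m (h' [^] \<delta>) (\<delta> *s v) 0" using rep_pow[OF T(1) h' mpow_0, of \<delta>] by simp
      ultimately have "h' [^] \<delta> \<otimes> inv (s \<otimes> g \<otimes> inv s \<otimes> inv g) \<in> ?L"
        using rep_same[OF T(1)] s(1) g(1) h'(1) by (intro N(2)[OF T(1) dvd_refl T(2)]) simp_all
      then have "n dvd \<phi> i (h' [^] \<delta> \<otimes> inv (s \<otimes> g \<otimes> inv s \<otimes> inv g))" using i by simp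
      moreover have "\<phi> i (h' [^] \<delta> \<otimes> inv (s \<otimes> g \<otimes> inv s \<otimes> inv g)) = \<delta> * \<phi> i h'"
        using s(1) g(1) h'(1) int_homD[OF h[OF i]] int_hom_inv[OF subgroup_self h[OF i]]
          int_hom_int_pow[OF subgroup_self h[OF i] h'(1)] by simp
      ultimately have "n dvd \<delta> * \<phi> i h'" by simp
      then have "n dvd \<bar>\<delta>\<bar> * \<phi> i h'" by (cases "\<delta> \<ge> 0") simp_all
      then have "n dvd n * \<phi> i h' - \<bar>\<delta>\<bar> * \<phi> i h'" by (intro dvd_diff) simp_all
      then show ?thesis by (simp add: n_def algebra_simps)
    qed
    have step: "\<exists>k. \<forall>i<d. n dvd \<phi> i h' - k * \<phi> i s" if h': "h' \<in> carrier H" for h'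
    proof -
      obtain v k where v: "R N m h' v k" using rep_exists[OF T(1) h'] by blast
      have "m dvd kpart N m (h' \<otimes> s [^] (-k)) - (kpart N m h' + kpart N m (s [^] (-k)))"
        using kpart_additive[OF T(1)] h' s(1) by (simp add: additive_mod_def)
      moreover have "m dvd kpart N m (s [^] (-k)) - (-k) * kpart N m s" by (rule additive_mod_pow[OF kpart_additive[OF T(1)] s(1)])
      moreover have "m dvd (-k) * (kpart N m s - 1)" using kpart_dvd[OF T(1) s] by (rule dvd_mult)
      moreover have "m dvd kpart N m h' - k" by (rule kpart_dvd[OF T(1) h' v])
      ultimately have "m dvd (kpart N m (h' \<otimes> s [^] (-k)) - (kpart N m h' + kpart N m (s [^] (-k))))
          + (kpart N m (s [^] (-k)) - (-k) * kpart N m s) + (-k) * (kpart N m s - 1) + (kpart N m h' - k)"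
        by (intro dvd_add)
      then have "m dvd kpart N m (h' \<otimes> s [^] (-k)) - 0" by (simp add: algebra_simps)
      then obtain w where "R N m (h' \<otimes> s [^] (-k)) w 0" using kpart_zero_rep[OF T(1)] h' s(1) by blast
      then have "n dvd \<phi> i (h' \<otimes> s [^] (-k))" if "i < d" for i
        using base[OF _ _ that] h' s(1) by blast
      then have "\<forall>i<d. n dvd \<phi> i h' - k * \<phi> i s"
        using int_homD[OF h] int_hom_int_pow[OF subgroup_self h s(1)] h' s(1) by simp
      then show ?thesis by blast
    qed
    obtain k0 k1 where k: "\<forall>i<d. n dvd \<phi> i (x 0) - k0 * \<phi> i s" "\<forall>i<d. n dvd \<phi> i (x 1) - k1 * \<phi> i s"
      using step xc d2 by (meson less_le_trans one_less_numeral_iff pos2 semiring_norm(76))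
    have a: "n dvd 1 - k0 * \<phi> 0 s" "n dvd 0 - k0 * \<phi> 1 s" "n dvd 0 - k1 * \<phi> 0 s" "n dvd 1 - k1 * \<phi> 1 s"
      using k(1)[rule_format, of 0] k(1)[rule_format, of 1] k(2)[rule_format, of 0] k(2)[rule_format, of 1] d2 dual
      by simp_all
    \<comment> \<open>Modulo \<open>n\<close> the identity matrix would be the product of the column
      \<open>(k0, k1)\<close> and the row \<open>(\<phi> 0 s, \<phi> 1 s)\<close>, whose determinant
      is \<open>0\<close>.\<close>
    have "n dvd (1 - k0 * \<phi> 0 s) + (1 - k1 * \<phi> 1 s) * (k0 * \<phi> 0 s) - (0 - k0 * \<phi> 1 s) * (k1 * \<phi> 0 s)"
      by (rule dvd_diff[OF dvd_add[OF a(1) dvd_mult2[OF a(4)]] dvd_mult2[OF a(2)]])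
    then have "n dvd 1 + (k0 * \<phi> 0 s) * 0" by (simp add: algebra_simps)
    then show False using n2 zdvd_imp_le[of n 1] by simp
  qed
  ultimately have d: "d = 1" by simp
  show ?thesis
  proof (rule that[of "\<phi> 0" "x 0"])
    show "int_hom H (carrier H) (\<phi> 0)" "x 0 \<in> carrier H" "\<phi> 0 (x 0) = 1" using h xc dual d by simp_all
    fix h r m assume hh: "h \<in> carrier H" "\<phi> 0 h = 0" "trivial_mod A r m"
    then have "h [^] e \<in> derived H (carrier H)" using d by (intro e(2)) simp_all
    then show "m dvd kpart r m h" by (rule torsion_kpart[OF hh(3,1) e(1)])
  qed
qed

text \<open>Some element has component \<open>1\<close>, which makes the component of
  \<open>t\<close> a unit. For surjectivity, a preimage of \<open>(v, 0)\<close> is taken at a finer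
  level and corrected by the power \<open>t [^] \<pi> h\<close>, which is trivial at the coarser
  one.\<close>

lemma surjective_main:
  assumes \<pi>: "int_hom H (carrier H) \<pi>" "t \<in> carrier H" "\<pi> t = 1"
    and ker: "\<And>h r m. h \<in> carrier H ==> \<pi> h = 0 ==> trivial_mod A r m ==> m dvd kpart r m h"
    and T: "trivial_mod A r m"
  shows "\<exists>u'. m dvd u' * kpart r m t - 1" "\<exists>h\<in>carrier H. \<pi> h = 0 \<and> R r m h v 0"
proof -
  \<comment> \<open>The element \<open>h \<otimes> t [^] (- \<pi> h)\<close> lies in the kernel of
    \<open>\<pi>\<close>, so the component of \<open>h\<close> is \<open>\<pi> h\<close> times that
    of \<open>t\<close>.\<close>
  have kp: "m' dvd kpart r m' h - \<pi> h * kpart r m' t" if T': "trivial_mod A r m'" and h: "h \<in> carrier H" for h m'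
  proof -
    have c: "h \<otimes> t [^] (- \<pi> h) \<in> carrier H" using h \<pi>(2) by simp
    have "\<pi> (h \<otimes> t [^] (- \<pi> h)) = 0"
      using int_homD[OF \<pi>(1)] int_hom_int_pow[OF subgroup_self \<pi>(1,2)] h \<pi>(2,3) by simp
    then have p: "m' dvd kpart r m' (h \<otimes> t [^] (- \<pi> h))" using ker[OF c _ T'] by simp
    have q: "m' dvd kpart r m' (h \<otimes> t [^] (- \<pi> h)) - (kpart r m' h + kpart r m' (t [^] (- \<pi> h)))"
      using kpart_additive[OF T'] h \<pi>(2) by (simp add: additive_mod_def)
    have u: "m' dvd kpart r m' (t [^] (- \<pi> h)) - (- \<pi> h) * kpart r m' t"
      by (rule additive_mod_pow[OF kpart_additive[OF T'] \<pi>(2)])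
    have "m' dvd kpart r m' (h \<otimes> t [^] (- \<pi> h)) - (kpart r m' (h \<otimes> t [^] (- \<pi> h)) - (kpart r m' h + kpart r m' (t [^] (- \<pi> h))))
        - (kpart r m' (t [^] (- \<pi> h)) - (- \<pi> h) * kpart r m' t)"
      by (rule dvd_diff[OF dvd_diff[OF p q] u])
    then show ?thesis by (simp add: algebra_simps)
  qed
  have unit: "\<exists>u'. m' dvd u' * kpart r m' t - 1" if T': "trivial_mod A r m'" for m'
  proof -
    obtain h where h: "h \<in> carrier H" "R r m' h 0 1" using rep_surj[OF T'] .
    have "m' dvd (kpart r m' h - 1) - (kpart r m' h - \<pi> h * kpart r m' t)"
      using kpart_dvd[OF T' h] kp[OF T' h(1)] by (rule dvd_diff)
    then have "m' dvd \<pi> h * kpart r m' t - 1" by simp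
    then show ?thesis by blast
  qed
  then show "\<exists>u'. m dvd u' * kpart r m t - 1" using T by blast
  have r0: "r > 0" using T by (simp add: trivial_mod_def)
  \<comment> \<open>At this level \<open>m * r\<close> divides \<open>\<pi> h\<close>: the factor
    \<open>m\<close> removes the \<int>-part of \<open>t [^] \<pi> h\<close>, the factor
    \<open>r\<close> its vector part.\<close>
  have T': "trivial_mod A r (m * r)" by (rule trivial_mod_mult[OF inv_A T r0])
  obtain h where h: "h \<in> carrier H" "R r (m * r) h v 0" using rep_surj[OF T'] .
  obtain u' where u': "m * r dvd u' * kpart r (m * r) t - 1" using unit[OF T'] by blast
  have "m * r dvd kpart r (m * r) h - 0" by (rule kpart_dvd[OF T' h])
  then have "m * r dvd (kpart r (m * r) h - 0) - (kpart r (m * r) h - \<pi> h * kpart r (m * r) t)"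
    using kp[OF T' h(1)] by (rule dvd_diff)
  then have p: "m * r dvd \<pi> h * kpart r (m * r) t" by simp
  have "m * r dvd (\<pi> h * kpart r (m * r) t) * u' - \<pi> h * (u' * kpart r (m * r) t - 1)"
    by (rule dvd_diff[OF dvd_mult2[OF p] dvd_mult[OF u']])
  then have "m * r dvd \<pi> h" by (simp add: algebra_simps)
  then obtain l where l: "\<pi> h = (m * r) * l" by blast
  have "m dvd kpart r m (t [^] m) - m * kpart r m t" by (rule additive_mod_pow[OF kpart_additive[OF T] \<pi>(2)])
  then have "m dvd (kpart r m (t [^] m) - m * kpart r m t) + m * kpart r m t" by (intro dvd_add) simp_all
  then have "m dvd kpart r m (t [^] m) - 0" by simp
  then obtain w where w: "R r m (t [^] m) w 0" using kpart_zero_rep[OF T] \<pi>(2) by blast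
  have "R r m ((t [^] m) [^] (r * l)) ((r * l) *s w) ((r * l) * 0)"
    by (rule rep_pow[OF T _ w mpow_0]) (use \<pi>(2) in simp)
  moreover have "(t [^] m) [^] (r * l) = t [^] \<pi> h" using \<pi>(2) l by (simp add: int_pow_pow mult.assoc)
  ultimately have tw: "R r m (t [^] \<pi> h) ((r * l) *s w) 0" by simp
  have "vdvd r (0 - (r * l) *s w)" by (simp add: vdvd_def)
  then have "R r m (t [^] \<pi> h) 0 0" using rep_iff[OF T int_pow_closed[OF \<pi>(2)] tw, of 0 0] by simp
  then have "R r m (inv (t [^] \<pi> h)) 0 0" using rep_inv[OF T, of "t [^] \<pi> h" 0 0] \<pi>(2) by simp
  moreover have "R r m h v 0" by (rule rep_mono[OF T T' _ _ h]) simp_all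
  ultimately have "R r m (h \<otimes> inv (t [^] \<pi> h)) v 0"
    using rep_mult[OF T h(1), of "inv (t [^] \<pi> h)" v 0 0 0] \<pi>(2) by simp
  moreover have "\<pi> (h \<otimes> inv (t [^] \<pi> h)) = 0"
    using int_homD[OF \<pi>(1)] int_hom_int_pow[OF subgroup_self \<pi>(1,2)] int_hom_inv[OF subgroup_self \<pi>(1)] h(1) \<pi>(2,3) by simp
  ultimately show "\<exists>h\<in>carrier H. \<pi> h = 0 \<and> R r m h v 0" using h(1) \<pi>(2) by (intro bexI[of _ "h \<otimes> inv (t [^] \<pi> h)"]) simp_all
qed

text \<open>
  For an involution \<open>A\<close> the abelianization may have higher rank; it suffices that the projection
  to \<open>\<int>\<close> agrees with the given one modulo \<open>2\<close>.
\<close>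

lemma projection_involution:
  assumes "noetherian_in H (carrier H)"
  obtains \<pi> t where "int_hom H (carrier H) \<pi>" "t \<in> carrier H" "\<pi> t = 1"
    "\<And>h. h \<in> carrier H ==> even (kpart 1 2 h - \<pi> h)"
proof -
  obtain d \<phi> x and e :: nat where ds: "dual_system H (carrier H) d \<phi> x" and e: "e > 0"
    "\<And>h. h \<in> carrier H ==> (\<And>i. i < d ==> \<phi> i h = 0) ==> h [^] e \<in> derived H (carrier H)"
    using abelianization[OF assms(1)] by blast
  have h: "\<And>i. i < d ==> int_hom H (carrier H) (\<phi> i)" and xc: "\<And>i. i < d ==> x i \<in> carrier H"
    and dual: "\<And>i j. i < d ==> j < d ==> \<phi> i (x j) = (if i = j then 1 else 0)"
    using ds by (auto simp: dual_system_def)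
  have T: "trivial_mod A 1 2" by (rule trivial_mod_1) simp
  let ?\<kappa> = "kpart 1 2"
  have add: "even (?\<kappa> (a \<otimes> b) - (?\<kappa> a + ?\<kappa> b))" if "a \<in> carrier H" "b \<in> carrier H" for a b
    using kpart_additive[OF T] that by (simp add: additive_mod_def)
  \<comment> \<open>The coefficients are reduced to \<open>0\<close> or \<open>1\<close>: this
    preserves parities, and a coefficient equal to \<open>1\<close> yields an element on which
    \<open>\<pi>\<close> is exactly \<open>1\<close>.\<close>
  define \<pi> where "\<pi> h = (\<Sum>i<d. (?\<kappa> (x i) mod 2) * \<phi> i h)" for h
  have \<pi>: "int_hom H (carrier H) \<pi>"
    unfolding int_hom_def \<pi>_def using int_homD[OF h] by (simp add: distrib_left sum.distrib)
  have cong: "even (?\<kappa> h - \<pi> h)" if hc: "h \<in> carrier H" for h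
  proof -
    have "\<exists>y\<in>carrier H. (\<forall>i<d. \<phi> i y = (if i < j then \<phi> i h else 0)) \<and> even (?\<kappa> y - (\<Sum>i<j. (?\<kappa> (x i) mod 2) * \<phi> i h))"
      if "j \<le> d" for j
      using that
    proof (induction j)
      case 0
      have "2 dvd ?\<kappa> \<one>" by (rule additive_mod_one[OF kpart_additive[OF T]])
      then show ?case using int_hom_one[OF subgroup_self h] by (intro bexI[of _ \<one>]) auto
    next
      case (Suc j)
      then have j: "j < d" by simp
      obtain y where y: "y \<in> carrier H" "\<forall>i<d. \<phi> i y = (if i < j then \<phi> i h else 0)"
        "even (?\<kappa> y - (\<Sum>i<j. (?\<kappa> (x i) mod 2) * \<phi> i h))" using Suc by auto
      let ?z = "x j [^] \<phi> j h"
      have z: "?z \<in> carrier H" using xc[OF j] by simp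
      have "\<phi> i (y \<otimes> ?z) = (if i < Suc j then \<phi> i h else 0)" if i: "i < d" for i
        using int_homD[OF h[OF i] y(1) z] int_hom_int_pow[OF subgroup_self h[OF i] xc[OF j]] dual[OF i j] y(2) i
        by (auto simp: less_Suc_eq)
      moreover have "even (?\<kappa> ?z - \<phi> j h * ?\<kappa> (x j))" by (rule additive_mod_pow[OF kpart_additive[OF T] xc[OF j]])
      then have "even (?\<kappa> (y \<otimes> ?z) - (\<Sum>i<Suc j. (?\<kappa> (x i) mod 2) * \<phi> i h))"
        using y(3) add[OF y(1) z] by (simp add: even_add) (auto simp: even_mod_2_iff)
      ultimately show ?case using y(1) z by blast
    qed
    then obtain y where y: "y \<in> carrier H" "\<forall>i<d. \<phi> i y = \<phi> i h" "even (?\<kappa> y - \<pi> h)"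
      unfolding \<pi>_def by (metis (no_types, lifting) order_refl)
    \<comment> \<open>All \<open>\<phi> i\<close> vanish on this element, so a power of it lies in
      the derived subgroup and its component is even.\<close>
    have c: "h \<otimes> inv y \<in> carrier H" using hc y(1) by simp
    have "(h \<otimes> inv y) [^] e \<in> derived H (carrier H)"
      by (rule e(2)[OF c]) (use y hc int_homD[OF h] int_hom_inv[OF subgroup_self h] in simp)
    then have "even (?\<kappa> (h \<otimes> inv y))" by (rule torsion_kpart[OF T c e(1)])
    moreover have "even (?\<kappa> (h \<otimes> inv y) - (?\<kappa> h + ?\<kappa> (inv y)))" using add hc y(1) by simp
    moreover have "even (?\<kappa> (inv y) + ?\<kappa> y)" by (rule additive_mod_inv[OF kpart_additive[OF T] y(1)])
    ultimately show ?thesis using y(3) by simp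
  qed
  have "\<exists>j<d. ?\<kappa> (x j) mod 2 = 1"
  proof (rule ccontr)
    assume "\<not> (\<exists>j<d. ?\<kappa> (x j) mod 2 = 1)"
    then have "?\<kappa> (x j) mod 2 = 0" if "j < d" for j using that by (metis mod2_eq_if)
    then have z: "\<pi> h = 0" for h by (simp add: \<pi>_def)
    obtain h where hh: "h \<in> carrier H" "R 1 2 h 0 1" using rep_surj[OF T] .
    then have "even (?\<kappa> h)" "even (?\<kappa> h - 1)" using cong[OF hh(1)] z kpart_dvd[OF T hh] by simp_all
    then show False by simp
  qed
  then obtain j where j: "j < d" "?\<kappa> (x j) mod 2 = 1" by blast
  have "\<pi> (x j) = (\<Sum>i<d. if i = j then 1 else 0)"
    unfolding \<pi>_def by (rule sum.cong) (use dual j in auto)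
  then have "\<pi> (x j) = 1" using j(1) by simp
  then show ?thesis using that[OF \<pi> xc[OF j(1)]] cong by blast
qed

end

section \<open>An abelian subgroup of a group in the genus and its rank\<close>

text \<open>
  The kernel \<open>c = 0\<close> of the projection, or for \<open>c = 2\<close> and \<open>A\<^sup>2 = 1\<close> the preimage
  of the even integers, is an abelian group whose completion is free of rank \<open>2\<close> or \<open>3\<close>.
\<close>

locale abelian_family = semidirect_family +
  fixes \<pi> :: "'a => int" and t :: 'a and c :: int
  assumes noeth: "noetherian_in H (carrier H)" and resfin: "residually_finite_in H (carrier H)"
    and pi: "int_hom H (carrier H) \<pi>" and t: "t \<in> carrier H" "\<pi> t = 1"
    and c: "c = 0 \<or> c = 2" and Ac: "mpow A c = mat 1"
    and rep_E: "\<And>h r m. h \<in> carrier H ==> c dvd \<pi> h ==> trivial_mod A r m ==> \<exists>v k. c dvd k \<and> R r m h v k"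
    and rep_E_surj: "\<And>r m v k. trivial_mod A r m ==> c dvd k ==> \<exists>h\<in>carrier H. c dvd \<pi> h \<and> R r m h v k"
begin

definition "E = {h \<in> carrier H. c dvd \<pi> h}"
definition "N = {h \<in> carrier H. \<pi> h = 0}"

lemma E_carrier: "h \<in> E ==> h \<in> carrier H" and N_carrier: "h \<in> N ==> h \<in> carrier H"
  by (simp_all add: E_def N_def)

lemma N_subset_E: "N \<subseteq> E" by (auto simp: N_def E_def)

lemmas pi_mult = int_homD[OF pi]
lemmas pi_inv = int_hom_inv[OF subgroup_self pi]
lemmas pi_pow = int_hom_int_pow[OF subgroup_self pi]
lemmas pi_one = int_hom_one[OF subgroup_self pi]

lemma subgroup_E: "subgroup E H"
  by (rule subgroupI) (auto simp: E_def pi_mult pi_inv pi_one intro!: exI[of _ \<one>])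

lemma subgroup_N: "subgroup N H"
  by (rule subgroupI) (auto simp: N_def pi_mult pi_inv pi_one intro!: exI[of _ \<one>])

lemma mpow_c: "c dvd k ==> mpow A k = mat 1"
proof -
  assume "c dvd k"
  then obtain j where j: "k = c * j" by blast
  show ?thesis unfolding j
  proof (induction j rule: int_induct[where k = 0])
    case (step2 i)
    have "mpow A (c * i) = mpow A (c * (i - 1)) ** mpow A c" by (simp add: right_diff_distrib flip: mpow_add[OF inv_A])
    then show ?case using step2 Ac by simp
  qed (simp_all add: distrib_left mpow_add[OF inv_A] Ac)
qed

lemma rep_mult_E:
  assumes "trivial_mod A r m" "x \<in> carrier H" "y \<in> carrier H" "R r m x v k" "R r m y w l" "c dvd k"
  shows "R r m (x \<otimes> y) (v + w) (k + l)"
  using rep_mult[OF assms(1-5)] mpow_c[OF assms(6)] by simp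

lemma rep_inv_E:
  assumes "trivial_mod A r m" "x \<in> carrier H" "R r m x v k" "c dvd k"
  shows "R r m (inv x) (- v) (- k)"
  using rep_inv[OF assms(1-3)] mpow_c[of "-k"] assms(4) by simp

text \<open>\<open>mpow A c\<close> is trivial, so representations of elements of \<open>E\<close>
  multiply by adding both components; a commutator is then trivial in every representation.\<close>

lemma E_comm:
  assumes "x \<in> E" "y \<in> E"
  shows "x \<otimes> y = y \<otimes> x"
proof -
  have xy: "x \<in> carrier H" "y \<in> carrier H" using assms by (auto simp: E_def)
  have "R r m (x \<otimes> y \<otimes> inv (y \<otimes> x)) 0 0" if T: "trivial_mod A r m" for r m
  proof -
    obtain v k where v: "c dvd k" "R r m x v k" using rep_E[OF _ _ T, of x] assms(1) unfolding E_def by blast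
    obtain w l where w: "c dvd l" "R r m y w l" using rep_E[OF _ _ T, of y] assms(2) unfolding E_def by blast
    have 1: "R r m (x \<otimes> y) (v + w) (k + l)" by (rule rep_mult_E[OF T xy v(2) w(2) v(1)])
    have 2: "R r m (y \<otimes> x) (w + v) (l + k)" by (rule rep_mult_E[OF T xy(2,1) w(2) v(2) w(1)])
    have "R r m (inv (y \<otimes> x)) (- (w + v)) (- (l + k))"
      by (rule rep_inv_E[OF T _ 2]) (use xy v w in auto)
    then have "R r m (x \<otimes> y \<otimes> inv (y \<otimes> x)) (v + w + - (w + v)) (k + l + - (l + k))"
      by (intro rep_mult_E[OF T _ _ 1]) (use xy v w in auto)
    then show ?thesis by simp
  qed
  then have "x \<otimes> y \<otimes> inv (y \<otimes> x) = \<one>" using xy by (intro rep_faithful[OF resfin]) auto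
  then show ?thesis using xy inv_equality[of "x \<otimes> y" "inv (y \<otimes> x)"] by (metis inv_closed inv_inv m_closed inv_comm)
qed

text \<open>Represent \<open>x\<close> modulo \<open>r * j\<close> and a multiple of
  \<open>m * j\<close>: there \<open>j\<close> times the pair vanishes, so the pair itself vanishes
  modulo \<open>r\<close> and \<open>m\<close>.\<close>

lemma E_torsion_free:
  assumes "x \<in> E" "(j::nat) > 0" "x [^] j = \<one>"
  shows "x = \<one>"
proof (rule rep_faithful[OF resfin])
  show x: "x \<in> carrier H" using assms by (simp add: E_def)
  fix r m assume T: "trivial_mod A r m"
  have r0: "r > 0" "m > 0" using T by (auto simp: trivial_mod_def)
  obtain m' where T': "trivial_mod A (r * int j) m'" "m * int j dvd m'"
    using trivial_mod_exists[OF inv_A, of "r * int j" "m * int j"] r0 assms(2) by auto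
  obtain v k where v: "c dvd k" "R (r * int j) m' x v k" using rep_E[OF _ _ T'(1)] assms(1) unfolding E_def by blast
  have "R (r * int j) m' (x [^] int j) (int j *s v) (int j * k)" by (rule rep_pow[OF T'(1) x v(2) mpow_c[OF v(1)]])
  then have "R (r * int j) m' \<one> (int j *s v) (int j * k)" using assms(3) by (simp add: int_pow_int)
  then have vd: "vdvd (r * int j) (int j *s v)" and md: "m' dvd int j * k"
    using rep_iff[OF T'(1) one_closed rep_one[OF T'(1)]] by simp_all
  have d: "vdvd r v" using vdvd_cancel[OF _ vd] assms(2) by simp
  have d': "m dvd k" using dvd_trans[OF T'(2) md] assms(2) by (simp add: mult.commute)
  have "R r m x v k"
    by (rule rep_mono[OF T T'(1) _ _ x v(2)]) (use T'(2) dvd_mult_left in auto)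
  then show "R r m x 0 0" using rep_iff[OF T x, of v k 0 0] d d' by simp
qed

lemma conj_N: "x \<in> N ==> t [^] (k::int) \<otimes> x \<otimes> t [^] (-k) \<in> N"
  using t by (simp add: N_def pi_mult pi_pow)

lemma comm_group_N: "comm_group (H\<lparr>carrier := N\<rparr>)"
proof -
  interpret N: group "H\<lparr>carrier := N\<rparr>" using subgroup.subgroup_is_group[OF subgroup_N is_group] .
  show ?thesis by (rule N.group_comm_groupI) (use E_comm N_subset_E in auto)
qed

lemma N_squares:
  obtains S where "finite S" "S \<subseteq> N" "\<And>x. x \<in> N ==> \<exists>\<rho>\<in>S. \<exists>y\<in>N. x = \<rho> \<otimes> (y \<otimes> y)"
proof -
  interpret N: comm_group "H\<lparr>carrier := N\<rparr>" by (rule comm_group_N)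
  obtain B where B: "finite B" "B \<subseteq> N" "N = generate H B"
    using noeth subgroup_N subgroup.subset[OF subgroup_N] unfolding noetherian_in_def by metis
  have gen: "generate (H\<lparr>carrier := N\<rparr>) B = N" using generate_consistent[OF B(2) subgroup_N] B(3) by simp
  obtain S where S: "finite S" "S \<subseteq> N" "\<forall>x\<in>N. \<exists>\<rho>\<in>S. \<exists>y\<in>N. x = \<rho> \<otimes>\<^bsub>H\<lparr>carrier := N\<rparr>\<^esub> (y \<otimes>\<^bsub>H\<lparr>carrier := N\<rparr>\<^esub> y)"
    using N.squares_finite_index[OF B(1)] B(2) unfolding gen by auto
  then show ?thesis using that[of S] by simp
qed

lemma pi_decomp:
  assumes "h \<in> carrier H"
  shows "t [^] (- \<pi> h) \<otimes> h \<in> N" "h \<otimes> t [^] (- \<pi> h) \<in> N" "h = t [^] \<pi> h \<otimes> (t [^] (- \<pi> h) \<otimes> h)"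
    "h = (h \<otimes> t [^] (- \<pi> h)) \<otimes> t [^] \<pi> h"
proof -
  show "t [^] (- \<pi> h) \<otimes> h \<in> N" "h \<otimes> t [^] (- \<pi> h) \<in> N"
    using assms t by (simp_all add: N_def pi_mult pi_pow)
  show "h = t [^] \<pi> h \<otimes> (t [^] (- \<pi> h) \<otimes> h)" using assms t by (simp add: int_pow_neg flip: m_assoc)
  show "h = (h \<otimes> t [^] (- \<pi> h)) \<otimes> t [^] \<pi> h" using assms t by (simp add: int_pow_neg m_assoc)
qed

text \<open>Squares of \<open>E\<close> are made visible in a finite quotient: the squares of
  \<open>N\<close> together with the powers of \<open>t [^] 4\<close> form a subgroup of finite
  index, and its elements that lie in \<open>E\<close> are squares of elements of
  \<open>E\<close>.\<close>

lemma finite_index_squares: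
  obtains L where "L \<in> fin_index_normal H" "\<And>h. h \<in> L ==> h \<in> E ==> \<exists>z\<in>E. h = z \<otimes> z"
proof -
  define N2 where "N2 = {y \<otimes> y | y. y \<in> N}"
  \<comment> \<open>The exponent is \<open>4\<close> because the square root
    \<open>t [^] (2 * k)\<close> has to lie in \<open>E\<close>, which for \<open>c = 2\<close>
    contains no odd power of \<open>t\<close>.\<close>
  define J where "J = {s \<otimes> t [^] ((4::int) * k) | s k::int. s \<in> N2}"
  have N2: "subgroup N2 H"
  proof (rule subgroupI)
    show "N2 \<subseteq> carrier H" by (auto simp: N2_def N_def)
    show "N2 \<noteq> {}" using subgroup.one_closed[OF subgroup_N] by (auto simp: N2_def)
  next
    fix a assume "a \<in> N2"
    then obtain y where y: "y \<in> N" "a = y \<otimes> y" by (auto simp: N2_def)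
    then have "inv a = inv y \<otimes> inv y" by (simp add: inv_mult_group N_carrier)
    then show "inv a \<in> N2" using subgroup.m_inv_closed[OF subgroup_N y(1)] by (auto simp: N2_def)
  next
    fix a b assume "a \<in> N2" "b \<in> N2"
    then obtain y z where y: "y \<in> N" "a = y \<otimes> y" "z \<in> N" "b = z \<otimes> z" by (auto simp: N2_def)
    have cc: "y \<in> carrier H" "z \<in> carrier H" using y N_carrier by auto
    have e: "z \<otimes> y = y \<otimes> z" using E_comm[of z y] y N_subset_E by auto
    have "(y \<otimes> z) \<otimes> (y \<otimes> z) = y \<otimes> (z \<otimes> y) \<otimes> z" using cc by (simp only: m_assoc m_closed)
    also have "\<dots> = a \<otimes> b" unfolding e y using cc by (simp only: m_assoc m_closed)
    finally have "a \<otimes> b = (y \<otimes> z) \<otimes> (y \<otimes> z)" by simp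
    then show "a \<otimes> b \<in> N2" using subgroup.m_closed[OF subgroup_N y(1,3)] by (auto simp: N2_def)
  qed
  have conj: "t [^] k \<otimes> s \<otimes> t [^] (-k) \<in> N2" if s: "s \<in> N2" for s and k :: int
  proof -
    obtain y where y: "y \<in> N" "s = y \<otimes> y" using s by (auto simp: N2_def)
    have "t [^] (-k) \<otimes> (t [^] k \<otimes> (y \<otimes> t [^] (-k))) = y \<otimes> t [^] (-k)"
      using y t by (simp add: int_pow_neg N_carrier flip: m_assoc)
    then have "t [^] k \<otimes> s \<otimes> t [^] (-k) = (t [^] k \<otimes> y \<otimes> t [^] (-k)) \<otimes> (t [^] k \<otimes> y \<otimes> t [^] (-k))"
      using y t by (simp add: N_carrier m_assoc)
    then show ?thesis using conj_N[OF y(1), of k] by (auto simp: N2_def)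
  qed
  have J: "subgroup J H" unfolding J_def by (rule subgroup_mult_cyclic[OF N2 t(1) conj])
  obtain S where S: "finite S" "S \<subseteq> N" "\<And>x. x \<in> N ==> \<exists>\<rho>\<in>S. \<exists>y\<in>N. x = \<rho> \<otimes> (y \<otimes> y)"
    using N_squares by blast
  then obtain \<rho> y where \<rho>: "\<And>x. x \<in> N ==> \<rho> x \<in> S" "\<And>x. x \<in> N ==> y x \<in> N" "\<And>x. x \<in> N ==> x = \<rho> x \<otimes> (y x \<otimes> y x)"
    by metis
  have "finite (rcosets J)"
  proof (rule finite_rcosetsI[OF J])
    \<comment> \<open>The invariant: the class modulo squares of the part in \<open>N\<close>, and
      the exponent of \<open>t\<close> modulo \<open>4\<close>.\<close>
    let ?f = "\<lambda>h. (\<rho> (t [^] (- \<pi> h) \<otimes> h), \<pi> h mod 4)"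
    have "?f ` carrier H \<subseteq> S \<times> {0..<4}" using \<rho>(1) pi_decomp(1) by auto
    then show "finite (?f ` carrier H)" by (rule finite_subset) (use S(1) in simp)
    fix g h assume gh: "g \<in> carrier H" "h \<in> carrier H" "?f g = ?f h"
    let ?x = "t [^] (- \<pi> g) \<otimes> g" and ?z = "t [^] (- \<pi> h) \<otimes> h"
    have xz: "?x \<in> N" "?z \<in> N" using pi_decomp(1) gh by auto
    have c: "\<rho> ?x \<in> N" "y ?x \<in> N" "y ?z \<in> N" "\<rho> ?z = \<rho> ?x" using \<rho> S xz gh(3) by auto
    have cc: "\<rho> ?x \<in> carrier H" "y ?x \<in> carrier H" "y ?z \<in> carrier H" using c N_carrier by auto
    have Ncomm: "a \<otimes> b = b \<otimes> a" if "a \<in> N" "b \<in> N" for a b using E_comm that N_subset_E by auto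
    have e0: "?x \<otimes> inv ?z = (\<rho> ?x \<otimes> (y ?x \<otimes> y ?x)) \<otimes> inv (\<rho> ?x \<otimes> (y ?z \<otimes> y ?z))"
      using \<rho>(3)[OF xz(1)] \<rho>(3)[OF xz(2)] c(4) by simp
    have e1: "(\<rho> ?x \<otimes> (y ?x \<otimes> y ?x)) \<otimes> inv (\<rho> ?x \<otimes> (y ?z \<otimes> y ?z)) = \<rho> ?x \<otimes> ((y ?x \<otimes> y ?x) \<otimes> inv (y ?z \<otimes> y ?z)) \<otimes> inv (\<rho> ?x)"
      using cc by (simp add: inv_mult_group m_assoc)
    have "(y ?x \<otimes> y ?x) \<otimes> inv (y ?z \<otimes> y ?z) \<in> N2"
      by (rule subgroup.m_closed[OF N2 _ subgroup.m_inv_closed[OF N2]]) (use c in \<open>auto simp: N2_def\<close>)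
    then obtain s where s: "s \<in> N2" "(y ?x \<otimes> y ?x) \<otimes> inv (y ?z \<otimes> y ?z) = s" by blast
    have sN: "s \<in> N" using s(1) subgroup.m_closed[OF subgroup_N] by (auto simp: N2_def)
    have e2: "\<rho> ?x \<otimes> s \<otimes> inv (\<rho> ?x) = s"
      using Ncomm[OF c(1) sN] cc(1) N_carrier[OF sN] by (simp add: m_assoc)
    have xs: "?x \<otimes> inv ?z = s" unfolding e0 e1 s(2) by (rule e2)
    have "4 dvd \<pi> g - \<pi> h" using gh(3) by (simp add: mod_eq_dvd_iff)
    then obtain j where j: "\<pi> g - \<pi> h = 4 * j" by blast
    have "g \<otimes> inv h = (t [^] \<pi> g \<otimes> ?x) \<otimes> inv (t [^] \<pi> h \<otimes> ?z)"
      using pi_decomp(3)[OF gh(1)] pi_decomp(3)[OF gh(2)] by simp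
    also have "\<dots> = t [^] \<pi> g \<otimes> (?x \<otimes> inv ?z) \<otimes> t [^] (- \<pi> h)"
      using gh t N_carrier[OF xz(1)] N_carrier[OF xz(2)] by (simp only: inv_mult_group int_pow_closed int_pow_neg m_assoc inv_closed m_closed)
    also have "\<dots> = t [^] \<pi> g \<otimes> s \<otimes> t [^] (- \<pi> h)" unfolding xs ..
    also have "\<dots> = (t [^] \<pi> g \<otimes> s \<otimes> t [^] (- \<pi> g)) \<otimes> t [^] (\<pi> g - \<pi> h)"
    proof -
      have "t [^] (- \<pi> g) \<otimes> t [^] (\<pi> g - \<pi> h) = t [^] (- \<pi> h)" using t by (simp flip: int_pow_mult)
      then show ?thesis using N_carrier[OF sN] t by (simp add: m_assoc)
    qed
    finally have "g \<otimes> inv h = (t [^] \<pi> g \<otimes> s \<otimes> t [^] (- \<pi> g)) \<otimes> t [^] (4 * j)" unfolding j .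
    then show "g \<otimes> inv h \<in> J" unfolding J_def using conj[OF s(1), of "\<pi> g"] by blast
  qed
  then obtain L where L: "L \<in> fin_index_normal H" "L \<subseteq> J" using normal_core[OF J] by blast
  have "\<exists>z\<in>E. h = z \<otimes> z" if h: "h \<in> L" "h \<in> E" for h
  proof -
    have "h \<in> J" using h(1) L(2) by blast
    then obtain y k where y: "h = (y \<otimes> y) \<otimes> t [^] ((4::int) * k)" "y \<in> N" unfolding J_def N2_def by blast
    have yc: "y \<in> carrier H" "y \<in> E" using y(2) N_carrier N_subset_E by auto
    show ?thesis
    proof (cases "c = 0")
      case True
      then have "\<pi> h = 0" using h(2) unfolding E_def by simp
      moreover have "\<pi> h = 4 * k" unfolding y(1) using y(2) yc t by (simp add: pi_mult pi_pow N_def)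
      ultimately show ?thesis using y yc by (intro bexI[of _ y]) simp_all
    next
      case False
      then have c2: "c = 2" using c by simp
      let ?u = "t [^] (2 * k)"
      have u: "?u \<in> E" "?u \<in> carrier H" unfolding E_def using t c2 by (simp_all add: pi_pow)
      have "?u \<otimes> ?u = t [^] (4 * k)" using t by (simp flip: int_pow_mult)
      moreover have "(y \<otimes> ?u) \<otimes> (y \<otimes> ?u) = y \<otimes> (?u \<otimes> y) \<otimes> ?u" using yc u by (simp add: m_assoc)
      moreover have "\<dots> = (y \<otimes> y) \<otimes> (?u \<otimes> ?u)" unfolding E_comm[OF u(1) yc(2)] using yc u by (simp add: m_assoc)
      ultimately have "h = (y \<otimes> ?u) \<otimes> (y \<otimes> ?u)" unfolding y(1) by metis
      then show ?thesis using subgroup.m_closed[OF subgroup_E yc(2) u(1)] by blast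
    qed
  qed
  then show ?thesis using that L(1) by blast
qed

text \<open>Modulo squares there are four possibilities for the vector part and, if
  \<open>c = 2\<close>, two for the \<int>-part. \<open>finite_index_squares\<close> ensures that an
  element trivial at a suitable level is a square in \<open>E\<close>, so parities can be read off
  from these classes.\<close>

lemma E_rank:
  assumes ds: "dual_system H E d \<phi> x"
  shows "d \<le> (if c = 0 then 2 else 3)"
proof -
  have h: "\<And>i. i < d ==> int_hom H E (\<phi> i)" using ds by (simp add: dual_system_def)
  obtain L where L: "L \<in> fin_index_normal H" "\<And>h. h \<in> L ==> h \<in> E ==> \<exists>z\<in>E. h = z \<otimes> z"
    using finite_index_squares by blast
  obtain n where n: "n > 0"
    "\<And>r m h. trivial_mod A r m ==> n dvd r ==> n dvd m ==> h \<in> carrier H ==> R r m h 0 0 ==> h \<in> L"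
    using rep_cofinal[OF L(1)] by blast
  obtain m where T: "trivial_mod A n m" "n dvd m" using trivial_mod_exists[OF inv_A n(1) n(1)] by blast
  have "\<exists>h\<in>E. R n m h v k" if "c dvd k" for v k using rep_E_surj[OF T(1) that] unfolding E_def by blast
  then have ex: "\<exists>h. h \<in> E \<and> R n m h v k" if "c dvd k" for v k using that by blast
  define g where "g v k = (SOME h. h \<in> E \<and> R n m h v k)" for v k
  have "g v k \<in> E \<and> R n m (g v k) v k" if "c dvd k" for v k
    unfolding g_def by (rule someI_ex[OF ex[OF that]])
  then have g: "\<And>v k. c dvd k ==> g v k \<in> E" "\<And>v k. c dvd k ==> R n m (g v k) v k" by blast+
  \<comment> \<open>Representatives of the multiples of \<open>c\<close> modulo the multiples of
    \<open>2 * c\<close>.\<close>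
  define K :: "int set" where "K = (if c = 0 then {0} else {0, 2})"
  have Kc: "c dvd k" if "k \<in> K" for k using that c by (auto simp: K_def split: if_splits)
  let ?F = "\<lambda>(a::int, b::int, k::int). g (vector [a, b]) k"
  let ?S = "?F ` ({0,1} \<times> {0,1} \<times> K)"
  have "2 ^ d \<le> card ?S"
  proof (rule dual_system_card[OF subgroup_E ds])
    show "finite ?S" by (simp add: K_def)
    show "?S \<subseteq> E" using g(1) Kc by auto
    fix h0 assume h0: "h0 \<in> E"
    have h0c: "h0 \<in> carrier H" using h0 by (rule E_carrier)
    obtain v k where v: "c dvd k" "R n m h0 v k" using rep_E[OF _ _ T(1)] h0 unfolding E_def by blast
    obtain l \<kappa> where l: "k = \<kappa> + (l + l)" "c dvd l" "\<kappa> \<in> K"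
    proof (cases "c = 0")
      case True
      then show thesis using that[of 0 0] v(1) by (simp add: K_def)
    next
      case False
      then have c2: "c = 2" using c by simp
      obtain j where "k = 2 * j" using v(1) c2 by blast
      moreover have "2 * j = 2 * (j mod 2) + (2 * (j div 2) + 2 * (j div 2))" by presburger
      moreover have "2 * (j mod 2) \<in> K" using c2 by (cases "even j") (auto simp: K_def)
      ultimately show thesis using that[of "2 * (j mod 2)" "2 * (j div 2)"] c2 by simp
    qed
    define \<epsilon> w where "\<epsilon> = (vector [v $ 1 mod 2, v $ 2 mod 2] :: int^2)" and "w = (vector [v $ 1 div 2, v $ 2 div 2] :: int^2)"
    define y \<rho> where "y = g w l" and "\<rho> = g \<epsilon> \<kappa>"
    have E: "y \<in> E" "\<rho> \<in> E" using g(1) l Kc by (simp_all add: y_def \<rho>_def)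
    have ch: "y \<in> carrier H" "\<rho> \<in> carrier H" using E E_carrier by auto
    have ry: "R n m y w l" and r\<rho>: "R n m \<rho> \<epsilon> \<kappa>" using g(2) l Kc by (simp_all add: y_def \<rho>_def)
    have "R n m (y \<otimes> y) (w + w) (l + l)" by (rule rep_mult_E[OF T(1) ch(1,1) ry ry l(2)])
    then have "R n m (\<rho> \<otimes> (y \<otimes> y)) (\<epsilon> + (w + w)) (\<kappa> + (l + l))"
      by (rule rep_mult_E[OF T(1) ch(2) m_closed[OF ch(1,1)] r\<rho> _ Kc[OF l(3)]])
    moreover have "\<epsilon> + (w + w) = v" by (simp add: \<epsilon>_def w_def vec2_eq_iff)
    ultimately have 1: "R n m (\<rho> \<otimes> (y \<otimes> y)) v k" using l(1) by simp
    have mem: "\<rho> \<otimes> (y \<otimes> y) \<in> E" using E subgroup.m_closed[OF subgroup_E] by blast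
    have "R n m (inv (\<rho> \<otimes> (y \<otimes> y))) (- v) (- k)" by (rule rep_inv_E[OF T(1) E_carrier[OF mem] 1 v(1)])
    then have "R n m (h0 \<otimes> inv (\<rho> \<otimes> (y \<otimes> y))) (v + - v) (k + - k)"
      by (rule rep_mult_E[OF T(1) h0c inv_closed[OF E_carrier[OF mem]] v(2) _ v(1)])
    then have "h0 \<otimes> inv (\<rho> \<otimes> (y \<otimes> y)) \<in> L"
      using h0c E_carrier[OF mem] by (intro n(2)[OF T(1) dvd_refl T(2)]) simp_all
    moreover have "h0 \<otimes> inv (\<rho> \<otimes> (y \<otimes> y)) \<in> E"
      using h0 mem subgroup.m_closed[OF subgroup_E] subgroup.m_inv_closed[OF subgroup_E] by blast
    ultimately obtain z where z: "z \<in> E" "h0 \<otimes> inv (\<rho> \<otimes> (y \<otimes> y)) = z \<otimes> z" using L(2) by blast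
    then have h0z: "h0 = (z \<otimes> z) \<otimes> (\<rho> \<otimes> (y \<otimes> y))"
      using h0c E_carrier[OF mem] E_carrier[OF z(1)] by (metis inv_solve_right m_closed)
    have "even (\<phi> i h0 - \<phi> i \<rho>)" if "i < d" for i
      unfolding h0z using int_homD[OF h[OF that]] E z(1) subgroup.m_closed[OF subgroup_E] by simp
    moreover have "\<rho> \<in> ?S"
    proof -
      have "(v $ 1 mod 2, v $ 2 mod 2, \<kappa>) \<in> {0,1} \<times> {0,1} \<times> K" using l(3) by auto
      then have "?F (v $ 1 mod 2, v $ 2 mod 2, \<kappa>) \<in> ?S" by (rule imageI)
      then show ?thesis by (simp only: \<rho>_def \<epsilon>_def split_conv)
    qed
    ultimately show "\<exists>\<rho>\<in>?S. \<forall>i<d. even (\<phi> i h0 - \<phi> i \<rho>)" by blast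
  qed
  also have "card ?S \<le> card ({0,1::int} \<times> {0,1::int} \<times> K)" by (rule card_image_le) (simp add: K_def)
  also have "\<dots> = 2 ^ (if c = 0 then 2 else 3)" by (simp add: K_def card_cartesian_product)
  finally show ?thesis by (rule power_le_imp_le_exp[rotated]) simp
qed

text \<open>For \<open>c = 2\<close> the group \<open>E\<close> is the direct product of
  \<open>N\<close> and the powers of \<open>t [^] 2\<close>, so a dual system on \<open>N\<close>
  extends to \<open>E\<close> by one more member, and the bound \<open>3\<close> drops to
  \<open>2\<close>.\<close>

lemma N_rank:
  assumes ds: "dual_system H N d \<phi> x"
  shows "d \<le> 2"
proof (cases "c = 0")
  case True
  then have "E = N" unfolding E_def N_def by simp
  then show ?thesis using E_rank[of d \<phi> x] ds by (simp only: True if_True refl)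
next
  case False
  then have c2: "c = 2" using c by simp
  have h: "\<And>i. i < d ==> int_hom H N (\<phi> i)" and xN: "\<And>i. i < d ==> x i \<in> N"
    and dual: "\<And>i j. i < d ==> j < d ==> \<phi> i (x j) = (if i = j then 1 else 0)"
    using ds by (auto simp: dual_system_def)
  \<comment> \<open>The projection to \<open>N\<close> along the powers of \<open>t\<close>; on
    \<open>E\<close> it is multiplicative because even powers of \<open>t\<close> commute with
    \<open>E\<close>.\<close>
  define p where "p h = h \<otimes> t [^] (- \<pi> h)" for h
  have pN: "p h \<in> N" if "h \<in> E" for h unfolding p_def by (rule pi_decomp(2)[OF E_carrier[OF that]])
  have pm: "p (a \<otimes> b) = p a \<otimes> p b" if ab: "a \<in> E" "b \<in> E" for a b
  proof -
    have cc: "a \<in> carrier H" "b \<in> carrier H" using ab E_carrier by auto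
    have u: "t [^] (- \<pi> a) \<in> E" "t [^] (- \<pi> a) \<in> carrier H" using ab t c2 unfolding E_def by (simp_all add: pi_pow)
    have "p a \<otimes> p b = a \<otimes> (t [^] (- \<pi> a) \<otimes> b) \<otimes> t [^] (- \<pi> b)" using cc t by (simp add: p_def m_assoc)
    also have "\<dots> = a \<otimes> b \<otimes> (t [^] (- \<pi> a) \<otimes> t [^] (- \<pi> b))" unfolding E_comm[OF u(1) ab(2)] using cc t by (simp add: m_assoc)
    also have "t [^] (- \<pi> a) \<otimes> t [^] (- \<pi> b) = t [^] (- \<pi> (a \<otimes> b))" using cc t by (simp add: pi_mult flip: int_pow_mult)
    finally show ?thesis by (simp add: p_def)
  qed
  define \<phi>' where "\<phi>' i = (if i < d then \<phi> i \<circ> p else (\<lambda>h. \<pi> h div 2))" for i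
  define x' where "x' i = (if i < d then x i else t [^] (2::int))" for i
  have "dual_system H E (Suc d) \<phi>' x'"
    unfolding dual_system_def
  proof (intro conjI allI impI)
    fix i assume i: "i < Suc d"
    show "int_hom H E (\<phi>' i)"
    proof (cases "i < d")
      case True
      then show ?thesis using int_homD[OF h[OF True] pN pN] pm by (simp add: \<phi>'_def int_hom_def)
    next
      case False
      then show ?thesis using c2 unfolding int_hom_def E_def \<phi>'_def by (simp add: pi_mult div_plus_div_distrib_dvd_left)
    qed
    have "t [^] (2::int) \<in> E" unfolding E_def using t c2 by (simp add: pi_pow)
    then show "x' i \<in> E" using xN N_subset_E by (auto simp: x'_def)
  next
    fix i j assume ij: "i < Suc d" "j < Suc d"
    have px: "p (x j) = x j" if "j < d" for j using xN[OF that] by (simp add: p_def N_def)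
    have pt: "p (t [^] (2::int)) = \<one>" using t by (simp add: p_def pi_pow int_pow_neg)
    have "\<phi> i \<one> = 0" if "i < d" for i using int_hom_one[OF subgroup_N h[OF that]] .
    moreover have "\<pi> (x j) = 0" if "j < d" for j using xN[OF that] by (simp add: N_def)
    ultimately show "\<phi>' i (x' j) = (if i = j then 1 else 0)"
      using ij dual px pt t by (auto simp: \<phi>'_def x'_def less_Suc_eq pi_pow)
  qed
  from E_rank[OF this] show ?thesis using c2 by simp
qed

text \<open>The splitting is attempted up to \<open>3\<close>, which the rank cannot reach; so the
  joint kernel is finite, and it is trivial because \<open>E\<close> is torsion-free.\<close>

lemma N_free:
  obtains d \<phi> x where "d \<le> 2" "dual_system H N d \<phi> x" "\<And>h. h \<in> N ==> (\<And>i. i < d ==> \<phi> i h = 0) ==> h = \<one>"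
proof -
  interpret N: comm_group "H\<lparr>carrier := N\<rparr>" by (rule comm_group_N)
  have nN: "noetherian_in (H\<lparr>carrier := N\<rparr>) (carrier (H\<lparr>carrier := N\<rparr>))"
    by (rule noetherian_in_subgroup[OF noeth subgroup_N])
  obtain d \<phi> x where ds: "d \<le> 3" "dual_system (H\<lparr>carrier := N\<rparr>) N d \<phi> x" "d = 3 \<or> finite {y \<in> N. \<forall>i<d. \<phi> i y = 0}"
    using N.dual_system_exists[OF nN, where d = 3] by auto
  have ds': "dual_system H N d \<phi> x" using ds(2) by (simp add: dual_system_def int_hom_def)
  have d2: "d \<le> 2" by (rule N_rank[OF ds'])
  let ?K = "{y \<in> N. \<forall>i<d. \<phi> i y = 0}"
  have h: "\<And>i. i < d ==> int_hom H N (\<phi> i)" using ds' by (simp add: dual_system_def)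
  have fin: "finite ?K" using ds(3) d2 by auto
  have sub: "subgroup ?K H" by (rule subgroup_int_hom_kernel[OF subgroup_N h])
  interpret K: group "H\<lparr>carrier := ?K\<rparr>" using subgroup.subgroup_is_group[OF sub is_group] .
  have "h' = \<one>" if h': "h' \<in> N" "\<And>i. i < d ==> \<phi> i h' = 0" for h'
  proof (rule E_torsion_free)
    show "h' \<in> E" using h' N_subset_E by blast
    show "0 < card ?K" using fin subgroup.one_closed[OF sub] card_gt_0_iff by blast
    have "h' \<in> ?K" using h' by simp
    then show "h' [^] card ?K = \<one>" using K.pow_order_eq_1[of h'] by (simp add: order_def nat_pow_def)
  qed
  then show ?thesis using that[OF d2 ds'] by blast
qed

text \<open>If the rank were at most one, \<open>E\<close> would be generated by \<open>z\<close>
  and \<open>t [^] c\<close>. But the representations map \<open>E\<close> onto the vectors modulo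
  \<open>2\<close> and, for \<open>c = 2\<close>, a further coordinate. This needs two generators
  for \<open>c = 0\<close>, where \<open>t [^] c\<close> is trivial, and three for
  \<open>c = 2\<close>.\<close>

lemma N_free_rank2:
  obtains \<phi> x where "dual_system H N 2 \<phi> x" "\<And>h. h \<in> N ==> (\<And>i. i < 2 ==> \<phi> i h = 0) ==> h = \<one>"
proof -
  obtain d \<phi> x where d: "d \<le> 2" "dual_system H N d \<phi> x" "\<And>h. h \<in> N ==> (\<And>i. i < d ==> \<phi> i h = 0) ==> h = \<one>"
    using N_free by blast
  have "\<not> d \<le> 1"
  proof
    assume d1: "d \<le> 1"
    have h: "\<And>i. i < d ==> int_hom H N (\<phi> i)" and xN: "\<And>i. i < d ==> x i \<in> N"
      and dual: "\<And>i j. i < d ==> j < d ==> \<phi> i (x j) = (if i = j then 1 else 0)"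
      using d(2) by (auto simp: dual_system_def)
    define z where "z = (if d = 1 then x 0 else \<one>)"
    have zN: "z \<in> N" using xN subgroup.one_closed[OF subgroup_N] by (simp add: z_def)
    have gen: "\<exists>a. h' = z [^] (a::int)" if h': "h' \<in> N" for h'
    proof (cases "d = 1")
      case True
      have 0: "(0::nat) < d" using True by simp
      let ?y = "h' \<otimes> z [^] (- \<phi> 0 h')"
      have zz: "z [^] (- \<phi> 0 h') \<in> N" using subgroup_int_pow_closed[OF subgroup_N zN] .
      have "?y = \<one>"
      proof (rule d(3))
        show "?y \<in> N" using h' zz subgroup.m_closed[OF subgroup_N] by blast
        fix i assume "i < d"
        then have "i = 0" using True by simp
        then show "\<phi> i ?y = 0"
          using int_homD[OF h[OF 0] h' zz] int_hom_int_pow[OF subgroup_N h[OF 0] zN] dual[OF 0 0] True by (simp add: z_def)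
      qed
      then have "h' = z [^] \<phi> 0 h'" using N_carrier[OF h'] N_carrier[OF zN]
        by (metis int_pow_closed int_pow_neg inv_equality inv_inv inv_closed)
      then show ?thesis by blast
    next
      case False
      then have "h' = \<one>" using d1 by (intro d(3)[OF h']) simp
      then show ?thesis by (intro exI[of _ 0]) simp
    qed
    \<comment> \<open>The \<int>-components of \<open>E\<close> are even if \<open>c = 2\<close>;
      modulo \<open>4\<close> their halves still have a parity, which is the third
      coordinate.\<close>
    obtain m where T: "trivial_mod A 2 m" "4 dvd m" using trivial_mod_exists[OF inv_A, of 2 4] by auto
    define y where "y = t [^] c"
    have yE: "y \<in> E" "y \<in> carrier H" using t by (simp_all add: y_def E_def pi_pow)
    have genE: "\<exists>a b. h' = z [^] (a::int) \<otimes> y [^] (b::int)" if h': "h' \<in> E" for h'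
    proof -
      obtain b where b: "\<pi> h' = c * b" using h' by (auto simp: E_def)
      obtain a where "h' \<otimes> t [^] (- \<pi> h') = z [^] (a::int)" using gen pi_decomp(2)[OF E_carrier[OF h']] by blast
      then have "h' = z [^] a \<otimes> t [^] \<pi> h'" using pi_decomp(4)[OF E_carrier[OF h']] by simp
      also have "t [^] \<pi> h' = y [^] b" using t b by (simp add: y_def int_pow_pow)
      finally show ?thesis by blast
    qed
    obtain p p3 where p: "c dvd p3" "R 2 m z p p3" using rep_E[OF _ _ T(1)] zN N_subset_E unfolding E_def by blast
    obtain q q3 where q: "c dvd q3" "R 2 m y q q3" using rep_E[OF _ _ T(1)] yE(1) unfolding E_def by blast
    have key: "\<exists>a b. even (a * p $ 1 + b * q $ 1 - v $ 1) \<and> even (a * p $ 2 + b * q $ 2 - v $ 2) \<and> 4 dvd a * p3 + b * q3 - k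
        \<and> (c = 0 \<longrightarrow> b = 0)"
      if k: "c dvd k" for v :: "int^2" and k
    proof -
      obtain h' where h': "h' \<in> E" "R 2 m h' v k" using rep_E_surj[OF T(1) k] unfolding E_def by blast
      obtain a b0 where "h' = z [^] (a::int) \<otimes> y [^] (b0::int)" using genE[OF h'(1)] by blast
      moreover define b where "b = (if c = 0 then 0 else b0)"
      ultimately have ab: "h' = z [^] a \<otimes> y [^] b" by (simp add: y_def)
      have "R 2 m (z [^] a) (a *s p) (a * p3)" by (rule rep_pow[OF T(1) N_carrier[OF zN] p(2) mpow_c[OF p(1)]])
      moreover have "R 2 m (y [^] b) (b *s q) (b * q3)" by (rule rep_pow[OF T(1) yE(2) q(2) mpow_c[OF q(1)]])
      ultimately have "R 2 m h' (a *s p + b *s q) (a * p3 + b * q3)"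
        unfolding ab using N_carrier[OF zN] yE(2) p(1) by (intro rep_mult_E[OF T(1)]) simp_all
      then have vd: "vdvd 2 (a *s p + b *s q - v)" and md: "m dvd a * p3 + b * q3 - k"
        using rep_iff[OF T(1) E_carrier[OF h'(1)] h'(2)] by simp_all
      show ?thesis using vd dvd_trans[OF T(2) md]
        by (intro exI[of _ a] exI[of _ b]) (simp add: vdvd_def b_def)
    qed
    obtain a1 b1 where 1: "even (a1 * p $ 1 + b1 * q $ 1 - 1)" "even (a1 * p $ 2 + b1 * q $ 2)" "4 dvd a1 * p3 + b1 * q3" "c = 0 \<longrightarrow> b1 = 0"
      using key[of 0 "vector [1, 0]"] by auto
    obtain a2 b2 where 2: "even (a2 * p $ 1 + b2 * q $ 1)" "even (a2 * p $ 2 + b2 * q $ 2 - 1)" "4 dvd a2 * p3 + b2 * q3" "c = 0 \<longrightarrow> b2 = 0"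
      using key[of 0 "vector [0, 1]"] by auto
    show False
    proof (cases "c = 0")
      case True
      then have "b1 = 0" "b2 = 0" using 1 2 by auto
      then have "odd (a1 * p $ 1)" "even (a1 * p $ 2)" "even (a2 * p $ 1)" "odd (a2 * p $ 2)" using 1 2 by simp_all
      then show False by simp
    next
      case False
      then have c2: "c = 2" using c by simp
      then obtain p' q' where pq: "p3 = 2 * p'" "q3 = 2 * q'" using p(1) q(1) by (auto elim!: dvdE)
      obtain a3 b3 where "even (a3 * p $ 1 + b3 * q $ 1)" "even (a3 * p $ 2 + b3 * q $ 2)" "4 dvd a3 * p3 + b3 * q3 - 2"
        using key[of 2 0] c2 by auto
      then have 3: "even (a3 * p $ 1 + b3 * q $ 1)" "even (a3 * p $ 2 + b3 * q $ 2)" "4 dvd 2 * (a3 * p' + b3 * q' - 1)"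
        unfolding pq by (simp_all add: algebra_simps)
      have 4: "4 dvd 2 * (a1 * p' + b1 * q')" "4 dvd 2 * (a2 * p' + b2 * q')"
        using 1(3) 2(3) unfolding pq by (simp_all add: algebra_simps)
      have half: "even y" if "4 dvd 2 * y" for y :: int using that by presburger
      \<comment> \<open>Over the field with two elements the three unit vectors would lie in the
        span of two vectors.\<close>
      show False using 1(1,2) 2(1,2) 3(1,2) half[OF 3(3)] half[OF 4(1)] half[OF 4(2)] by auto
    qed
  qed
  then have "d = 2" using d(1) by simp
  then show ?thesis using that d by blast
qed

end

section \<open>Matrices with the same procyclic closure\<close>

text \<open>\<open>P\<close> is onto modulo \<open>r\<close>, so its determinant is a unit modulo
  \<open>r\<close>. Each congruence is first proved after multiplication by \<open>det P\<close>,
  with the adjugate in place of an inverse.\<close>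

lemma det_congruence:
  fixes P B C :: "int^2^2"
  assumes c: "\<And>v. vdvd r (P *v (B *v v) - C *v (P *v v))" and onto: "\<And>w. \<exists>v. vdvd r (P *v v - w)"
  shows "r dvd trace B - trace C" "r dvd det B - det C" "\<And>v. vdvd r (P *v v) ==> vdvd r v"
proof -
  let ?e1 = "vector [1, 0] :: int^2" and ?e2 = "vector [0, 1] :: int^2"
  obtain v1 v2 where v: "vdvd r (P *v v1 - ?e1)" "vdvd r (P *v v2 - ?e2)" using onto by metis
  let ?p = "P $ 1 $ 1" and ?q = "P $ 1 $ 2" and ?s = "P $ 2 $ 1" and ?u = "P $ 2 $ 2"
  obtain x1 x2 x3 x4 where x: "?p * v1 $ 1 + ?q * v1 $ 2 = 1 + r * x1" "?s * v1 $ 1 + ?u * v1 $ 2 = r * x2"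
    "?p * v2 $ 1 + ?q * v2 $ 2 = r * x3" "?s * v2 $ 1 + ?u * v2 $ 2 = 1 + r * x4"
  proof -
    have "r dvd ?p * v1 $ 1 + ?q * v1 $ 2 - 1" "r dvd ?s * v1 $ 1 + ?u * v1 $ 2"
      "r dvd ?p * v2 $ 1 + ?q * v2 $ 2" "r dvd ?s * v2 $ 1 + ?u * v2 $ 2 - 1"
      using v by (simp_all add: vdvd_def mat2_vec_nth)
    then show thesis using that by (metis dvdE add.commute diff_add_cancel)
  qed
  \<comment> \<open>The determinant of the matrix with columns \<open>v1\<close> and
    \<open>v2\<close>, a right inverse of \<open>P\<close> modulo \<open>r\<close>.\<close>
  define D where "D = v1 $ 1 * v2 $ 2 - v1 $ 2 * v2 $ 1"
  have "det P * D = (?p * v1 $ 1 + ?q * v1 $ 2) * (?s * v2 $ 1 + ?u * v2 $ 2) - (?p * v2 $ 1 + ?q * v2 $ 2) * (?s * v1 $ 1 + ?u * v1 $ 2)"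
    by (simp add: det_2 D_def algebra_simps)
  also have "\<dots> = 1 + r * (x1 + x4 + r * x1 * x4 - r * x3 * x2)" unfolding x by (simp add: algebra_simps)
  finally have D: "r dvd det P * D - 1" by simp
  have cancel: "r dvd y" if "r dvd det P * y" for y
  proof -
    have "r dvd det P * y * D - (det P * D - 1) * y" using that D by (intro dvd_diff) simp_all
    then show ?thesis by (simp add: algebra_simps)
  qed
  have e: "r dvd (P ** B) $ i $ 1 - (C ** P) $ i $ 1" "r dvd (P ** B) $ i $ 2 - (C ** P) $ i $ 2" if "i = 1 \<or> i = 2" for i
    using c[of ?e1] c[of ?e2] that by (auto simp: vdvd_def mat2_vec_nth mat2_mult_nth)
  obtain k11 k12 k21 k22 where k: "(P ** B) $ 1 $ 1 = (C ** P) $ 1 $ 1 + r * k11" "(P ** B) $ 1 $ 2 = (C ** P) $ 1 $ 2 + r * k12"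
    "(P ** B) $ 2 $ 1 = (C ** P) $ 2 $ 1 + r * k21" "(P ** B) $ 2 $ 2 = (C ** P) $ 2 $ 2 + r * k22"
    using e[of 1] e[of 2] that by (metis dvdE add.commute diff_add_cancel)
  \<comment> \<open>The trace of \<open>adj2 P ** (P ** B)\<close>, written out.\<close>
  have "det P * trace B = ?u * (P ** B) $ 1 $ 1 - ?s * (P ** B) $ 1 $ 2 + (?p * (P ** B) $ 2 $ 2 - ?q * (P ** B) $ 2 $ 1)"
    by (simp add: trace_2 det_2 mat2_mult_nth algebra_simps)
  also have "\<dots> = det P * trace C + r * (?u * k11 - ?s * k12 + ?p * k22 - ?q * k21)"
    unfolding k by (simp add: trace_2 det_2 mat2_mult_nth algebra_simps)
  finally have "det P * (trace B - trace C) = r * (?u * k11 - ?s * k12 + ?p * k22 - ?q * k21)" by (simp add: algebra_simps)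
  then have "r dvd det P * (trace B - trace C)" by simp
  then show "r dvd trace B - trace C" by (rule cancel)
  have "det P * det B = det (P ** B)" by (simp add: det_mul)
  also have "\<dots> = (P ** B) $ 1 $ 1 * (P ** B) $ 2 $ 2 - (P ** B) $ 1 $ 2 * (P ** B) $ 2 $ 1" by (rule det_2)
  finally have "det P * det B = det (C ** P) + r * ((C ** P) $ 1 $ 1 * k22 + k11 * (C ** P) $ 2 $ 2 + r * k11 * k22
     - (C ** P) $ 1 $ 2 * k21 - k12 * (C ** P) $ 2 $ 1 - r * k12 * k21)"
    unfolding k det_2[of "C ** P"] by (simp add: algebra_simps)
  then have "r dvd det P * det B - det (C ** P)" by simp
  then have "r dvd det P * (det B - det C)" by (simp add: det_mul algebra_simps)
  then show "r dvd det B - det C" by (rule cancel)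
  show "vdvd r v" if "vdvd r (P *v v)" for v
  proof -
    have "vdvd r (adj2 P *v (P *v v))" using that by (rule vdvd_matvec)
    then have a: "r dvd det P * v $ 1" "r dvd det P * v $ 2" by (simp_all add: vdvd_def mat2_vec_nth det_2 algebra_simps)
    show ?thesis using cancel[OF a(1)] cancel[OF a(2)] by (simp add: vdvd_def)
  qed
qed

lemma cayley_hamilton2: "(A::int^2^2) *v (A *v v) = trace A *s (A *v v) - det A *s v"
  by (simp add: vec2_eq_iff mat2_vec_nth trace_2 det_2 algebra_simps)

lemma trace_mpow_rec:
  assumes "invertible A"
  shows "trace (mpow A (k + 2)) = trace A * trace (mpow A (k + 1)) - det A * trace (mpow A k)"
proof -
  have "mpow A (k + 1) = A ** mpow A k" using mpow_add[OF assms, of 1 k] mpow_1[OF assms] by (simp add: add.commute)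
  moreover have "mpow A (k + 2) = A ** (A ** mpow A k)"
    using mpow_add[OF assms, of 1 "1 + k"] mpow_add[OF assms, of 1 k] mpow_1[OF assms] by (simp add: add.commute)
  ultimately show ?thesis by (simp add: trace_2 det_2 mat2_mult_nth algebra_simps)
qed

text \<open>Modulo \<open>trace A\<close> the recursion for traces of powers passes from
  \<open>k\<close> to \<open>k + 2\<close> by the factor \<open>- det A\<close>, starting with
  \<open>trace A\<close> itself at \<open>k = 1\<close>.\<close>

lemma trace_mpow_odd:
  assumes "invertible A"
  shows "trace A dvd trace (mpow A (2 * int n + 1))"
proof (induction n)
  case 0 show ?case using mpow_1[OF assms] by simp
next
  case (Suc n)
  have "trace (mpow A (2 * int (Suc n) + 1)) = trace A * trace (mpow A (2 * int n + 2)) - det A * trace (mpow A (2 * int n + 1))"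
    using trace_mpow_rec[OF assms, of "2 * int n + 1"] by (simp add: algebra_simps)
  then show ?case using Suc by simp
qed

text \<open>Modulo \<open>trace A - 2\<close> the characteristic polynomial is
  \<open>(x - 1)^2\<close>, so all traces of powers are \<open>2\<close>. The recursion has order
  two, hence two consecutive terms in the induction.\<close>

lemma trace_mpow_unipotent:
  assumes "invertible A" "det A = 1"
  shows "trace A - 2 dvd trace (mpow A (int n)) - 2 \<and> trace A - 2 dvd trace (mpow A (int n + 1)) - 2"
proof (induction n)
  case 0 show ?case using mpow_1[OF assms(1)] by (simp add: trace_2)
next
  case (Suc n)
  let ?a = "trace (mpow A (int n))" and ?b = "trace (mpow A (int n + 1))" and ?t = "trace A"
  have "trace (mpow A (int (Suc n) + 1)) = ?t * ?b - ?a"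
    using trace_mpow_rec[OF assms(1), of "int n"] assms(2) by (simp add: algebra_simps)
  then have "trace (mpow A (int (Suc n) + 1)) - 2 = (?t - 2) * ?b + 2 * (?b - 2) - (?a - 2)" by (simp add: algebra_simps)
  moreover have "?t - 2 dvd (?t - 2) * ?b + 2 * (?b - 2) - (?a - 2)"
    by (rule dvd_diff[OF dvd_add[OF dvd_triv_left dvd_mult]]) (use Suc in auto)
  ultimately have 1: "?t - 2 dvd trace (mpow A (int (Suc n) + 1)) - 2" by simp
  have e: "int (Suc n) = int n + 1" by simp
  show ?case using Suc 1 unfolding e by blast
qed

lemma det_mpow_odd:
  assumes "invertible A" "odd u"
  shows "det (mpow A u) = det A"
proof -
  obtain j where j: "u = 2 * j + 1" using assms(2) by (rule oddE)
  have "mpow A u = mpow A j ** mpow A j ** A" unfolding j using mpow_add[OF assms(1)] mpow_1[OF assms(1)] by (metis mult_2)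
  moreover have "det (mpow A j) * det (mpow A j) = 1"
    using invertible_mpow[OF assms(1), of j] unfolding invertible_iff_det by auto
  ultimately show ?thesis by (simp add: det_mul)
qed

lemma dvd_of_all_divisors:
  fixes x y :: int
  assumes "\<And>r. r > 0 ==> r dvd x ==> r dvd y"
  shows "x dvd y"
proof (cases "x = 0")
  case True
  then have "\<bar>y\<bar> + 1 dvd y" using assms by simp
  then have "y = 0" using dvd_imp_le_int[of y "\<bar>y\<bar> + 1"] by auto
  then show ?thesis by simp
next
  case False
  then show ?thesis using assms[of "\<bar>x\<bar>"] by simp
qed

text \<open>\<open>B\<close> is conjugate to a power \<open>A\<^sup>u\<close> with \<open>u\<close> a unit, modulo every \<open>r\<close>.\<close>

definition profinitely_equivalent :: "int^2^2 => int^2^2 => bool" where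
  "profinitely_equivalent A B \<longleftrightarrow> (\<forall>r m. trivial_mod A r m \<longrightarrow> (\<exists>P u u'. u > 0 \<and> u' > 0 \<and> m dvd u * u' - 1 \<and>
     (\<forall>v. vdvd r (P *v (B *v v) - mpow A u *v (P *v v))) \<and> (\<forall>w. \<exists>v. vdvd r (P *v v - w))))"

text \<open>An even \<open>m\<close> makes both exponents odd. The reverse relation comes from
  raising to the power \<open>u'\<close>, because \<open>u * u'\<close> is \<open>1\<close> modulo
  \<open>m\<close> and \<open>mpow A m\<close> acts trivially modulo \<open>r\<close>.\<close>

lemma profinitely_equivalentD:
  assumes A: "invertible A" and B: "invertible B" and eq: "profinitely_equivalent A B" and r: "r > 0"
  shows "\<exists>P (u::nat) (u'::nat). odd u \<and> odd u' \<and> (\<forall>v. vdvd r (P *v (B *v v) - mpow A (int u) *v (P *v v))) \<and>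
    (\<forall>v. vdvd r (P *v (mpow B (int u') *v v) - A *v (P *v v))) \<and> (\<forall>w. \<exists>v. vdvd r (P *v v - w))"
proof -
  obtain m where T: "trivial_mod A r m" "2 dvd m" using trivial_mod_exists[OF A r, of 2] by auto
  obtain P u u' where P: "u > 0" "u' > 0" "m dvd u * u' - 1"
    "\<And>v. vdvd r (P *v (B *v v) - mpow A u *v (P *v v))" "\<And>w. \<exists>v. vdvd r (P *v v - w)"
    using eq T(1) unfolding profinitely_equivalent_def by blast
  have "2 dvd u * u' - 1" using dvd_trans[OF T(2) P(3)] .
  then have odd: "odd u" "odd u'" by auto
  have pow: "vdvd r (P *v (mpow B (int n) *v v) - mpow A (u * int n) *v (P *v v))" for n v
  proof (induction n arbitrary: v)
    case (Suc n)
    have "mpow A (u * int (Suc n)) *v (P *v v) = mpow A (u * int n) *v (mpow A u *v (P *v v))"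
      using mpow_vec_add[OF A, of "u * int n" u "P *v v"] by (simp add: algebra_simps)
    moreover have "mpow B (int (Suc n)) *v v = mpow B (int n) *v (B *v v)"
      using mpow_vec_add[OF B, of "int n" 1 v] mpow_1[OF B] by (simp add: algebra_simps)
    ultimately have "P *v (mpow B (int (Suc n)) *v v) - mpow A (u * int (Suc n)) *v (P *v v)
      = (P *v (mpow B (int n) *v (B *v v)) - mpow A (u * int n) *v (P *v (B *v v)))
        + mpow A (u * int n) *v (P *v (B *v v) - mpow A u *v (P *v v))" by (simp add: matvec_diff)
    then show ?case using vdvd_add[OF Suc vdvd_matvec[OF P(4)]] by simp
  qed simp
  have "vdvd r (P *v (mpow B u' *v v) - A *v (P *v v))" for v
  proof -
    have "vdvd r (P *v (mpow B u' *v v) - mpow A (u * u') *v (P *v v))" using pow[of "nat u'" v] P(2) by simp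
    moreover have "mpow A (u * u') *v (P *v v) = mpow A (u * u' - 1) *v (A *v (P *v v))"
      using mpow_vec_add[OF A, of "u * u' - 1" 1 "P *v v"] mpow_1[OF A] by simp
    moreover have "vdvd r (mpow A (u * u' - 1) *v (A *v (P *v v)) - A *v (P *v v))" by (rule trivial_mod_dvd[OF A T(1) P(3)])
    ultimately have "vdvd r ((P *v (mpow B u' *v v) - mpow A (u * u') *v (P *v v)) + (mpow A (u * u') *v (P *v v) - A *v (P *v v)))"
      by (intro vdvd_add) simp_all
    then show ?thesis by simp
  qed
  then show ?thesis using P odd by (intro exI[of _ P] exI[of _ "nat u"] exI[of _ "nat u'"]) (simp add: even_nat_iff)
qed

text \<open>Odd powers keep the determinant, and \<open>1\<close> and \<open>-1\<close> differ
  modulo \<open>3\<close>.\<close>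

lemma profinitely_equivalent_det:
  assumes A: "invertible A" and B: "invertible B" and eq: "profinitely_equivalent A B"
  shows "det B = det A"
proof -
  obtain P and u :: nat where P: "odd u" "\<forall>v. vdvd 3 (P *v (B *v v) - mpow A (int u) *v (P *v v))" "\<forall>w. \<exists>v. vdvd 3 (P *v v - w)"
    using profinitely_equivalentD[OF A B eq zero_less_numeral] by blast
  have "3 dvd det B - det (mpow A (int u))" by (rule det_congruence(2)[OF P(2)[rule_format] P(3)[rule_format]])
  then have "3 dvd det B - det A" using det_mpow_odd[OF A, of "int u"] P(1) by simp
  then show ?thesis using A B unfolding invertible_iff_det by auto
qed

lemma odd_nat_int: "odd (u::nat) ==> \<exists>n. int u = 2 * int n + 1"
  by (elim oddE) auto

lemma profinitely_equivalent_trace: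
  assumes A: "invertible A" and B: "invertible B" and eq: "profinitely_equivalent A B"
  shows "\<bar>trace B\<bar> = \<bar>trace A\<bar>" "det A = 1 ==> trace B = trace A"
proof -
  have key: "r dvd trace A \<longleftrightarrow> r dvd trace B" if r: "r > 0" for r
  proof -
    obtain P and u u' :: nat where P: "odd u" "odd u'"
      "\<forall>v. vdvd r (P *v (B *v v) - mpow A (int u) *v (P *v v))"
      "\<forall>v. vdvd r (P *v (mpow B (int u') *v v) - A *v (P *v v))" "\<forall>w. \<exists>v. vdvd r (P *v v - w)"
      using profinitely_equivalentD[OF A B eq r] by blast
    have 1: "r dvd trace B - trace (mpow A (int u))" by (rule det_congruence(1)[OF P(3)[rule_format] P(5)[rule_format]])
    have 2: "r dvd trace (mpow B (int u')) - trace A" by (rule det_congruence(1)[OF P(4)[rule_format] P(5)[rule_format]])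
    have "trace A dvd trace (mpow A (int u))" "trace B dvd trace (mpow B (int u'))"
      using odd_nat_int[OF P(1)] odd_nat_int[OF P(2)] trace_mpow_odd[OF A] trace_mpow_odd[OF B] by force+
    then show ?thesis using 1 2 by (metis dvd_trans dvd_diff_right_iff dvd_diff_left_iff dvd_diff_commute)
  qed
  have "trace A dvd trace B" "trace B dvd trace A" using key by (auto intro: dvd_of_all_divisors)
  then show abs: "\<bar>trace B\<bar> = \<bar>trace A\<bar>" by (rule zdvd_antisym_abs[rotated])
  assume d: "det A = 1"
  then have dB: "det B = 1" using profinitely_equivalent_det[OF A B eq] by simp
  have key2: "r dvd trace A - 2 \<longleftrightarrow> r dvd trace B - 2" if r: "r > 0" for r
  proof -
    obtain P and u u' :: nat where P: "odd u" "odd u'"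
      "\<forall>v. vdvd r (P *v (B *v v) - mpow A (int u) *v (P *v v))"
      "\<forall>v. vdvd r (P *v (mpow B (int u') *v v) - A *v (P *v v))" "\<forall>w. \<exists>v. vdvd r (P *v v - w)"
      using profinitely_equivalentD[OF A B eq r] by blast
    have 1: "r dvd trace B - trace (mpow A (int u))" by (rule det_congruence(1)[OF P(3)[rule_format] P(5)[rule_format]])
    have 2: "r dvd trace (mpow B (int u')) - trace A" by (rule det_congruence(1)[OF P(4)[rule_format] P(5)[rule_format]])
    have 3: "trace A - 2 dvd trace (mpow A (int u)) - 2" "trace B - 2 dvd trace (mpow B (int u')) - 2"
      using trace_mpow_unipotent[OF A d] trace_mpow_unipotent[OF B dB] by blast+
    have "r dvd trace B - 2" if "r dvd trace A - 2"
      using dvd_add[OF 1 dvd_trans[OF that 3(1)]] by simp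
    moreover have "r dvd trace A - 2" if "r dvd trace B - 2"
      using dvd_diff[OF dvd_trans[OF that 3(2)] 2] by simp
    ultimately show ?thesis by blast
  qed
  have "trace A - 2 dvd trace B - 2" "trace B - 2 dvd trace A - 2" using key2 by (auto intro: dvd_of_all_divisors)
  then have "\<bar>trace B - 2\<bar> = \<bar>trace A - 2\<bar>" by (rule zdvd_antisym_abs[rotated])
  \<comment> \<open>Two opposite numbers at equal distance from \<open>2\<close> are both
    \<open>0\<close>.\<close>
  then show "trace B = trace A" using abs by linarith
qed

text \<open>Acting as \<open>-1\<close> modulo \<open>r\<close> passes to odd powers and to
  conjugates modulo \<open>r\<close>. When both eigenvalues are \<open>-1\<close>, this recovers the
  invariant that trace and determinant cannot see.\<close>

lemma profinitely_equivalent_minus_1: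
  assumes A: "invertible A" and B: "invertible B" and eq: "profinitely_equivalent A B" and r: "r > 0"
  shows "(\<forall>v. vdvd r (A *v v + v)) \<longleftrightarrow> (\<forall>v. vdvd r (B *v v + v))"
proof -
  have odd_pow: "vdvd r (mpow C (2 * int n + 1) *v v + v)" if C: "invertible C" "\<forall>v. vdvd r (C *v v + v)" for C n v
  proof (induction n arbitrary: v)
    case 0 show ?case using C mpow_1[OF C(1)] by simp
  next
    case (Suc n)
    have "mpow C (2 * int (Suc n) + 1) *v v = mpow C (2 * int n + 1) *v (C *v (C *v v))"
      using mpow_vec_add[OF C(1), of "2 * int n + 1" 2 v] mpow_vec_add[OF C(1), of 1 1 v] mpow_1[OF C(1)] by (simp add: algebra_simps)
    moreover have "vdvd r ((mpow C (2 * int n + 1) *v (C *v (C *v v)) + C *v (C *v v)) - (C *v (C *v v) + C *v v) + (C *v v + v))"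
      by (rule vdvd_add[OF vdvd_diff[OF Suc]]) (use C in auto)
    ultimately show ?case by simp
  qed
  obtain P and u u' :: nat where P: "odd u" "odd u'"
    "\<forall>v. vdvd r (P *v (B *v v) - mpow A (int u) *v (P *v v))"
    "\<forall>v. vdvd r (P *v (mpow B (int u') *v v) - A *v (P *v v))" "\<forall>w. \<exists>v. vdvd r (P *v v - w)"
    using profinitely_equivalentD[OF A B eq r] by blast
  show ?thesis
  proof (intro iffI allI)
    fix v assume a: "\<forall>v. vdvd r (A *v v + v)"
    have "vdvd r (mpow A (int u) *v (P *v v) + P *v v)" using odd_nat_int[OF P(1)] odd_pow[OF A a] by metis
    then have "vdvd r ((P *v (B *v v) - mpow A (int u) *v (P *v v)) + (mpow A (int u) *v (P *v v) + P *v v))"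
      using P(3) vdvd_add by blast
    then have "vdvd r (P *v (B *v v + v))" by (simp add: matvec_add)
    then show "vdvd r (B *v v + v)" by (rule det_congruence(3)[OF P(3)[rule_format] P(5)[rule_format]])
  next
    fix w assume b: "\<forall>v. vdvd r (B *v v + v)"
    obtain v where v: "vdvd r (P *v v - w)" using P(5) by blast
    have "vdvd r (mpow B (int u') *v v + v)" using odd_nat_int[OF P(2)] odd_pow[OF B b] by metis
    then have "vdvd r (P *v (mpow B (int u') *v v + v))" by (rule vdvd_matvec)
    then have "vdvd r (P *v (mpow B (int u') *v v + v) - (P *v (mpow B (int u') *v v) - A *v (P *v v)))" using P(4) vdvd_diff by blast
    then have 1: "vdvd r (A *v (P *v v) + P *v v)" by (simp add: matvec_add algebra_simps)
    have "vdvd r ((A *v (P *v v) + P *v v) - (A *v (P *v v - w) + (P *v v - w)))"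
      by (rule vdvd_diff[OF 1 vdvd_add[OF vdvd_matvec[OF v] v]])
    then show "vdvd r (A *v w + w)" by (simp add: matvec_diff)
  qed
qed

lemma additive_vec2:
  fixes f :: "int^2 => int"
  assumes a: "\<And>v w. f (v + w) = f v + f w"
  shows "f v = v $ 1 * f (vector [1, 0]) + v $ 2 * f (vector [0, 1])"
proof -
  have z: "f 0 = 0" using a[of 0 0] by simp
  have n: "f (- v) = - f v" for v using a[of v "- v"] z by simp
  have sc: "f (j *s v) = j * f v" for j v
  proof (induction j rule: int_induct[where k = 0])
    case base show ?case using z by simp
  next
    case (step1 i)
    have e: "(i + 1) *s v = i *s v + v" by (simp add: vec2_eq_iff algebra_simps)
    show ?case unfolding e a step1.IH by (simp add: algebra_simps)
  next
    case (step2 i)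
    have e: "(i - 1) *s v = i *s v + - v" by (simp add: vec2_eq_iff algebra_simps)
    show ?case unfolding e a n step2.IH by (simp add: algebra_simps)
  qed
  have "v = (v $ 1) *s vector [1, 0] + (v $ 2) *s vector [0, 1]" by (simp add: vec2_eq_iff)
  then show ?thesis using a sc by metis
qed

lemma mpow_mat_1: "mpow (mat 1) k = mat 1"
  using group.int_pow_one[OF group_GL2Z, of k]
  by (simp add: mpow_def GL2Z_def)

lemma mpow_minus_1: "mpow (- mat 1) k *v v = (if even k then v else - v)"
proof -
  have inv: "invertible (- mat 1 :: int^2^2)" by (simp add: invertible_iff_det det_2)
  have m: "(- mat 1) *v v = - v" for v :: "int^2" by (simp add: vec2_eq_iff mat2_vec_nth)
  have s: "mpow (- mat 1) (k + 1) *v v = - (mpow (- mat 1) k *v v)" for k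
    using mpow_vec_add[OF inv, of k 1 v] mpow_1[OF inv] by (simp add: m matvec_minus)
  show ?thesis
  proof (induction k rule: int_induct[where k = 0])
    case (step1 i) then show ?case using s[of i] by simp
  next
    case (step2 i)
    have "mpow (- mat 1) (i - 1) *v v = - (mpow (- mat 1) i *v v)" using s[of "i - 1"] by simp
    then show ?case using step2 by simp
  qed simp
qed

section \<open>Splitting a group in the genus as a semidirect product\<close>

context abelian_family
begin

text \<open>\<open>\<nu>\<close> identifies the integral plane with \<open>N\<close> and turns
  conjugation by \<open>t\<close> into \<open>B\<close>. The last clause writes
  \<open>\<nu> v\<close> with powers of two elements, so that its representations follow from
  theirs.\<close>

definition split_by :: "int^2^2 => (int^2 => 'a) => bool" where
  "split_by B \<nu> \<longleftrightarrow> invertible B \<and> (\<forall>v. \<nu> v \<in> N) \<and> (\<forall>v w. \<nu> (v + w) = \<nu> v \<otimes> \<nu> w) \<and>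
     (\<forall>h\<in>N. \<exists>v. h = \<nu> v) \<and> (\<forall>v. \<nu> v = \<one> \<longrightarrow> v = 0) \<and> (\<forall>v. t \<otimes> \<nu> v \<otimes> inv t = \<nu> (B *v v)) \<and>
     (\<forall>v. \<nu> v = \<nu> (vector [1, 0]) [^] (v $ 1) \<otimes> \<nu> (vector [0, 1]) [^] (v $ 2))"

text \<open>The dual homomorphisms are coordinates on \<open>N\<close>. In them, conjugation by a
  power of \<open>t\<close> is additive and hence a matrix; the matrices for \<open>t\<close> and
  for its inverse are inverse to each other.\<close>

lemma split_exists: "\<exists>B \<nu>. split_by B \<nu>"
proof -
  obtain \<phi> x where ds: "dual_system H N 2 \<phi> x" and ker: "\<And>h. h \<in> N ==> (\<And>i. i < 2 ==> \<phi> i h = 0) ==> h = \<one>"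
    using N_free_rank2 by blast
  have h: "int_hom H N (\<phi> 0)" "int_hom H N (\<phi> 1)" and xN: "x 0 \<in> N" "x 1 \<in> N"
    and dual: "\<phi> 0 (x 0) = 1" "\<phi> 0 (x 1) = 0" "\<phi> 1 (x 0) = 0" "\<phi> 1 (x 1) = 1"
    using ds by (auto simp: dual_system_def)
  note S = subgroup_N
  have pw: "x 0 [^] (k::int) \<in> N" "x 1 [^] (k::int) \<in> N" for k
    using subgroup_int_pow_closed[OF S] xN by auto
  define \<nu> where "\<nu> v = x 0 [^] (v $ 1) \<otimes> x 1 [^] (v $ 2)" for v :: "int^2"
  define \<Phi> where "\<Phi> h = (vector [\<phi> 0 h, \<phi> 1 h] :: int^2)" for h
  have \<nu>N: "\<nu> v \<in> N" for v unfolding \<nu>_def using pw subgroup.m_closed[OF S] by blast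
  have \<phi>\<nu>: "\<phi> 0 (\<nu> v) = v $ 1" "\<phi> 1 (\<nu> v) = v $ 2" for v
    unfolding \<nu>_def using int_homD[OF h(1) pw] int_homD[OF h(2) pw]
      int_hom_int_pow[OF S h(1) xN(1)] int_hom_int_pow[OF S h(1) xN(2)]
      int_hom_int_pow[OF S h(2) xN(1)] int_hom_int_pow[OF S h(2) xN(2)] dual by simp_all
  have comm: "a \<otimes> b = b \<otimes> a" if "a \<in> N" "b \<in> N" for a b using E_comm N_subset_E that by blast
  have eqI: "a = b" if ab: "a \<in> N" "b \<in> N" "\<phi> 0 a = \<phi> 0 b" "\<phi> 1 a = \<phi> 1 b" for a b
  proof -
    have ib: "inv b \<in> N" using subgroup.m_inv_closed[OF S ab(2)] .
    have "a \<otimes> inv b = \<one>"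
    proof (rule ker)
      show "a \<otimes> inv b \<in> N" using subgroup.m_closed[OF S ab(1) ib] .
      fix i :: nat assume "i < 2"
      then have "i = 0 \<or> i = 1" by auto
      then show "\<phi> i (a \<otimes> inv b) = 0"
        using int_homD[OF h(1) ab(1) ib] int_homD[OF h(2) ab(1) ib] int_hom_inv[OF S h(1) ab(2)] int_hom_inv[OF S h(2) ab(2)] ab(3,4)
        by auto
    qed
    then show ?thesis using N_carrier ab(1,2) by (metis inv_equality inv_inv inv_closed)
  qed
  have \<nu>\<Phi>: "\<nu> (\<Phi> h) = h" if "h \<in> N" for h
    by (rule eqI[OF \<nu>N that]) (simp_all add: \<phi>\<nu> \<Phi>_def del: One_nat_def)
  have \<nu>add: "\<nu> (v + w) = \<nu> v \<otimes> \<nu> w" for v w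
    by (rule eqI[OF \<nu>N subgroup.m_closed[OF S \<nu>N \<nu>N]])
      (simp_all add: \<phi>\<nu> int_homD[OF h(1) \<nu>N \<nu>N] int_homD[OF h(2) \<nu>N \<nu>N] del: One_nat_def)
  have mat: "\<exists>B. \<forall>v. t [^] k \<otimes> \<nu> v \<otimes> t [^] (-k) = \<nu> (B *v v)" for k :: int
  proof -
    let ?y = "\<lambda>v. t [^] k \<otimes> \<nu> v \<otimes> t [^] (-k)"
    have yN: "?y v \<in> N" for v using conj_N[OF \<nu>N] .
    have yadd: "?y (v + w) = ?y v \<otimes> ?y w" for v w
    proof -
      have c: "\<nu> v \<in> carrier H" "\<nu> w \<in> carrier H" using \<nu>N N_carrier by auto
      have "t [^] (-k) \<otimes> (t [^] k \<otimes> (\<nu> w \<otimes> t [^] (-k))) = \<nu> w \<otimes> t [^] (-k)"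
        using c t by (simp add: int_pow_neg flip: m_assoc)
      then show ?thesis unfolding \<nu>add using c t by (simp add: m_assoc)
    qed
    have lin: "f (?y v) = v $ 1 * f (?y (vector [1, 0])) + v $ 2 * f (?y (vector [0, 1]))"
      if f: "int_hom H N f" for f v
      by (rule additive_vec2[of "\<lambda>v. f (?y v)"]) (simp only: yadd int_homD[OF f yN yN])
    define B where "B = M2 (\<phi> 0 (?y (vector [1, 0]))) (\<phi> 0 (?y (vector [0, 1]))) (\<phi> 1 (?y (vector [1, 0]))) (\<phi> 1 (?y (vector [0, 1])))"
    have "?y v = \<nu> (B *v v)" for v
      by (rule eqI[OF yN \<nu>N]) (simp_all only: \<phi>\<nu> lin[OF h(1), of v] lin[OF h(2), of v], simp_all add: B_def mat2_vec_nth mult.commute)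
    then show ?thesis by blast
  qed
  obtain B where B: "\<And>v. t [^] (1::int) \<otimes> \<nu> v \<otimes> t [^] (-1::int) = \<nu> (B *v v)" using mat[of 1] by auto
  obtain B' where B': "\<And>v. t [^] (-1::int) \<otimes> \<nu> v \<otimes> t [^] (1::int) = \<nu> (B' *v v)" using mat[of "-1"] by auto
  have inj: "v = w" if "\<nu> v = \<nu> w" for v w using \<phi>\<nu> that by (metis vec2_eq_iff)
  have "\<nu> (B *v (B' *v v)) = \<nu> v" for v
  proof -
    have c: "\<nu> v \<in> carrier H" using \<nu>N N_carrier by auto
    show ?thesis using c t by (simp add: B[symmetric] B'[symmetric] int_pow_neg m_assoc) (simp flip: m_assoc)
  qed
  then have BB: "B *v (B' *v v) = v" for v using inj by blast
  have "B ** B' = mat 1"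
    using BB[of "vector [1, 0]"] BB[of "vector [0, 1]"] by (simp add: mat2_eq_iff mat2_mult_nth vec2_eq_iff mat2_vec_nth)
  then have "invertible B" by (rule invertible_of_left_inverse)
  moreover have "t \<otimes> \<nu> v \<otimes> inv t = \<nu> (B *v v)" for v using B[of v] t by (simp add: int_pow_neg)
  moreover have "\<exists>v. h = \<nu> v" if "h \<in> N" for h using \<nu>\<Phi>[OF that] by metis
  moreover have "v = 0" if "\<nu> v = \<one>" for v
  proof (rule inj)
    show "\<nu> v = \<nu> 0" using that by (simp add: \<nu>_def)
  qed
  moreover have "\<nu> (vector [1, 0]) = x 0" "\<nu> (vector [0, 1]) = x 1" using xN N_carrier by (simp_all add: \<nu>_def)
  then have "\<nu> v = \<nu> (vector [1, 0]) [^] (v $ 1) \<otimes> \<nu> (vector [0, 1]) [^] (v $ 2)" for v unfolding \<nu>_def[of v] by simp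
  ultimately have "split_by B \<nu>" unfolding split_by_def using \<nu>N \<nu>add by blast
  then show ?thesis by blast
qed

context
  fixes B \<nu>
  assumes split: "split_by B \<nu>"
begin

lemmas split_conjs = split[unfolded split_by_def]
lemma inv_B: "invertible B" by (rule split_conjs[THEN conjunct1])
lemma nu_N: "\<nu> v \<in> N" using split_conjs[THEN conjunct2, THEN conjunct1] by (rule spec)
lemma nu_add: "\<nu> (v + w) = \<nu> v \<otimes> \<nu> w" by (rule split_conjs[THEN conjunct2, THEN conjunct2, THEN conjunct1, rule_format])
lemma nu_onto: "h \<in> N ==> \<exists>v. h = \<nu> v" by (rule split_conjs[THEN conjunct2, THEN conjunct2, THEN conjunct2, THEN conjunct1, rule_format])
lemma nu_inj: "\<nu> v = \<one> ==> v = 0" by (rule split_conjs[THEN conjunct2, THEN conjunct2, THEN conjunct2, THEN conjunct2, THEN conjunct1, rule_format])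
lemma nu_conj: "t \<otimes> \<nu> v \<otimes> inv t = \<nu> (B *v v)"
  by (rule split_conjs[THEN conjunct2, THEN conjunct2, THEN conjunct2, THEN conjunct2, THEN conjunct2, THEN conjunct1, rule_format])
lemma nu_basis: "\<nu> v = \<nu> (vector [1, 0]) [^] (v $ 1) \<otimes> \<nu> (vector [0, 1]) [^] (v $ 2)"
  by (rule split_conjs[THEN conjunct2, THEN conjunct2, THEN conjunct2, THEN conjunct2, THEN conjunct2, THEN conjunct2, rule_format])

lemma nu_carrier: "\<nu> v \<in> carrier H" using nu_N N_carrier by blast

lemma nu_zero: "\<nu> 0 = \<one>"
  using nu_add[of 0 0] nu_carrier[of 0] by simp

lemma nu_eq_iff: "\<nu> v = \<nu> w \<longleftrightarrow> v = w"
proof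
  assume e: "\<nu> v = \<nu> w"
  have "\<nu> (v - w) \<otimes> \<nu> w = \<nu> v" by (simp flip: nu_add)
  then have "\<nu> (v - w) = \<one>" using e nu_carrier by (metis r_cancel_one')
  then show "v = w" using nu_inj by force
qed simp

lemma nu_conj_pow: "t [^] (k::int) \<otimes> \<nu> v \<otimes> t [^] (-k) = \<nu> (mpow B k *v v)"
proof -
  have up: "t [^] (i + 1) \<otimes> \<nu> v \<otimes> t [^] (- (i + 1)) = t \<otimes> (t [^] i \<otimes> \<nu> v \<otimes> t [^] (-i)) \<otimes> inv t" for i :: int
  proof -
    have "t [^] (i + 1) = t \<otimes> t [^] i" using t int_pow_mult[of t 1 i] by (simp add: add.commute)
    moreover have "t [^] (- (i + 1)) = t [^] (-i) \<otimes> inv t" using t int_pow_mult[of t "-i" "-1"] by (simp add: int_pow_neg)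
    ultimately show ?thesis using t nu_carrier by (simp add: m_assoc)
  qed
  have step: "mpow B (i + 1) *v v = B *v (mpow B i *v v)" for i
    using mpow_vec_add[OF inv_B, of 1 i v] mpow_1[OF inv_B] by (simp add: add.commute)
  show ?thesis
  proof (induction k rule: int_induct[where k = 0])
    case base show ?case using nu_carrier by simp
  next
    case (step1 i)
    then show ?case unfolding up step nu_conj[symmetric] by simp
  next
    case (step2 i)
    let ?x = "t [^] (i - 1) \<otimes> \<nu> v \<otimes> t [^] (- (i - 1))"
    have xN: "?x \<in> carrier H" using t nu_carrier by simp
    have "t \<otimes> ?x \<otimes> inv t = \<nu> (mpow B i *v v)" using up[of "i - 1"] step2 by simp
    also have "\<dots> = t \<otimes> \<nu> (mpow B (i - 1) *v v) \<otimes> inv t" using step[of "i - 1"] nu_conj by simp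
    finally have "t \<otimes> ?x = t \<otimes> \<nu> (mpow B (i - 1) *v v)" using t xN nu_carrier by (metis inv_closed m_closed r_cancel)
    then show ?case using t xN nu_carrier by (metis l_cancel)
  qed
qed

lemma split_iso: "(\<lambda>(v, k). \<nu> v \<otimes> t [^] k) \<in> iso (\<G> B) H"
proof -
  have hom: "(\<lambda>(v, k). \<nu> v \<otimes> t [^] k) \<in> hom (\<G> B) H"
  proof (rule homI)
    fix x :: "(int^2) \<times> int" show "(case x of (v, k) => \<nu> v \<otimes> t [^] k) \<in> carrier H" using nu_carrier t by (auto split: prod.split)
  next
    fix x y :: "(int^2) \<times> int"
    obtain v k w l where xy: "x = (v, k)" "y = (w, l)" by (metis surj_pair)
    have "(\<nu> v \<otimes> t [^] k) \<otimes> (\<nu> w \<otimes> t [^] l) = (\<nu> v \<otimes> (t [^] k \<otimes> \<nu> w \<otimes> t [^] (-k))) \<otimes> t [^] (k + l)"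
      by (rule conj_pow_mult[OF t(1) nu_carrier nu_carrier])
    then show "(case x \<otimes>\<^bsub>\<G> B\<^esub> y of (v, k) => \<nu> v \<otimes> t [^] k) = (case x of (v, k) => \<nu> v \<otimes> t [^] k) \<otimes> (case y of (v, k) => \<nu> v \<otimes> t [^] k)"
      unfolding xy nu_conj_pow by (simp add: semidirect_simps[OF inv_B] nu_add)
  qed
  have \<pi>\<nu>: "\<pi> (\<nu> v \<otimes> t [^] k) = k" for v k
    using nu_N[of v] nu_carrier[of v] t by (simp add: pi_mult pi_pow N_def)
  have inj: "inj_on (\<lambda>(v, k :: int). \<nu> v \<otimes> t [^] k) UNIV"
  proof (rule inj_onI, clarify)
    fix v w and k l :: int assume e: "\<nu> v \<otimes> t [^] k = \<nu> w \<otimes> t [^] (l::int)"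
    then have "k = l" using \<pi>\<nu> by metis
    moreover from this have "\<nu> v = \<nu> w" using e nu_carrier t by (metis int_pow_closed r_cancel)
    ultimately show "v = w \<and> k = l" using nu_eq_iff by simp
  qed
  have "\<exists>v k. h = \<nu> v \<otimes> t [^] (k::int)" if "h \<in> carrier H" for h
    using nu_onto[OF pi_decomp(2)[OF that]] pi_decomp(4)[OF that] by metis
  then have "(\<lambda>(v, k :: int). \<nu> v \<otimes> t [^] k) ` UNIV = carrier H" using nu_carrier t(1) by force
  then show ?thesis using hom inj by (simp add: iso_def bij_betw_def semidirect_simps(1)[OF inv_B])
qed

lemma rep_nu:
  assumes T: "trivial_mod A r m" and e: "R r m (\<nu> (vector [1, 0])) p 0" "R r m (\<nu> (vector [0, 1])) q 0"
  shows "R r m (\<nu> v) (M2 (p $ 1) (q $ 1) (p $ 2) (q $ 2) *v v) 0"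
proof -
  have "R r m (\<nu> (vector [1, 0]) [^] (v $ 1)) (v $ 1 *s p) (v $ 1 * 0)" by (rule rep_pow[OF T nu_carrier e(1) mpow_0])
  moreover have "R r m (\<nu> (vector [0, 1]) [^] (v $ 2)) (v $ 2 *s q) (v $ 2 * 0)" by (rule rep_pow[OF T nu_carrier e(2) mpow_0])
  ultimately have "R r m (\<nu> v) (v $ 1 *s p + v $ 2 *s q) 0"
    unfolding nu_basis[of v] using rep_mult_E[OF T int_pow_closed[OF nu_carrier] int_pow_closed[OF nu_carrier], of "vector [1, 0]" "v $ 1" _ 0 "vector [0, 1]" "v $ 2" _ 0]
    by simp
  moreover have "v $ 1 *s p + v $ 2 *s q = M2 (p $ 1) (q $ 1) (p $ 2) (q $ 2) *v v" by (simp add: vec2_eq_iff mat2_vec_nth algebra_simps)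
  ultimately show ?thesis by simp
qed

text \<open>\<open>P\<close> is \<open>\<nu>\<close> read modulo \<open>r\<close>, and
  \<open>u\<close> is the \<int>-component of \<open>t\<close>; conjugation by \<open>t\<close> is
  \<open>B\<close> on one side and \<open>mpow A u\<close> on the other. An element \<open>h\<close>
  with component \<open>1\<close> shows that \<open>\<pi> h\<close> is inverse to \<open>u\<close>
  modulo \<open>m\<close>.\<close>

lemma split_profinitely_equivalent:
  assumes c0: "c = 0"
  shows "profinitely_equivalent A B"
  unfolding profinitely_equivalent_def
proof (intro allI impI)
  fix r m assume T: "trivial_mod A r m"
  have m0: "m > 0" using T by (simp add: trivial_mod_def)
  have rep0: "\<exists>v. R r m h v 0" if "h \<in> N" for h
    using rep_E[OF N_carrier[OF that] _ T] that c0 by (simp add: N_def)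
  obtain p q where pq: "R r m (\<nu> (vector [1, 0])) p 0" "R r m (\<nu> (vector [0, 1])) q 0" using rep0 nu_N by metis
  define P where "P = M2 (p $ 1) (q $ 1) (p $ 2) (q $ 2)"
  have P: "R r m (\<nu> v) (P *v v) 0" for v unfolding P_def by (rule rep_nu[OF T pq])
  obtain w0 u0 where w0: "R r m t w0 u0" using rep_exists[OF T t(1)] by blast
  \<comment> \<open>Adding \<open>m\<close> makes the exponent positive, as the results on traces of
    powers require.\<close>
  define u where "u = u0 mod m + m"
  have u: "u > 0" using m0 by (simp add: u_def add_nonneg_pos)
  have "m dvd u - u0" unfolding u_def by (simp add: mod_eq_dvd_iff[symmetric])
  then have w: "R r m t w0 u" using rep_iff[OF T t(1) w0] by simp
  obtain h where h: "h \<in> carrier H" "R r m h 0 1" using rep_surj[OF T] .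
  obtain w1 where w1: "R r m (h \<otimes> t [^] (- \<pi> h)) w1 0" using rep0[OF pi_decomp(2)[OF h(1)]] by blast
  have hk: "m dvd kpart r m (h \<otimes> t [^] (- \<pi> h))" using kpart_dvd[OF T _ w1] h(1) t by simp
  have "m dvd 1 - \<pi> h * u"
  proof -
    have a1: "m dvd kpart r m (h \<otimes> t [^] (- \<pi> h)) - (kpart r m h + kpart r m (t [^] (- \<pi> h)))"
      by (rule additive_modD[OF kpart_additive[OF T]]) (use h(1) t in auto)
    have a2: "m dvd kpart r m (t [^] (- \<pi> h)) - (- \<pi> h) * kpart r m t" by (rule additive_mod_pow[OF kpart_additive[OF T] t(1)])
    have a3: "m dvd kpart r m h - 1" by (rule kpart_dvd[OF T h])
    have a4: "m dvd \<pi> h * (kpart r m t - u)" by (rule dvd_mult[OF kpart_dvd[OF T t(1) w]])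
    have "m dvd kpart r m (h \<otimes> t [^] (- \<pi> h)) - (kpart r m (h \<otimes> t [^] (- \<pi> h)) - (kpart r m h + kpart r m (t [^] (- \<pi> h))))
       - (kpart r m (t [^] (- \<pi> h)) - (- \<pi> h) * kpart r m t) - (kpart r m h - 1) + \<pi> h * (kpart r m t - u)"
      by (rule dvd_add[OF dvd_diff[OF dvd_diff[OF dvd_diff[OF hk a1] a2] a3] a4])
    then show ?thesis by (simp add: algebra_simps)
  qed
  then have "m dvd - (1 - \<pi> h * u)" by (simp only: dvd_minus_iff)
  then have ju: "m dvd u * \<pi> h - 1" by (simp add: algebra_simps)
  define u' where "u' = \<pi> h mod m + m"
  have u': "u' > 0" using m0 by (simp add: u'_def add_nonneg_pos)
  have "m dvd u' - \<pi> h" unfolding u'_def by (simp add: mod_eq_dvd_iff[symmetric])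
  then have "m dvd (u * \<pi> h - 1) + u * (u' - \<pi> h)" using ju by (intro dvd_add dvd_mult)
  then have uu: "m dvd u * u' - 1" by (simp add: algebra_simps)
  have rel: "vdvd r (P *v (B *v v) - mpow A u *v (P *v v))" for v
  proof -
    have 1: "R r m (t \<otimes> \<nu> v) (w0 + mpow A u *v (P *v v)) (u + 0)" by (rule rep_mult[OF T t(1) nu_carrier w P])
    have 2: "R r m (inv t) (- (mpow A (- u) *v w0)) (- u)" by (rule rep_inv[OF T t(1) w])
    have "R r m (t \<otimes> \<nu> v \<otimes> inv t) (w0 + mpow A u *v (P *v v) + mpow A (u + 0) *v (- (mpow A (- u) *v w0))) (u + 0 + - u)"
      by (rule rep_mult[OF T m_closed[OF t(1) nu_carrier] inv_closed[OF t(1)] 1 2])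
    then have "R r m (\<nu> (B *v v)) (mpow A u *v (P *v v)) 0"
      using inv_A unfolding nu_conj by (simp add: matvec_minus)
    then show ?thesis using rep_iff[OF T nu_carrier, of "B *v v" "mpow A u *v (P *v v)" 0 "P *v (B *v v)" 0] P by simp
  qed
  have onto: "\<exists>v. vdvd r (P *v v - w)" for w
  proof -
    obtain h where h: "h \<in> carrier H" "c dvd \<pi> h" "R r m h w 0" using rep_E_surj[OF T, of 0 w] by auto
    then have "h \<in> N" using c0 by (simp add: N_def)
    then obtain v where v: "h = \<nu> v" using nu_onto by blast
    have "R r m (\<nu> v) (P *v v) 0" by (rule P)
    then have "vdvd r (P *v v - w)" using rep_iff[OF T h(1,3)] v by simp
    then show ?thesis by blast
  qed
  show "\<exists>P u u'. u > 0 \<and> u' > 0 \<and> m dvd u * u' - 1 \<and>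
     (\<forall>v. vdvd r (P *v (B *v v) - mpow A u *v (P *v v))) \<and> (\<forall>w. \<exists>v. vdvd r (P *v v - w))"
    using u u' uu rel onto by blast
qed

lemma split_involution:
  assumes "c = 2"
  shows "B ** B = mat 1"
proof -
  have E: "t [^] (2::int) \<in> E" unfolding E_def using t assms by (simp add: pi_pow)
  have "\<nu> (mpow B 2 *v v) = \<nu> v" for v
  proof -
    have "t [^] (2::int) \<otimes> \<nu> v = \<nu> v \<otimes> t [^] (2::int)" using E_comm[OF E] nu_N N_subset_E by blast
    then have "t [^] (2::int) \<otimes> \<nu> v \<otimes> t [^] (-2::int) = \<nu> v"
      using t nu_carrier by (simp add: m_assoc flip: int_pow_mult)
    then show ?thesis using nu_conj_pow[of 2 v] by simp
  qed
  then have b: "mpow B 2 *v v = v" for v using nu_eq_iff by blast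
  have "mpow B 2 = B ** B" using mpow_add[OF inv_B, of 1 1] mpow_1[OF inv_B] by simp
  then show ?thesis using b[of "vector [1, 0]"] b[of "vector [0, 1]"]
    by (simp add: mat2_eq_iff vec2_eq_iff mat2_vec_nth)
qed

lemma pi_decomp_nu: "h \<in> carrier H ==> \<exists>v. h = \<nu> v \<otimes> t [^] \<pi> h"
  using nu_onto[OF pi_decomp(2)] pi_decomp(4) by metis

text \<open>\<open>B = mat 1\<close> makes \<open>H\<close> commutative, hence also its finite
  images, and then \<open>A\<close> is the identity modulo every \<open>r\<close>.\<close>

lemma split_ne_1:
  assumes "B = mat 1"
  shows "A = mat 1"
proof -
  have conj: "t [^] (k::int) \<otimes> \<nu> v \<otimes> t [^] (-k) = \<nu> v" for k v
    by (simp add: nu_conj_pow assms mpow_mat_1)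
  have comm: "x \<otimes> y = y \<otimes> x" if xy: "x \<in> carrier H" "y \<in> carrier H" for x y
  proof -
    obtain v k where x: "x = \<nu> v \<otimes> t [^] (k::int)" using pi_decomp_nu[OF xy(1)] by blast
    obtain w l where y: "y = \<nu> w \<otimes> t [^] (l::int)" using pi_decomp_nu[OF xy(2)] by blast
    show ?thesis
      unfolding x y conj_pow_mult[OF t(1) nu_carrier nu_carrier] conj by (simp add: add.commute flip: nu_add)
  qed
  have "A *v w - w = 0" for w
  proof (rule vdvd_all_0)
    fix r :: int assume r: "r > 0"
    obtain m where T: "trivial_mod A r m" using trivial_mod_exists[OF inv_A r, of 1] by auto
    obtain g s where g: "g \<in> carrier H" "R r m g w 0" "s \<in> carrier H" "R r m s 0 1" using rep_surj[OF T] by metis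
    have "R r m (s \<otimes> g) (0 + mpow A 1 *v w) (1 + 0)" by (rule rep_mult[OF T g(3,1,4,2)])
    moreover have "R r m (g \<otimes> s) (w + mpow A 0 *v 0) (0 + 1)" by (rule rep_mult[OF T g(1,3,2,4)])
    ultimately show "vdvd r (A *v w - w)"
      using rep_iff[OF T, of "g \<otimes> s" w 1 "A *v w" 1] comm[OF g(1,3)] g(1,3) mpow_1[OF inv_A] by simp
  qed
  then show ?thesis by (simp add: matrix_eq)
qed

text \<open>For \<open>B = -1\<close> all squares of elements outside \<open>E\<close> are powers of \<open>t\<^sup>2\<close>.\<close>

lemma split_ne_minus_1:
  assumes B: "B = - mat 1" and c: "c = 2"
  shows "A = - mat 1"
proof -
  have sq: "h \<otimes> h = t [^] (2 * \<pi> h)" if h: "h \<in> carrier H" "odd (\<pi> h)" for h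
  proof -
    obtain v where v: "h = \<nu> v \<otimes> t [^] \<pi> h" using pi_decomp_nu[OF h(1)] by blast
    have "h \<otimes> h = (\<nu> v \<otimes> (t [^] \<pi> h \<otimes> \<nu> v \<otimes> t [^] (- \<pi> h))) \<otimes> t [^] (\<pi> h + \<pi> h)"
      using conj_pow_mult[OF t(1) nu_carrier nu_carrier, of v "\<pi> h" v "\<pi> h"] unfolding v[symmetric] .
    also have "t [^] \<pi> h \<otimes> \<nu> v \<otimes> t [^] (- \<pi> h) = \<nu> (- v)" unfolding nu_conj_pow B mpow_minus_1 using h(2) by simp
    also have "\<nu> v \<otimes> \<nu> (- v) = \<one>" using nu_add[of v "- v"] nu_zero by simp
    finally show ?thesis using t by simp
  qed
  have "2 *s (v + A *v v) = 0" for v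
  proof (rule vdvd_all_0)
    fix r :: int assume r: "r > 0"
    \<comment> \<open>The factor \<open>2\<close> makes parities of \<int>-components meaningful;
      the factor \<open>r\<close> allows congruences between them to be used as scalars modulo
      \<open>r\<close>.\<close>
    obtain m where T: "trivial_mod A r m" "2 * r dvd m" using trivial_mod_exists[OF inv_A r, of "2 * r"] r by auto
    have m: "even m" "r dvd m" using dvd_trans[OF _ T(2)] by simp_all
    have sqr: "R r m (t [^] (2 * \<pi> h)) (w + A *v w) 2" if h: "h \<in> carrier H" "R r m h w 1" for h w
    proof -
      have "odd (\<pi> h)"
      proof
        assume "even (\<pi> h)"
        then obtain w' k where k: "even k" "R r m h w' k" using rep_E[OF h(1) _ T(1)] unfolding c by blast
        then have "m dvd k - 1" using rep_iff[OF T(1) h] by blast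
        then have "even (k - 1)" using m(1) dvd_trans by blast
        then show False using k(1) by simp
      qed
      then have e: "t [^] (2 * \<pi> h) = h \<otimes> h" using sq[OF h(1)] by simp
      show ?thesis unfolding e using rep_mult[OF T(1) h(1,1,2,2)] mpow_1[OF inv_A] by simp
    qed
    obtain h1 where h1: "h1 \<in> carrier H" "R r m h1 v 1" using rep_surj[OF T(1)] .
    obtain h2 where h2: "h2 \<in> carrier H" "R r m h2 0 1" using rep_surj[OF T(1)] .
    let ?s = "t [^] (2::int)" and ?i = "\<pi> h1" and ?j = "\<pi> h2"
    have s: "?s \<in> carrier H" "\<And>k. ?s [^] (k::int) = t [^] (2 * k)" using t by (simp_all add: int_pow_pow)
    obtain b u where b: "even u" "R r m ?s b u" using rep_E[OF s(1) _ T(1)] t unfolding c by (auto simp: pi_pow)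
    have pw: "R r m (t [^] (2 * k)) (k *s b) (k * u)" for k
      using rep_pow[OF T(1) s(1) b(2)] mpow_c b(1) unfolding s(2) c by blast
    have e: "vdvd r (?i *s b - (v + A *v v))" "vdvd r (?j *s b)" "m dvd ?j * u - 2"
      using rep_iff[OF T(1) int_pow_closed[OF t(1)] sqr[OF h1]] pw[of ?i]
        rep_iff[OF T(1) int_pow_closed[OF t(1)] sqr[OF h2]] pw[of ?j] by simp_all
    have rj: "r dvd ?j * u - 2" using dvd_trans[OF m(2) e(3)] .
    \<comment> \<open>Elimination of \<open>b\<close>: modulo \<open>r\<close>, \<open>?i\<close>
      times \<open>b\<close> is \<open>v + A *v v\<close>, \<open>?j\<close> times \<open>b\<close>
      vanishes, and \<open>?j * u\<close> is \<open>2\<close>; so \<open>2 (v + A v)\<close>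
      vanishes.\<close>
    have "vdvd r ((?i * u) *s (?j *s b) - (?j * u) *s (?i *s b - (v + A *v v)))"
      by (rule vdvd_diff[OF vdvd_smult[OF e(2)] vdvd_smult[OF e(1)]])
    moreover have "(?i * u) *s (?j *s b) - (?j * u) *s (?i *s b - (v + A *v v)) = (?j * u) *s (v + A *v v)"
      by (simp add: vec2_eq_iff algebra_simps)
    moreover have "vdvd r ((?j * u - 2) *s (v + A *v v))" using rj unfolding vdvd_def vector_smult_component by (simp only: dvd_mult2)
    ultimately have "vdvd r ((?j * u) *s (v + A *v v) - (?j * u - 2) *s (v + A *v v))" using vdvd_diff by metis
    moreover have "(?j * u) *s (v + A *v v) - (?j * u - 2) *s (v + A *v v) = 2 *s (v + A *v v)"
      by (simp add: vec2_eq_iff algebra_simps)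
    ultimately show "vdvd r (2 *s (v + A *v v))" by simp
  qed
  from this[of "vector [1, 0]"] this[of "vector [0, 1]"] show ?thesis
    by (simp add: mat2_eq_iff vec2_eq_iff mat2_vec_nth)
qed

end

end

lemma family_of_profinitely_iso:
  assumes "polycyclic_by_finite H" "invertible A" "profinitely_iso H (\<G> A)"
  obtains \<theta> where "semidirect_family H A \<theta>" "noetherian_in H (carrier H)" "residually_finite_in H (carrier H)"
proof -
  have g: "group H" using assms(1) by (simp add: polycyclic_by_finite_def)
  obtain \<theta> where "profinite_family H (\<G> A) \<theta>"
    using profinitely_iso_imp_family[OF g group_semidirect_Z2_Z[OF assms(2)] assms(3)] by blast
  then have "semidirect_family H A \<theta>" using g assms(2) by (simp add: semidirect_family_def semidirect_family_axioms_def)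
  then show ?thesis using that group.polycyclic_by_finite_imp[OF g assms(1)] by blast
qed

text \<open>The case \<open>c = 0\<close>: the kernel of the projection has no \<int>-component at
  any level, and every vector is the representation of one of its elements.\<close>

theorem genus_of_semidirect:
  assumes "polycyclic_by_finite H" "invertible A" "profinitely_iso H (\<G> A)" "det (A - mat 1) \<noteq> 0"
  obtains B where "invertible B" "\<G> B \<cong> H" "profinitely_equivalent A B"
proof -
  obtain \<theta> where fam: "semidirect_family H A \<theta>" and H: "noetherian_in H (carrier H)" "residually_finite_in H (carrier H)"
    using family_of_profinitely_iso[OF assms(1-3)] .
  interpret semidirect_family H A \<theta> by (rule fam)
  obtain \<pi> t where \<pi>: "int_hom H (carrier H) \<pi>" "t \<in> carrier H" "\<pi> t = 1"
    "\<And>h r m. h \<in> carrier H ==> \<pi> h = 0 ==> trivial_mod A r m ==> m dvd kpart r m h"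
    by (rule projection_main[OF H(1) assms(4)]) (rule that; blast)
  have "abelian_family H A \<theta> \<pi> t 0"
  proof (unfold_locales)
    fix h r m assume h: "h \<in> carrier H" "0 dvd \<pi> h" "trivial_mod A r m"
    then have "m dvd kpart r m h - 0" using \<pi>(4) by simp
    then obtain v where "R r m h v 0" using kpart_zero_rep[OF h(3,1)] by blast
    then show "\<exists>v k. 0 dvd k \<and> R r m h v k" by auto
  next
    fix r m v and k :: int assume "trivial_mod A r m" "0 dvd k"
    then show "\<exists>h\<in>carrier H. 0 dvd \<pi> h \<and> R r m h v k" using surjective_main(2)[OF \<pi>] by simp
  qed (use H \<pi> in auto)
  then interpret abelian_family H A \<theta> \<pi> t 0 .
  obtain B \<nu> where s: "split_by B \<nu>" using split_exists by blast
  show ?thesis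
    using that[OF inv_B[OF s]] split_iso[OF s] split_profinitely_equivalent[OF s] unfolding is_iso_def by blast
qed

theorem genus_of_involution:
  assumes "polycyclic_by_finite H" "invertible A" "profinitely_iso H (\<G> A)"
    and A: "A ** A = mat 1" "A \<noteq> mat 1" "A \<noteq> - mat 1"
  obtains B where "invertible B" "\<G> B \<cong> H" "B ** B = mat 1" "B \<noteq> mat 1" "B \<noteq> - mat 1"
proof -
  obtain \<theta> where fam: "semidirect_family H A \<theta>" and H: "noetherian_in H (carrier H)" "residually_finite_in H (carrier H)"
    using family_of_profinitely_iso[OF assms(1-3)] .
  interpret semidirect_family H A \<theta> by (rule fam)
  obtain \<pi> t where \<pi>: "int_hom H (carrier H) \<pi>" "t \<in> carrier H" "\<pi> t = 1"
    "\<And>h. h \<in> carrier H ==> even (kpart 1 2 h - \<pi> h)"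
    by (rule projection_involution[OF H(1)]) (rule that; blast)
  have T1: "trivial_mod A 1 2" by (rule trivial_mod_1) simp
  \<comment> \<open>\<open>\<pi>\<close> and the \<int>-component agree modulo \<open>2\<close>
    only, and \<open>m\<close> may be odd; at the doubled level parities are defined.\<close>
  have T2: "trivial_mod A r (m * 2)" if "trivial_mod A r m" for r m by (rule trivial_mod_mult[OF inv_A that]) simp
  have par: "even k \<longleftrightarrow> even (\<pi> h)" if T: "trivial_mod A r m" and h: "h \<in> carrier H" "R r (m * 2) h v k" for r m h v k
  proof -
    have "R 1 2 h v k" by (rule rep_mono[OF T1 T2[OF T] _ _ h]) simp_all
    then have "even (kpart 1 2 h - k)" by (rule kpart_dvd[OF T1 h(1)])
    then show ?thesis using \<pi>(4)[OF h(1)] by auto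
  qed
  have "abelian_family H A \<theta> \<pi> t 2"
  proof (unfold_locales)
    fix h r m assume h: "h \<in> carrier H" "2 dvd \<pi> h" and T: "trivial_mod A r m"
    obtain v k where v: "R r (m * 2) h v k" using rep_exists[OF T2[OF T] h(1)] by blast
    then have "2 dvd k" using par[OF T h(1)] h(2) by blast
    moreover have "R r m h v k" by (rule rep_mono[OF T T2[OF T] _ _ h(1) v]) simp_all
    ultimately show "\<exists>v k. 2 dvd k \<and> R r m h v k" by blast
  next
    fix r m v and k :: int assume T: "trivial_mod A r m" and k: "2 dvd k"
    obtain h where h: "h \<in> carrier H" "R r (m * 2) h v k" using rep_surj[OF T2[OF T]] .
    then have "2 dvd \<pi> h" using par[OF T h] k by blast
    moreover have "R r m h v k" by (rule rep_mono[OF T T2[OF T] _ _ h]) simp_all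
    ultimately show "\<exists>h\<in>carrier H. 2 dvd \<pi> h \<and> R r m h v k" using h(1) by blast
  next
    show "mpow A 2 = mat 1" using mpow_add[OF inv_A, of 1 1] mpow_1[OF inv_A] A(1) by simp
  qed (use H \<pi> in auto)
  then interpret abelian_family H A \<theta> \<pi> t 2 .
  obtain B \<nu> where s: "split_by B \<nu>" using split_exists by blast
  have "\<G> B \<cong> H" using split_iso[OF s] unfolding is_iso_def by blast
  then show ?thesis
    using that[OF inv_B[OF s] _ split_involution[OF s]] split_ne_1[OF s] split_ne_minus_1[OF s _ refl] A(2,3) by blast
qed

section \<open>Local conjugacy of primitive matrices\<close>

text \<open>The quotient by a subgroup of index \<open>n\<close> is handled by \<open>P n\<close>,
  which is bijective modulo \<open>n\<close> by coprimality. Compatibility allows any positive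
  multiple of the index instead, and this is how two levels are compared.\<close>

lemma intertwining_profinitely_iso:
  fixes P :: "int => int^2^2"
  assumes A: "invertible A" and C: "invertible C" and intw: "\<And>n. P n ** C = A ** P n"
    and cop: "\<And>n. n > 0 ==> coprime (det (P n)) n"
    and compat: "\<And>n n' v. n > 0 ==> n' > 0 ==> n' dvd n ==> vdvd n' (P n *v v - P n' *v v)"
  shows "profinitely_iso (\<G> C) (\<G> A)"
proof (rule profinite_family_imp_iso[OF group_semidirect_Z2_Z[OF C] group_semidirect_Z2_Z[OF A]])
  let ?GA = "\<G> A" and ?GC = "\<G> C"
  interpret GA: group ?GA by (rule group_semidirect_Z2_Z[OF A])
  note simps = semidirect_simps[OF A] semidirect_simps[OF C]
  define N where "N M = int (card (rcosets\<^bsub>?GA\<^esub> M))" for M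
  define \<theta> where "\<theta> M = (\<lambda>(v, k). M #>\<^bsub>?GA\<^esub> (P (N M) *v v, k))" for M
  have N: "N M > 0" "Mset (N M) (N M) \<subseteq> M" if "M \<in> fin_index_normal ?GA" for M
    using fin_index_normal_contains[OF A that N_def] by simp_all
  have coset: "M #>\<^bsub>?GA\<^esub> (w, k) = M #>\<^bsub>?GA\<^esub> (w', k)"
    if M: "M \<in> fin_index_normal ?GA" and w: "vdvd (N M) (w - w')" for M w w' k
  proof -
    have sg: "subgroup M ?GA" using normal_imp_subgroup[OF fin_index_normal_normal[OF M]] .
    have "(w, k) \<otimes>\<^bsub>?GA\<^esub> inv\<^bsub>?GA\<^esub> (w', k) = (w - w', 0)"
      using mpow_cancel(1)[OF A, of k w'] by (simp add: semidirect_inv[OF A] simps matvec_minus)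
    moreover have "(w - w', 0) \<in> M" using N(2)[OF M] w by (auto simp: Mset_def)
    ultimately show ?thesis by (subst GA.r_coset_eq_iff[OF sg]) (simp_all add: simps)
  qed
  have refine: "M #>\<^bsub>?GA\<^esub> (P (N M * j) *v v, k) = \<theta> M (v, k)"
    if M: "M \<in> fin_index_normal ?GA" and j: "j > 0" for M j v k
    unfolding \<theta>_def by (simp add: coset[OF M compat[OF mult_pos_pos[OF N(1)[OF M] j] N(1)[OF M] dvd_triv_left]])
  have hom: "\<theta> M \<in> hom ?GC (?GA Mod M)" if M: "M \<in> fin_index_normal ?GA" for M
  proof (rule homI)
    fix x show "\<theta> M x \<in> carrier (?GA Mod M)" by (auto simp: \<theta>_def carrier_FactGroup simps split: prod.split)
  next
    fix x y :: "(int^2) \<times> int"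
    obtain v k w l where xy: "x = (v, k)" "y = (w, l)" by (metis surj_pair)
    have "P (N M) *v (mpow C k *v w) = mpow A k *v (P (N M) *v w)"
      using mpow_intertwine[OF C A intw, of "N M" k] by (simp add: matrix_vector_mul_assoc)
    then show "\<theta> M (x \<otimes>\<^bsub>?GC\<^esub> y) = \<theta> M x \<otimes>\<^bsub>?GA Mod M\<^esub> \<theta> M y"
      using GA.rcos_mult[OF fin_index_normal_normal[OF M], of "(P (N M) *v v, k)" "(P (N M) *v w, l)"]
      by (simp add: xy \<theta>_def simps matvec_add)
  qed
  have surj: "\<theta> M ` carrier ?GC = carrier (?GA Mod M)" if M: "M \<in> fin_index_normal ?GA" for M
  proof
    show "\<theta> M ` carrier ?GC \<subseteq> carrier (?GA Mod M)" using hom[OF M] by (auto simp: hom_def)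
    show "carrier (?GA Mod M) \<subseteq> \<theta> M ` carrier ?GC"
    proof
      fix K assume "K \<in> carrier (?GA Mod M)"
      then obtain w l where K: "K = M #>\<^bsub>?GA\<^esub> (w, l)" by (auto simp: carrier_FactGroup)
      \<comment> \<open>A preimage of \<open>w\<close> modulo the index is the adjugate applied to
        \<open>w\<close>, times an inverse of the determinant.\<close>
      obtain s where s: "[det (P (N M)) * s = 1] (mod N M)" using cong_solve_coprime_int[OF cop[OF N(1)[OF M]]] by blast
      have e: "P (N M) *v (s *s (adj2 (P (N M)) *v w)) - w = (det (P (N M)) * s - 1) *s w"
        by (simp add: vec2_eq_iff mat2_vec_nth det_2 algebra_simps)
      have "vdvd (N M) (P (N M) *v (s *s (adj2 (P (N M)) *v w)) - w)"
        using s unfolding e vdvd_def vector_smult_component by (simp only: cong_iff_dvd_diff dvd_mult2)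
      then have "\<theta> M (s *s (adj2 (P (N M)) *v w), l) = K" unfolding K \<theta>_def by (simp add: coset[OF M])
      then show "K \<in> \<theta> M ` carrier ?GC" by (force simp: simps)
    qed
  qed
  have comp: "\<theta> M' h \<subseteq> \<theta> M h"
    if M: "M \<in> fin_index_normal ?GA" "M' \<in> fin_index_normal ?GA" "M' \<subseteq> M" for M M' h
  proof -
    obtain v k where h: "h = (v, k)" by fastforce
    have "\<theta> M' h = M' #>\<^bsub>?GA\<^esub> (P (N M * N M') *v v, k)"
      using refine[OF M(2) N(1)[OF M(1)], of v k] by (simp add: h mult.commute)
    also have "\<dots> \<subseteq> M #>\<^bsub>?GA\<^esub> (P (N M * N M') *v v, k)" using M(3) by (auto simp: r_coset_def)
    also have "\<dots> = \<theta> M h" using refine[OF M(1) N(1)[OF M(2)], of v k] by (simp add: h)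
    finally show ?thesis .
  qed
  have cofinal: "\<exists>M\<in>fin_index_normal ?GA. \<forall>h\<in>carrier ?GC. \<theta> M h = M \<longrightarrow> h \<in> L"
    if L: "L \<in> fin_index_normal ?GC" for L
  proof -
    define n where "n = int (card (rcosets\<^bsub>?GC\<^esub> L))"
    have n: "n > 0" "Mset n n \<subseteq> L" using fin_index_normal_contains[OF C L n_def] by simp_all
    obtain m where T: "trivial_mod A n m" "n dvd m" using trivial_mod_exists[OF A n(1) n(1)] by blast
    let ?M = "Mset n m"
    have M: "?M \<in> fin_index_normal ?GA" by (rule Mset_fin_index_normal[OF A T(1)])
    have "h \<in> L" if h: "\<theta> ?M h = ?M" for h
    proof -
      obtain v k where vk: "h = (v, k)" by fastforce
      \<comment> \<open>This choice makes the determinant prime to \<open>n\<close> as well as to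
        the index of \<open>?M\<close>.\<close>
      let ?Q = "P (N ?M * n)"
      have "?M #>\<^bsub>?GA\<^esub> (?Q *v v, k) = ?M" using refine[OF M n(1), of v k] h by (simp add: vk)
      moreover have "(?Q *v v, k) \<in> ?M #>\<^bsub>?GA\<^esub> (?Q *v v, k)" by (simp add: Mset_coset[OF A T(1)])
      ultimately have vd: "vdvd n (?Q *v v)" and k: "n dvd k" using dvd_trans[OF T(2)] by (auto simp: Mset_def)
      have "coprime (det ?Q) (N ?M * n)" by (rule cop[OF mult_pos_pos[OF N(1)[OF M] n(1)]])
      then have co: "coprime n (det ?Q)" by (simp add: coprime_commute)
      have "adj2 ?Q *v (?Q *v v) = det ?Q *s v" by (simp add: vec2_eq_iff mat2_vec_nth det_2 algebra_simps)
      then have "vdvd n (det ?Q *s v)" using vdvd_matvec[OF vd, of "adj2 ?Q"] by simp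
      then have "vdvd n v" using co by (simp add: vdvd_def coprime_dvd_mult_right_iff)
      then show ?thesis using n(2) k by (auto simp: vk Mset_def)
    qed
    then show ?thesis using M by blast
  qed
  show "profinite_family ?GC ?GA \<theta>"
    unfolding profinite_family_def by (intro conjI ballI impI hom surj comp cofinal)
qed

lemma int_dvd_of_prime_powers:
  fixes n :: nat and z :: int
  assumes "n > 0" "\<And>p. normalization_semidom_class.prime p ==> int (p ^ multiplicity p n) dvd z"
  shows "int n dvd z"
proof (cases "z = 0")
  case False
  have "n dvd nat \<bar>z\<bar>"
  proof (rule multiplicity_le_imp_dvd)
    fix p :: nat assume p: "normalization_semidom_class.prime p"
    have "p ^ multiplicity p n dvd nat \<bar>z\<bar>" using assms(2)[OF p] by (simp add: nat_abs_dvd_iff dvd_nat_abs_iff)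
    then show "multiplicity p n \<le> multiplicity p (nat \<bar>z\<bar>)"
      using p False by (intro multiplicity_geI) (auto simp: prime_gt_1_nat not_prime_unit)
  qed (use assms(1) in simp)
  then show ?thesis by (simp add: dvd_nat_abs_iff)
qed simp

text \<open>A profinite integer with component \<open>y p\<close> at each prime \<open>p\<close>,
  given by approximations: \<open>x n\<close> is correct modulo the exact power of each prime in
  \<open>n\<close>.\<close>

lemma prime_power_residues:
  fixes y :: "nat => nat"
  obtains x :: "int => int" where "\<And>n p. n > 0 ==> normalization_semidom_class.prime p ==> int (p ^ multiplicity p (nat n)) dvd x n - int (y p)"
proof -
  have "\<exists>x :: int. \<forall>p. normalization_semidom_class.prime p \<longrightarrow> int (p ^ multiplicity p (nat n)) dvd x - int (y p)" if n: "n > 0" for n :: int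
  proof -
    let ?S = "prime_factors (nat n)" and ?m = "\<lambda>p. p ^ multiplicity p (nat n)"
    have "\<exists>x. \<forall>p\<in>?S. [x = y p] (mod ?m p)"
    proof (rule chinese_remainder_nat[of ?S ?m y])
      show "finite ?S" by simp
      show "\<forall>i\<in>?S. \<forall>j\<in>?S. i \<noteq> j \<longrightarrow> coprime (?m i) (?m j)"
        by (auto simp: in_prime_factors_iff primes_coprime coprime_power_left_iff coprime_power_right_iff)
    qed
    then obtain x where x: "\<And>p. p \<in> ?S ==> [x = y p] (mod ?m p)" by blast
    have "int (?m p) dvd int x - int (y p)" if p: "normalization_semidom_class.prime p" for p
    proof (cases "p \<in> ?S")
      case True
      then have "[int x = int (y p)] (mod int (?m p))" using x cong_int_iff by blast
      then show ?thesis by (simp add: cong_iff_dvd_diff)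
    next
      case False
      then have "multiplicity p (nat n) = 0" using p n by (simp add: in_prime_factors_iff not_dvd_imp_multiplicity_0)
      then show ?thesis by simp
    qed
    then show ?thesis by blast
  qed
  then obtain x where "\<And>n. n > 0 ==> \<forall>p. normalization_semidom_class.prime p \<longrightarrow> int (p ^ multiplicity p (nat n)) dvd x n - int (y p)"
    by metis
  then show ?thesis using that by blast
qed

text \<open>Locally at every prime, a primitive matrix has a cyclic vector, so it is conjugate to the
  companion matrix of its characteristic polynomial.\<close>

theorem primitive_profinitely_iso_companion:
  fixes A :: "int^2^2"
  assumes A: "invertible A"
    and prim: "\<And>q. q dvd A $ 1 $ 2 ==> q dvd A $ 2 $ 1 ==> q dvd A $ 2 $ 2 - A $ 1 $ 1 ==> \<bar>q\<bar> = 1"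
  shows "profinitely_iso (\<G> (M2 0 (- det A) 1 (trace A))) (\<G> A)"
proof -
  define a b c d where "a = A $ 1 $ 1" "b = A $ 1 $ 2" "c = A $ 2 $ 1" "d = A $ 2 $ 2"
  note abcd = this
  \<comment> \<open>The determinant formed by the vector \<open>(x, y)\<close> and its image under
    \<open>A\<close>; where \<open>p\<close> does not divide it, the vector is cyclic modulo
    \<open>p\<close>.\<close>
  define Q where "Q x y = c * x * x + (d - a) * x * y - b * y * y" for x y
  \<comment> \<open>The values of \<open>Q\<close> at \<open>(1, 0)\<close>, \<open>(0, 1)\<close>
    and \<open>(1, 1)\<close> determine its coefficients, which by primitivity are not all divisible
    by \<open>p\<close>.\<close>
  have "\<exists>x y :: nat. \<not> int p dvd Q (int x) (int y)" if p: "normalization_semidom_class.prime p" for p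
  proof (rule ccontr)
    assume "\<not> ?thesis"
    then have h: "int p dvd Q (int x) (int y)" for x y by blast
    have c: "int p dvd c" and b: "int p dvd b" using h[of 1 0] h[of 0 1] by (simp_all add: Q_def)
    have "int p dvd Q 1 1 - c + b" using h[of 1 1] c b dvd_add[OF dvd_diff] by simp
    then have "int p dvd d - a" by (simp add: Q_def)
    then have "\<bar>int p\<bar> = 1" using b c by (intro prim) (simp_all only: abcd)
    then show False using p by simp
  qed
  then obtain y1 y2 :: "nat => nat" where y: "\<And>p. normalization_semidom_class.prime p ==> \<not> int p dvd Q (int (y1 p)) (int (y2 p))" by metis
  obtain x1 where x1: "\<And>n p. n > 0 ==> normalization_semidom_class.prime p ==> int (p ^ multiplicity p (nat n)) dvd x1 n - int (y1 p)"
    using prime_power_residues by blast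
  obtain x2 where x2: "\<And>n p. n > 0 ==> normalization_semidom_class.prime p ==> int (p ^ multiplicity p (nat n)) dvd x2 n - int (y2 p)"
    using prime_power_residues by blast
  \<comment> \<open>The columns are the approximate cyclic vector and its image under
    \<open>A\<close>; in this basis \<open>A\<close> becomes the companion matrix.\<close>
  define P where "P n = M2 (x1 n) (a * x1 n + b * x2 n) (x2 n) (c * x1 n + d * x2 n)" for n
  have detP: "det (P n) = Q (x1 n) (x2 n)" for n by (simp add: P_def Q_def det_2 algebra_simps)
  show ?thesis
  proof (rule intertwining_profinitely_iso[OF A, of _ P])
    show "invertible (M2 0 (- det A) 1 (trace A))" using A by (simp add: invertible_iff_det det_2[of "M2 _ _ _ _"])
    show "P n ** M2 0 (- det A) 1 (trace A) = A ** P n" for n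
      by (simp add: mat2_eq_iff mat2_mult_nth P_def det_2[of A] trace_2 abcd algebra_simps)
  next
    fix n :: int assume n: "n > 0"
    show "coprime (det (P n)) n"
    proof (rule ccontr)
      assume "\<not> coprime (det (P n)) n"
      then have "gcd (det (P n)) n \<noteq> 1" by (simp add: coprime_iff_gcd_eq_1)
      then obtain q where q: "normalization_semidom_class.prime q" "q dvd gcd (det (P n)) n"
        using prime_divisor_exists[of "gcd (det (P n)) n"] n by auto
      define p where "p = nat q"
      have qp: "q = int p" using prime_gt_0_int[OF q(1)] by (simp add: p_def)
      then have p: "normalization_semidom_class.prime p" "int p dvd det (P n)" "int p dvd n" using q by auto
      have "int p dvd int (nat n)" using p(3) n by simp
      then have "p dvd nat n" by (simp only: int_dvd_int_iff)
      then have "p dvd p ^ multiplicity p (nat n)" using p(1) n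
        by (metis dvd_power multiplicity_eq_zero_iff nat_neq_iff not_prime_unit zero_less_nat_eq bot_nat_0.not_eq_extremum)
      then have d: "int p dvd int (p ^ multiplicity p (nat n))" by (simp only: int_dvd_int_iff)
      have e: "int p dvd x1 n - int (y1 p)" "int p dvd x2 n - int (y2 p)"
        using dvd_trans[OF d x1[OF n p(1)]] dvd_trans[OF d x2[OF n p(1)]] .
      have "[Q (x1 n) (x2 n) = Q (int (y1 p)) (int (y2 p))] (mod int p)"
        unfolding Q_def using e by (intro cong_diff cong_add cong_mult cong_refl) (simp_all add: cong_iff_dvd_diff)
      then show False using p(2) y[OF p(1)] unfolding detP by (simp add: cong_dvd_iff)
    qed
  next
    fix n n' :: int and v assume n: "n > 0" "n' > 0" "n' dvd n"
    have cg: "n' dvd x n - x n'" if x: "\<And>n p. n > 0 ==> normalization_semidom_class.prime p ==> int (p ^ multiplicity p (nat n)) dvd x n - int (y p)"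
      for x :: "int => int" and y
    proof -
      have "int (nat n') dvd x n - x n'"
      proof (rule int_dvd_of_prime_powers)
        fix p :: nat assume p: "normalization_semidom_class.prime p"
        have "nat n' dvd nat n" using n by (simp add: nat_dvd_iff)
        then have "multiplicity p (nat n') \<le> multiplicity p (nat n)" using n by (intro dvd_imp_multiplicity_le) simp_all
        then have "int (p ^ multiplicity p (nat n')) dvd int (p ^ multiplicity p (nat n))" by (simp add: le_imp_power_dvd)
        then have "int (p ^ multiplicity p (nat n')) dvd x n - int (y p)" using x[OF n(1) p] dvd_trans by blast
        then have "int (p ^ multiplicity p (nat n')) dvd (x n - int (y p)) - (x n' - int (y p))" using x[OF n(2) p] by (rule dvd_diff)
        then show "int (p ^ multiplicity p (nat n')) dvd x n - x n'" by simp
      qed (use n in simp)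
      then show ?thesis using n by simp
    qed
    note e = cg[OF x1] cg[OF x2]
    have "[w1 * x1 n + w2 * x2 n = w1 * x1 n' + w2 * x2 n'] (mod n')" for w1 w2
      using e by (intro cong_add cong_mult cong_refl) (simp_all add: cong_iff_dvd_diff)
    then have l: "n' dvd (w1 * x1 n + w2 * x2 n) - (w1 * x1 n' + w2 * x2 n')" for w1 w2
      by (simp add: cong_iff_dvd_diff)
    show "vdvd n' (P n *v v - P n' *v v)"
      using l[of "v $ 1 + a * v $ 2" "b * v $ 2"] l[of "c * v $ 2" "v $ 1 + d * v $ 2"]
      by (simp add: vdvd_def mat2_vec_nth P_def algebra_simps)
  qed
qed

section \<open>Isomorphisms between semidirect products\<close>

lemma mpow_inverse:
  assumes "invertible B"
  shows "mpow (mpow B (-1)) k = mpow B (-k)"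
  using group.int_pow_pow[OF group_GL2Z, of B "-1" k] assms by (simp add: mpow_def GL2Z_def)

lemma det_mpow_inverse:
  assumes "invertible B"
  shows "det (mpow B (-1)) = det B"
proof -
  have "B ** mpow B (-1) = mat 1" using mpow_add[OF assms, of 1 "-1"] mpow_1[OF assms] by simp
  then have "det B * det (mpow B (-1)) = 1" by (metis det_I det_mul)
  then show ?thesis using assms unfolding invertible_iff_det by auto
qed

lemma trace_mpow_inverse:
  assumes "invertible B"
  shows "trace (mpow B (-1)) = det B * trace B"
proof -
  let ?C = "mpow B (-1)"
  have "B ** ?C = mat 1" using mpow_add[OF assms, of 1 "-1"] mpow_1[OF assms] by simp
  then have "adj2 B ** (B ** ?C) = adj2 B" by simp
  moreover have "adj2 B ** (B ** ?C) = (adj2 B ** B) ** ?C" by (simp add: matrix_mul_assoc)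
  ultimately have e: "(adj2 B ** B) ** ?C = adj2 B" by simp
  have "det B * ?C $ 1 $ 1 = B $ 2 $ 2" "det B * ?C $ 2 $ 2 = B $ 1 $ 1"
    using e by (simp_all add: mat2_eq_iff mat2_mult_nth det_2 algebra_simps)
  then have "det B * trace ?C = trace B" by (simp add: trace_2 distrib_left)
  then show ?thesis using assms unfolding invertible_iff_det by auto
qed

lemma mconj_imp_semidirect_iso:
  assumes "invertible B" "invertible C" "mconj B C"
  shows "\<G> B \<cong> \<G> C"
proof -
  obtain P where P: "invertible P" "P ** B = C ** P" using assms(3) by (auto simp: mconj_def)
  obtain Q where Q: "P ** Q = mat 1" "Q ** P = mat 1" using P(1) by (auto simp: invertible_def)
  let ?f = "\<lambda>(v, k). (P *v v, k :: int)"
  have pow: "P *v (mpow B k *v v) = mpow C k *v (P *v v)" for k v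
    using mpow_intertwine[OF assms(1,2) P(2), of k] by (simp add: matrix_vector_mul_assoc)
  have "?f \<in> hom (\<G> B) (\<G> C)"
    by (rule homI) (auto simp: semidirect_simps[OF assms(1)] semidirect_simps[OF assms(2)] matvec_add pow)
  moreover have "bij_betw ?f UNIV UNIV"
    by (rule bij_betw_byWitness[where f' = "\<lambda>(v, k). (Q *v v, k)"]) (auto simp: matrix_vector_mul_assoc Q)
  ultimately show ?thesis
    unfolding is_iso_def iso_def by (auto simp: semidirect_simps[OF assms(1)] semidirect_simps[OF assms(2)])
qed

lemma inverse_semidirect_iso:
  assumes "invertible C"
  shows "\<G> (mpow C (-1)) \<cong> \<G> C"
proof -
  note inv = invertible_mpow[OF assms, of "-1"]
  note simps = semidirect_simps[OF assms] semidirect_simps[OF inv]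
  let ?f = "\<lambda>(v :: int^2, k :: int). (v, - k)"
  have "?f \<in> hom (\<G> (mpow C (-1))) (\<G> C)"
    by (rule homI) (auto simp: simps mpow_inverse[OF assms])
  moreover have "bij_betw ?f UNIV UNIV" by (rule bij_betw_byWitness[where f' = ?f]) auto
  ultimately show ?thesis unfolding is_iso_def iso_def by (auto simp: simps)
qed

text \<open>As \<open>det (B - 1) \<noteq> 0\<close>, the subgroup \<open>\<int>\<^sup>2\<close> is the kernel of every homomorphism onto \<open>\<int>\<close>, so an
  isomorphism preserves it.\<close>

theorem semidirect_iso_imp_mconj:
  assumes B: "invertible B" "det (B - mat 1) \<noteq> 0" and C: "invertible C"
    and iso: "\<G> B \<cong> \<G> C"
  shows "mconj B C \<or> mconj B (mpow C (-1))"
proof -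
  let ?GB = "\<G> B" and ?GC = "\<G> C"
  note sB = semidirect_simps[OF B(1)] and sC = semidirect_simps[OF C]
  obtain f where f: "f \<in> iso ?GB ?GC" using iso by (auto simp: is_iso_def)
  have mult: "f ((v, k) \<otimes>\<^bsub>?GB\<^esub> (w, l)) = f (v, k) \<otimes>\<^bsub>?GC\<^esub> f (w, l)" for v k w l
    using f by (auto simp: iso_def hom_def sB)
  have bij: "bij f" using f by (auto simp: iso_def sB sC)
  have snd: "snd (f (v + mpow B k *v w, k + l)) = snd (f (v, k)) + snd (f (w, l))" for v k w l
    using mult[of v k w l] unfolding sB by (cases "f (v, k)"; cases "f (w, l)") (simp add: sC)
  define g where "g v = snd (f (v, 0))" for v
  have g_add: "g (v + w) = g v + g w" for v w using snd[of v 0 w 0] by (simp add: g_def)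
  have "g (B *v v) = g v" for v
    using snd[of 0 1 v 0] snd[of "B *v v" 0 0 1] mpow_1[OF B(1)] by (simp add: g_def)
  moreover have "g (w - v) = g w - g v" for v w using g_add[of "w - v" v] by simp
  ultimately have gB: "g (B *v v - v) = 0" for v by simp
  \<comment> \<open>The multiple of \<open>v\<close> by \<open>det (B - mat 1)\<close> lies in the
    image of \<open>B - mat 1\<close>, where \<open>g\<close> vanishes.\<close>
  have "g v = 0" for v
  proof -
    let ?e = "B - mat 1"
    have "det ?e *s v = ?e *v (adj2 ?e *v v)" by (simp add: vec2_eq_iff mat2_vec_nth det_2 algebra_simps)
    also have "\<dots> = B *v (adj2 ?e *v v) - adj2 ?e *v v" by (simp add: vec2_eq_iff mat2_vec_nth algebra_simps)
    finally have "g (det ?e *s v) = 0" using gB by simp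
    moreover have "g (j *s v) = j * g v" for j
      unfolding additive_vec2[OF g_add, of "j *s v"] additive_vec2[OF g_add, of v] by (simp add: algebra_simps)
    ultimately show ?thesis using B(2) by simp
  qed
  then have g0: "snd (f (v, 0)) = 0" for v by (simp add: g_def)
  define \<phi> where "\<phi> v = fst (f (v, 0))" for v
  have f0: "f (v, 0) = (\<phi> v, 0)" for v using g0[of v] by (simp add: \<phi>_def prod_eq_iff)
  define w \<epsilon> where "w = fst (f (0, 1))" and "\<epsilon> = snd (f (0, 1))"
  have f1: "f (0, 1) = (w, \<epsilon>)" by (simp add: w_def \<epsilon>_def)
  have \<phi>_add: "\<phi> (v + v') = \<phi> v + \<phi> v'" for v v'
    using mult[of v 0 v' 0] by (simp add: sB sC f0)
  have snd_f: "snd (f (v, k)) = k * \<epsilon>" for v k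
  proof -
    have k1: "snd (f (0, k + 1)) = snd (f (0, k)) + \<epsilon>" for k using snd[of 0 k 0 1] by (simp add: \<epsilon>_def)
    have "snd (f (0, k)) = k * \<epsilon>"
    proof (induction k rule: int_induct[where k = 0])
      case base show ?case using g0[of 0] by simp
    next
      case (step1 i) then show ?case using k1[of i] by (simp add: algebra_simps)
    next
      case (step2 i) then show ?case using k1[of "i - 1"] by (simp add: algebra_simps)
    qed
    then show ?thesis using snd[of v 0 0 k] g0[of v] by simp
  qed
  have onto: "\<exists>v k. f (v, k) = (u, l)" for u l using bij by (metis bij_pointE surj_pair)
  \<comment> \<open>Surjectivity makes \<open>\<epsilon>\<close> a unit of \<int>; its sign decides
    between \<open>C\<close> and the inverse of \<open>C\<close>.\<close>
  obtain v1 k1 where "f (v1, k1) = (0, 1)" using onto by blast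
  then have "k1 * \<epsilon> = 1" using snd_f[of v1 k1] by simp
  then have \<epsilon>: "\<epsilon> = 1 \<or> \<epsilon> = -1" by (auto simp: zmult_eq_1_iff)
  have \<phi>_onto: "\<exists>v. \<phi> v = u" for u
  proof -
    obtain v k where vk: "f (v, k) = (u, 0)" using onto by blast
    then have "k = 0" using snd_f[of v k] \<epsilon> by auto
    then show ?thesis using vk f0[of v] by auto
  qed
  define P where "P = M2 (\<phi> (vector [1, 0]) $ 1) (\<phi> (vector [0, 1]) $ 1) (\<phi> (vector [1, 0]) $ 2) (\<phi> (vector [0, 1]) $ 2)"
  have \<phi>P: "\<phi> v = P *v v" for v
    using additive_vec2[of "\<lambda>v. \<phi> v $ 1" v] additive_vec2[of "\<lambda>v. \<phi> v $ 2" v] \<phi>_add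
    by (simp add: vec2_eq_iff mat2_vec_nth P_def mult.commute)
  obtain q1 q2 where q: "P *v q1 = vector [1, 0]" "P *v q2 = vector [0, 1]" using \<phi>_onto \<phi>P by metis
  have "P ** M2 (q1 $ 1) (q2 $ 1) (q1 $ 2) (q2 $ 2) = mat 1"
    using q by (simp add: mat2_eq_iff mat2_mult_nth vec2_eq_iff mat2_vec_nth)
  then have invP: "invertible P" by (rule invertible_of_left_inverse)
  have "\<phi> (B *v v) = mpow C \<epsilon> *v \<phi> v" for v
  proof -
    have "f (B *v v, 1) = (w + mpow C \<epsilon> *v \<phi> v, \<epsilon>)"
      using mult[of 0 1 v 0] mpow_1[OF B(1)] by (simp add: sB sC f0 f1)
    moreover have "f (B *v v, 1) = (\<phi> (B *v v) + w, \<epsilon>)"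
      using mult[of "B *v v" 0 0 1] by (simp add: sB sC f0 f1)
    ultimately show ?thesis by (simp add: add.commute)
  qed
  then have "(P ** B) *v v = (mpow C \<epsilon> ** P) *v v" for v by (simp add: \<phi>P matrix_vector_mul_assoc)
  then have "P ** B = mpow C \<epsilon> ** P" by (simp add: matrix_eq)
  then have "mconj B (mpow C \<epsilon>)" using invP unfolding mconj_def by blast
  then show ?thesis using \<epsilon> mpow_1[OF C] by auto
qed

section \<open>Semidirect products are polycyclic\<close>

lemma (in group) cyclic_quotientI:
  assumes K: "subgroup K G" and S: "subgroup S G" "S \<subseteq> K" and t: "t \<in> K"
    and conj: "\<And>x s. x \<in> K ==> s \<in> S ==> x \<otimes> s \<otimes> inv x \<in> S"
    and gen: "\<And>x. x \<in> K ==> \<exists>s\<in>S. \<exists>k::int. x = s \<otimes> t [^] k"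
  shows "S \<lhd> G\<lparr>carrier := K\<rparr>" "cyclic_group (G\<lparr>carrier := K\<rparr> Mod S)"
proof -
  let ?K = "G\<lparr>carrier := K\<rparr>"
  interpret K: group ?K by (rule subgroup_imp_group[OF K])
  have SK: "subgroup S ?K" by (rule subgroup_incl[OF S(1) K S(2)])
  have inv: "inv\<^bsub>?K\<^esub> x = inv x" if "x \<in> K" for x by (rule m_inv_consistent[OF K that])
  show n: "S \<lhd> ?K" using SK conj by (simp add: K.normal_inv_iff inv)
  interpret n: normal S ?K by (rule n)
  interpret Q: group "?K Mod S" by (rule n.factorgroup_is_group)
  have h: "(\<lambda>x. S #>\<^bsub>?K\<^esub> x) \<in> hom ?K (?K Mod S)" by (rule n.r_coset_hom_Mod)
  interpret h: group_hom ?K "?K Mod S" "\<lambda>x. S #>\<^bsub>?K\<^esub> x"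
    using h by (simp add: group_hom_def group_hom_axioms_def K.group_axioms Q.group_axioms)
  have c: "S #>\<^bsub>?K\<^esub> t \<in> carrier (?K Mod S)" using t by (auto simp: carrier_FactGroup)
  have "\<exists>k::int. y = (S #>\<^bsub>?K\<^esub> t) [^]\<^bsub>?K Mod S\<^esub> k" if y: "y \<in> carrier (?K Mod S)" for y
  proof -
    obtain x where x: "x \<in> K" "y = S #>\<^bsub>?K\<^esub> x" using y by (auto simp: carrier_FactGroup)
    obtain s and k :: int where s: "s \<in> S" "x = s \<otimes> t [^] k" using gen[OF x(1)] by blast
    have p: "t [^]\<^bsub>?K\<^esub> k = t [^] k" using int_pow_consistent[OF K t] by simp
    have "y = S #>\<^bsub>?K\<^esub> (s \<otimes>\<^bsub>?K\<^esub> t [^]\<^bsub>?K\<^esub> k)" using x(2) s(2) p by simp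
    also have "\<dots> = (S #>\<^bsub>?K\<^esub> s) \<otimes>\<^bsub>?K Mod S\<^esub> (S #>\<^bsub>?K\<^esub> (t [^]\<^bsub>?K\<^esub> k))"
      by (rule h.hom_mult) (use s(1) S(2) t K.int_pow_closed[of t k] in auto)
    also have "S #>\<^bsub>?K\<^esub> s = \<one>\<^bsub>?K Mod S\<^esub>"
      using K.coset_join2[OF _ SK s(1)] s(1) S(2) by auto
    also have "S #>\<^bsub>?K\<^esub> (t [^]\<^bsub>?K\<^esub> k) = (S #>\<^bsub>?K\<^esub> t) [^]\<^bsub>?K Mod S\<^esub> k"
      by (rule h.hom_int_pow) (use t in simp)
    also have "\<one>\<^bsub>?K Mod S\<^esub> \<otimes>\<^bsub>?K Mod S\<^esub> (S #>\<^bsub>?K\<^esub> t) [^]\<^bsub>?K Mod S\<^esub> k = (S #>\<^bsub>?K\<^esub> t) [^]\<^bsub>?K Mod S\<^esub> k"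
      by (rule Q.l_one[OF Q.int_pow_closed[OF c]])
    finally show ?thesis by blast
  qed
  then have "carrier (?K Mod S) = range (\<lambda>k::int. (S #>\<^bsub>?K\<^esub> t) [^]\<^bsub>?K Mod S\<^esub> k)"
    using Q.int_pow_closed[OF c] by blast
  then show "cyclic_group (?K Mod S)" using c by (subst Q.cyclic_group) blast
qed

lemma semidirect_int_pow_vec:
  assumes "invertible B"
  shows "(v, 0) [^]\<^bsub>\<G> B\<^esub> (k::int) = (k *s v, 0)"
proof -
  interpret group "\<G> B" by (rule group_semidirect_Z2_Z[OF assms])
  show ?thesis
    unfolding int_pow_def2 semidirect_pow[OF assms mpow_0]
    by (simp add: semidirect_inv[OF assms] vec2_eq_iff)
qed

lemma semidirect_int_pow_one:
  assumes "invertible B"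
  shows "(0, 1) [^]\<^bsub>\<G> B\<^esub> (k::int) = (0, k)"
proof -
  interpret group "\<G> B" by (rule group_semidirect_Z2_Z[OF assms])
  show ?thesis
    unfolding int_pow_def2 semidirect_pow2[OF assms]
    by (simp add: semidirect_inv[OF assms] vec2_eq_iff mat2_vec_nth)
qed

text \<open>The series runs through the first coordinate axis and the integral plane; the axis has
  to be normal in the plane only. It is transported along the isomorphism, since \<open>H\<close> is
  arbitrary.\<close>

lemma polycyclic_by_finite_semidirect:
  assumes B: "invertible B" and H: "group H" and iso: "\<G> B \<cong> H"
  shows "polycyclic_by_finite H"
proof -
  interpret H: group H by (rule H)
  let ?G = "\<G> B"
  interpret G: group ?G by (rule group_semidirect_Z2_Z[OF B])
  note simps = semidirect_simps[OF B] semidirect_inv[OF B]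
  obtain f where f: "f \<in> iso ?G H" using iso by (auto simp: is_iso_def)
  interpret f: group_hom ?G H f using f by (simp add: group_hom_def group_hom_axioms_def iso_def G.group_axioms H)
  have surj: "carrier H = range f" using f by (auto simp: iso_def bij_betw_def simps)
  define U :: "nat => ((int^2) \<times> int) set" where
    "U i = (if i = 0 then {(0, 0)} else if i = 1 then {(v, k). v $ 2 = 0 \<and> k = 0} else if i = 2 then {(v, k). k = 0} else UNIV)" for i
  have U: "subgroup (U i) ?G" for i
    by (rule G.subgroupI) (auto simp: U_def simps mat2_vec_nth vec2_eq_iff intro: exI[of _ 0] split: if_splits)
  have fU: "subgroup (f ` U i) H" for i using f.subgroup_img_is_subgroup[OF U] .
  have step: "f ` U i \<lhd> H\<lparr>carrier := f ` U (Suc i)\<rparr> \<and> cyclic_group (H\<lparr>carrier := f ` U (Suc i)\<rparr> Mod f ` U i)"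
    if sub: "U i \<subseteq> U (Suc i)" and t: "t \<in> U (Suc i)"
      and conj: "\<And>x s. x \<in> U (Suc i) ==> s \<in> U i ==> x \<otimes>\<^bsub>?G\<^esub> s \<otimes>\<^bsub>?G\<^esub> inv\<^bsub>?G\<^esub> x \<in> U i"
      and gen: "\<And>x. x \<in> U (Suc i) ==> \<exists>s\<in>U i. \<exists>k::int. x = s \<otimes>\<^bsub>?G\<^esub> t [^]\<^bsub>?G\<^esub> k" for i t
  proof -
    have U_c: "x \<in> carrier ?G" for x by (simp add: simps)
    have c: "x \<otimes>\<^bsub>H\<^esub> s \<otimes>\<^bsub>H\<^esub> inv\<^bsub>H\<^esub> x \<in> f ` U i" if xs0: "x \<in> f ` U (Suc i)" "s \<in> f ` U i" for x s
    proof -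
      obtain x' s' where xs: "x' \<in> U (Suc i)" "x = f x'" "s' \<in> U i" "s = f s'" using xs0 by blast
      have "x \<otimes>\<^bsub>H\<^esub> s \<otimes>\<^bsub>H\<^esub> inv\<^bsub>H\<^esub> x = f (x' \<otimes>\<^bsub>?G\<^esub> s' \<otimes>\<^bsub>?G\<^esub> inv\<^bsub>?G\<^esub> x')" using U_c by (simp add: xs)
      then show ?thesis using conj[OF xs(1,3)] by blast
    qed
    have g: "\<exists>s\<in>f ` U i. \<exists>k::int. x = s \<otimes>\<^bsub>H\<^esub> f t [^]\<^bsub>H\<^esub> k" if x0: "x \<in> f ` U (Suc i)" for x
    proof -
      obtain x' where x: "x' \<in> U (Suc i)" "x = f x'" using x0 by blast
      obtain s and k :: int where "s \<in> U i" "x' = s \<otimes>\<^bsub>?G\<^esub> t [^]\<^bsub>?G\<^esub> k" using gen[OF x(1)] by blast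
      moreover from this have "x = f s \<otimes>\<^bsub>H\<^esub> f t [^]\<^bsub>H\<^esub> k" using x(2) U_c f.hom_int_pow[OF U_c, of t k] by simp
      ultimately show ?thesis by blast
    qed
    show ?thesis
      using H.cyclic_quotientI[OF fU fU image_mono[OF sub] imageI[OF t] c g] by blast
  qed
  note pv = semidirect_int_pow_vec[OF B] and p1 = semidirect_int_pow_one[OF B]
  have s0: "f ` U 0 \<lhd> H\<lparr>carrier := f ` U (Suc 0)\<rparr> \<and> cyclic_group (H\<lparr>carrier := f ` U (Suc 0)\<rparr> Mod f ` U 0)"
    by (rule step[where t = "(vector [1, 0], 0)"])
      (auto simp: U_def simps vec2_eq_iff mat2_vec_nth pv)
  have s1: "f ` U 1 \<lhd> H\<lparr>carrier := f ` U (Suc 1)\<rparr> \<and> cyclic_group (H\<lparr>carrier := f ` U (Suc 1)\<rparr> Mod f ` U 1)"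
  proof (rule step[where t = "(vector [0, 1], 0)"])
    fix x assume "x \<in> U (Suc 1)"
    then obtain v where x: "x = (v, 0)" by (auto simp: U_def)
    show "\<exists>s\<in>U 1. \<exists>k::int. x = s \<otimes>\<^bsub>?G\<^esub> (vector [0, 1], 0) [^]\<^bsub>?G\<^esub> k"
      by (rule bexI[of _ "(vector [v $ 1, 0], 0)"], rule exI[of _ "v $ 2"]) (auto simp: x U_def simps pv vec2_eq_iff)
  qed (auto simp: U_def simps)
  have s2: "f ` U 2 \<lhd> H\<lparr>carrier := f ` U (Suc 2)\<rparr> \<and> cyclic_group (H\<lparr>carrier := f ` U (Suc 2)\<rparr> Mod f ` U 2)"
  proof (rule step[where t = "(0, 1)"])
    fix x assume "x \<in> U (Suc 2)"
    obtain v k where x: "x = (v, k)" by fastforce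
    show "\<exists>s\<in>U 2. \<exists>k::int. x = s \<otimes>\<^bsub>?G\<^esub> (0, 1) [^]\<^bsub>?G\<^esub> k"
      by (rule bexI[of _ "(v, 0)"], rule exI[of _ k]) (auto simp: x U_def simps p1 vec2_eq_iff mat2_vec_nth)
  qed (auto simp: U_def simps)
  have "polycyclic H"
    unfolding polycyclic_def
  proof (intro conjI H exI[of _ "3::nat"] exI[of _ "\<lambda>i. f ` U i"])
    show "f ` U 0 = {\<one>\<^bsub>H\<^esub>}" using f.hom_one by (simp add: U_def simps)
    show "f ` U 3 = carrier H" by (simp add: U_def surj)
    show "\<forall>i\<le>3. subgroup (f ` U i) H" using fU by blast
    have i: "i = 0 \<or> i = 1 \<or> i = 2" if "i < 3" for i :: nat using that by auto
    show "\<forall>i<3. f ` U i \<lhd> H\<lparr>carrier := f ` U (Suc i)\<rparr> \<and> cyclic_group (H\<lparr>carrier := f ` U (Suc i)\<rparr> Mod f ` U i)"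
      using i s0 s1 s2 by blast
  qed
  moreover have "carrier H \<lhd> H" "finite (rcosets\<^bsub>H\<^esub> (carrier H))"
    using H.fin_index_normal_carrier by (auto simp: fin_index_normal_def)
  moreover have "H\<lparr>carrier := carrier H\<rparr> = H" by simp
  ultimately show ?thesis unfolding polycyclic_by_finite_def using H by metis
qed

section \<open>Involutions\<close>

text \<open>\<open>A\<close> is trivial modulo \<open>2\<close>, so the two vector coordinates and
  the \<int>-component modulo \<open>2\<close> map \<open>H\<close> onto the elementary abelian
  group of order eight, which two elements cannot generate. \<open>gen\<close> expresses generation
  through homomorphisms to the group of order two.\<close>

lemma (in semidirect_family) not_two_generated:
  assumes T: "trivial_mod A 2 1" and yz: "y \<in> carrier H" "z \<in> carrier H"
    and gen: "\<And>h. h \<in> carrier H ==> \<exists>a b. \<forall>q. additive_mod 2 q \<longrightarrow> even (q h - (a * q y + b * q z))"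
  shows False
proof -
  have T2: "trivial_mod A 2 2" using trivial_mod_mult[OF inv_A T, of 2] by simp
  define p where "p h = (SOME v. \<exists>k. R 2 2 h v k)" for h
  have pd: "vdvd 2 (p h - v)" if h: "h \<in> carrier H" "R 2 2 h v k" for h v k
  proof -
    have "\<exists>v. \<exists>k. R 2 2 h v k" using h by blast
    then have "\<exists>k. R 2 2 h (p h) k" unfolding p_def by (rule someI_ex)
    then show ?thesis using rep_iff[OF T2 h] by blast
  qed
  have add: "vdvd 2 (p (x \<otimes> y) - (p x + p y))" if xy: "x \<in> carrier H" "y \<in> carrier H" for x y
  proof -
    obtain v k where v: "R 2 2 x v k" using rep_exists[OF T2 xy(1)] by blast
    obtain w l where w: "R 2 2 y w l" using rep_exists[OF T2 xy(2)] by blast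
    have "vdvd 2 (p (x \<otimes> y) - (v + mpow A k *v w))" by (rule pd[OF m_closed[OF xy] rep_mult[OF T2 xy v w]])
    moreover have "vdvd 2 (mpow A k *v w - w)" by (rule trivial_mod_dvd[OF inv_A T]) simp
    ultimately have "vdvd 2 ((p (x \<otimes> y) - (v + mpow A k *v w)) + (mpow A k *v w - w) - (p x - v) - (p y - w))"
      using pd[OF xy(1) v] pd[OF xy(2) w] by (meson vdvd_diff vdvd_add)
    then show ?thesis by (simp add: algebra_simps)
  qed
  have q: "additive_mod 2 (\<lambda>h. p h $ 1)" "additive_mod 2 (\<lambda>h. p h $ 2)" "additive_mod 2 (kpart 2 2)"
    using add kpart_additive[OF T2] unfolding additive_mod_def vdvd_def by simp_all
  have key: "\<exists>a b. even (v $ 1 - (a * p y $ 1 + b * p z $ 1)) \<and> even (v $ 2 - (a * p y $ 2 + b * p z $ 2))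
      \<and> even (k - (a * kpart 2 2 y + b * kpart 2 2 z))" for v :: "int^2" and k
  proof -
    obtain h where h: "h \<in> carrier H" "R 2 2 h v k" using rep_surj[OF T2] .
    obtain a b where ab: "\<And>q. additive_mod 2 q ==> even (q h - (a * q y + b * q z))" using gen[OF h(1)] by blast
    have e: "even (p h $ 1 - v $ 1)" "even (p h $ 2 - v $ 2)" "even (kpart 2 2 h - k)"
      using pd[OF h] kpart_dvd[OF T2 h] by (simp_all add: vdvd_def)
    have "even ((p h $ 1 - (a * p y $ 1 + b * p z $ 1)) - (p h $ 1 - v $ 1))"
      by (rule dvd_diff[OF ab[OF q(1)] e(1)])
    moreover have "even ((p h $ 2 - (a * p y $ 2 + b * p z $ 2)) - (p h $ 2 - v $ 2))"
      by (rule dvd_diff[OF ab[OF q(2)] e(2)])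
    moreover have "even ((kpart 2 2 h - (a * kpart 2 2 y + b * kpart 2 2 z)) - (kpart 2 2 h - k))"
      by (rule dvd_diff[OF ab[OF q(3)] e(3)])
    ultimately show ?thesis by (intro exI[of _ a] exI[of _ b]) (simp add: algebra_simps)
  qed
  obtain a1 b1 where 1: "even (1 - (a1 * p y $ 1 + b1 * p z $ 1))" "even (a1 * p y $ 2 + b1 * p z $ 2)"
      "even (a1 * kpart 2 2 y + b1 * kpart 2 2 z)"
    using key[of "vector [1, 0]" 0] by auto
  obtain a2 b2 where 2: "even (a2 * p y $ 1 + b2 * p z $ 1)" "even (1 - (a2 * p y $ 2 + b2 * p z $ 2))"
      "even (a2 * kpart 2 2 y + b2 * kpart 2 2 z)"
    using key[of "vector [0, 1]" 0] by auto
  obtain a3 b3 where 3: "even (a3 * p y $ 1 + b3 * p z $ 1)" "even (a3 * p y $ 2 + b3 * p z $ 2)"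
      "even (1 - (a3 * kpart 2 2 y + b3 * kpart 2 2 z))"
    using key[of 0 1] by auto
  show False using 1 2 3 by auto
qed

text \<open>For the matrix \<open>M2 1 1 0 (-1)\<close> the first basis vector is the product of the
  second one and its conjugate by \<open>t\<close>, so it is invisible modulo \<open>2\<close>. The
  second basis vector and \<open>t\<close> then generate modulo \<open>2\<close>, while the diagonal
  matrix is trivial modulo \<open>2\<close>.\<close>

lemma involutions_not_profinitely_iso:
  "\<not> profinitely_iso (\<G> (M2 1 1 0 (-1))) (\<G> (M2 1 0 0 (-1)))"
proof
  let ?A = "M2 1 0 0 (-1)" and ?B = "M2 1 1 0 (-1)"
  let ?G = "\<G> ?B"
  assume iso: "profinitely_iso ?G (\<G> ?A)"
  have A: "invertible ?A" and B: "invertible ?B" by (simp_all add: invertible_iff_det det_2)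
  obtain \<theta> where "profinite_family ?G (\<G> ?A) \<theta>"
    using profinitely_iso_imp_family[OF group_semidirect_Z2_Z[OF B] group_semidirect_Z2_Z[OF A] iso] by blast
  then interpret semidirect_family ?G ?A \<theta>
    using A group_semidirect_Z2_Z[OF B] by (simp add: semidirect_family_def semidirect_family_axioms_def)
  note simps = semidirect_simps[OF B]
  let ?e1 = "(vector [1, 0], 0) :: (int^2) \<times> int" and ?e2 = "(vector [0, 1], 0) :: (int^2) \<times> int"
  let ?t = "(0, 1) :: (int^2) \<times> int"
  have c: "x \<in> carrier ?G" for x by (simp add: simps)
  show False
  proof (rule not_two_generated[of ?e2 ?t])
    show "trivial_mod ?A 2 1" by (simp add: trivial_mod_def mpow_1[OF A] vdvd_def mat2_vec_nth)
    show "\<exists>a b. \<forall>q. additive_mod 2 q \<longrightarrow> even (q h - (a * q ?e2 + b * q ?t))" for h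
    proof -
      obtain v k where h: "h = (v, k)" by fastforce
      have "even (q h - (v $ 2 * q ?e2 + k * q ?t))" if q: "additive_mod 2 q" for q
      proof -
        note m = additive_modD[OF q c c] and pw = additive_mod_pow[OF q c]
        let ?c = "?t \<otimes>\<^bsub>?G\<^esub> ?e2 \<otimes>\<^bsub>?G\<^esub> inv\<^bsub>?G\<^esub> ?t"
        have "?c = (vector [1, -1], 0)"
          by (simp add: simps semidirect_inv[OF B] mpow_1[OF B] vec2_eq_iff mat2_vec_nth)
        then have "?c \<otimes>\<^bsub>?G\<^esub> ?e2 = ?e1" by (simp add: simps vec2_eq_iff)
        then have "even (q ?e1 - (q ?c + q ?e2))" using m[of ?c ?e2] by simp
        moreover have "even (q ?c - q ?e2)" by (rule additive_mod_conj[OF q c c])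
        ultimately have e1: "even (q ?e1)" by auto
        have "?e1 [^]\<^bsub>?G\<^esub> (v $ 1) \<otimes>\<^bsub>?G\<^esub> ?e2 [^]\<^bsub>?G\<^esub> (v $ 2) \<otimes>\<^bsub>?G\<^esub> ?t [^]\<^bsub>?G\<^esub> k = h"
          by (simp add: h simps semidirect_int_pow_vec[OF B] semidirect_int_pow_one[OF B] vec2_eq_iff mat2_vec_nth)
        then have "even (q h - (q (?e1 [^]\<^bsub>?G\<^esub> (v $ 1) \<otimes>\<^bsub>?G\<^esub> ?e2 [^]\<^bsub>?G\<^esub> (v $ 2)) + q (?t [^]\<^bsub>?G\<^esub> k)))" using m by metis
        moreover have "even (q (?e1 [^]\<^bsub>?G\<^esub> (v $ 1) \<otimes>\<^bsub>?G\<^esub> ?e2 [^]\<^bsub>?G\<^esub> (v $ 2)) - (q (?e1 [^]\<^bsub>?G\<^esub> (v $ 1)) + q (?e2 [^]\<^bsub>?G\<^esub> (v $ 2))))" by (rule m)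
        moreover have "even (q (?e1 [^]\<^bsub>?G\<^esub> (v $ 1)) - v $ 1 * q ?e1)" "even (q (?e2 [^]\<^bsub>?G\<^esub> (v $ 2)) - v $ 2 * q ?e2)"
          "even (q (?t [^]\<^bsub>?G\<^esub> k) - k * q ?t)" by (rule pw)+
        ultimately show ?thesis using e1 by auto
      qed
      then show ?thesis by blast
    qed
  qed (rule c)+
qed

text \<open>The discriminant is \<open>4\<close>, so reduction reaches an upper right entry
  \<open>0\<close>, \<open>1\<close> or \<open>-1\<close>, and the last two become triangular as
  well. For a triangular matrix, shears change the lower left entry by even numbers, so only its
  parity remains.\<close>

lemma mconj_trace_0_det_minus_1:
  assumes "trace B = 0" "det B = -1"
  shows "mconj B (M2 1 0 0 (-1)) \<or> mconj B (M2 1 1 0 (-1))"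
proof -
  have "\<exists>C. mconj B C \<and> C $ 1 $ 2 = 0"
  proof (rule ccontr)
    assume no: "\<not> ?thesis"
    then obtain C where C: "mconj B C" "\<bar>2 * C $ 1 $ 1 - trace B\<bar> \<le> \<bar>C $ 1 $ 2\<bar>" "3 * (C $ 1 $ 2)^2 \<le> \<bar>(trace B)^2 - 4 * det B\<bar>"
      using mconj_reduced[of B] by metis
    have c3: "3 * (C $ 1 $ 2)^2 \<le> 4" using C(3) assms by simp
    have "\<bar>C $ 1 $ 2\<bar> \<le> 1"
    proof (rule ccontr)
      assume "\<not> ?thesis"
      then have "2^2 \<le> \<bar>C $ 1 $ 2\<bar>^2" by (intro power_mono) auto
      then show False using c3 by simp
    qed
    moreover have "C $ 1 $ 2 \<noteq> 0" using no C(1) by blast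
    ultimately have b: "C $ 1 $ 2 = 1 \<or> C $ 1 $ 2 = -1" by linarith
    have tr: "C $ 1 $ 1 + C $ 2 $ 2 = 0" and dt: "C $ 1 $ 1 * C $ 2 $ 2 - C $ 1 $ 2 * C $ 2 $ 1 = -1"
      using mconj_trace[OF C(1)] mconj_det[OF C(1)] assms by (simp_all add: trace_2 det_2)
    have a: "C $ 1 $ 1 = 0" using C(2) b assms by auto
    have cb: "C $ 2 $ 1 = C $ 1 $ 2" "C $ 2 $ 2 = 0" using b dt tr a by auto
    \<comment> \<open>With zero diagonal and equal entries off it, a shear by \<open>1\<close>
      clears the lower left entry; the swap moves this zero to the upper right.\<close>
    let ?E = "M2 (C $ 1 $ 1 - 1 * C $ 1 $ 2) (C $ 1 $ 2) (C $ 2 $ 1 + 1 * (C $ 1 $ 1 - C $ 2 $ 2) - 1 * 1 * C $ 1 $ 2) (C $ 2 $ 2 + 1 * C $ 1 $ 2)"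
    have "mconj B (M2 (?E $ 2 $ 2) (?E $ 2 $ 1) (?E $ 1 $ 2) (?E $ 1 $ 1))"
      by (rule mconj_trans[OF mconj_trans[OF C(1) mconj_shear] mconj_swap])
    moreover have "?E $ 2 $ 1 = 0" using a cb by simp
    ultimately show False using no by fastforce
  qed
  then obtain C where C: "mconj B C" "C $ 1 $ 2 = 0" by blast
  define a c where "a = C $ 1 $ 1" and "c = C $ 2 $ 1"
  have tr0: "C $ 1 $ 1 + C $ 2 $ 2 = 0" and dt0: "C $ 1 $ 1 * C $ 2 $ 2 - C $ 1 $ 2 * C $ 2 $ 1 = -1"
    using mconj_trace[OF C(1)] mconj_det[OF C(1)] assms by (simp_all add: trace_2 det_2)
  have tr: "C $ 2 $ 2 = - a" using tr0 by (simp add: a_def)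
  have "a * a = 1" using dt0 C(2) by (simp add: tr flip: a_def)
  then have a: "a = 1 \<or> a = -1" by (auto simp: zmult_eq_1_iff)
  have Ceq: "C = M2 a 0 c (- a)" using C(2) tr by (simp add: mat2_eq_iff a_def c_def)
  have shear: "mconj C (M2 a 0 (c + s * (2 * a)) (- a))" for s
    using mconj_shear[of C s] by (simp add: Ceq algebra_simps)
  define x where "x = c mod 2"
  have "c = 2 * (c div 2) + x" by (simp add: x_def)
  moreover have e: "c + (- (c div 2) * a) * (2 * a) = c - 2 * (c div 2) * (a * a)" by (simp add: algebra_simps)
  ultimately have "c + (- (c div 2) * a) * (2 * a) = x" unfolding e \<open>a * a = 1\<close> by linarith
  then have Bx: "mconj B (M2 a 0 x (- a))" using mconj_trans[OF C(1) shear[of "- (c div 2) * a"]] by simp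
  have x: "x = 0 \<or> x = 1" unfolding x_def by auto
  have sw: "mconj (M2 a 0 x (- a)) (M2 (- a) x 0 a)" using mconj_swap[of "M2 a 0 x (- a)"] by simp
  from a show ?thesis
  proof
    assume a1: "a = -1"
    then show ?thesis using mconj_trans[OF Bx sw] x by auto
  next
    assume a1: "a = 1"
    have "mconj (M2 (-1) 1 0 1) (M2 1 1 0 (-1))" using mconj_shear[of "M2 (-1) 1 0 1" "-2"] by simp
    then show ?thesis using Bx mconj_trans[OF mconj_trans[OF Bx sw]] x a1 by auto
  qed
qed

lemma involution_trace_det:
  fixes B :: "int^2^2"
  assumes "B ** B = mat 1" "B \<noteq> mat 1" "B \<noteq> - mat 1"
  shows "trace B = 0" "det B = -1"
proof -
  define a b c d where "a = B $ 1 $ 1" "b = B $ 1 $ 2" "c = B $ 2 $ 1" "d = B $ 2 $ 2"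
  note abcd = this
  have e: "a * a + b * c = 1" "(a + d) * b = 0" "(a + d) * c = 0" "c * b + d * d = 1"
    using assms(1) by (simp_all add: mat2_eq_iff mat2_mult_nth abcd algebra_simps)
  have "a + d = 0"
  proof (rule ccontr)
    assume n: "a + d \<noteq> 0"
    then have bc: "b = 0" "c = 0" using e(2,3) by simp_all
    then have "a = 1 \<or> a = -1" "d = 1 \<or> d = -1" using e(1,4) by (simp_all add: zmult_eq_1_iff)
    then have "a = d" using n by auto
    then show False using assms(2,3) bc \<open>a = 1 \<or> a = -1\<close> by (auto simp: mat2_eq_iff abcd)
  qed
  then show "trace B = 0" by (simp add: trace_2 abcd)
  have "d = - a" using \<open>a + d = 0\<close> by simp
  then show "det B = -1" using e(1) by (simp add: det_2 flip: abcd)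
qed

section \<open>Counting classes\<close>

text \<open>\<open>f\<close> need not be constant on classes, so it may depend on arbitrary choices;
  only equal values must imply equivalence.\<close>

lemma quotient_card_le:
  assumes "equiv S r" "finite T" "\<And>x. x \<in> S ==> f x \<in> T"
    and "\<And>x y. x \<in> S ==> y \<in> S ==> f x = f y ==> (x, y) \<in> r"
  shows "finite (S // r)" "card (S // r) \<le> card T"
proof -
  have sub: "S // r \<subseteq> (\<lambda>z. r `` {SOME x. x \<in> S \<and> f x = z}) ` T"
  proof
    fix C assume "C \<in> S // r"
    then obtain x where x: "x \<in> S" "C = r `` {x}" by (auto simp: quotient_def)
    let ?y = "SOME y. y \<in> S \<and> f y = f x"
    have y: "?y \<in> S \<and> f ?y = f x" by (rule someI_ex) (use x in blast)
    then have "r `` {x} = r `` {?y}" using assms(4)[OF x(1), of ?y] equiv_class_eq[OF assms(1)] by simp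
    then show "C \<in> (\<lambda>z. r `` {SOME x. x \<in> S \<and> f x = z}) ` T" using x assms(3) by blast
  qed
  then show "finite (S // r)" using assms(2) finite_subset by blast
  show "card (S // r) \<le> card T"
    using sub card_image_le[OF assms(2)] assms(2) by (meson card_mono finite_imageI le_trans)
qed

lemma card_le_two_to_one:
  assumes "finite P" "finite Q" "\<And>x. x \<in> P ==> f x \<in> Q"
    and two: "\<And>x y z. x \<in> P ==> y \<in> P ==> z \<in> P ==> f y = f x ==> f z = f x ==> y \<noteq> x ==> z \<noteq> x ==> y = z"
  shows "card P \<le> 2 * card Q"
proof -
  define F where "F q = {x \<in> P. f x = q}" for q
  have fin: "finite (F q)" for q using assms(1) by (simp add: F_def)
  have "card (F q) \<le> 2" for q
  proof (cases "F q = {}")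
    case False
    then obtain x where x: "x \<in> F q" by blast
    have "card (F q - {x}) \<le> Suc 0"
      by (subst card_le_Suc0_iff_eq) (use fin two[of x] x in \<open>auto simp: F_def\<close>)
    then show ?thesis using x fin by (simp add: card_Diff_singleton_if)
  qed simp
  then have "(\<Sum>q\<in>Q. card (F q)) \<le> of_nat (card Q) * 2" by (rule sum_bounded_above)
  moreover have "P = (\<Union>q\<in>Q. F q)" using assms(3) by (auto simp: F_def)
  then have "card P \<le> (\<Sum>q\<in>Q. card (F q))" using card_UN_le[OF assms(2), of F] by simp
  ultimately show ?thesis by simp
qed

definition genus_reps :: "int^2^2 => nat monoid set" where
  "genus_reps A = {H. polycyclic_by_finite H \<and> profinitely_iso H (\<G> A)}"

definition genus_rel :: "int^2^2 => (nat monoid \<times> nat monoid) set" where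
  "genus_rel A = {(H, K). H \<in> genus_reps A \<and> K \<in> genus_reps A \<and> H \<cong> K}"

lemma PF_genus_eq: "PF_genus (\<G> A) = genus_reps A // genus_rel A"
  by (simp add: PF_genus_def genus_reps_def genus_rel_def)

lemma genus_reps_group: "H \<in> genus_reps A ==> group H"
  by (simp add: genus_reps_def polycyclic_by_finite_def)

lemma equiv_genus_rel: "equiv (genus_reps A) (genus_rel A)"
proof (rule equivI)
  show "genus_rel A \<subseteq> genus_reps A \<times> genus_reps A" by (auto simp: genus_rel_def)
  show "refl_on (genus_reps A) (genus_rel A)" by (auto simp: refl_on_def genus_rel_def iso_refl)
  show "sym (genus_rel A)" using genus_reps_group by (auto simp: sym_def genus_rel_def intro: group.iso_sym)
  show "trans (genus_rel A)" unfolding trans_def genus_rel_def using iso_trans by fast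
qed

lemma semidirect_nat_model:
  assumes "invertible B"
  obtains H :: "nat monoid" where "polycyclic_by_finite H" "\<G> B \<cong> H"
proof -
  have "polycyclic_by_finite (\<G> B)"
    by (rule polycyclic_by_finite_semidirect[OF assms group_semidirect_Z2_Z[OF assms] iso_refl])
  then obtain H :: "nat monoid" where "group H" "\<G> B \<cong> H"
    using polycyclic_by_finite_nat_model by blast
  then show ?thesis using that polycyclic_by_finite_semidirect[OF assms] by blast
qed

lemma nat_model_in_genus:
  assumes "invertible A" "invertible B" "profinitely_iso (\<G> B) (\<G> A)"
  obtains H where "H \<in> genus_reps A" "\<G> B \<cong> H"
proof -
  obtain H :: "nat monoid" where H: "polycyclic_by_finite H" "\<G> B \<cong> H"
    using semidirect_nat_model[OF assms(2)] .
  have g: "group H" using H(1) by (simp add: polycyclic_by_finite_def)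
  have "H \<cong> \<G> B" by (rule group.iso_sym[OF group_semidirect_Z2_Z[OF assms(2)] H(2)])
  then obtain \<phi> where "\<phi> \<in> iso H (\<G> B)" by (auto simp: is_iso_def)
  then have "profinitely_iso H (\<G> B)" by (rule iso_imp_profinitely_iso[OF g group_semidirect_Z2_Z[OF assms(2)]])
  then have "profinitely_iso H (\<G> A)" using assms(3) by (rule profinitely_iso_trans)
  then show ?thesis using that H by (simp add: genus_reps_def)
qed

lemma semidirect_isos_imp_iso:
  assumes "invertible B" "invertible C" "\<G> B \<cong> H" "\<G> C \<cong> K" "\<G> B \<cong> \<G> C"
  shows "H \<cong> K"
  using iso_trans[OF iso_trans[OF group.iso_sym[OF group_semidirect_Z2_Z[OF assms(1)] assms(3)] assms(5)] assms(4)] .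

lemma card_PF_genus_eq_1:
  assumes A: "invertible A"
    and H: "\<And>H :: nat monoid. H \<in> genus_reps A ==> \<exists>B. invertible B \<and> \<G> B \<cong> H \<and> mconj B A"
  shows "card (PF_genus (\<G> A)) = 1"
proof -
  obtain H0 where H0: "H0 \<in> genus_reps A" "\<G> A \<cong> H0"
  proof (rule nat_model_in_genus[OF A A])
    obtain \<phi> where "\<phi> \<in> iso (\<G> A) (\<G> A)" using iso_refl unfolding is_iso_def by blast
    then show "profinitely_iso (\<G> A) (\<G> A)"
      by (rule iso_imp_profinitely_iso[OF group_semidirect_Z2_Z[OF A] group_semidirect_Z2_Z[OF A]])
  qed
  have "(H, H0) \<in> genus_rel A" if HS: "H \<in> genus_reps A" for H
  proof -
    obtain B where B: "invertible B" "\<G> B \<cong> H" "mconj B A" using H[OF HS] by blast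
    have "H \<cong> H0"
      by (rule semidirect_isos_imp_iso[OF B(1) A B(2) H0(2) mconj_imp_semidirect_iso[OF B(1) A B(3)]])
    then show ?thesis using HS H0(1) by (simp add: genus_rel_def)
  qed
  then have eq: "genus_rel A `` {H} = genus_rel A `` {H0}" if "H \<in> genus_reps A" for H
    using that equiv_class_eq[OF equiv_genus_rel] by blast
  have "genus_reps A // genus_rel A = (\<lambda>H. genus_rel A `` {H}) ` genus_reps A" by (auto simp: quotient_def)
  also have "\<dots> = (\<lambda>_. genus_rel A `` {H0}) ` genus_reps A" by (rule image_cong[OF refl eq])
  also have "\<dots> = {genus_rel A `` {H0}}" using H0(1) by auto
  finally have "genus_reps A // genus_rel A = {genus_rel A `` {H0}}" .
  then show ?thesis by (simp add: PF_genus_eq)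
qed

lemma card_PF_genus_eq_1_of_normal_form:
  assumes A: "invertible A" "det (A - mat 1) \<noteq> 0"
    and n: "\<And>B. invertible B ==> profinitely_equivalent A B ==> mconj B A"
  shows "card (PF_genus (\<G> A)) = 1"
proof (rule card_PF_genus_eq_1[OF A(1)])
  fix H assume "H \<in> genus_reps A"
  then have "polycyclic_by_finite H" "profinitely_iso H (\<G> A)" by (simp_all add: genus_reps_def)
  then obtain B where B: "invertible B" "\<G> B \<cong> H" "profinitely_equivalent A B"
    by (rule genus_of_semidirect[OF _ A(1) _ A(2)]) (rule that)
  then show "\<exists>B. invertible B \<and> \<G> B \<cong> H \<and> mconj B A" using n by blast
qed

section \<open>Reducible and imaginary cases\<close>

lemma det_minus_1: "det (A - mat 1 :: int^2^2) = 1 - trace A + det A"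
  by (simp add: det_2 trace_2 algebra_simps)

lemma card_PF_genus_trace_0_det_minus_1:
  assumes A: "invertible A" "trace A = 0" "det A = -1"
  shows "card (PF_genus (\<G> A)) = 1"
proof (rule card_PF_genus_eq_1[OF A(1)])
  fix H assume HS: "H \<in> genus_reps A"
  then have H: "polycyclic_by_finite H" "profinitely_iso H (\<G> A)" by (simp_all add: genus_reps_def)
  have "A *v (A *v v) = v" for v using cayley_hamilton2[of A v] A(2,3) by (simp add: vec2_eq_iff)
  from this[of "vector [1, 0]"] this[of "vector [0, 1]"] have A2: "A ** A = mat 1"
    by (simp add: mat2_eq_iff mat2_mult_nth vec2_eq_iff mat2_vec_nth)
  have ne: "A \<noteq> mat 1" "A \<noteq> - mat 1" using A(2) by (auto simp: trace_2)
  obtain B where B: "invertible B" "\<G> B \<cong> H" "B ** B = mat 1" "B \<noteq> mat 1" "B \<noteq> - mat 1"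
    by (rule genus_of_involution[OF H(1) A(1) H(2) A2 ne]) (rule that)
  have gA: "group (\<G> C)" if "invertible C" for C using that by (rule group_semidirect_Z2_Z)
  have pi: "profinitely_iso (\<G> C) (\<G> C')" if C: "invertible C" "invertible C'" "mconj C C'" for C C'
    using mconj_imp_semidirect_iso[OF C] iso_imp_profinitely_iso[OF gA[OF C(1)] gA[OF C(2)]] unfolding is_iso_def by blast
  obtain \<phi> where "\<phi> \<in> iso (\<G> B) H" using B(2) by (auto simp: is_iso_def)
  then have BA: "profinitely_iso (\<G> B) (\<G> A)"
    using profinitely_iso_trans[OF iso_imp_profinitely_iso[OF gA[OF B(1)] genus_reps_group[OF HS]] H(2)] by blast
  let ?M = "M2 1 0 0 (-1)" and ?N = "M2 1 1 0 (-1)"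
  have inv: "invertible ?M" "invertible ?N" by (simp_all add: invertible_iff_det det_2)
  have no: False if C: "invertible C" "invertible C'" "profinitely_iso (\<G> C) (\<G> C')" "mconj C ?N" "mconj C' ?M" for C C'
  proof -
    have "profinitely_iso (\<G> ?N) (\<G> C)" by (rule pi[OF inv(2) C(1) mconj_sym[OF C(4)]])
    then have "profinitely_iso (\<G> ?N) (\<G> C')" using C(3) by (rule profinitely_iso_trans)
    then have "profinitely_iso (\<G> ?N) (\<G> ?M)" using pi[OF C(2) inv(1) C(5)] by (rule profinitely_iso_trans)
    then show False using involutions_not_profinitely_iso by blast
  qed
  have AB: "profinitely_iso (\<G> A) (\<G> B)" by (rule profinitely_iso_sym[OF gA[OF B(1)] gA[OF A(1)] BA])
  have "mconj B A"
    using mconj_trace_0_det_minus_1[OF A(2,3)] mconj_trace_0_det_minus_1[OF involution_trace_det[OF B(3-5)]]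
      no[OF B(1) A(1) BA] no[OF A(1) B(1) AB] mconj_trans[OF _ mconj_sym] by blast
  then show "\<exists>B. invertible B \<and> \<G> B \<cong> H \<and> mconj B A" using B by blast
qed

section \<open>Both eigenvalues equal to -1\<close>

lemma mconj_unipotent_normal_form:
  assumes "trace B = -2" "det B = 1"
  obtains k where "k \<ge> 0" "mconj B (M2 (-1) 0 k (-1))"
proof -
  have "\<exists>C. mconj B C \<and> C $ 1 $ 2 = 0"
  proof (rule ccontr)
    assume no: "\<not> ?thesis"
    then obtain C where C: "mconj B C" "3 * (C $ 1 $ 2)^2 \<le> \<bar>(trace B)^2 - 4 * det B\<bar>"
      using mconj_reduced[of B] by metis
    \<comment> \<open>The discriminant is \<open>0\<close>, so the bound of
      \<open>mconj_reduced\<close> leaves no room for a nonzero entry.\<close>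
    then have "(C $ 1 $ 2)^2 \<le> 0" using assms by simp
    then show False using no C(1) by simp
  qed
  then obtain C where C: "mconj B C" "C $ 1 $ 2 = 0" by blast
  define a d c where "a = C $ 1 $ 1" and "d = C $ 2 $ 2" and "c = C $ 2 $ 1"
  have ad: "a + d = -2" "a * d = 1"
    using mconj_trace[OF C(1)] mconj_det[OF C(1)] assms C(2) by (simp_all add: trace_2 det_2 a_def d_def)
  then have "a = -1" "d = -1" by (auto simp: zmult_eq_1_iff)
  then have Ceq: "C = M2 (-1) 0 c (-1)" using C(2) by (simp add: mat2_eq_iff a_def d_def c_def)
  \<comment> \<open>A diagonal conjugation reverses the sign of the lower left entry, so it may be
    taken nonnegative.\<close>
  have "mconj (M2 (-1) 0 c (-1)) (M2 (-1) 0 (- c) (-1))"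
    unfolding mconj_def by (intro exI[of _ "M2 1 0 0 (-1)"]) (simp add: invertible_iff_det det_2 mat2_eq_iff mat2_mult_nth)
  then have "mconj B (M2 (-1) 0 (- c) (-1))" using mconj_trans[OF C(1)] Ceq by simp
  then show ?thesis using that[of c] that[of "- c"] C(1) Ceq by (cases "c \<ge> 0") simp_all
qed

text \<open>Conjugation preserves the property of acting as \<open>-1\<close> modulo
  \<open>r\<close>. So \<open>k\<close> is recovered, up to sign, from the moduli at which this
  happens.\<close>

lemma vdvd_unipotent_normal_form:
  assumes "mconj B (M2 (-1) 0 k (-1))"
  shows "(\<forall>v. vdvd r (B *v v + v)) \<longleftrightarrow> r dvd k"
proof -
  have tr: "\<forall>v. vdvd r (C' *v v + v)" if m: "mconj C C'" and C: "\<forall>v. vdvd r (C *v v + v)" for C C'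
  proof
    fix v
    obtain P Q where P: "P ** Q = mat 1" "P ** C = C' ** P" using m by (auto simp: mconj_def invertible_def)
    have "vdvd r (P *v (C *v (Q *v v) + Q *v v))" using C vdvd_matvec by blast
    moreover have "P *v (C *v (Q *v v) + Q *v v) = C' *v v + v"
    proof -
      have "P *v (C *v (Q *v v)) = (P ** C) *v (Q *v v)" by (simp only: matrix_vector_mul_assoc matrix_mul_assoc)
      also have "\<dots> = C' *v ((P ** Q) *v v)" unfolding P(2) by (simp only: matrix_vector_mul_assoc matrix_mul_assoc)
      finally show ?thesis using P(1) by (simp add: matvec_add matrix_vector_mul_assoc)
    qed
    ultimately show "vdvd r (C' *v v + v)" by simp
  qed
  have "(\<forall>v. vdvd r (B *v v + v)) \<longleftrightarrow> (\<forall>v. vdvd r (M2 (-1) 0 k (-1) *v v + v))"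
    using tr[OF assms] tr[OF mconj_sym[OF assms]] by blast
  also have "\<dots> \<longleftrightarrow> r dvd k"
  proof
    assume "\<forall>v. vdvd r (M2 (-1) 0 k (-1) *v v + v)"
    from this[rule_format, of "vector [1, 0]"] show "r dvd k" by (simp add: vdvd_def mat2_vec_nth)
  qed (simp add: vdvd_def mat2_vec_nth)
  finally show ?thesis .
qed

lemma card_PF_genus_trace_minus_2:
  assumes A: "invertible A" "trace A = -2" "det A = 1"
  shows "card (PF_genus (\<G> A)) = 1"
proof (rule card_PF_genus_eq_1_of_normal_form[OF A(1)])
  show "det (A - mat 1) \<noteq> 0" using A by (simp add: det_minus_1)
  fix B assume B: "invertible B" "profinitely_equivalent A B"
  have tB: "trace B = -2" "det B = 1"
    using profinitely_equivalent_trace(2)[OF A(1) B A(3)] profinitely_equivalent_det[OF A(1) B] A by simp_all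
  obtain k where k: "k \<ge> 0" "mconj A (M2 (-1) 0 k (-1))" using mconj_unipotent_normal_form[OF A(2,3)] .
  obtain l where l: "l \<ge> 0" "mconj B (M2 (-1) 0 l (-1))" using mconj_unipotent_normal_form[OF tB] .
  have "r dvd k \<longleftrightarrow> r dvd l" if "r > 0" for r
    using profinitely_equivalent_minus_1[OF A(1) B that] vdvd_unipotent_normal_form[OF k(2)] vdvd_unipotent_normal_form[OF l(2)] by simp
  then have "k dvd l" "l dvd k" using dvd_of_all_divisors by blast+
  then have "k = l" using k(1) l(1) zdvd_antisym_nonneg by blast
  then show "mconj B A" using mconj_trans[OF l(2)] mconj_sym[OF k(2)] by blast
qed

section \<open>Trace 0 and determinant 1: the Gaussian integers\<close>

locale gaussian = quadratic \<mu> 0 1 for \<mu>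
begin

lemma reduced_cases:
  assumes "B \<in> reduced_matrices"
  shows "B = M2 0 1 (-1) 0 \<or> B = M2 0 (-1) 1 0"
proof -
  interpret quadratic_matrix \<mu> 0 1 B using assms by (simp add: reduced_matrices_def)
  have r: "\<bar>2 * B $ 1 $ 1\<bar> \<le> \<bar>B $ 1 $ 2\<bar>" "3 * (B $ 1 $ 2)^2 \<le> 4" using assms by (simp_all add: reduced_matrices_def)
  have "\<bar>B $ 1 $ 2\<bar> \<le> 1"
  proof (rule ccontr)
    assume "\<not> ?thesis"
    then have "2^2 \<le> \<bar>B $ 1 $ 2\<bar>^2" by (intro power_mono) auto
    then show False using r(2) by simp
  qed
  then have b: "B $ 1 $ 2 = 1 \<or> B $ 1 $ 2 = -1" using b_nonzero by linarith
  then have a: "B $ 1 $ 1 = 0" using r(1) by auto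
  then have "B $ 2 $ 2 = 0" "B $ 1 $ 2 * B $ 2 $ 1 = -1" using t_eq D_eq by simp_all
  then show ?thesis using a b by (auto simp: mat2_eq_iff)
qed

lemma all_mconj:
  assumes "quadratic_matrix \<mu> 0 1 B"
  shows "mconj B (M2 0 1 (-1) 0)"
proof -
  obtain C where C: "C \<in> reduced_matrices" "mconj B C" using mconj_reduced_matrix[OF assms] .
  have "mconj (M2 0 (-1) 1 0) (M2 0 1 (-1) 0)" using mconj_swap[of "M2 0 (-1) 1 0"] by simp
  then show ?thesis using reduced_cases[OF C(1)] C(2) mconj_trans by blast
qed

text \<open>Both reduced matrices have the whole order as their ideal, so every fractional ideal is
  principal.\<close>

lemma class_number: "class_number \<O> = 1"
proof (rule class_number_eq_1[OF subring])
  fix I assume I: "fractional_ideal \<O> I"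
  obtain \<alpha> B where B: "B \<in> reduced_matrices" "\<alpha> \<in> K - {0}" "LM_ideal B \<mu> = (*) \<alpha> ` I"
    using fractional_ideal_reduced[OF I] .
  have eq: "\<O> = LM_ideal B \<mu>"
  proof -
    from reduced_cases[OF B(1)] show ?thesis
    proof
      assume "B = M2 0 1 (-1) 0"
      then show ?thesis unfolding adjoin_eq LM_ideal_def by simp
    next
      assume Beq: "B = M2 0 (-1) 1 0"
      show ?thesis unfolding adjoin_eq LM_ideal_def Beq
      proof (intro subset_antisym subsetI; clarsimp)
        fix m n :: int
        show "\<exists>m' n'::int. of_int m + of_int n * \<mu> = of_int n' * \<mu> - of_int m'" by (rule exI[of _ "- m"], rule exI[of _ n]) simp
        show "\<exists>m' n'::int. of_int n * \<mu> - of_int m = of_int m' + of_int n' * \<mu>" by (rule exI[of _ "- m"], rule exI[of _ n]) simp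
      qed
    qed
  qed
  have "scalings \<O> I = scalings \<O> \<O>" using frac_field_mult_scalings[OF subring B(2), of I] B(3) eq by simp
  then show "I \<in> scalings \<O> \<O>" using scalings_refl[OF subring, of I] by simp
qed

end

lemma class_number_of_int_root: "\<mu> \<in> \<int> ==> class_number (adjoin_Z \<mu>) = 1"
  by (simp add: adjoin_Z_Ints class_number_Ints)

section \<open>Eigenvalues\<close>

lemma eigenvalue_iff: "eigenvalue A \<mu> \<longleftrightarrow> \<mu> * \<mu> = of_int (trace A) * \<mu> - of_int (det A)"
proof -
  define a b c d where "a = complex_of_int (A $ 1 $ 1)" "b = complex_of_int (A $ 1 $ 2)"
    "c = complex_of_int (A $ 2 $ 1)" "d = complex_of_int (A $ 2 $ 2)"
  note abcd = this
  have ev: "eigenvalue A \<mu> \<longleftrightarrow> (\<exists>v :: complex^2. v \<noteq> 0 \<and> a * v $ 1 + b * v $ 2 = \<mu> * v $ 1 \<and> c * v $ 1 + d * v $ 2 = \<mu> * v $ 2)"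
    unfolding eigenvalue_def by (simp add: vec2_eq_iff mat2_vec_nth map_matrix_def abcd)
  have cp: "\<mu> * \<mu> = of_int (trace A) * \<mu> - of_int (det A) \<longleftrightarrow> (a - \<mu>) * (d - \<mu>) - b * c = 0"
  proof -
    have "(a - \<mu>) * (d - \<mu>) - b * c = \<mu> * \<mu> - (of_int (trace A) * \<mu> - of_int (det A))"
      by (simp add: trace_2 det_2 abcd algebra_simps)
    then show ?thesis by (simp only: right_minus_eq)
  qed
  show ?thesis unfolding ev cp
  proof
    assume "\<exists>v :: complex^2. v \<noteq> 0 \<and> a * v $ 1 + b * v $ 2 = \<mu> * v $ 1 \<and> c * v $ 1 + d * v $ 2 = \<mu> * v $ 2"
    then obtain v :: "complex^2" where v: "v \<noteq> 0" and "a * v $ 1 + b * v $ 2 = \<mu> * v $ 1" "c * v $ 1 + d * v $ 2 = \<mu> * v $ 2"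
      by blast
    then have e: "(a - \<mu>) * v $ 1 + b * v $ 2 = 0" "c * v $ 1 + (d - \<mu>) * v $ 2 = 0" by (simp_all add: algebra_simps)
    have "((a - \<mu>) * (d - \<mu>) - b * c) * v $ 1 = (d - \<mu>) * ((a - \<mu>) * v $ 1 + b * v $ 2) - b * (c * v $ 1 + (d - \<mu>) * v $ 2)"
      "((a - \<mu>) * (d - \<mu>) - b * c) * v $ 2 = (a - \<mu>) * (c * v $ 1 + (d - \<mu>) * v $ 2) - c * ((a - \<mu>) * v $ 1 + b * v $ 2)"
      by (simp_all add: algebra_simps)
    then show "(a - \<mu>) * (d - \<mu>) - b * c = 0" using v unfolding e by (auto simp: vec2_eq_iff)
  next
    assume z: "(a - \<mu>) * (d - \<mu>) - b * c = 0"
    \<comment> \<open>A nonzero row of \<open>A - \<mu>\<close> yields an eigenvector orthogonal to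
      it; if both rows vanish, any vector will do.\<close>
    consider "b \<noteq> 0 \<or> \<mu> \<noteq> a" | "b = 0" "\<mu> = a" "c \<noteq> 0 \<or> \<mu> \<noteq> d" | "b = 0" "\<mu> = a" "c = 0" "\<mu> = d" by blast
    then show "\<exists>v :: complex^2. v \<noteq> 0 \<and> a * v $ 1 + b * v $ 2 = \<mu> * v $ 1 \<and> c * v $ 1 + d * v $ 2 = \<mu> * v $ 2"
    proof cases
      case 1
      then show ?thesis using z by (intro exI[of _ "vector [b, \<mu> - a]"]) (auto simp: vec2_eq_iff algebra_simps)
    next
      case 2
      then show ?thesis by (intro exI[of _ "vector [\<mu> - d, c]"]) (auto simp: vec2_eq_iff algebra_simps)
    next
      case 3
      then show ?thesis by (intro exI[of _ "vector [1, 0]"]) (auto simp: vec2_eq_iff)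
    qed
  qed
qed

text \<open>If \<open>\<mu>\<close> were rational, the discriminant would be a square
  \<open>s * s\<close>, and the eigenvalues \<open>u\<close> and \<open>u + s\<close> would be
  integers with product \<open>det A\<close>. Determinant \<open>1\<close> makes them equal,
  determinant \<open>-1\<close> makes the trace \<open>0\<close>; both are excluded.\<close>

lemma quadratic_of_distinct_eigenvalues:
  assumes A: "invertible A" "eigenvalue A \<mu>" "trace A \<noteq> 0" "(trace A)^2 \<noteq> 4 * det A"
  shows "quadratic \<mu> (trace A) (det A)"
proof
  let ?t = "trace A" and ?D = "det A"
  show root: "\<mu> * \<mu> = of_int ?t * \<mu> - of_int ?D" using A(2) by (simp add: eigenvalue_iff)
  fix m n :: int assume mn: "of_int m + of_int n * \<mu> = 0"
  have "n = 0"
  proof (rule ccontr)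
    assume n: "n \<noteq> 0"
    have m: "of_int m = - (of_int n * \<mu>)" using mn by (simp add: eq_neg_iff_add_eq_0)
    have "of_int ((2 * m + ?t * n)^2) = (of_int n)^2 * (4 * (\<mu> * \<mu>) - 4 * of_int ?t * \<mu> + (of_int ?t)^2)"
      by (simp add: m power2_eq_square algebra_simps)
    also have "\<dots> = of_int (n^2 * (?t^2 - 4 * ?D))" unfolding root by (simp add: power2_eq_square algebra_simps)
    finally have e: "(2 * m + ?t * n)^2 = n^2 * (?t^2 - 4 * ?D)" unfolding of_int_eq_iff .
    then have "n^2 dvd (2 * m + ?t * n)^2" by simp
    then have "n dvd 2 * m + ?t * n" by simp
    then obtain s where s: "2 * m + ?t * n = n * s" by blast
    have sq: "s * s = ?t * ?t - 4 * ?D" using e n unfolding s by (simp add: power_mult_distrib power2_eq_square)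
    have "even (s * s) \<longleftrightarrow> even (?t * ?t)" unfolding sq by simp
    then have "even (?t - s)" by auto
    then obtain u where u: "?t - s = 2 * u" by blast
    have "4 * (u * (u + s)) = (?t - s) * (?t + s)" using u by (simp add: algebra_simps)
    also have "\<dots> = 4 * ?D" using sq by (simp add: algebra_simps)
    finally have "u * (u + s) = ?D" by simp
    moreover have D: "?D = 1 \<or> ?D = -1" using A(1) by (simp add: invertible_iff_det)
    ultimately consider "?D = 1" "u * (u + s) = 1" | "?D = -1" "u * - (u + s) = 1" by fastforce
    then show False
    proof cases
      case 1
      then have "s = 0" by (auto simp: zmult_eq_1_iff)
      then show False using sq A(4) by (simp add: power2_eq_square)
    next
      case 2
      then have "2 * u + s = 0" by (auto simp: zmult_eq_1_iff)
      then show False using u A(3) by simp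
    qed
  qed
  then show "m = 0 \<and> n = 0" using mn by simp
qed

lemma card_eigenvalues_2_imp:
  assumes "card {\<nu>. eigenvalue A \<nu>} = 2"
  shows "(trace A)^2 \<noteq> 4 * det A"
proof
  assume e: "(trace A)^2 = 4 * det A"
  have "\<nu> = of_int (trace A) / 2" if "eigenvalue A \<nu>" for \<nu>
  proof -
    have "(2 * \<nu> - of_int (trace A))^2 = 4 * (\<nu> * \<nu>) - 4 * of_int (trace A) * \<nu> + of_int ((trace A)^2)"
      by (simp add: power2_eq_square algebra_simps)
    also have "\<dots> = 0" unfolding e that[unfolded eigenvalue_iff] by (simp add: algebra_simps)
    finally have "2 * \<nu> = of_int (trace A)" by simp
    then show ?thesis by (simp add: eq_divide_eq mult.commute)
  qed
  then have "{\<nu>. eigenvalue A \<nu>} \<subseteq> {of_int (trace A) / 2}" by blast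
  then have "card {\<nu>. eigenvalue A \<nu>} \<le> 1" using card_mono[of "{of_int (trace A) / 2 :: complex}"] by fastforce
  then show False using assms by simp
qed

section \<open>The irreducible case\<close>

context quadratic
begin

definition ideal_rel :: "(complex set \<times> complex set) set" where
  "ideal_rel = {(I, J). fractional_ideal \<O> I \<and> fractional_ideal \<O> J \<and> (\<exists>\<alpha>\<in>K - {0}. J = (*) \<alpha> ` I)}"

lemma ideal_classes_eq: "ideal_classes \<O> = {I. fractional_ideal \<O> I} // ideal_rel"
  by (simp add: ideal_classes_def ideal_rel_def)

lemma equiv_ideal_rel: "equiv {I. fractional_ideal \<O> I} ideal_rel"
proof (rule equivI)
  show "ideal_rel \<subseteq> {I. fractional_ideal \<O> I} \<times> {I. fractional_ideal \<O> I}" by (auto simp: ideal_rel_def)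
  have one: "1 \<in> K - {0}" using frac_field_simps(1)[OF subring, of 1] Ints_in[of 1] by simp
  show "refl_on {I. fractional_ideal \<O> I} ideal_rel"
    unfolding refl_on_def ideal_rel_def using one by (auto intro!: bexI[of _ 1])
  show "sym ideal_rel"
  proof (rule symI)
    fix I J assume "(I, J) \<in> ideal_rel"
    then obtain \<alpha> where a: "fractional_ideal \<O> I" "fractional_ideal \<O> J" "\<alpha> \<in> K - {0}" "J = (*) \<alpha> ` I" by (auto simp: ideal_rel_def)
    have "inverse \<alpha> * \<alpha> = 1" using a(3) by simp
    then have "inverse \<alpha> * (\<alpha> * x) = x" for x by (metis mult.assoc mult_1)
    then have "I = (*) (inverse \<alpha>) ` J" unfolding a(4) image_image by (simp only: image_ident)
    moreover have "inverse \<alpha> \<in> K - {0}" using a(3) frac_field_simps(2)[OF subring] by simp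
    ultimately show "(J, I) \<in> ideal_rel" using a unfolding ideal_rel_def by blast
  qed
  show "trans ideal_rel"
  proof (rule transI)
    fix I J L assume "(I, J) \<in> ideal_rel" "(J, L) \<in> ideal_rel"
    then obtain \<alpha> \<beta> where a: "fractional_ideal \<O> I" "fractional_ideal \<O> L" "\<alpha> \<in> K - {0}" "J = (*) \<alpha> ` I" "\<beta> \<in> K - {0}" "L = (*) \<beta> ` J"
      by (auto simp: ideal_rel_def)
    have "L = (*) (\<beta> * \<alpha>) ` I" unfolding a(4,6) by (auto simp: image_image mult.assoc)
    moreover have "\<beta> * \<alpha> \<in> K - {0}" using a(3,5) frac_field_simps(3)[OF subring] by simp
    ultimately show "(I, L) \<in> ideal_rel" using a unfolding ideal_rel_def by blast
  qed
qed

text \<open>Every class contains the ideal of a reduced matrix; \<open>?f\<close> chooses one for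
  each ideal.\<close>

lemma finite_ideal_classes: "finite (ideal_classes \<O>)"
  unfolding ideal_classes_eq
proof (rule quotient_card_le(1)[OF equiv_ideal_rel finite_reduced_matrices])
  let ?P = "\<lambda>I B. B \<in> reduced_matrices \<and> (\<exists>\<alpha>\<in>K - {0}. LM_ideal B \<mu> = (*) \<alpha> ` I)"
  let ?f = "\<lambda>I. SOME B. ?P I B"
  have f: "?P I (?f I)" if I: "I \<in> {I. fractional_ideal \<O> I}" for I
  proof (rule someI_ex)
    have "fractional_ideal \<O> I" using I by simp
    then obtain \<alpha> B where "B \<in> reduced_matrices" "\<alpha> \<in> K - {0}" "LM_ideal B \<mu> = (*) \<alpha> ` I"
      by (rule fractional_ideal_reduced) (rule that)
    then show "\<exists>B. ?P I B" by blast
  qed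
  then show "?f I \<in> reduced_matrices" if "I \<in> {I. fractional_ideal \<O> I}" for I using that by blast
  have rel: "(I, LM_ideal (?f I) \<mu>) \<in> ideal_rel" if I: "I \<in> {I. fractional_ideal \<O> I}" for I
  proof -
    have "quadratic_matrix \<mu> t D (?f I)" using f[OF I] by (simp add: reduced_matrices_def)
    then have "fractional_ideal \<O> (LM_ideal (?f I) \<mu>)" by (rule quadratic_matrix.LM_fractional)
    then show ?thesis using f[OF I] I unfolding ideal_rel_def by blast
  qed
  show "(I, J) \<in> ideal_rel" if IJ: "I \<in> {I. fractional_ideal \<O> I}" "J \<in> {I. fractional_ideal \<O> I}" "?f I = ?f J" for I J
  proof -
    have "(J, LM_ideal (?f I) \<mu>) \<in> ideal_rel" unfolding IJ(3) by (rule rel[OF IJ(2)])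
    then have "(LM_ideal (?f I) \<mu>, J) \<in> ideal_rel" using equiv_ideal_rel by (meson equivE symD)
    with rel[OF IJ(1)] show ?thesis using equiv_ideal_rel by (meson equivE transD)
  qed
qed

lemma Picard_reduced:
  assumes "c \<in> carrier (Picard_group \<O>)"
  obtains B where "B \<in> reduced_matrices" "c = scalings \<O> (LM_ideal B \<mu>)"
    "\<And>q. q dvd B $ 1 $ 2 ==> q dvd B $ 2 $ 1 ==> q dvd B $ 2 $ 2 - B $ 1 $ 1 ==> \<bar>q\<bar> = 1"
proof -
  obtain I where I: "c = scalings \<O> I" "invertible_ideal \<O> I" using assms carrier_Picard_group[OF subring] by auto
  have "fractional_ideal \<O> I" using I(2) by (simp add: invertible_ideal_def)
  then obtain \<alpha> B where B: "B \<in> reduced_matrices" "\<alpha> \<in> K - {0}" "LM_ideal B \<mu> = (*) \<alpha> ` I"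
    by (rule fractional_ideal_reduced) (rule that)
  have q: "quadratic_matrix \<mu> t D B" using B(1) by (simp add: reduced_matrices_def)
  show ?thesis
  proof (rule that[OF B(1)])
    show "c = scalings \<O> (LM_ideal B \<mu>)" unfolding B(3) frac_field_mult_scalings[OF subring B(2)] by (rule I(1))
    show "\<bar>r\<bar> = 1" if "r dvd B $ 1 $ 2" "r dvd B $ 2 $ 1" "r dvd B $ 2 $ 2 - B $ 1 $ 1" for r
      using quadratic_matrix.primitive_of_invertible[OF q I(2) _ B(3) that] B(2) by simp
  qed
qed

lemma finite_Picard: "finite (carrier (Picard_group \<O>))"
proof (rule finite_subset)
  show "carrier (Picard_group \<O>) \<subseteq> (\<lambda>B. scalings \<O> (LM_ideal B \<mu>)) ` reduced_matrices"
    using Picard_reduced by blast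
qed (use finite_reduced_matrices in simp)

text \<open>Equal trace and determinant give one companion matrix, through which the two groups are
  compared.\<close>

lemma primitive_profinitely_iso:
  assumes A: "invertible A" "quadratic_matrix \<mu> t D A" and B: "quadratic_matrix \<mu> t D B"
    and pA: "\<And>q. q dvd A $ 1 $ 2 ==> q dvd A $ 2 $ 1 ==> q dvd A $ 2 $ 2 - A $ 1 $ 1 ==> \<bar>q\<bar> = 1"
    and pB: "\<And>q. q dvd B $ 1 $ 2 ==> q dvd B $ 2 $ 1 ==> q dvd B $ 2 $ 2 - B $ 1 $ 1 ==> \<bar>q\<bar> = 1"
  shows "invertible B" "profinitely_iso (\<G> B) (\<G> A)"
proof -
  have tA: "trace A = t" "det A = D" and tB: "trace B = t" "det B = D"
    using A(2) B by (simp_all add: quadratic_matrix_def quadratic_matrix_axioms_def)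
  then show invB: "invertible B" using A(1) by (simp add: invertible_iff_det)
  let ?C = "M2 0 (- D) 1 t"
  have invC: "invertible ?C" using A(1) tA by (simp add: invertible_iff_det det_2)
  have CA: "profinitely_iso (\<G> ?C) (\<G> A)"
    using primitive_profinitely_iso_companion[OF A(1) pA] by (simp add: tA)
  have "profinitely_iso (\<G> ?C) (\<G> B)"
    using primitive_profinitely_iso_companion[OF invB pB] by (simp add: tB)
  then have "profinitely_iso (\<G> B) (\<G> ?C)"
    by (rule profinitely_iso_sym[OF group_semidirect_Z2_Z[OF invC] group_semidirect_Z2_Z[OF invB]])
  then show "profinitely_iso (\<G> B) (\<G> A)" using CA by (rule profinitely_iso_trans)
qed

section \<open>Bounds for the genus in the irreducible case\<close>

context
  fixes A
  assumes inv: "invertible A" and qA: "quadratic_matrix \<mu> t D A" and t0: "t \<noteq> 0" and disc: "t^2 \<noteq> 4 * D"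
begin

lemma trA: "trace A = t" and detA: "det A = D"
  using qA by (simp_all add: quadratic_matrix_def quadratic_matrix_axioms_def)

lemma D_cases: "D = 1 \<or> D = -1"
  using inv by (simp add: invertible_iff_det detA)

text \<open>The determinant is \<open>1 - t + D\<close>. It vanishes for \<open>D = -1\<close> only
  if \<open>t = 0\<close>, and for \<open>D = 1\<close> only if \<open>t = 2\<close>, where the
  discriminant is \<open>0\<close>.\<close>

lemma no_eigenvalue_1:
  assumes "quadratic_matrix \<mu> t D B"
  shows "det (B - mat 1) \<noteq> 0"
proof -
  have "trace B = t" "det B = D" using assms by (simp_all add: quadratic_matrix_def quadratic_matrix_axioms_def)
  then show ?thesis using D_cases t0 disc by (auto simp: det_minus_1)
qed

lemma genus_matrix:
  assumes "H \<in> genus_reps A"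
  obtains B where "quadratic_matrix \<mu> t D B" "invertible B" "\<G> B \<cong> H"
proof -
  have "polycyclic_by_finite H" "profinitely_iso H (\<G> A)" using assms by (simp_all add: genus_reps_def)
  then obtain B where B: "invertible B" "\<G> B \<cong> H" "profinitely_equivalent A B"
    by (rule genus_of_semidirect[OF _ inv _ no_eigenvalue_1[OF qA]]) (rule that)
  have dB: "det B = D" using profinitely_equivalent_det[OF inv B(1,3)] detA by simp
  have q: "quadratic_matrix \<mu> t D C" if "trace C = t" "det C = D" for C
    using that quadratic_axioms by (simp add: quadratic_matrix_def quadratic_matrix_axioms_def)
  show ?thesis
  proof (cases "trace B = t")
    case True
    then show ?thesis using that[OF q[OF _ dB] B(1,2)] by simp
  next
    case False
    have "\<bar>trace B\<bar> = \<bar>t\<bar>" using profinitely_equivalent_trace(1)[OF inv B(1,3)] trA by simp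
    then have tB: "trace B = - t" using False by linarith
    have D: "D = -1" using profinitely_equivalent_trace(2)[OF inv B(1,3)] False trA detA D_cases by auto
    \<comment> \<open>The sign of the trace can change only for determinant \<open>-1\<close>; the
      inverse of \<open>B\<close> then restores the trace \<open>t\<close>, and its group is
      isomorphic.\<close>
    let ?C = "mpow B (-1)"
    have C: "trace ?C = t" "det ?C = D"
      using trace_mpow_inverse[OF B(1)] det_mpow_inverse[OF B(1)] tB dB D by simp_all
    have "\<G> ?C \<cong> H" using iso_trans[OF inverse_semidirect_iso[OF B(1)] B(2)] .
    then show ?thesis using that[OF q[OF C] invertible_mpow[OF B(1)]] by simp
  qed
qed

text \<open>The matrix \<open>b H\<close> is chosen for each \<open>H\<close> separately and may
  vary within an isomorphism class. This is harmless: equal ideal classes give conjugate matrices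
  and hence isomorphic groups, which is all the count needs.\<close>

lemma genus_upper_bound:
  "finite (PF_genus (\<G> A))" "card (PF_genus (\<G> A)) \<le> card (ideal_classes \<O>)"
proof -
  let ?P = "\<lambda>(H :: nat monoid) B. quadratic_matrix \<mu> t D B \<and> invertible B \<and> \<G> B \<cong> H"
  define b where "b H = (SOME B. ?P H B)" for H
  have b: "?P H (b H)" if H: "H \<in> genus_reps A" for H
    unfolding b_def
  proof (rule someI_ex)
    obtain B where "quadratic_matrix \<mu> t D B" "invertible B" "\<G> B \<cong> H" using genus_matrix[OF H] .
    then show "\<exists>B. ?P H B" by blast
  qed
  define f where "f H = ideal_rel `` {LM_ideal (b H) \<mu>}" for H
  have fr: "fractional_ideal \<O> (LM_ideal (b H) \<mu>)" if "H \<in> genus_reps A" for H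
    using quadratic_matrix.LM_fractional b[OF that] by blast
  have f: "f H \<in> ideal_classes \<O>" if "H \<in> genus_reps A" for H
    unfolding ideal_classes_eq f_def by (rule quotientI) (use fr[OF that] in simp)
  have inj: "(H, L) \<in> genus_rel A" if HL: "H \<in> genus_reps A" "L \<in> genus_reps A" "f H = f L" for H L
  proof -
    have "(LM_ideal (b H) \<mu>, LM_ideal (b L) \<mu>) \<in> ideal_rel"
      by (rule eq_equiv_class[OF _ equiv_ideal_rel]) (use HL(3) fr[OF HL(2)] in \<open>simp_all add: f_def\<close>)
    then obtain \<alpha> where a: "\<alpha> \<noteq> 0" "LM_ideal (b L) \<mu> = (*) \<alpha> ` LM_ideal (b H) \<mu>" by (auto simp: ideal_rel_def)
    note bH = b[OF HL(1)] and bL = b[OF HL(2)]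
    have "mconj (b H) (b L)" by (rule scaling_imp_conj[OF _ _ a]) (use bH bL in simp_all)
    then have "\<G> (b H) \<cong> \<G> (b L)" using mconj_imp_semidirect_iso bH bL by blast
    then have "H \<cong> L" using semidirect_isos_imp_iso[of "b H" "b L" H L] bH bL by blast
    then show ?thesis using HL by (simp add: genus_rel_def)
  qed
  show "finite (PF_genus (\<G> A))"
    unfolding PF_genus_eq by (rule quotient_card_le(1)[OF equiv_genus_rel finite_ideal_classes f inj])
  show "card (PF_genus (\<G> A)) \<le> card (ideal_classes \<O>)"
    unfolding PF_genus_eq by (rule quotient_card_le(2)[OF equiv_genus_rel finite_ideal_classes f inj])
qed

text \<open>Two classes with isomorphic groups have matrices that are conjugate directly or after
  inverting one of them. For \<open>D = -1\<close> inversion changes the sign of the nonzero trace,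
  so this cannot happen. In general, any two further classes in the fibre of \<open>x\<close> are
  conjugate to the same inverse, hence equal.\<close>

lemma genus_lower_bound:
  assumes I: "invertible_ideal \<O> (LM_ideal A \<mu>)"
  shows "D = -1 ==> class_number \<O> \<le> card (PF_genus (\<G> A))"
    "class_number \<O> \<le> 2 * card (PF_genus (\<G> A))"
proof -
  let ?Pic = "carrier (Picard_group \<O>)"
  have pA: "\<bar>q\<bar> = 1" if "q dvd A $ 1 $ 2" "q dvd A $ 2 $ 1" "q dvd A $ 2 $ 2 - A $ 1 $ 1" for q
    using quadratic_matrix.primitive_of_invertible[OF qA I, of 1] that by simp
  let ?P = "\<lambda>c B H. quadratic_matrix \<mu> t D B \<and> invertible B \<and> c = scalings \<O> (LM_ideal B \<mu>) \<and> H \<in> genus_reps A \<and> \<G> B \<cong> H"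
  have "\<exists>B H. ?P c B H" if c: "c \<in> ?Pic" for c
  proof -
    obtain B where B: "B \<in> reduced_matrices" "c = scalings \<O> (LM_ideal B \<mu>)"
      "\<And>q. q dvd B $ 1 $ 2 ==> q dvd B $ 2 $ 1 ==> q dvd B $ 2 $ 2 - B $ 1 $ 1 ==> \<bar>q\<bar> = 1"
      by (rule Picard_reduced[OF c]) (rule that; blast)
    have q: "quadratic_matrix \<mu> t D B" using B(1) by (simp add: reduced_matrices_def)
    note pr = primitive_profinitely_iso[OF inv qA q pA B(3)]
    obtain H where "H \<in> genus_reps A" "\<G> B \<cong> H" using nat_model_in_genus[OF inv pr] .
    then show ?thesis using q B(2) pr(1) by blast
  qed
  then obtain b h where bh: "\<And>c. c \<in> ?Pic ==> ?P c (b c) (h c)" by metis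
  define f where "f c = genus_rel A `` {h c}" for c
  have f: "f c \<in> PF_genus (\<G> A)" if "c \<in> ?Pic" for c
    unfolding PF_genus_eq f_def by (rule quotientI) (use bh[OF that] in blast)
  have eqI: "c = c'" if cc: "c \<in> ?Pic" "c' \<in> ?Pic" "mconj (b c) (b c')" for c c'
  proof -
    note B = bh[OF cc(1)] and B' = bh[OF cc(2)]
    obtain \<alpha> where a: "\<alpha> \<in> K - {0}" "LM_ideal (b c) \<mu> = (*) \<alpha> ` LM_ideal (b c') \<mu>"
      using conj_imp_scaling[of "b c" "b c'"] B B' cc(3) by blast
    have "scalings \<O> (LM_ideal (b c) \<mu>) = scalings \<O> (LM_ideal (b c') \<mu>)"
      unfolding a(2) by (rule frac_field_mult_scalings[OF subring a(1)])
    then show ?thesis using B B' by simp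
  qed
  have fib: "mconj (b c) (b c') \<or> mconj (b c) (mpow (b c') (-1))" if cc: "c \<in> ?Pic" "c' \<in> ?Pic" "f c = f c'" for c c'
  proof -
    note B = bh[OF cc(1)] and B' = bh[OF cc(2)]
    have "(h c, h c') \<in> genus_rel A"
      by (rule eq_equiv_class[OF _ equiv_genus_rel]) (use cc(3) B' in \<open>simp_all add: f_def\<close>)
    then have hh: "h c \<cong> h c'" by (simp add: genus_rel_def)
    have "h c' \<cong> \<G> (b c')"
      using group.iso_sym[OF group_semidirect_Z2_Z] B' by blast
    then have "\<G> (b c) \<cong> \<G> (b c')" using iso_trans[OF iso_trans] B hh by blast
    then show ?thesis using semidirect_iso_imp_mconj[of "b c" "b c'"] no_eigenvalue_1 B B' by blast
  qed
  have cn: "class_number \<O> = card ?Pic" by (simp add: class_number_def Coset.order_def)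
  show "class_number \<O> \<le> card (PF_genus (\<G> A))" if D: "D = -1"
  proof -
    have "inj_on f ?Pic"
    proof (rule inj_onI)
      fix c c' assume cc: "c \<in> ?Pic" "c' \<in> ?Pic" "f c = f c'"
      have tr: "trace (b c) = t" "trace (b c') = t" "det (b c') = D"
        using bh[OF cc(1)] bh[OF cc(2)] by (simp_all add: quadratic_matrix_def quadratic_matrix_axioms_def)
      have "\<not> mconj (b c) (mpow (b c') (-1))"
      proof
        assume "mconj (b c) (mpow (b c') (-1))"
        then have "t = - t" using mconj_trace[of "b c"] trace_mpow_inverse[of "b c'"] bh[OF cc(2)] tr D by simp
        then show False using t0 by simp
      qed
      then show "c = c'" using fib[OF cc] eqI[OF cc(1,2)] by blast
    qed
    then show ?thesis unfolding cn using f genus_upper_bound(1) by (intro card_inj_on_le[of f]) auto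
  qed
  show "class_number \<O> \<le> 2 * card (PF_genus (\<G> A))"
    unfolding cn
  proof (rule card_le_two_to_one[OF finite_Picard genus_upper_bound(1) f])
    fix x y z assume xyz: "x \<in> ?Pic" "y \<in> ?Pic" "z \<in> ?Pic" "f y = f x" "f z = f x" "y \<noteq> x" "z \<noteq> x"
    have y: "mconj (b y) (mpow (b x) (-1))" using fib[OF xyz(2,1,4)] eqI[OF xyz(2,1)] xyz(6) by blast
    have z: "mconj (b z) (mpow (b x) (-1))" using fib[OF xyz(3,1,5)] eqI[OF xyz(3,1)] xyz(7) by blast
    show "y = z" by (rule eqI[OF xyz(2,3) mconj_trans[OF y mconj_sym[OF z]]])
  qed
qed

end

end

theorem theorem1p2:
  fixes A :: "int^2^2" and \<mu> :: complex
  assumes "A \<in> carrier GL2Z"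
    and "eigenvalue A \<mu>"
  shows
    "(card {\<nu>. eigenvalue A \<nu>} = 2 \<and> trace A \<noteq> 0 \<and>
        invertible_ideal (adjoin_Z \<mu>) (LM_ideal A \<mu>) \<longrightarrow>
        finite (PF_genus (semidirect_Z2_Z A)) \<and>
        finite (carrier (Picard_group (adjoin_Z \<mu>))) \<and>
        finite (ideal_classes (adjoin_Z \<mu>)) \<and>
        (det A = -1 \<longrightarrow>
           class_number (adjoin_Z \<mu>) \<le> card (PF_genus (semidirect_Z2_Z A)) \<and>
           card (PF_genus (semidirect_Z2_Z A)) \<le> card (ideal_classes (adjoin_Z \<mu>))) \<and>
        (det A = 1 \<longrightarrow>
           real (class_number (adjoin_Z \<mu>)) / 2 \<le> real (card (PF_genus (semidirect_Z2_Z A))) \<and>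
           card (PF_genus (semidirect_Z2_Z A)) \<le> card (ideal_classes (adjoin_Z \<mu>)))) \<and>
     (trace A = 0 \<or> (\<forall>\<nu>. eigenvalue A \<nu> \<longrightarrow> \<nu> = -1) \<longrightarrow>
        card (PF_genus (semidirect_Z2_Z A)) = 1 \<and> class_number (adjoin_Z \<mu>) = 1)"
proof -
  have A: "invertible A" using assms(1) by (simp add: GL2Z_def)
  have D: "det A = 1 \<or> det A = -1" using A by (simp add: invertible_iff_det)
  have root: "\<mu> * \<mu> = of_int (trace A) * \<mu> - of_int (det A)" using assms(2) by (simp add: eigenvalue_iff)
  have irr: "finite (PF_genus (semidirect_Z2_Z A)) \<and> finite (carrier (Picard_group (adjoin_Z \<mu>))) \<and>
      finite (ideal_classes (adjoin_Z \<mu>)) \<and> card (PF_genus (semidirect_Z2_Z A)) \<le> card (ideal_classes (adjoin_Z \<mu>)) \<and>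
      (det A = -1 \<longrightarrow> class_number (adjoin_Z \<mu>) \<le> card (PF_genus (semidirect_Z2_Z A))) \<and>
      class_number (adjoin_Z \<mu>) \<le> 2 * card (PF_genus (semidirect_Z2_Z A))"
    if "card {\<nu>. eigenvalue A \<nu>} = 2" "trace A \<noteq> 0" "invertible_ideal (adjoin_Z \<mu>) (LM_ideal A \<mu>)"
  proof -
    have disc: "(trace A)^2 \<noteq> 4 * det A" by (rule card_eigenvalues_2_imp[OF that(1)])
    interpret quadratic \<mu> "trace A" "det A" by (rule quadratic_of_distinct_eigenvalues[OF A assms(2) that(2) disc])
    have q: "quadratic_matrix \<mu> (trace A) (det A) A" by unfold_locales simp_all
    show ?thesis
      using genus_upper_bound[OF A q that(2) disc] genus_lower_bound[OF A q that(2) disc that(3)] finite_Picard finite_ideal_classes by blast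
  qed
  have red: "card (PF_genus (semidirect_Z2_Z A)) = 1 \<and> class_number (adjoin_Z \<mu>) = 1" if t: "trace A = 0"
    using D
  proof
    assume D1: "det A = 1"
    have mu: "\<mu> * \<mu> = -1" using root t D1 by simp
    interpret gaussian \<mu>
    proof
      show "\<mu> * \<mu> = of_int 0 * \<mu> - of_int 1" using mu by simp
      fix m n :: int assume mn: "of_int m + of_int n * \<mu> = 0"
      \<comment> \<open>The norm shows that \<open>\<mu>\<close> is irrational; the last term
        vanishes as \<open>\<mu>\<close> squares to \<open>-1\<close>.\<close>
      have "of_int (m^2 + n^2) = (of_int m + of_int n * \<mu>) * (of_int m - of_int n * \<mu>) + (of_int n)^2 * (\<mu> * \<mu> + 1)"
        by (simp add: power2_eq_square algebra_simps)
      then have "of_int (m^2 + n^2) = (0 :: complex)" unfolding mn mu by simp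
      then have "m^2 + n^2 = 0" by (simp only: of_int_eq_0_iff)
      then show "m = 0 \<and> n = 0" by (simp add: sum_power2_eq_zero_iff)
    qed
    have q: "quadratic_matrix \<mu> 0 1 B" if "trace B = 0" "det B = 1" for B by unfold_locales (use that in simp_all)
    have "card (PF_genus (semidirect_Z2_Z A)) = 1"
    proof (rule card_PF_genus_eq_1_of_normal_form[OF A])
      show "det (A - mat 1) \<noteq> 0" using t D1 by (simp add: det_minus_1)
      fix B assume B: "invertible B" "profinitely_equivalent A B"
      have "trace B = 0" "det B = 1"
        using profinitely_equivalent_trace(2)[OF A B D1] profinitely_equivalent_det[OF A B] t D1 by simp_all
      then show "mconj B A" using mconj_trans[OF all_mconj[OF q]] mconj_sym[OF all_mconj[OF q[OF t D1]]] by blast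
    qed
    then show ?thesis using class_number by simp
  next
    assume D1: "det A = -1"
    have "(\<mu> - 1) * (\<mu> + 1) = 0" using root t D1 by (simp add: algebra_simps)
    then have "\<mu> = 1 \<or> \<mu> = -1" by (auto simp: eq_neg_iff_add_eq_0)
    then have "\<mu> \<in> \<int>" by auto
    then show ?thesis using card_PF_genus_trace_0_det_minus_1[OF A t D1] class_number_of_int_root by blast
  qed
  have uni: "card (PF_genus (semidirect_Z2_Z A)) = 1 \<and> class_number (adjoin_Z \<mu>) = 1"
    if ev: "\<forall>\<nu>. eigenvalue A \<nu> \<longrightarrow> \<nu> = -1"
  proof -
    have mu: "\<mu> = -1" using ev assms(2) by blast
    \<comment> \<open>The second root of the characteristic polynomial; being \<open>-1\<close> as
      well, it fixes the trace and then the determinant.\<close>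
    have "eigenvalue A (of_int (trace A) - \<mu>)" unfolding eigenvalue_iff using root by (simp add: algebra_simps)
    then have "of_int (trace A) - \<mu> = -1" using ev by blast
    then have "of_int (trace A) = \<mu> - 1" by (simp add: diff_eq_eq)
    then have "of_int (trace A) = (of_int (-2) :: complex)" using mu by simp
    then have t: "trace A = -2" by (simp only: of_int_eq_iff)
    have "of_int (det A) = (of_int 1 :: complex)" using root mu t by (simp add: algebra_simps)
    then have D1: "det A = 1" by (simp only: of_int_eq_iff)
    show ?thesis using card_PF_genus_trace_minus_2[OF A t D1] class_number_of_int_root[of \<mu>] mu by simp
  qed
  show ?thesis using irr red uni by auto
qed

end
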